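(* Let $\Omega\subset\mathbb{C}^n$ be a bounded pseudoconvex domain. Then $DF_{\Lambda^1}(\Omega)=DF_w(\Omega)$. If the boundary $b\Omega$ is $C^k$ for some $k\geq 2$, then $DF_{C^k}(\Omega)=DF_{C^2}(\Omega)$.
   Context: $\delta_\Omega(z)=\operatorname{dist}(z,b\Omega)$. The weak Diederich-Fornæss index $DF_w(\Omega)$ is the supremum over all exponents $0<\eta<1$ such that there exists an upper semi-continuous plurisubharmonic function $\lambda_\eta$ on $\Omega$ satisfying $-c(\delta_\Omega)^\eta\leq\lambda_\eta\leq-(\delta_\Omega)^\eta$ on $\Omega$ for some $c>1$. If no such function exists, $DF_w(\Omega)=0$. For a family $\mathcal{F}(\overline\Omega)$ of functions on $\overline\Omega$ that are at least upper semi-continuous, $DF_{\mathcal{F}}(\Omega)$ is the supremum over all exponents $0<\eta<1$ such that there exists $\rho_\eta\in\mathcal{F}(\overline\Omega)$ satisfying $-c\,\delta_\Omega\leq\rho_\eta\leq-\delta_\Omega$ on $\overline\Omega$ for some $c>1$ and such that $-(-\rho_\eta)^\eta$ is plurisubharmonic on $\Omega$. If no such function exists, $DF_{\mathcal{F}}(\Omega)=0$. $DF_{\Lambda^1}$ denotes this index for the family $\mathcal F=\Lambda^1(\overline\Omega)$ of Lipschitz functions on $\overline\Omega$, and $DF_{C^k}$ denotes this index for the family $\mathcal F=C^k(\overline\Omega)$. *)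

theory Defs
  imports "HOL-Analysis.Analysis"
begin

section \<open>Plurisubharmonic functions and pseudoconvexity\<close>

text \<open>Complex n-space is \<open>complex ^ 'n\<close>. Its topology and distance are the Euclidean ones, and
  derivatives are real (Frechet) derivatives, that is, it is treated as real 2n-space.\<close>

definition usc_on :: "'a::topological_space set \<Rightarrow> ('a \<Rightarrow> real) \<Rightarrow> bool" where
  "usc_on S u \<longleftrightarrow> (\<forall>a. openin (top_of_set S) {x \<in> S. u x < a})"

text \<open>Only finite-valued functions are needed below. For a finite-valued upper semi-continuous
  function, the mean over a circle always exists in the extended sense with a value less than
  \<open>\<infinity>\<close>, and the sub-mean value inequality forces this value to be finite. Since the
  Bochner integral of a non-integrable function is 0, integrability has to be stated explicitly.\<close>

definition subharmonic_on :: "complex set \<Rightarrow> (complex \<Rightarrow> real) \<Rightarrow> bool" where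
  "subharmonic_on S u \<longleftrightarrow> usc_on S u \<and>
     (\<forall>a r. 0 < r \<longrightarrow> cball a r \<subseteq> S \<longrightarrow>
        set_integrable lborel {0..2*pi} (\<lambda>t. u (a + of_real r * cis t)) \<and>
        u a \<le> (1 / (2*pi)) * (LBINT t:{0..2*pi}. u (a + of_real r * cis t)))"

definition psh_on :: "(complex ^ 'n) set \<Rightarrow> (complex ^ 'n \<Rightarrow> real) \<Rightarrow> bool" where
  "psh_on \<Omega> u \<longleftrightarrow> usc_on \<Omega> u \<and>
     (\<forall>z w. subharmonic_on {\<tau>. z + \<tau> *s w \<in> \<Omega>} (\<lambda>\<tau>. u (z + \<tau> *s w)))"

text \<open>Existence of a continuous plurisubharmonic exhaustion function.\<close>

definition pseudoconvex :: "(complex ^ 'n) set \<Rightarrow> bool" where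
  "pseudoconvex \<Omega> \<longleftrightarrow> open \<Omega> \<and>
     (\<exists>u. continuous_on \<Omega> u \<and> psh_on \<Omega> u \<and>
        (\<forall>c. compact (closure {z \<in> \<Omega>. u z < c}) \<and> closure {z \<in> \<Omega>. u z < c} \<subseteq> \<Omega>))"

section \<open>Function families and boundary regularity\<close>

definition Lip_closure :: "(complex ^ 'n) set \<Rightarrow> (complex ^ 'n \<Rightarrow> real) set" where
  "Lip_closure \<Omega> = {\<rho>. \<exists>L. L-lipschitz_on (closure \<Omega>) \<rho>}"

text \<open>Meant for open sets: all iterated directional derivatives of order at most k exist and
  are continuous.\<close>

fun Ck_on :: "nat \<Rightarrow> 'a::real_normed_vector set \<Rightarrow> ('a \<Rightarrow> real) \<Rightarrow> bool" where
  "Ck_on 0 U f \<longleftrightarrow> continuous_on U f"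
| "Ck_on (Suc k) U f \<longleftrightarrow>
     (\<forall>x\<in>U. f differentiable (at x)) \<and> (\<forall>v. Ck_on k U (\<lambda>x. frechet_derivative f (at x) v))"

text \<open>A function is \<open>C\<^sup>k\<close> on the closed set \<open>closure \<Omega>\<close> if it is there the restriction of a
  \<open>C\<^sup>k\<close> function on an open neighbourhood. When the boundary is at least \<open>C\<^sup>1\<close>, this is the same
  (Whitney) as being \<open>C\<^sup>k\<close> in \<open>\<Omega>\<close> with all derivatives up to order k continuous up to the
  boundary.\<close>

definition Ck_closure :: "nat \<Rightarrow> (complex ^ 'n) set \<Rightarrow> (complex ^ 'n \<Rightarrow> real) set" where
  "Ck_closure k \<Omega> =
     {\<rho>. \<exists>U g. open U \<and> closure \<Omega> \<subseteq> U \<and> Ck_on k U g \<and> (\<forall>z\<in>closure \<Omega>. g z = \<rho> z)}"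

definition Ck_boundary :: "nat \<Rightarrow> (complex ^ 'n) set \<Rightarrow> bool" where
  "Ck_boundary k \<Omega> \<longleftrightarrow>
     (\<forall>p\<in>frontier \<Omega>. \<exists>U r. open U \<and> p \<in> U \<and> Ck_on k U r \<and>
        U \<inter> \<Omega> = {z \<in> U. r z < 0} \<and>
        (\<forall>z\<in>U. \<exists>v. frechet_derivative r (at z) v \<noteq> 0))"

section \<open>Diederich-Fornaess indices\<close>

definition bdist :: "(complex ^ 'n) set \<Rightarrow> complex ^ 'n \<Rightarrow> real" where
  "bdist \<Omega> z = infdist z (frontier \<Omega>)"

definition DF_w_exponents :: "(complex ^ 'n) set \<Rightarrow> real set" where
  "DF_w_exponents \<Omega> = {\<eta>. 0 < \<eta> \<and> \<eta> < 1 \<and>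
     (\<exists>\<mu>. psh_on \<Omega> \<mu> \<and>
        (\<exists>c>1. \<forall>z\<in>\<Omega>. - c * (bdist \<Omega> z powr \<eta>) \<le> \<mu> z \<and> \<mu> z \<le> - (bdist \<Omega> z powr \<eta>)))}"

definition DF_w :: "(complex ^ 'n) set \<Rightarrow> real" where
  "DF_w \<Omega> = (if DF_w_exponents \<Omega> = {} then 0 else Sup (DF_w_exponents \<Omega>))"

definition DF_exponents :: "(complex ^ 'n \<Rightarrow> real) set \<Rightarrow> (complex ^ 'n) set \<Rightarrow> real set" where
  "DF_exponents F \<Omega> = {\<eta>. 0 < \<eta> \<and> \<eta> < 1 \<and>
     (\<exists>\<rho>\<in>F. (\<exists>c>1. \<forall>z\<in>closure \<Omega>. - c * bdist \<Omega> z \<le> \<rho> z \<and> \<rho> z \<le> - bdist \<Omega> z) \<and>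
        psh_on \<Omega> (\<lambda>z. - ((- \<rho> z) powr \<eta>)))}"

definition DF :: "(complex ^ 'n \<Rightarrow> real) set \<Rightarrow> (complex ^ 'n) set \<Rightarrow> real" where
  "DF F \<Omega> = (if DF_exponents F \<Omega> = {} then 0 else Sup (DF_exponents F \<Omega>))"

end

theory Submission
  imports Defs "HOL-Computational_Algebra.Polynomial"
begin

text \<open>Lipschitz index. Let \<open>q = \<eta>' / \<eta>\<close> and \<open>s = - \<mu>\<close>, where \<open>\<mu>\<close> realises \<open>\<eta>\<close>. The infimum of
  \<open>((1 - q) * \<tau> powr \<eta>' + q * \<tau> powr (\<eta>' - \<eta>) * s \<zeta>) powr (1 / \<eta>')\<close> over all \<open>\<zeta>\<close> and all \<open>\<tau> \<ge> b * dist \<zeta> z\<close>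
  is a Lipschitz function of \<open>z\<close>, comparable to the boundary distance for large \<open>b\<close>. With \<open>w = \<zeta> - z\<close> and \<open>\<tau>\<close>
  fixed the negative of its \<open>\<eta>'\<close>-th power is affine in \<open>\<mu> (z + w)\<close>, so the negative of the \<open>\<eta>'\<close>-th power of the
  infimum is locally a supremum of plurisubharmonic functions.

  \<open>C\<^sup>k\<close> index, \<open>k \<ge> 3\<close>. Let \<open>r\<close> be a \<open>C\<^sup>k\<close> defining function, let the \<open>C\<^sup>2\<close> function \<open>\<rho>\<close> realise \<open>\<eta>\<close>, and let
  \<open>g = ln (r / \<rho>)\<close>. Up to the boundary \<open>g\<close> is in general not \<open>C\<^sup>2\<close>, but its first derivatives are bounded and
  its second derivatives are \<open>o(1 / \<bar>r\<bar>)\<close>. Hence \<open>g\<close> can be replaced by its pullback under a small shift along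
  the inner normal field of \<open>r\<close>, which is \<open>C\<^sup>2\<close> up to the boundary: this costs arbitrarily little in the exponent,
  since the Levi form of \<open>r\<close> divided by \<open>\<bar>r\<bar>\<close>, on vectors with a prescribed value of \<open>\<partial>r / r\<close>, is almost
  monotone along transversal segments. Now the pullback can be approximated in \<open>C\<^sup>2\<close> by a \<open>C\<^sup>k\<close> function \<open>g1\<close>, and
  \<open>r * exp (- g1 - L * \<bar>z\<bar>\<^sup>2)\<close> realises every \<open>\<eta>' < \<eta>\<close> near the boundary; a concave cutoff of its
  \<open>\<eta>'\<close>-th power makes it constant away from the boundary.\<close>

section \<open>Circle means and plurisubharmonicity\<close>

text \<open>The obstacle in the \<open>C\<^sup>k\<close> part is that \<open>g\<close> has to be
  approximated in \<open>C\<^sup>2\<close> on a compact set that contains the boundary, where its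
  second derivatives may blow up. Shifting by a fixed \<open>t\<close> removes this singularity but
  forces a comparison of Levi forms at two points. Write \<open>a\<close> for \<open>dd r\<close>
  divided by \<open>- r\<close> on a vector \<open>w\<close>: it is not bounded by
  \<open>norm w\<close>, so errors are measured in \<open>norm w + norm a\<close>, and the vectors
  at the two points must share the same \<open>a\<close>. At the shifted point the second
  derivatives of \<open>g\<close> are at most a small constant over \<open>t\<close>, while the
  vectors to be compared differ by a multiple of \<open>t\<close>, so \<open>t\<close> cancels.
  Errors in \<open>a\<close> are absorbed by the gap between the exponents, which is where exponent
  is lost; errors in \<open>w\<close> are repaired by \<open>L * \<bar>z\<bar>\<^sup>2\<close>,
  whose gain is linear in \<open>L\<close> while its effect on the squared gradient is quadratic.
  Three derivatives of \<open>r\<close> are used: the normal field must be \<open>C\<^sup>2\<close>,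
  and the comparison of Levi forms differentiates them once more.\<close>

definition cmean :: "(complex \<Rightarrow> real) \<Rightarrow> complex \<Rightarrow> real \<Rightarrow> real" where
  "cmean u a r = (1 / (2*pi)) * (LBINT t:{0..2*pi}. u (a + of_real r * cis t))"

definition circ_integrable :: "(complex \<Rightarrow> real) \<Rightarrow> complex \<Rightarrow> real \<Rightarrow> bool" where
  "circ_integrable u a r \<longleftrightarrow> set_integrable lborel {0..2*pi} (\<lambda>t. u (a + of_real r * cis t))"

lemma circle_point_sphere: "r \<ge> 0 \<Longrightarrow> a + of_real r * cis t \<in> sphere a r"
  by (simp add: dist_norm norm_mult)

lemma continuous_on_circle:
  assumes "continuous_on (sphere a r) u" "r \<ge> 0"
  shows "continuous_on T (\<lambda>t. u (a + of_real r * cis t))"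
  by (rule continuous_on_compose2[OF assms(1)])
    (use assms(2) in \<open>auto intro!: continuous_intros circle_point_sphere simp del: mem_sphere\<close>)

lemma circ_integrable_continuous:
  assumes "continuous_on (sphere a r) u" "r \<ge> 0"
  shows "circ_integrable u a r"
  unfolding circ_integrable_def
  by (rule borel_integrable_atLeastAtMost'[OF continuous_on_circle[OF assms]])

lemma cmean_continuous:
  assumes "continuous_on (sphere a r) u" "r \<ge> 0"
  shows "cmean u a r = (1 / (2*pi)) * integral {0..2*pi} (\<lambda>t. u (a + of_real r * cis t))"
  using circ_integrable_continuous[OF assms] unfolding cmean_def circ_integrable_def
  by (simp add: set_borel_integral_eq_integral)

lemma cmean_mono:
  assumes "circ_integrable u a r" "circ_integrable v a r" "r \<ge> 0"
    and "\<And>z. z \<in> sphere a r \<Longrightarrow> u z \<le> v z"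
  shows "cmean u a r \<le> cmean v a r"
  unfolding cmean_def
  by (intro mult_left_mono set_integral_mono)
    (use assms circle_point_sphere[of r a] in \<open>auto simp: circ_integrable_def simp del: mem_sphere\<close>)

lemma circ_integrable_affine:
  assumes "circ_integrable u a r"
  shows "circ_integrable (\<lambda>z. c * u z + d) a r"
  using assms unfolding circ_integrable_def
  by (intro set_integral_add set_integrable_mult_right)
    (auto intro: borel_integrable_atLeastAtMost')

lemma cmean_affine:
  assumes "circ_integrable u a r"
  shows "cmean (\<lambda>z. c * u z + d) a r = c * cmean u a r + d"
proof -
  have i: "set_integrable lborel {0..2*pi} (\<lambda>t. u (a + of_real r * cis t))"
    using assms unfolding circ_integrable_def .
  have j: "set_integrable lborel {0..2*pi} (\<lambda>t. d::real)"
    by (auto intro: borel_integrable_atLeastAtMost')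
  have "(LBINT t:{0..2*pi}. d) = 2 * pi * d"
    by (subst set_borel_integral_eq_integral(2)[OF j]) simp
  then show ?thesis
    unfolding cmean_def using i j by (simp add: set_integral_add field_simps)
qed

lemma cmean_add:
  assumes "circ_integrable u a r" "circ_integrable v a r"
  shows "cmean (\<lambda>z. u z + v z) a r = cmean u a r + cmean v a r"
  using assms unfolding cmean_def circ_integrable_def
  by (simp add: set_integral_add algebra_simps)

lemma cmean_cong:
  assumes "r \<ge> 0" "\<And>z. z \<in> sphere a r \<Longrightarrow> u z = v z"
  shows "cmean u a r = cmean v a r"
  using assms circle_point_sphere[of r a] by (simp add: cmean_def del: mem_sphere)

lemma continuous_on_Re_poly [continuous_intros]:
  "continuous_on S f \<Longrightarrow> continuous_on S (\<lambda>z. Re (poly p (f z)))"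
  by (intro continuous_intros)

text \<open>After re-centring at \<open>a\<close>, every monomial of positive degree integrates to
  zero over the circle, so only the constant term is left. The separate centre \<open>b\<close>
  matters because later circles are not centred where the polynomial is.\<close>

lemma cmean_poly:
  assumes "r \<ge> 0"
  shows "cmean (\<lambda>z. Re (poly p (z - b))) a r = Re (poly p (a - b))"
proof -
  define q where "q = pcompose p [:a - b, 1:]"
  have pq: "poly p (a + \<zeta> - b) = poly q \<zeta>" for \<zeta>
    by (simp add: q_def poly_pcompose algebra_simps)
  have trm: "((\<lambda>t. Re (coeff q i * (of_real r * cis t) ^ i)) has_integral
      (if i = 0 then 2 * pi * Re (coeff q 0) else 0)) {0..2*pi}" for i
  proof (cases "i = 0")
    case True
    then show ?thesis
      using has_integral_const_real[of "Re (coeff q 0)" 0 "2*pi"] by simp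
  next
    case False
    define c where "c = coeff q i * of_real (r ^ i)"
    define A where "A t = Im c * cos (real i * t) / real i + Re c * sin (real i * t) / real i" for t
    have "((\<lambda>t. Re c * cos (real i * t) - Im c * sin (real i * t)) has_integral (A (2*pi) - A 0)) {0..2*pi}"
      by (rule fundamental_theorem_of_calculus)
        (use False in \<open>auto simp: A_def has_real_derivative_iff_has_vector_derivative[symmetric]
            intro!: derivative_eq_intros simp: field_simps\<close>)
    moreover have "A (2*pi) = A 0"
      using sin_int_2pin[of "int i"] cos_int_2pin[of "int i"]
      by (simp add: A_def mult.commute mult.left_commute)
    moreover have "Re (coeff q i * (of_real r * cis t) ^ i)
        = Re c * cos (real i * t) - Im c * sin (real i * t)" for t
    proof -
      have "coeff q i * (of_real r * cis t) ^ i = c * cis (real i * t)"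
        by (simp add: c_def power_mult_distrib Complex.DeMoivre)
      then show ?thesis by simp
    qed
    ultimately show ?thesis using False by simp
  qed
  have "((\<lambda>t. \<Sum>i\<le>degree q. Re (coeff q i * (of_real r * cis t) ^ i)) has_integral
      (\<Sum>i\<le>degree q. (if i = 0 then 2 * pi * Re (coeff q 0) else 0))) {0..2*pi}"
    by (intro has_integral_sum trm) auto
  then have "((\<lambda>t. Re (poly p (a + of_real r * cis t - b))) has_integral 2 * pi * Re (coeff q 0)) {0..2*pi}"
    unfolding pq unfolding poly_altdef Re_sum by (simp del: times_complex.sel)
  moreover have "Re (coeff q 0) = Re (poly p (a - b))"
    using pq[of 0] by (simp add: poly_0_coeff_0)
  ultimately show ?thesis
    by (subst cmean_continuous) (auto intro!: continuous_intros assms simp: integral_unique)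
qed

text \<open>\<open>Re x * Re y\<close> is half of \<open>Re (x * y) + Re (cnj x * y)\<close>. On the
  circle \<open>cnj z ^ j * z ^ i = r ^ (2 * j) * z ^ (i - j)\<close>, and assuming
  \<open>j \<le> i\<close> without loss of generality keeps the exponent non-negative.\<close>

lemma Re_monom_mult:
  fixes a b :: complex
  shows "\<exists>p. \<forall>z. norm z = r \<longrightarrow> Re (a * z ^ i) * Re (b * z ^ j) = Re (poly p z)"
proof (induction i j arbitrary: a b rule: linorder_wlog)
  case (le j i)
  define p where "p = monom (a * b / 2) (i + j) + monom (cnj a * b * of_real (r ^ (2*j)) / 2) (i - j)"
  have "Re (a * z ^ j) * Re (b * z ^ i) = Re (poly p z)" if z: "norm z = r" for z
  proof -
    have zz: "z * cnj z = of_real (r^2)"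
      using z by (simp add: complex_norm_square[symmetric])
    have "z ^ i = z ^ (i - j) * z ^ j" using le by (simp flip: power_add)
    then have "cnj (a * z ^ j) * (b * z ^ i) = cnj a * b * (z * cnj z) ^ j * z ^ (i - j)"
      by (simp add: power_mult_distrib)
    also have "\<dots> = cnj a * b * of_real (r ^ (2*j)) * z ^ (i - j)"
      by (simp add: zz power_mult)
    finally have 1: "cnj (a * z ^ j) * (b * z ^ i) = cnj a * b * of_real (r ^ (2*j)) * z ^ (i - j)" .
    have 2: "Re x * Re y = Re (x * y / 2) + Re (cnj x * y / 2)" for x y :: complex
      by (simp add: field_simps)
    have "poly p z = a * z ^ j * (b * z ^ i) / 2 + cnj (a * z ^ j) * (b * z ^ i) / 2"
      unfolding 1 by (simp add: p_def poly_monom power_add)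
    then show ?thesis using 2[of "a * z ^ j" "b * z ^ i"] by (simp only: plus_complex.sel)
  qed
  then show ?case by blast
next
  case (sym i j)
  then show ?case by (metis mult.commute)
qed

lemma Re_poly_mult:
  fixes p q :: "complex poly"
  shows "\<exists>s. \<forall>z. norm z = r \<longrightarrow> Re (poly p z) * Re (poly q z) = Re (poly s z)"
proof -
  obtain P where P: "\<And>i j z. norm z = r \<Longrightarrow>
      Re (coeff p i * z ^ i) * Re (coeff q j * z ^ j) = Re (poly (P i j) z)"
  proof -
    have "\<forall>i j. \<exists>P. \<forall>z. norm z = r \<longrightarrow> Re (coeff p i * z ^ i) * Re (coeff q j * z ^ j) = Re (poly P z)"
      by (intro allI Re_monom_mult)
    then show thesis using that by metis
  qed
  define s where "s = (\<Sum>i\<le>degree p. \<Sum>j\<le>degree q. P i j)"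
  have "Re (poly p z) * Re (poly q z) = Re (poly s z)" if "norm z = r" for z
  proof -
    have "Re (poly p z) * Re (poly q z) =
       (\<Sum>i\<le>degree p. \<Sum>j\<le>degree q. Re (coeff p i * z ^ i) * Re (coeff q j * z ^ j))"
      by (simp add: poly_altdef sum_product)
    also have "\<dots> = Re (poly s z)"
      unfolding s_def poly_sum Re_sum using P[OF that] by (simp del: mult.left_commute)
    finally show ?thesis .
  qed
  then show ?thesis by blast
qed

text \<open>Products of real parts of polynomials are again real parts of polynomials on a circle,
  because there the conjugate of \<open>z\<close> is a multiple of \<open>1/z\<close>; so Stone-Weierstrass applies and
  solves the Dirichlet problem approximately.\<close>

lemma harmonic_approximation:
  assumes f: "continuous_on (sphere a r) f" and "e > 0"
  obtains p :: "complex poly" where "\<And>z. z \<in> sphere a r \<Longrightarrow> \<bar>f z - Re (poly p (z - a))\<bar> < e"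
proof -
  define R where "R = {h :: complex \<Rightarrow> real. continuous_on (sphere a r) h \<and>
     (\<exists>p. \<forall>z\<in>sphere a r. h z = Re (poly p (z - a)))}"
  interpret function_ring_on R "sphere a r"
  proof
    show "compact (sphere a r)" by simp
    show "continuous_on (sphere a r) h" if "h \<in> R" for h using that by (simp add: R_def)
    show "(\<lambda>x. h x + k x) \<in> R" if "h \<in> R" "k \<in> R" for h k
    proof -
      obtain p q where "\<forall>z\<in>sphere a r. h z = Re (poly p (z - a))" "\<forall>z\<in>sphere a r. k z = Re (poly q (z - a))"
        using \<open>h \<in> R\<close> \<open>k \<in> R\<close> R_def by auto
      then have "\<forall>z\<in>sphere a r. h z + k z = Re (poly (p + q) (z - a))" by simp
      then show ?thesis using that unfolding R_def by (blast intro: continuous_intros)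
    qed
    show "(\<lambda>x. h x * k x) \<in> R" if "h \<in> R" "k \<in> R" for h k
    proof -
      obtain p q where *: "\<forall>z\<in>sphere a r. h z = Re (poly p (z - a))" "\<forall>z\<in>sphere a r. k z = Re (poly q (z - a))"
        using \<open>h \<in> R\<close> \<open>k \<in> R\<close> R_def by auto
      obtain s where "\<forall>z. norm z = r \<longrightarrow> Re (poly p z) * Re (poly q z) = Re (poly s z)"
        using Re_poly_mult by metis
      then have "\<forall>z\<in>sphere a r. h z * k z = Re (poly s (z - a))"
        using * by (simp add: dist_norm norm_minus_commute)
      then show ?thesis using that unfolding R_def by (blast intro: continuous_intros)
    qed
    show "(\<lambda>_. c) \<in> R" for c
      by (auto simp: R_def intro!: exI[of _ "[:of_real c:]"])
    show "\<exists>h\<in>R. h x \<noteq> h y" if "x \<in> sphere a r" "y \<in> sphere a r" "x \<noteq> y" for x y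
    proof -
      \<comment> \<open>The second polynomial has real part \<open>Im (z - a)\<close>, because
        \<open>Re (- \<i> * w) = Im w\<close>.\<close>
      have 1: "(\<lambda>z. Re (poly [:0, 1:] (z - a))) \<in> R" "(\<lambda>z. Re (poly [:0, -\<i>:] (z - a))) \<in> R"
        unfolding R_def mem_Collect_eq by (intro conjI continuous_intros; blast)+
      then show ?thesis using that(3)
        by (cases "Re x = Re y") (auto simp: complex_eq_iff intro: bexI[OF _ 1(1)] bexI[OF _ 1(2)])
    qed
  qed
  obtain h where h: "h \<in> R" "\<And>x. x \<in> sphere a r \<Longrightarrow> \<bar>f x - h x\<bar> < e"
    using Stone_Weierstrass_basic[OF f \<open>e > 0\<close>] by blast
  then obtain p where "\<And>z. z \<in> sphere a r \<Longrightarrow> h z = Re (poly p (z - a))"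
    unfolding R_def by blast
  then show ?thesis using that[of p] h(2) by metis
qed

text \<open>Subtract a harmonic polynomial that is close to \<open>f\<close> on the circle. If the
  maximum can only occur on the circle, the value of \<open>f\<close> at the centre exceeds that of
  the polynomial, which is its mean, by a small error only. The quadratic term is there to give a
  strict contradiction at an interior maximum when the criterion is applied.\<close>

lemma submean_no_max:
  fixes f :: "complex \<Rightarrow> real"
  assumes r: "r > 0" and f: "continuous_on (cball a r) f"
    and nomax: "\<And>p e z0. e > 0 \<Longrightarrow> z0 \<in> ball a r \<Longrightarrow>
      \<exists>z\<in>cball a r. f z0 + Re (poly p (z0 - a)) + e * (norm (z0 - a))\<^sup>2 < f z + Re (poly p (z - a)) + e * (norm (z - a))\<^sup>2"
  shows "f a \<le> cmean f a r"
proof (rule field_le_epsilon)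
  fix e0 :: real assume "e0 > 0"
  \<comment> \<open>Three errors: the approximation on the circle, the quadratic term on the circle,
    and the comparison of the two means.\<close>
  define e where "e = e0 / 3"
  have e: "e > 0" using \<open>e0 > 0\<close> by (simp add: e_def)
  have fs: "continuous_on (sphere a r) f" by (rule continuous_on_subset[OF f]) auto
  obtain p where p: "\<And>z. z \<in> sphere a r \<Longrightarrow> \<bar>f z - Re (poly p (z - a))\<bar> < e"
    using harmonic_approximation[OF fs e] by blast
  define F where "F z = f z + Re (poly (-p) (z - a)) + e / r\<^sup>2 * (norm (z - a))\<^sup>2" for z
  have "continuous_on (cball a r) F"
    unfolding F_def by (intro continuous_intros f)
  then obtain z0 where z0: "z0 \<in> cball a r" "\<And>z. z \<in> cball a r \<Longrightarrow> F z \<le> F z0"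
    using continuous_attains_sup[of "cball a r" F] r by auto
  have "z0 \<notin> ball a r"
    using nomax[of "e / r\<^sup>2" z0 "-p"] z0(2) e r unfolding F_def by (meson divide_pos_pos not_le zero_less_power)
  then have s: "z0 \<in> sphere a r" using z0(1) by auto
  then have "norm (z0 - a) = r" by (simp add: dist_norm norm_minus_commute)
  then have "F z0 \<le> 2 * e" using p[OF s] r unfolding F_def by simp
  then have 1: "f a \<le> 2 * e + Re (poly p 0)"
    using z0(2)[of a] r unfolding F_def by simp
  have "Re (poly p 0) = cmean (\<lambda>z. Re (poly p (z - a))) a r"
    using r by (simp add: cmean_poly)
  also have "\<dots> \<le> cmean (\<lambda>z. 1 * f z + e) a r"
  proof (rule cmean_mono)
    show "circ_integrable (\<lambda>z. Re (poly p (z - a))) a r"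
      by (intro circ_integrable_continuous continuous_intros) (use r in auto)
    show "circ_integrable (\<lambda>z. 1 * f z + e) a r"
      by (intro circ_integrable_continuous continuous_intros fs) (use r in auto)
  qed (use p r in \<open>force simp: abs_less_iff\<close>)+
  also have "\<dots> = cmean f a r + e"
    using cmean_affine[OF circ_integrable_continuous[OF fs], of 1 e] r by simp
  finally show "f a \<le> cmean f a r + e0" using 1 by (simp add: e_def)
qed

text \<open>Expanding about \<open>z0\<close>, the term \<open>norm (z - z0)\<close> is constant on
  the circle and the rest is linear in \<open>z - z0\<close>. So the square, though not harmonic,
  agrees there with a harmonic polynomial, and its mean can be read off.\<close>

lemma norm_sq_circle:
  fixes z z0 a :: complex
  assumes "norm (z - z0) = s"
  shows "(norm (z - a))\<^sup>2 = Re (poly [:of_real ((norm (z0 - a))\<^sup>2 + s\<^sup>2), 2 * cnj (z0 - a):] (z - z0))"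
proof -
  have "(norm (z - a))\<^sup>2 = (norm (z0 - a))\<^sup>2 + (norm (z - z0))\<^sup>2 + Re (2 * cnj (z0 - a) * (z - z0))"
    unfolding cmod_power2 by (simp add: power2_eq_square algebra_simps)
  then show ?thesis using assms by (simp add: mult.commute)
qed

lemma cmean_norm_sq:
  assumes "s \<ge> 0"
  shows "cmean (\<lambda>z. (norm (z - a))\<^sup>2) z0 s = (norm (z0 - a))\<^sup>2 + s\<^sup>2"
proof -
  have "cmean (\<lambda>z. (norm (z - a))\<^sup>2) z0 s
     = cmean (\<lambda>z. Re (poly [:of_real ((norm (z0 - a))\<^sup>2 + s\<^sup>2), 2 * cnj (z0 - a):] (z - z0))) z0 s"
    by (rule cmean_cong[OF assms]) (rule norm_sq_circle, simp add: dist_norm norm_minus_commute)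
  also have "\<dots> = (norm (z0 - a))\<^sup>2 + s\<^sup>2"
    by (subst cmean_poly[OF assms]) simp
  finally show ?thesis .
qed

text \<open>Suppose \<open>f\<close> plus a harmonic polynomial plus
  \<open>e * (norm (z - a))\<^sup>2\<close> had an interior maximum at \<open>z0\<close>. Its mean
  over a small circle about \<open>z0\<close> would be at most the value there, while the local
  inequality and the quadratic term give at least that value plus
  \<open>e * s\<^sup>2\<close>.\<close>

lemma submean_local_to_global:
  fixes f :: "complex \<Rightarrow> real"
  assumes r: "r > 0" and f: "continuous_on (cball a r) f"
    and loc: "\<And>z. z \<in> ball a r \<Longrightarrow> \<exists>d>0. \<forall>s. 0 < s \<and> s < d \<longrightarrow> f z \<le> cmean f z s"
  shows "f a \<le> cmean f a r"
proof (rule submean_no_max[OF r f])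
  fix p :: "complex poly" and e :: real and z0
  assume e: "e > 0" and z0: "z0 \<in> ball a r"
  define F where "F z = f z + Re (poly p (z - a)) + e * (norm (z - a))\<^sup>2" for z
  show "\<exists>z\<in>cball a r. f z0 + Re (poly p (z0 - a)) + e * (norm (z0 - a))\<^sup>2
      < f z + Re (poly p (z - a)) + e * (norm (z - a))\<^sup>2"
  proof (rule ccontr)
    assume "\<not> ?thesis"
    then have max: "F z \<le> F z0" if "z \<in> cball a r" for z
      using that unfolding F_def by force
    obtain d where d: "d > 0" "\<And>s. 0 < s \<and> s < d \<Longrightarrow> f z0 \<le> cmean f z0 s" using loc[OF z0] by blast
    obtain d' where d': "d' > 0" "cball z0 d' \<subseteq> ball a r"
      using z0 open_contains_cball_eq[OF open_ball] by blast
    define s where "s = min (d/2) d'"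
    have s: "s > 0" "s < d" "s \<le> d'" using d d' by (auto simp: s_def)
    have sub: "sphere z0 s \<subseteq> cball a r" using d'(2) s by auto
    note fs = continuous_on_subset[OF f sub]
    have ci: "circ_integrable f z0 s" "circ_integrable (\<lambda>z. Re (poly p (z - a))) z0 s"
       "circ_integrable (\<lambda>z. e * (norm (z - a))\<^sup>2) z0 s" "circ_integrable (\<lambda>z. (norm (z - a))\<^sup>2) z0 s"
       "circ_integrable (\<lambda>z. f z + Re (poly p (z - a))) z0 s" "circ_integrable F z0 s"
       "circ_integrable (\<lambda>z. F z0) z0 s"
      unfolding F_def
      by (intro circ_integrable_continuous continuous_intros fs; use s in simp)+
    have "cmean F z0 s = cmean f z0 s + Re (poly p (z0 - a)) + e * ((norm (z0 - a))\<^sup>2 + s\<^sup>2)"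
      unfolding F_def cmean_add[OF ci(5,3)] cmean_add[OF ci(1,2)] 
      using cmean_affine[OF ci(4), of e 0] cmean_norm_sq[of s a z0] cmean_poly[of s p a z0] s by simp
    moreover have "cmean F z0 s \<le> cmean (\<lambda>z. F z0) z0 s"
      by (rule cmean_mono) (use ci s max sub in auto)
    moreover have "cmean (\<lambda>z. F z0) z0 s = F z0"
      using cmean_affine[OF ci(1), of 0 "F z0"] by simp
    moreover have "e * s\<^sup>2 > 0" using e s by simp
    ultimately show False using d(2)[of s] s unfolding F_def by (simp add: algebra_simps)
  qed
qed

section \<open>Second derivatives and the Laplacian test for the sub-mean value inequality\<close>

lemma second_derivative_local_max:
  fixes \<phi> \<phi>' :: "real \<Rightarrow> real"
  assumes d: "d > 0" and \<phi>: "\<And>s. \<bar>s\<bar> < d \<Longrightarrow> (\<phi> has_real_derivative \<phi>' s) (at s)"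
    and \<phi>': "(\<phi>' has_real_derivative D) (at 0)"
    and max: "\<And>s. \<bar>s\<bar> < d \<Longrightarrow> \<phi> s \<le> \<phi> 0"
  shows "D \<le> 0"
proof (rule ccontr)
  assume "\<not> D \<le> 0"
  have "\<phi>' 0 = 0"
    by (rule DERIV_local_max[OF \<phi>[of 0] d]) (use d max in auto)
  then obtain d2 where d2: "d2 > 0" "\<And>h. 0 < h \<Longrightarrow> h < d2 \<Longrightarrow> 0 < \<phi>' h"
    using DERIV_pos_inc_right[OF \<phi>'] \<open>\<not> D \<le> 0\<close> by auto
  define h where "h = min d d2 / 2"
  have h: "h > 0" "h < d" "h < d2" using d d2 by (auto simp: h_def)
  obtain \<xi> where \<xi>: "0 < \<xi>" "\<xi> < h" "\<phi> h - \<phi> 0 = (h - 0) * \<phi>' \<xi>"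
    using MVT2[of 0 h \<phi> \<phi>'] h \<phi> by force
  then have "\<phi> h > \<phi> 0" using d2(2)[of \<xi>] h by (smt (verit) mult_pos_pos)
  then show False using max[of h] h by simp
qed

text \<open>A relation at a single point and direction, so that sums can be handled pointwise
  without assuming \<open>f\<close> to be \<open>C\<^sup>2\<close>.\<close>

definition second_deriv :: "(complex \<Rightarrow> real) \<Rightarrow> complex \<Rightarrow> complex \<Rightarrow> real \<Rightarrow> bool" where
  "second_deriv f z (v::complex) (D::real) \<longleftrightarrow> (\<exists>d>0. \<exists>\<phi>'. (\<forall>s. \<bar>s\<bar> < d \<longrightarrow> ((\<lambda>s. f (z + of_real s * v)) has_real_derivative \<phi>' s) (at s))
     \<and> (\<phi>' has_real_derivative D) (at 0))"

lemma second_deriv_add: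
  assumes "second_deriv f z v D" "second_deriv g z v E"
  shows "second_deriv (\<lambda>z. f z + g z) z v (D + E)"
proof -
  obtain d \<phi> where 1: "d > 0" "\<And>s. \<bar>s\<bar> < d \<Longrightarrow> ((\<lambda>s. f (z + of_real s * v)) has_real_derivative \<phi> s) (at s)"
     "(\<phi> has_real_derivative D) (at 0)" using assms(1) unfolding second_deriv_def by metis
  obtain e \<psi> where 2: "e > 0" "\<And>s. \<bar>s\<bar> < e \<Longrightarrow> ((\<lambda>s. g (z + of_real s * v)) has_real_derivative \<psi> s) (at s)"
     "(\<psi> has_real_derivative E) (at 0)" using assms(2) unfolding second_deriv_def by metis
  show ?thesis unfolding second_deriv_def
    by (rule exI[of _ "min d e"], intro conjI exI[of _ "\<lambda>s. \<phi> s + \<psi> s"])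
      (use 1 2 in \<open>auto intro!: derivative_intros\<close>)
qed

lemma second_deriv_uminus:
  assumes "second_deriv f z v D"
  shows "second_deriv (\<lambda>z. - f z) z v (- D)"
proof -
  obtain d \<phi> where 1: "d > 0" "\<And>s. \<bar>s\<bar> < d \<Longrightarrow> ((\<lambda>s. f (z + of_real s * v)) has_real_derivative \<phi> s) (at s)"
     "(\<phi> has_real_derivative D) (at 0)" using assms(1) unfolding second_deriv_def by metis
  show ?thesis unfolding second_deriv_def
    by (rule exI[of _ d], intro conjI exI[of _ "\<lambda>s. - \<phi> s"])
      (use 1 in \<open>auto intro!: derivative_intros\<close>)
qed

text \<open>The factor \<open>v\<^sup>2\<close> is \<open>1\<close> for \<open>v = 1\<close> and
  \<open>-1\<close> for \<open>v = \<i>\<close>; the two contributions cancel, which is harmonicity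
  in the form used below.\<close>

lemma second_deriv_Re_poly:
  "second_deriv (\<lambda>z. Re (poly p (z - a))) z v (Re (poly (pderiv (pderiv p)) (z - a) * v\<^sup>2))"
proof -
  have 1: "((\<lambda>s. poly p (z + of_real s * v - a)) has_vector_derivative poly (pderiv p) (z + of_real s * v - a) * v) (at s)"
    for p :: "complex poly" and s :: real
  proof -
    have "((\<lambda>\<zeta>. poly p (z + \<zeta> * v - a)) has_field_derivative poly (pderiv p) (z + of_real s * v - a) * v) (at (of_real s))"
      by (rule DERIV_chain2[OF poly_DERIV]) (auto intro!: derivative_eq_intros)
    then show ?thesis
      using has_vector_derivative_real_field by blast
  qed
  have 2: "((\<lambda>s. Re (poly p (z + of_real s * v - a) * w)) has_real_derivative Re (poly (pderiv p) (z + of_real s * v - a) * v * w)) (at s)"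
    for p :: "complex poly" and s :: real and w
    unfolding has_real_derivative_iff_has_vector_derivative
    by (rule has_vector_derivative_mult_left[OF 1, THEN bounded_linear.has_vector_derivative[OF bounded_linear_Re]])
  show ?thesis unfolding second_deriv_def
    by (rule exI[of _ 1], intro conjI exI[of _ "\<lambda>s. Re (poly (pderiv p) (z + of_real s * v - a) * v)"])
      (use 2[where p=p and w=1] 2[where p="pderiv p" and w=v and s=0] in \<open>auto simp: power2_eq_square mult.assoc\<close>)
qed

lemma second_deriv_norm_sq:
  "second_deriv (\<lambda>z. e * (norm (z - a))\<^sup>2) z v (2 * e * (norm v)\<^sup>2)"
proof -
  have 1: "e * (norm (z + of_real s * v - a))\<^sup>2 = e * ((norm (z - a))\<^sup>2 + 2 * s * Re (cnj v * (z - a)) + s\<^sup>2 * (norm v)\<^sup>2)" for s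
    unfolding cmod_power2 by (simp add: power2_eq_square algebra_simps)
  show ?thesis unfolding second_deriv_def 1
    by (rule exI[of _ 1], intro conjI exI[of _ "\<lambda>s. e * (2 * Re (cnj v * (z - a)) + 2 * s * (norm v)\<^sup>2)"])
      (auto intro!: derivative_eq_intros)
qed

text \<open>At an interior maximum both second derivatives are at most \<open>0\<close>, but their
  sum is at least \<open>4 * e\<close>: the harmonic part cancels and the quadratic term contributes
  \<open>2 * e\<close> in each direction.\<close>

lemma submean_of_laplacian_nonneg:
  fixes f :: "complex \<Rightarrow> real"
  assumes r: "r > 0" and f: "continuous_on (cball a r) f"
    and lap: "\<And>z. z \<in> ball a r \<Longrightarrow> second_deriv f z 1 (D z) \<and> second_deriv f z \<i> (E z) \<and> D z + E z \<ge> 0"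
  shows "f a \<le> cmean f a r"
proof (rule submean_no_max[OF r f])
  fix p :: "complex poly" and e :: real and z0
  assume e: "e > 0" and z0: "z0 \<in> ball a r"
  define F where "F z = f z + Re (poly p (z - a)) + e * (norm (z - a))\<^sup>2" for z
  define P where "P = Re (poly (pderiv (pderiv p)) (z0 - a))"
  have D1: "second_deriv F z0 1 (D z0 + P + 2 * e)"
    unfolding F_def P_def
    using second_deriv_add[OF second_deriv_add[OF conjunct1[OF lap[OF z0]] second_deriv_Re_poly[of p a z0 1]] second_deriv_norm_sq[of e a z0 1]]
    by simp
  have D2: "second_deriv F z0 \<i> (E z0 - P + 2 * e)"
    unfolding F_def P_def
    using second_deriv_add[OF second_deriv_add[OF conjunct1[OF conjunct2[OF lap[OF z0]]] second_deriv_Re_poly[of p a z0 \<i>]] second_deriv_norm_sq[of e a z0 \<i>]]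
    by simp
  show "\<exists>z\<in>cball a r. f z0 + Re (poly p (z0 - a)) + e * (norm (z0 - a))\<^sup>2
      < f z + Re (poly p (z - a)) + e * (norm (z - a))\<^sup>2"
  proof (rule ccontr)
    assume "\<not> ?thesis"
    then have max: "F z \<le> F z0" if "z \<in> cball a r" for z
      using that unfolding F_def by force
    have *: "C \<le> 0" if sd: "second_deriv F z0 v C" and v: "norm v = 1" for v C
    proof -
      obtain d where d: "d > 0" "ball z0 d \<subseteq> cball a r"
        using z0 open_contains_ball_eq[OF open_ball] ball_subset_cball by (metis subset_trans)
      obtain d2 \<phi>' where d2: "d2 > 0" "\<And>s. \<bar>s\<bar> < d2 \<Longrightarrow> ((\<lambda>s. F (z0 + of_real s * v)) has_real_derivative \<phi>' s) (at s)"
        "(\<phi>' has_real_derivative C) (at 0)"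
        using sd unfolding second_deriv_def by metis
      show ?thesis
      proof (rule second_derivative_local_max[of "min d d2" "\<lambda>s. F (z0 + of_real s * v)" \<phi>'])
        fix s :: real assume s: "\<bar>s\<bar> < min d d2"
        have "z0 + of_real s * v \<in> ball z0 d" using s v by (simp add: dist_norm norm_mult)
        then show "F (z0 + of_real s * v) \<le> F (z0 + of_real 0 * v)" using max d(2) by auto
      qed (use d d2 in auto)
    qed
    have "D z0 + E z0 + 4 * e \<le> 0" using *[OF D1] *[OF D2] by simp
    then show False using lap[OF z0] e by simp
  qed
qed

text \<open>Used as a contrapositive. Subtracting \<open>(e / 4) * (norm (z - a))\<^sup>2\<close>
  from \<open>- f\<close> uses up exactly the margin \<open>e\<close> and leaves a non-negative
  Laplacian; the mean of the subtracted term then makes the inequality for \<open>f\<close>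
  strict.\<close>

lemma laplacian_nonneg_of_submean:
  fixes f :: "complex \<Rightarrow> real"
  assumes f: "continuous_on (cball a r) f" and r: "r > 0"
    and lap: "\<And>z. z \<in> ball a r \<Longrightarrow> second_deriv f z 1 (D z) \<and> second_deriv f z \<i> (E z)"
    and neg: "\<And>z. z \<in> ball a r \<Longrightarrow> D z + E z \<le> - e" "e > 0"
  shows "cmean f a r < f a"
proof -
  define G where "G z = - f z + (- (e/4)) * (norm (z - a))\<^sup>2" for z
  have fs: "continuous_on (sphere a r) f" by (rule continuous_on_subset[OF f]) auto
  have "G a \<le> cmean G a r"
  proof (rule submean_of_laplacian_nonneg[OF r, where D="\<lambda>z. - D z - e/2" and E="\<lambda>z. - E z - e/2"])
    show "continuous_on (cball a r) G" unfolding G_def by (intro continuous_intros f)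
    fix z assume z: "z \<in> ball a r"
    show "second_deriv G z 1 (- D z - e / 2) \<and> second_deriv G z \<i> (- E z - e / 2) \<and> 0 \<le> - D z - e / 2 + (- E z - e / 2)"
      using second_deriv_add[OF second_deriv_uminus second_deriv_norm_sq[of "-(e/4)" a z 1], of f "D z"]
       second_deriv_add[OF second_deriv_uminus second_deriv_norm_sq[of "-(e/4)" a z \<i>], of f "E z"]
       lap[OF z] neg(1)[OF z] unfolding G_def by simp
  qed
  also have "cmean G a r = - cmean f a r + (- (e/4)) * r\<^sup>2"
  proof -
    have ci: "circ_integrable (\<lambda>z. - f z) a r" "circ_integrable (\<lambda>z. - (e/4) * (norm (z - a))\<^sup>2) a r"
      "circ_integrable f a r" "circ_integrable (\<lambda>z. (norm (z - a))\<^sup>2) a r"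
      by (intro circ_integrable_continuous continuous_intros fs; use r in simp)+
    show ?thesis unfolding G_def cmean_add[OF ci(1,2)]
      using cmean_affine[OF ci(3), of "-1" 0] cmean_affine[OF ci(4), of "-(e/4)" 0] cmean_norm_sq[of r a a] r by simp
  qed
  finally have "cmean f a r \<le> f a - e / 4 * r\<^sup>2" by (simp add: G_def)
  moreover have "e / 4 * r\<^sup>2 > 0" using r neg(2) by simp
  ultimately show ?thesis by linarith
qed

section \<open>Plurisubharmonicity tested on small circles\<close>

lemma usc_on_continuous: "continuous_on S f \<Longrightarrow> usc_on S f"
  unfolding usc_on_def
proof
  fix a assume "continuous_on S f"
  from continuous_openin_preimage_gen[OF this, of "{..<a}"]
  show "openin (top_of_set S) {x \<in> S. f x < a}"
    by (simp add: vimage_def Int_def)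
qed

lemma open_slice:
  fixes \<Omega> :: "(complex ^ 'n) set"
  assumes "open \<Omega>" shows "open {\<tau>. z + \<tau> *s w \<in> \<Omega>}"
proof -
  have "continuous_on UNIV (\<lambda>\<tau>::complex. z + \<tau> *s w)"
    unfolding vector_scalar_mult_def by (intro continuous_intros)
  then show ?thesis using assms by (simp add: continuous_on_open_vimage vimage_def)
qed

lemma continuous_on_slice_map: "continuous_on T (\<lambda>\<tau>::complex. z + \<tau> *s (w :: complex ^ 'n))"
  unfolding vector_scalar_mult_def by (intro continuous_intros)

lemma cmean_slice: "cmean (\<lambda>\<tau>. u (z + \<tau> *s w)) a s = cmean (\<lambda>\<tau>. u ((z + a *s w) + \<tau> *s w)) 0 s"
  unfolding cmean_def by (simp add: vector_sadd_rdistrib add.assoc)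

text \<open>Continuity supplies integrability and allows \<open>submean_local_to_global\<close> to
  pass from small circles to all admissible ones; \<open>cmean_slice\<close> moves the centre of a
  circle to the base point of the slice.\<close>

lemma psh_onI_local:
  fixes u :: "complex ^ 'n \<Rightarrow> real"
  assumes "open \<Omega>" and cont: "continuous_on \<Omega> u"
    and loc: "\<And>z w. z \<in> \<Omega> \<Longrightarrow> \<exists>d>0. \<forall>s. 0 < s \<and> s < d \<longrightarrow> u z \<le> cmean (\<lambda>\<tau>. u (z + \<tau> *s w)) 0 s"
  shows "psh_on \<Omega> u"
  unfolding psh_on_def
proof (intro conjI allI)
  show "usc_on \<Omega> u" by (rule usc_on_continuous[OF cont])
  fix z w
  define S where "S = {\<tau>. z + \<tau> *s w \<in> \<Omega>}"
  have c: "continuous_on S (\<lambda>\<tau>. u (z + \<tau> *s w))"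
    by (rule continuous_on_compose2[OF cont continuous_on_slice_map]) (auto simp: S_def)
  show "subharmonic_on {\<tau>. z + \<tau> *s w \<in> \<Omega>} (\<lambda>\<tau>. u (z + \<tau> *s w))"
    unfolding subharmonic_on_def S_def[symmetric]
  proof (intro conjI allI impI)
    show "usc_on S (\<lambda>\<tau>. u (z + \<tau> *s w))" by (rule usc_on_continuous[OF c])
    fix a and r :: real assume r: "0 < r" and sub: "cball a r \<subseteq> S"
    have cs: "continuous_on (sphere a r) (\<lambda>\<tau>. u (z + \<tau> *s w))"
      by (rule continuous_on_subset[OF c]) (use sub in auto)
    show "set_integrable lborel {0..2 * pi} (\<lambda>t. u (z + (a + complex_of_real r * cis t) *s w))"
      using circ_integrable_continuous[OF cs] r by (simp add: circ_integrable_def)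
    have "u (z + a *s w) \<le> cmean (\<lambda>\<tau>. u (z + \<tau> *s w)) a r"
    proof (rule submean_local_to_global[OF r continuous_on_subset[OF c sub]])
      fix b assume "b \<in> ball a r"
      then have "b \<in> cball a r" by simp
      then have "z + b *s w \<in> \<Omega>" using sub unfolding S_def by blast
      from loc[OF this, of w] show "\<exists>d>0. \<forall>s. 0 < s \<and> s < d \<longrightarrow> u (z + b *s w) \<le> cmean (\<lambda>\<tau>. u (z + \<tau> *s w)) b s"
        unfolding cmean_slice[of u z w b] .
    qed
    then show "u (z + a *s w) \<le> 1 / (2 * pi) * (LBINT t:{0..2 * pi}. u (z + (a + complex_of_real r * cis t) *s w))"
      unfolding cmean_def .
  qed
qed

lemma psh_on_submean:
  fixes u :: "complex ^ 'n \<Rightarrow> real"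
  assumes "psh_on \<Omega> u" "r > 0" "\<And>\<tau>. norm \<tau> \<le> r \<Longrightarrow> z + \<tau> *s w \<in> \<Omega>"
  shows "circ_integrable (\<lambda>\<tau>. u (z + \<tau> *s w)) 0 r" "u z \<le> cmean (\<lambda>\<tau>. u (z + \<tau> *s w)) 0 r"
proof -
  have "subharmonic_on {\<tau>. z + \<tau> *s w \<in> \<Omega>} (\<lambda>\<tau>. u (z + \<tau> *s w))"
    using assms(1) unfolding psh_on_def by blast
  moreover have "cball 0 r \<subseteq> {\<tau>. z + \<tau> *s w \<in> \<Omega>}" using assms(3) by auto
  ultimately show "circ_integrable (\<lambda>\<tau>. u (z + \<tau> *s w)) 0 r" "u z \<le> cmean (\<lambda>\<tau>. u (z + \<tau> *s w)) 0 r"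
    using assms(2) unfolding subharmonic_on_def circ_integrable_def cmean_def by fastforce+
qed

section \<open>The Lipschitz index\<close>

text \<open>\<open>A\<close> may lack the largest exponent of \<open>B\<close>, which does not
  affect the supremum. \<open>dense\<close> also makes \<open>A\<close> nonempty when
  \<open>B\<close> is, so the default value \<open>0\<close> is taken on both sides or on neither.
  Both index comparisons end here, and this is why an arbitrarily small loss of exponent is
  harmless.\<close>

lemma Sup_exponents_eq:
  fixes A B :: "real set"
  assumes "A \<subseteq> B" "\<And>\<eta>. \<eta> \<in> B \<Longrightarrow> 0 < \<eta> \<and> \<eta> < 1"
    and dense: "\<And>\<eta> \<eta>'. \<eta> \<in> B \<Longrightarrow> 0 < \<eta>' \<Longrightarrow> \<eta>' < \<eta> \<Longrightarrow> \<eta>' \<in> A"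
  shows "(if A = {} then 0 else Sup A) = (if B = {} then 0 else Sup B)"
proof (cases "B = {}")
  case False
  then obtain \<eta> where \<eta>: "\<eta> \<in> B" by blast
  then have "\<eta> / 2 \<in> A" using dense[of \<eta> "\<eta>/2"] assms(2)[of \<eta>] by simp
  then have A: "A \<noteq> {}" by blast
  have bB: "bdd_above B" using assms(2) by (meson bdd_above.I less_imp_le)
  then have bA: "bdd_above A" using assms(1) by (rule bdd_above_mono)
  have "Sup B \<le> Sup A"
  proof (rule cSup_least[OF False])
    fix x assume x: "x \<in> B"
    show "x \<le> Sup A"
    proof (rule dense_le_bounded[of 0])
      show "0 < x" using assms(2)[OF x] by blast
      fix w assume "0 < w" "w < x"
      then show "w \<le> Sup A" using dense[OF x] bA by (simp add: cSup_upper)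
    qed
  qed
  moreover have "Sup A \<le> Sup B" by (rule cSup_subset_mono[OF A bB assms(1)])
  ultimately show ?thesis using A False by simp
qed (use assms(1) in auto)

lemma norm_complex_scalar_mult: "norm (c *s (w :: complex ^ 'n)) = norm c * norm w"
  by (simp add: norm_vec_def L2_set_def norm_mult power_mult_distrib real_sqrt_mult
      flip: sum_distrib_left)

lemma bdist_nonneg: "0 \<le> bdist \<Omega> z"
  by (simp add: bdist_def infdist_nonneg)

lemma continuous_on_bdist: "continuous_on S (bdist \<Omega>)"
  unfolding bdist_def by (intro continuous_intros)

lemma bdist_triangle: "bdist \<Omega> z \<le> bdist \<Omega> w + dist z w"
  unfolding bdist_def by (rule infdist_triangle)

lemma frontier_ne:
  fixes \<Omega> :: "(complex ^ 'n) set"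
  assumes "\<Omega> \<noteq> {}" "bounded \<Omega>"
  shows "frontier \<Omega> \<noteq> {}"
  using assms frontier_not_empty[of \<Omega>] not_bounded_UNIV by fastforce

text \<open>A ball is connected; meeting both \<open>\<Omega>\<close> and its complement it would
  contain a boundary point closer to \<open>z\<close> than \<open>bdist \<Omega> z\<close>.\<close>

lemma ball_bdist_subset:
  fixes \<Omega> :: "(complex ^ 'n) set"
  assumes "z \<in> \<Omega>"
  shows "ball z (bdist \<Omega> z) \<subseteq> \<Omega>"
proof (rule ccontr)
  assume "\<not> ?thesis"
  then have "ball z (bdist \<Omega> z) - \<Omega> \<noteq> {}" by blast
  moreover from this have "bdist \<Omega> z > 0"
    by (metis Diff_eq_empty_iff ball_eq_empty empty_subsetI not_le)
  ultimately have "ball z (bdist \<Omega> z) \<inter> frontier \<Omega> \<noteq> {}"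
    using assms centre_in_ball[of z "bdist \<Omega> z"] by (intro connected_Int_frontier) blast+
  then obtain p where "p \<in> frontier \<Omega>" "dist z p < bdist \<Omega> z" by auto
  then show False using infdist_le[of p "frontier \<Omega>" z] unfolding bdist_def by simp
qed

lemma bdist_pos:
  fixes \<Omega> :: "(complex ^ 'n) set"
  assumes "open \<Omega>" "bounded \<Omega>" "z \<in> \<Omega>"
  shows "bdist \<Omega> z > 0"
proof -
  have "z \<notin> frontier \<Omega>" using assms by (simp add: frontier_def interior_open)
  then show ?thesis
    using infdist_pos_not_in_closed[of "frontier \<Omega>" z] frontier_ne[of \<Omega>] assms
    by (auto simp: bdist_def frontier_closed)
qed

lemma bdist_closure_bounds:
  assumes "\<And>z. z \<in> \<Omega> \<Longrightarrow> f z \<le> g z" "continuous_on (closure \<Omega>) f" "continuous_on (closure \<Omega>) g" "z \<in> closure \<Omega>"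
  shows "f z \<le> (g z :: real)"
proof -
  have "0 \<le> g z - f z"
    by (rule continuous_ge_on_closure[of \<Omega> "\<lambda>z. g z - f z"])
      (use assms in \<open>auto intro!: continuous_intros\<close>)
  then show ?thesis by simp
qed

section \<open>Affine majorants of a power and their Lipschitz dependence on the parameter\<close>

locale young_power =
  fixes \<eta> \<eta>' q :: real
  assumes eta: "0 < \<eta>'" "\<eta>' < \<eta>" "\<eta> < 1" and q_def: "q = \<eta>' / \<eta>"
begin

text \<open>The minimum over \<open>\<tau>\<close> of \<open>T \<tau> s\<close> is \<open>s powr q\<close>; being affine in \<open>s\<close>, each of these
  majorants turns a plurisubharmonic \<open>-s\<close> into a plurisubharmonic function.\<close>

definition T :: "real \<Rightarrow> real \<Rightarrow> real" where
  "T \<tau> s = (1 - q) * \<tau> powr \<eta>' + q * \<tau> powr (\<eta>' - \<eta>) * s"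

definition V :: "real \<Rightarrow> real \<Rightarrow> real" where
  "V \<tau> s = T \<tau> s powr (1 / \<eta>')"

definition \<kappa> :: real where "\<kappa> = (1 - q) powr (1 / \<eta>')"

lemma q: "0 < q" "q < 1" "q * \<eta> = \<eta>'"
  using eta by (auto simp: q_def)

lemma kappa_pos: "\<kappa> > 0"
  using q by (simp add: \<kappa>_def)

lemma T_pos: "\<tau> > 0 \<Longrightarrow> s > 0 \<Longrightarrow> T \<tau> s > 0"
  using q unfolding T_def by (intro add_pos_pos mult_pos_pos) auto

lemma V_pos: "\<tau> > 0 \<Longrightarrow> s > 0 \<Longrightarrow> V \<tau> s > 0"
  using T_pos[of \<tau> s] unfolding V_def by simp

lemma V_powr: "\<tau> > 0 \<Longrightarrow> s > 0 \<Longrightarrow> V \<tau> s powr \<eta>' = T \<tau> s"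
  using T_pos[of \<tau> s] eta by (simp add: V_def powr_powr)

lemma V_ge_kappa:
  assumes "\<tau> > 0" "s > 0"
  shows "\<kappa> * \<tau> \<le> V \<tau> s"
proof -
  have "\<kappa> * \<tau> = ((1 - q) * \<tau> powr \<eta>') powr (1 / \<eta>')"
    using assms q eta by (simp add: \<kappa>_def powr_mult powr_powr)
  also have "\<dots> \<le> V \<tau> s"
    unfolding V_def T_def using assms q eta by (intro powr_mono2) auto
  finally show ?thesis .
qed

text \<open>Weighted arithmetic-geometric mean inequality with weights \<open>1 - q\<close> and
  \<open>q\<close>; the powers of \<open>\<tau>\<close> cancel because
  \<open>q * \<eta> = \<eta>'\<close>.\<close>

lemma V_ge:
  assumes "\<tau> > 0" "s > 0"
  shows "s powr (1 / \<eta>) \<le> V \<tau> s"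
proof -
  have e: "\<eta>' * (1 - q) + (\<eta>' - \<eta>) * q = 0"
    using q by (simp add: algebra_simps)
  have "s powr q = \<tau> powr (\<eta>' * (1 - q) + (\<eta>' - \<eta>) * q) * s powr q"
    using assms unfolding e by simp
  also have "\<dots> = (\<tau> powr \<eta>') powr (1 - q) * (\<tau> powr (\<eta>' - \<eta>) * s) powr q"
    using assms by (simp add: powr_mult powr_powr powr_add)
  also have "\<dots> \<le> T \<tau> s"
    unfolding T_def using Youngs_inequality_0[of "1 - q" q "\<tau> powr \<eta>'" "\<tau> powr (\<eta>' - \<eta>) * s"] assms q
    by (simp add: mult.assoc)
  finally have "s powr q \<le> T \<tau> s" .
  from powr_mono2[OF _ _ this, of "1 / \<eta>'"] have "(s powr q) powr (1 / \<eta>') \<le> V \<tau> s"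
    unfolding V_def using eta by simp
  then show ?thesis using eta q by (simp add: powr_powr q_def)
qed

text \<open>The equality case \<open>\<tau> powr \<eta> = s\<close> of Young's inequality: here the
  lower bound \<open>V_ge\<close> is attained.\<close>

lemma V_self:
  assumes "s > 0"
  shows "V (s powr (1 / \<eta>)) s = s powr (1 / \<eta>)"
proof -
  have a: "\<eta>' / \<eta> = q" "(\<eta>' - \<eta>) / \<eta> = q - 1" using eta by (auto simp: q_def field_simps)
  have "s powr (q - 1) * s = s powr q"
    using assms powr_add[of s "q - 1" 1] by simp
  then have "T (s powr (1 / \<eta>)) s = s powr q"
    unfolding T_def powr_powr times_divide_eq_left mult_1 a by (simp add: mult.assoc algebra_simps)
  then show ?thesis using eta unfolding V_def by (simp add: powr_powr q_def)
qed

text \<open>The derivative in \<open>\<tau>\<close> is at most \<open>1\<close>, uniformly in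
  \<open>s\<close>. It has the sign of \<open>B\<close>, and where \<open>B > 0\<close> one has
  \<open>T x s \<le> x powr \<eta>'\<close>; then the two variable factors are bounded by
  \<open>x powr (1 - \<eta>')\<close> and \<open>x powr (\<eta>' - 1)\<close>, whose product is
  \<open>1\<close>.\<close>

lemma V_lipschitz:
  assumes "\<tau> > 0" "s > 0" "d \<ge> 0"
  shows "V (\<tau> + d) s \<le> V \<tau> s + d"
proof (cases "d = 0")
  case False
  define V' where "V' x = (1 / \<eta>') * T x s powr (1 / \<eta>' - 1) *
     ((1 - q) * (\<eta>' * x powr (\<eta>' - 1)) + q * ((\<eta>' - \<eta>) * x powr (\<eta>' - \<eta> - 1)) * s)" for x
  have der: "((\<lambda>x. V x s) has_real_derivative V' x) (at x)" if x: "x > 0" for x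
  proof -
    have "((\<lambda>x. T x s) has_real_derivative
      ((1 - q) * (\<eta>' * x powr (\<eta>' - 1)) + q * ((\<eta>' - \<eta>) * x powr (\<eta>' - \<eta> - 1)) * s)) (at x)"
      unfolding T_def using x by (auto intro!: derivative_eq_intros)
    from DERIV_fun_powr[OF this T_pos[OF x \<open>s > 0\<close>], of "1 / \<eta>'"]
    show ?thesis unfolding V_def V'_def by simp
  qed
  have le1: "V' x \<le> 1" if x: "x > 0" for x
  proof -
    define B where "B = x powr (\<eta>' - 1) - x powr (\<eta>' - \<eta> - 1) * s"
    have "q * (\<eta>' - \<eta>) = - (\<eta>' * (1 - q))" using q by (simp add: algebra_simps)
    then have e: "q * ((\<eta>' - \<eta>) * x powr (\<eta>' - \<eta> - 1)) * s = - (\<eta>' * (1 - q)) * (x powr (\<eta>' - \<eta> - 1) * s)"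
      by (metis mult.assoc)
    have V': "V' x = (1 - q) * (T x s powr (1 / \<eta>' - 1) * B)"
      unfolding V'_def B_def e using eta by (simp add: field_simps)
    show ?thesis
    proof (cases "B \<le> 0")
      case True
      then have "V' x \<le> 0" unfolding V' using q by (simp add: mult_nonneg_nonpos)
      then show ?thesis by simp
    next
      case False
      have "x powr (\<eta>' - \<eta> - 1) * s \<le> x powr (\<eta>' - 1)" using False by (simp add: B_def)
      then have "x powr (\<eta>' - \<eta> - 1) * s * x \<le> x powr (\<eta>' - 1) * x" using x by simp
      then have "x powr (\<eta>' - \<eta>) * s \<le> x powr \<eta>'"
        using x powr_add[of x "\<eta>' - \<eta> - 1" 1] powr_add[of x "\<eta>' - 1" 1] by (simp add: mult_ac)
      then have "q * (x powr (\<eta>' - \<eta>) * s) \<le> q * x powr \<eta>'" using q by simp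
      then have "T x s \<le> x powr \<eta>'" unfolding T_def by (simp add: algebra_simps)
      then have "T x s powr (1 / \<eta>' - 1) \<le> (x powr \<eta>') powr (1 / \<eta>' - 1)"
        using eta T_pos[OF x \<open>s > 0\<close>] by (intro powr_mono2) auto
      also have "\<dots> = x powr (1 - \<eta>')" using eta by (simp add: powr_powr algebra_simps)
      finally have 1: "T x s powr (1 / \<eta>' - 1) \<le> x powr (1 - \<eta>')" .
      have 2: "B \<le> x powr (\<eta>' - 1)" using \<open>s > 0\<close> by (simp add: B_def)
      have "T x s powr (1 / \<eta>' - 1) * B \<le> x powr (1 - \<eta>') * x powr (\<eta>' - 1)"
        using 1 2 False by (intro mult_mono) auto
      also have "\<dots> = 1" using x by (simp flip: powr_add)
      finally show ?thesis unfolding V' using q False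
        by (smt (verit) mult_le_one mult_nonneg_nonneg powr_ge_zero)
    qed
  qed
  have "\<exists>z>\<tau>. z < \<tau> + d \<and> V (\<tau> + d) s - V \<tau> s = (\<tau> + d - \<tau>) * V' z"
    by (rule MVT2) (use False assms der in auto)
  then obtain z where z: "z > \<tau>" "V (\<tau> + d) s - V \<tau> s = d * V' z" by auto
  have "d * V' z \<le> d * 1" using le1[of z] z assms by (intro mult_left_mono) auto
  then show ?thesis using z by simp
qed simp

end

theorem lipschitz_improvement:
  fixes \<Omega> :: "(complex ^ 'n) set"
  assumes \<Omega>: "open \<Omega>" "bounded \<Omega>" "\<Omega> \<noteq> {}"
    and \<eta>: "\<eta> \<in> DF_w_exponents \<Omega>" and \<eta>': "0 < \<eta>'" "\<eta>' < \<eta>"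
  shows "\<eta>' \<in> DF_exponents (Lip_closure \<Omega>) \<Omega>"
proof -
  obtain \<mu> c where psh: "psh_on \<Omega> \<mu>" and c: "c > 1"
    and \<mu>: "\<And>z. z \<in> \<Omega> \<Longrightarrow> - c * (bdist \<Omega> z powr \<eta>) \<le> \<mu> z" "\<And>z. z \<in> \<Omega> \<Longrightarrow> \<mu> z \<le> - (bdist \<Omega> z powr \<eta>)"
    and \<eta>1: "\<eta> < 1"
    using \<eta> unfolding DF_w_exponents_def by auto
  define q where "q = \<eta>' / \<eta>"
  interpret young_power \<eta> \<eta>' q by unfold_locales (use \<eta>' \<eta>1 q_def in auto)
  define s where "s z = - \<mu> z" for z
  define C where "C = c powr (1 / \<eta>)"
  \<comment> \<open>The size of \<open>b\<close> localises the infimum: a competitor of value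
    \<open>v < 2 * C * bdist \<Omega> z\<close> satisfies
    \<open>4 * C * dist \<zeta> z \<le> \<kappa> * \<tau> \<le> v\<close>, so \<open>\<zeta>\<close>
    lies within half the boundary distance of \<open>z\<close>.\<close>
  define b where "b = 4 * C / \<kappa>"
  have C: "C > 1" unfolding C_def using c eta by simp
  have b: "b > 0" "\<kappa> * b = 4 * C" using C kappa_pos by (auto simp: b_def)
  have bd: "bdist \<Omega> z > 0" if "z \<in> \<Omega>" for z using bdist_pos \<Omega> that by blast
  have s: "s z > 0" "bdist \<Omega> z \<le> s z powr (1 / \<eta>)" "s z powr (1 / \<eta>) \<le> C * bdist \<Omega> z" if z: "z \<in> \<Omega>" for z
  proof -
    have 0: "bdist \<Omega> z powr \<eta> > 0" using bd[OF z] by simp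
    have 1: "bdist \<Omega> z powr \<eta> \<le> s z" "s z \<le> c * bdist \<Omega> z powr \<eta>"
      using \<mu>[OF z] by (auto simp: s_def)
    show 2: "s z > 0" using 0 1 by linarith
    have e: "(bdist \<Omega> z powr \<eta>) powr (1 / \<eta>) = bdist \<Omega> z" using bd[OF z] eta by (simp add: powr_powr)
    show "bdist \<Omega> z \<le> s z powr (1 / \<eta>)"
      using powr_mono2[OF _ _ 1(1), of "1 / \<eta>"] eta e by simp
    have "s z powr (1 / \<eta>) \<le> (c * bdist \<Omega> z powr \<eta>) powr (1 / \<eta>)"
      using powr_mono2[OF _ _ 1(2), of "1 / \<eta>"] eta 2 by simp
    also have "\<dots> = C * bdist \<Omega> z" unfolding powr_mult C_def e ..
    finally show "s z powr (1 / \<eta>) \<le> C * bdist \<Omega> z" .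
  qed
  define Y where "Y z = {V \<tau> (s \<zeta>) | \<tau> \<zeta>. \<zeta> \<in> \<Omega> \<and> \<tau> > 0 \<and> b * dist \<zeta> z \<le> \<tau>}" for z
  define P where "P z = Inf (Y z)" for z
  have Ybd: "bdd_below (Y z)" for z
    unfolding Y_def by (rule bdd_belowI[of _ 0]) (use V_pos s in force)
  have Yne: "Y z \<noteq> {}" for z
  proof -
    obtain \<zeta> where "\<zeta> \<in> \<Omega>" using \<Omega> by blast
    moreover have "1 + b * dist \<zeta> z > 0" using b by (simp add: add_pos_nonneg)
    ultimately have "V (1 + b * dist \<zeta> z) (s \<zeta>) \<in> Y z" unfolding Y_def by fastforce
    then show ?thesis by blast
  qed
  have P_le: "P z \<le> V \<tau> (s \<zeta>)" if "\<zeta> \<in> \<Omega>" "\<tau> > 0" "b * dist \<zeta> z \<le> \<tau>" for z \<tau> \<zeta>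
    unfolding P_def by (rule cInf_lower[OF _ Ybd]) (use that in \<open>auto simp: Y_def\<close>)
  \<comment> \<open>A competitor for \<open>z'\<close> becomes one for \<open>z\<close> when
    \<open>\<tau>\<close> is enlarged by \<open>b * dist z z'\<close>, and by
    \<open>V_lipschitz\<close> this costs no more than the enlargement.\<close>
  have lip1: "P z \<le> P z' + b * dist z z'" for z z'
  proof -
    have "P z - b * dist z z' \<le> P z'"
      unfolding P_def[of z']
    proof (rule cInf_greatest[OF Yne])
      fix y assume "y \<in> Y z'"
      then obtain \<tau> \<zeta> where 1: "y = V \<tau> (s \<zeta>)" "\<zeta> \<in> \<Omega>" "\<tau> > 0" "b * dist \<zeta> z' \<le> \<tau>" unfolding Y_def by blast
      have d: "b * dist z z' \<ge> 0" using b by simp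
      have "b * dist \<zeta> z \<le> b * (dist \<zeta> z' + dist z z')"
        using b by (intro mult_left_mono) (auto simp: dist_triangle2 add.commute)
      then have "P z \<le> V (\<tau> + b * dist z z') (s \<zeta>)"
        using P_le[OF 1(2), of "\<tau> + b * dist z z'" z] 1 d by (simp add: algebra_simps)
      also have "\<dots> \<le> V \<tau> (s \<zeta>) + b * dist z z'"
        by (rule V_lipschitz) (use 1 s d in auto)
      finally show "P z - b * dist z z' \<le> y" using 1 by simp
    qed
    then show ?thesis by simp
  qed
  have lip: "b-lipschitz_on X P" for X
  proof (rule lipschitz_onI)
    show "dist (P x) (P y) \<le> b * dist x y" for x y
      using lip1[of x y] lip1[of y x] by (simp add: dist_real_def dist_commute abs_le_iff)
  qed (use b in simp)
  have contP: "continuous_on X P" for X using lip by (rule lipschitz_on_continuous_on)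
  have P_up: "P z \<le> C * bdist \<Omega> z" if z: "z \<in> \<Omega>" for z
    using P_le[OF z, of "s z powr (1 / \<eta>)" z] V_self[OF s(1)[OF z]] s[OF z] by simp
  \<comment> \<open>Both terms of the triangle inequality for the boundary distance are below the
    competitor's value, one by \<open>V_ge\<close> and the other by \<open>V_ge_kappa\<close>. This
    accounts for the factor \<open>1 / 2\<close> here and for \<open>2 * P\<close> in the final
    function.\<close>
  have P_lo: "bdist \<Omega> z / 2 \<le> P z" if z: "z \<in> \<Omega>" for z
    unfolding P_def
  proof (rule cInf_greatest[OF Yne])
    fix y assume "y \<in> Y z"
    then obtain \<tau> \<zeta> where 1: "y = V \<tau> (s \<zeta>)" "\<zeta> \<in> \<Omega>" "\<tau> > 0" "b * dist \<zeta> z \<le> \<tau>" unfolding Y_def by blast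
    have "bdist \<Omega> z \<le> bdist \<Omega> \<zeta> + dist \<zeta> z" using bdist_triangle[of \<Omega> z \<zeta>] by (simp add: dist_commute)
    also have "bdist \<Omega> \<zeta> \<le> y" using V_ge[OF 1(3) s(1)[OF 1(2)]] s(2)[OF 1(2)] 1(1) by linarith
    also have "dist \<zeta> z \<le> y"
    proof -
      have "dist \<zeta> z \<le> 4 * C * dist \<zeta> z" using C by (simp add: mult_le_cancel_right1)
      also have "\<dots> = \<kappa> * (b * dist \<zeta> z)" using b(2) by (metis mult.assoc)
      also have "\<dots> \<le> \<kappa> * \<tau>" using 1(4) kappa_pos by simp
      also have "\<dots> \<le> y" using V_ge_kappa[OF 1(3) s(1)[OF 1(2)]] 1(1) by simp
      finally show ?thesis .
    qed
    finally show "bdist \<Omega> z / 2 \<le> y" by simp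
  qed
  have P0: "0 \<le> P z" for z
    unfolding P_def by (rule cInf_greatest[OF Yne]) (use V_pos s in \<open>force simp: Y_def\<close>)
  define u where "u z = - ((2 * P z) powr \<eta>')" for z
  have cu: "continuous_on X u" for X
    unfolding u_def using P0 eta by (intro continuous_intros continuous_on_powr' contP) auto
  have pshu: "psh_on \<Omega> u"
  proof (rule psh_onI_local[OF \<Omega>(1) cu])
    fix z w :: "complex ^ 'n" assume z: "z \<in> \<Omega>"
    define \<delta> where "\<delta> = bdist \<Omega> z"
    have \<delta>: "\<delta> > 0" using bd[OF z] by (simp add: \<delta>_def)
    define d where "d = \<delta> / 2 / (1 + norm w)"
    have d: "d > 0" using \<delta> by (simp add: d_def add_pos_nonneg)
    have "u z \<le> cmean (\<lambda>\<tau>. u (z + \<tau> *s w)) 0 r" if r: "0 < r" "r < d" for r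
    \<comment> \<open>If the mean \<open>m\<close> were below \<open>u z\<close>, some competitor
      for \<open>z\<close> would have a value \<open>v\<close> below the level \<open>y\<close> with
      \<open>- ((2 * y) powr \<eta>') = m\<close>. Translating its \<open>\<zeta>\<close> along the
      disc with \<open>\<tau>\<close> fixed gives an affine function of \<open>\<mu>\<close> that
      lies below \<open>u\<close> on the circle, and the sub-mean inequality of \<open>\<mu>\<close>
      contradicts \<open>v < y\<close>.\<close>
    proof (rule ccontr)
      assume contra: "\<not> ?thesis"
      define m where "m = cmean (\<lambda>\<tau>. u (z + \<tau> *s w)) 0 r"
      have cu2: "circ_integrable (\<lambda>\<tau>. u (z + \<tau> *s w)) 0 r"
        by (intro circ_integrable_continuous continuous_on_compose2[OF cu continuous_on_slice_map])
          (use r in auto)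
      have m: "(2 * P z) powr \<eta>' < - m" using contra by (simp add: u_def m_def)
      define y where "y = (- m) powr (1 / \<eta>') / 2"
      have "- m > 0" using m powr_ge_zero[of "2 * P z" \<eta>'] by linarith
      then have y: "y > 0" "(2 * y) powr \<eta>' = - m" using eta by (auto simp: y_def powr_powr)
      have "P z < y"
        using m y(1) P0[of z] eta unfolding y(2)[symmetric] by (smt (verit) powr_mono2)
      moreover have "P z < 2 * C * \<delta>"
      proof -
        have "C * \<delta> > 0" using C \<delta> by simp
        then show ?thesis using P_up[OF z] unfolding \<delta>_def[symmetric] by linarith
      qed
      ultimately have "Inf (Y z) < min y (2 * C * \<delta>)" unfolding P_def by simp
      then obtain v where "v \<in> Y z" "v < min y (2 * C * \<delta>)"
        using cInf_less_iff[OF Yne Ybd] by blast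
      then have v: "v \<in> Y z" "v < y" "v < 2 * C * \<delta>" by auto
      then obtain \<tau> \<zeta> where 1: "v = V \<tau> (s \<zeta>)" "\<zeta> \<in> \<Omega>" "\<tau> > 0" "b * dist \<zeta> z \<le> \<tau>" unfolding Y_def by blast
      have "4 * C * dist \<zeta> z = \<kappa> * (b * dist \<zeta> z)" using b(2) by (metis mult.assoc)
      also have "\<dots> \<le> \<kappa> * \<tau>" using 1(4) kappa_pos by simp
      also have "\<dots> \<le> v" using V_ge_kappa[OF 1(3) s(1)[OF 1(2)]] 1(1) by simp
      also have "\<dots> < 4 * C * (\<delta> / 2)" using v by simp
      finally have dz: "dist \<zeta> z < \<delta> / 2" using C by simp
      have rw: "norm (x *s w) < \<delta> / 2" if "norm x \<le> r" for x
      proof -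
        have "norm (x *s w) \<le> r * norm w"
          using that by (simp add: norm_complex_scalar_mult mult_right_mono)
        also have "\<dots> \<le> r * (1 + norm w)" using r by simp
        also have "\<dots> < d * (1 + norm w)" using r by (intro mult_strict_right_mono) (auto simp: add_pos_nonneg)
        also have "\<dots> = \<delta> / 2"
        proof -
          have "1 + norm w \<noteq> 0" using norm_ge_zero[of w] by linarith
          then show ?thesis unfolding d_def by (rule nonzero_eq_divide_eq[THEN iffD1, OF _ refl])
        qed
        finally show ?thesis .
      qed
      have inO: "z + x *s w \<in> \<Omega>" "\<zeta> + x *s w \<in> \<Omega>" if "norm x \<le> r" for x
      proof -
        have "dist z (z + x *s w) < \<delta>" using rw[OF that] \<delta> by (simp add: dist_norm)
        then show "z + x *s w \<in> \<Omega>" using ball_bdist_subset[OF z] unfolding \<delta>_def by auto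
        have "dist z (\<zeta> + x *s w) \<le> dist z \<zeta> + dist \<zeta> (\<zeta> + x *s w)" by (rule dist_triangle)
        also have "\<dots> < \<delta>" using dz rw[OF that] by (simp add: dist_norm norm_minus_commute)
        finally show "\<zeta> + x *s w \<in> \<Omega>" using ball_bdist_subset[OF z] unfolding \<delta>_def by auto
      qed
      have sm: "circ_integrable (\<lambda>x. \<mu> (\<zeta> + x *s w)) 0 r" "\<mu> \<zeta> \<le> cmean (\<lambda>x. \<mu> (\<zeta> + x *s w)) 0 r"
        by (rule psh_on_submean[OF psh r(1)], rule inO(2), assumption)+
      \<comment> \<open>Coefficients of \<open>- (2 powr \<eta>' * T \<tau> s)\<close> as an affine
        function of \<open>\<mu> = - s\<close>; the sign of \<open>A\<close> preserves the sub-mean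
        inequality.\<close>
      define A where "A = 2 powr \<eta>' * (q * \<tau> powr (\<eta>' - \<eta>))"
      define B where "B = - (2 powr \<eta>' * ((1 - q) * \<tau> powr \<eta>'))"
      have A: "A \<ge> 0" using q by (simp add: A_def)
      have AB: "- (2 powr \<eta>' * T \<tau> (s \<xi>)) = A * \<mu> \<xi> + B" for \<xi>
        by (simp add: A_def B_def T_def s_def algebra_simps)
      have "A * \<mu> \<zeta> + B \<le> A * cmean (\<lambda>x. \<mu> (\<zeta> + x *s w)) 0 r + B"
        using sm(2) A by (simp add: mult_left_mono)
      also have "\<dots> = cmean (\<lambda>x. A * \<mu> (\<zeta> + x *s w) + B) 0 r"
        using cmean_affine[OF sm(1)] by simp
      also have "\<dots> \<le> m"
        unfolding m_def
      proof (rule cmean_mono[OF circ_integrable_affine[OF sm(1)] cu2])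
        fix x :: complex assume "x \<in> sphere 0 r"
        then have x: "norm x \<le> r" by simp
        have "P (z + x *s w) \<le> V \<tau> (s (\<zeta> + x *s w))"
          by (rule P_le[OF inO(2)[OF x] 1(3)]) (use 1(4) in \<open>simp add: dist_norm\<close>)
        then have "(2 * P (z + x *s w)) powr \<eta>' \<le> (2 * V \<tau> (s (\<zeta> + x *s w))) powr \<eta>'"
          using P0 eta by (intro powr_mono2) auto
        also have "\<dots> = 2 powr \<eta>' * T \<tau> (s (\<zeta> + x *s w))"
          using V_powr[OF 1(3) s(1)[OF inO(2)[OF x]]] V_pos[OF 1(3) s(1)[OF inO(2)[OF x]]]
          by (simp add: powr_mult)
        finally show "A * \<mu> (\<zeta> + x *s w) + B \<le> u (z + x *s w)"
          unfolding AB[symmetric] u_def by simp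
      qed (rule less_imp_le[OF r(1)])
      finally have "- m \<le> 2 powr \<eta>' * T \<tau> (s \<zeta>)" unfolding AB[symmetric] by simp
      also have "\<dots> = (2 * v) powr \<eta>'"
        using V_powr[OF 1(3) s(1)[OF 1(2)]] V_pos[OF 1(3) s(1)[OF 1(2)]] 1(1) by (simp add: powr_mult)
      also have "\<dots> < (2 * y) powr \<eta>'"
        using v V_pos[OF 1(3) s(1)[OF 1(2)]] 1(1) eta by (intro powr_less_mono2) auto
      finally show False using y by simp
    qed
    then show "\<exists>d>0. \<forall>r. 0 < r \<and> r < d \<longrightarrow> u z \<le> cmean (\<lambda>\<tau>. u (z + \<tau> *s w)) 0 r"
      using d by blast
  qed
  define \<rho> where "\<rho> z = - (2 * P z)" for z
  have "\<rho> \<in> Lip_closure \<Omega>"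
  proof -
    have "(2 * b)-lipschitz_on (closure \<Omega>) \<rho>"
      using lip[of "closure \<Omega>"] unfolding lipschitz_on_def \<rho>_def dist_real_def by force
    then show ?thesis unfolding Lip_closure_def by blast
  qed
  moreover have "\<exists>c>1. \<forall>z\<in>closure \<Omega>. - c * bdist \<Omega> z \<le> \<rho> z \<and> \<rho> z \<le> - bdist \<Omega> z"
  proof (intro exI[of _ "2 * C"] conjI ballI)
    fix z assume z: "z \<in> closure \<Omega>"
    have cr: "continuous_on (closure \<Omega>) \<rho>" unfolding \<rho>_def by (intro continuous_intros contP)
    have lo2: "bdist \<Omega> z \<le> 2 * P z" if "z \<in> \<Omega>" for z using P_lo[OF that] by linarith
    show "- (2 * C) * bdist \<Omega> z \<le> \<rho> z"
      by (rule bdist_closure_bounds[OF _ _ cr z])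
        (use P_up in \<open>auto simp: \<rho>_def intro!: continuous_intros continuous_on_bdist\<close>)
    show "\<rho> z \<le> - bdist \<Omega> z"
      by (rule bdist_closure_bounds[OF _ cr _ z])
        (use lo2 in \<open>auto simp: \<rho>_def intro!: continuous_intros continuous_on_bdist\<close>)
  qed (use C in simp)
  moreover have "psh_on \<Omega> (\<lambda>z. - ((- \<rho> z) powr \<eta>'))"
    using pshu unfolding u_def[abs_def] \<rho>_def minus_minus .
  ultimately show ?thesis unfolding DF_exponents_def using eta by auto
qed

text \<open>The power \<open>- ((- \<rho>) powr \<eta>)\<close> is itself the weak witness, with
  \<open>c\<close> replaced by \<open>c powr \<eta>\<close>.\<close>

lemma DF_exponents_subset_weak:
  fixes \<Omega> :: "(complex ^ 'n) set"
  shows "DF_exponents F \<Omega> \<subseteq> DF_w_exponents \<Omega>"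
proof
  fix \<eta> assume "\<eta> \<in> DF_exponents F \<Omega>"
  then obtain \<rho> c where \<eta>: "0 < \<eta>" "\<eta> < 1" and c: "c > 1"
    and \<rho>: "\<And>z. z \<in> closure \<Omega> \<Longrightarrow> - c * bdist \<Omega> z \<le> \<rho> z \<and> \<rho> z \<le> - bdist \<Omega> z"
    and psh: "psh_on \<Omega> (\<lambda>z. - ((- \<rho> z) powr \<eta>))"
    unfolding DF_exponents_def by auto
  have "- (c powr \<eta>) * bdist \<Omega> z powr \<eta> \<le> - ((- \<rho> z) powr \<eta>) \<and> - ((- \<rho> z) powr \<eta>) \<le> - (bdist \<Omega> z powr \<eta>)"
    if "z \<in> \<Omega>" for z
  proof -
    have 1: "bdist \<Omega> z \<le> - \<rho> z" "- \<rho> z \<le> c * bdist \<Omega> z"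
      using \<rho>[of z] closure_subset that by force+
    have 2: "0 \<le> bdist \<Omega> z" by (rule bdist_nonneg)
    show ?thesis
      using powr_mono2[OF _ _ 1(1), of \<eta>] powr_mono2[OF _ _ 1(2), of \<eta>] 1 2 \<eta> c by (simp add: powr_mult)
  qed
  moreover have "c powr \<eta> > 1" using c \<eta> by simp
  ultimately show "\<eta> \<in> DF_w_exponents \<Omega>"
    unfolding DF_w_exponents_def using \<eta> psh by blast
qed

lemma DF_Lip_eq_DF_w:
  fixes \<Omega> :: "(complex ^ 'n) set"
  assumes "open \<Omega>" "bounded \<Omega>" "\<Omega> \<noteq> {}"
  shows "DF (Lip_closure \<Omega>) \<Omega> = DF_w \<Omega>"
  unfolding DF_def DF_w_def
  by (rule Sup_exponents_eq[OF DF_exponents_subset_weak])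
    (use lipschitz_improvement[OF assms] in \<open>auto simp: DF_w_exponents_def\<close>)

section \<open>Calculus of \<open>C\<^sup>k\<close> functions\<close>

abbreviation D1 :: "('a::real_normed_vector \<Rightarrow> real) \<Rightarrow> 'a \<Rightarrow> 'a \<Rightarrow> real" where
  "D1 f x v \<equiv> frechet_derivative f (at x) v"

abbreviation D2 :: "('a::real_normed_vector \<Rightarrow> real) \<Rightarrow> 'a \<Rightarrow> 'a \<Rightarrow> 'a \<Rightarrow> real" where
  "D2 f x v w \<equiv> frechet_derivative (\<lambda>y. frechet_derivative f (at y) v) (at x) w"

lemma D1_eqI: "(f has_derivative f') (at x) \<Longrightarrow> D1 f x v = f' v"
  using frechet_derivative_at[of f f' x] by simp

lemma D1_cong:
  assumes "open U" "x \<in> U" "\<And>y. y \<in> U \<Longrightarrow> f y = g y" "f differentiable (at x)"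
  shows "D1 g x v = D1 f x v" "g differentiable (at x)"
proof -
  have "(f has_derivative D1 f x) (at x)" using assms(4) frechet_derivative_works by blast
  then have "(g has_derivative D1 f x) (at x)"
    using has_derivative_transform_within_open assms(1-3) by blast
  then show "D1 g x v = D1 f x v" "g differentiable (at x)"
    by (auto simp: D1_eqI differentiable_def)
qed

lemma Ck_on_SucD:
  assumes "Ck_on (Suc k) U f"
  shows "\<And>x. x \<in> U \<Longrightarrow> (f has_derivative D1 f x) (at x)" "\<And>v. Ck_on k U (\<lambda>x. D1 f x v)"
    "\<And>x. x \<in> U \<Longrightarrow> f differentiable (at x)"
  using assms by (auto simp: frechet_derivative_works)

lemma Ck_on_cong:
  assumes "open U" "Ck_on k U f" "\<And>x. x \<in> U \<Longrightarrow> f x = g x"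
  shows "Ck_on k U g"
  using assms(2,3)
proof (induction k arbitrary: f g)
  case 0
  then show ?case by (simp cong: continuous_on_cong)
next
  case (Suc k)
  have *: "x \<in> U \<Longrightarrow> D1 g x v = D1 f x v" "x \<in> U \<Longrightarrow> g differentiable (at x)" for x v
    using D1_cong[OF assms(1) _ Suc.prems(2) Ck_on_SucD(3)[OF Suc.prems(1)], of x] by auto
  have "Ck_on k U (\<lambda>x. D1 g x v)" for v
    by (rule Suc.IH[OF Ck_on_SucD(2)[OF Suc.prems(1), of v]]) (simp add: *)
  then show ?case using * by simp
qed

text \<open>Lets an explicitly computed derivative stand in for \<open>frechet_derivative\<close>,
  which \<open>Ck_on\<close> mentions literally.\<close>

lemma Ck_on_SucI:
  assumes "open U" "\<And>x. x \<in> U \<Longrightarrow> (f has_derivative f' x) (at x)" "\<And>v. Ck_on k U (\<lambda>x. f' x v)"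
  shows "Ck_on (Suc k) U f"
  unfolding Ck_on.simps
proof (intro conjI ballI allI)
  show "f differentiable (at x)" if "x \<in> U" for x using assms(2)[OF that] differentiable_def by blast
  show "Ck_on k U (\<lambda>x. D1 f x v)" for v
    by (rule Ck_on_cong[OF assms(1) assms(3)[of v]]) (simp add: D1_eqI[OF assms(2)])
qed

lemma Ck_on_subset: "Ck_on k U f \<Longrightarrow> V \<subseteq> U \<Longrightarrow> Ck_on k V f"
  by (induction k arbitrary: f) (auto intro: continuous_on_subset)

lemma Ck_on_Suc_continuous: "Ck_on (Suc k) U f \<Longrightarrow> continuous_on U f"
  by (metis Ck_on_SucD(3) continuous_at_imp_continuous_on differentiable_imp_continuous_within)

lemma Ck_on_Suc_imp: "Ck_on (Suc k) U f \<Longrightarrow> Ck_on k U f"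
proof (induction k arbitrary: f)
  case 0
  then show ?case using Ck_on_Suc_continuous[OF 0] by simp
next
  case (Suc k)
  show ?case
    unfolding Ck_on.simps(2)[of k]
    using Suc.IH Ck_on_SucD(2,3)[OF Suc.prems] by blast
qed

lemma Ck_on_mono: "Ck_on k U f \<Longrightarrow> j \<le> k \<Longrightarrow> Ck_on j U f"
proof (induction k)
  case (Suc k)
  then show ?case using Ck_on_Suc_imp le_Suc_eq by metis
qed simp

lemma Ck_on_continuous: "Ck_on k U f \<Longrightarrow> continuous_on U f"
  using Ck_on_mono[of k U f 0] by simp

lemma Ck_on_local:
  assumes "\<And>x. x \<in> U \<Longrightarrow> \<exists>W. open W \<and> x \<in> W \<and> Ck_on k W f"
  shows "Ck_on k U f"
  using assms
proof (induction k arbitrary: f)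
  case 0
  show ?case unfolding Ck_on.simps
  proof (rule continuous_at_imp_continuous_on, intro ballI)
    fix x assume "x \<in> U"
    then show "isCont f x" using 0 by (metis Ck_on.simps(1) continuous_on_eq_continuous_at)
  qed
next
  case (Suc k)
  show ?case unfolding Ck_on.simps
  proof (intro conjI ballI allI)
    show "f differentiable (at x)" if "x \<in> U" for x using Suc.prems[OF that] by auto
    show "Ck_on k U (\<lambda>x. D1 f x v)" for v
      by (rule Suc.IH) (use Suc.prems in fastforce)
  qed
qed

lemma Ck_on_Un: "open U \<Longrightarrow> open V \<Longrightarrow> Ck_on k U f \<Longrightarrow> Ck_on k V f \<Longrightarrow> Ck_on k (U \<union> V) f"
  by (rule Ck_on_local) blast

lemma Ck_on_const: "Ck_on k U (\<lambda>x. c)"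
  by (induction k arbitrary: c) auto

lemma Ck_on_linear: "bounded_linear f \<Longrightarrow> Ck_on k U f"
proof (cases k)
  case 0
  then show "bounded_linear f \<Longrightarrow> Ck_on k U f" by (simp add: linear_continuous_on)
next
  case (Suc j)
  assume "bounded_linear f"
  then have d: "(f has_derivative f) (at x)" for x by (rule bounded_linear_imp_has_derivative)
  have "f differentiable (at x)" for x using d differentiable_def by blast
  then show "Ck_on k U f" using D1_eqI[OF d] by (simp add: Suc Ck_on_const)
qed

lemma Ck_on_add:
  assumes "open U" "Ck_on k U f" "Ck_on k U g"
  shows "Ck_on k U (\<lambda>x. f x + g x)"
  using assms(2,3)
proof (induction k arbitrary: f g)
  case 0
  then show ?case by (simp add: continuous_on_add)
next
  case (Suc k)
  show ?case
    by (rule Ck_on_SucI[OF assms(1) has_derivative_add[OF Ck_on_SucD(1)[OF Suc.prems(1)] Ck_on_SucD(1)[OF Suc.prems(2)]]])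
      (use Suc.IH Ck_on_SucD(2)[OF Suc.prems(1)] Ck_on_SucD(2)[OF Suc.prems(2)] in auto)
qed

lemma Ck_on_mult:
  assumes "open U" "Ck_on k U f" "Ck_on k U g"
  shows "Ck_on k U (\<lambda>x. f x * g x)"
  using assms(2,3)
proof (induction k arbitrary: f g)
  case 0
  then show ?case by (simp add: continuous_on_mult)
next
  case (Suc k)
  show ?case
    by (rule Ck_on_SucI[OF assms(1) has_derivative_mult[OF Ck_on_SucD(1)[OF Suc.prems(1)] Ck_on_SucD(1)[OF Suc.prems(2)]]],
        assumption, assumption)
      (intro Ck_on_add[OF assms(1)] Suc.IH Ck_on_SucD(2)[OF Suc.prems(1)] Ck_on_SucD(2)[OF Suc.prems(2)]
        Ck_on_Suc_imp[OF Suc.prems(1)] Ck_on_Suc_imp[OF Suc.prems(2)])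
qed

lemma Ck_on_cmult: "open U \<Longrightarrow> Ck_on k U f \<Longrightarrow> Ck_on k U (\<lambda>x. c * f x)"
  by (rule Ck_on_mult[OF _ Ck_on_const])

lemma Ck_on_uminus: "open U \<Longrightarrow> Ck_on k U f \<Longrightarrow> Ck_on k U (\<lambda>x. - f x)"
  using Ck_on_cmult[of U k f "-1"] by simp

lemma Ck_on_diff: "open U \<Longrightarrow> Ck_on k U f \<Longrightarrow> Ck_on k U g \<Longrightarrow> Ck_on k U (\<lambda>x. f x - g x)"
  using Ck_on_add[OF _ _ Ck_on_uminus, of U k f g] by simp

lemma Ck_on_sum:
  assumes "open U" "\<And>i. i \<in> I \<Longrightarrow> Ck_on k U (f i)"
  shows "Ck_on k U (\<lambda>x. \<Sum>i\<in>I. f i x)"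
  using assms(2)
  by (induction I rule: infinite_finite_induct) (auto intro: Ck_on_const Ck_on_add[OF assms(1)])

lemma linear_basis_expansion:
  fixes L :: "'a::euclidean_space \<Rightarrow> real"
  assumes "linear L"
  shows "L v = (\<Sum>b\<in>Basis. (v \<bullet> b) * L b)"
proof -
  have "L v = L (\<Sum>b\<in>Basis. (v \<bullet> b) *\<^sub>R b)" by (simp add: euclidean_representation)
  also have "\<dots> = (\<Sum>b\<in>Basis. (v \<bullet> b) * L b)"
    using assms by (simp add: linear_sum linear_cmul)
  finally show ?thesis .
qed

text \<open>\<open>Ck_on\<close> speaks of real-valued functions only, so the inner map enters
  through its coordinates. The chain rule then writes the derivative as a sum of products of
  functions one class lower, to which the induction applies.\<close>

lemma Ck_on_compose:
  fixes \<Phi> :: "'a::real_normed_vector \<Rightarrow> 'b::euclidean_space"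
  assumes "open U" and \<Phi>: "\<And>b. b \<in> Basis \<Longrightarrow> Ck_on k U (\<lambda>x. \<Phi> x \<bullet> b)"
    and "Ck_on k W f" "\<And>x. x \<in> U \<Longrightarrow> \<Phi> x \<in> W"
  shows "Ck_on k U (\<lambda>x. f (\<Phi> x))"
  using assms(2,3)
proof (induction k arbitrary: f)
  case 0
  have "continuous_on U \<Phi>"
    using 0(1) by (subst continuous_on_componentwise) auto
  then show ?case using 0(2) assms(4) by (auto intro: continuous_on_compose2)
next
  case (Suc k)
  have \<Phi>': "(\<Phi> has_derivative (\<lambda>v. \<Sum>b\<in>Basis. D1 (\<lambda>x. \<Phi> x \<bullet> b) x v *\<^sub>R b)) (at x)" if "x \<in> U" for x
    by (subst has_derivative_componentwise_within)
      (use Ck_on_SucD(1)[OF Suc.prems(1) that] in \<open>simp\<close>)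
  show ?case
  proof (rule Ck_on_SucI[OF assms(1)])
    fix x assume x: "x \<in> U"
    have "((\<lambda>x. f (\<Phi> x)) has_derivative (\<lambda>v. D1 f (\<Phi> x) (\<Sum>b\<in>Basis. D1 (\<lambda>x. \<Phi> x \<bullet> b) x v *\<^sub>R b))) (at x)"
      by (rule has_derivative_compose[OF \<Phi>'[OF x] Ck_on_SucD(1)[OF Suc.prems(2) assms(4)[OF x]]])
    moreover have "linear (D1 f (\<Phi> x))"
      using Ck_on_SucD(3)[OF Suc.prems(2) assms(4)[OF x]] linear_frechet_derivative by blast
    ultimately show "((\<lambda>x. f (\<Phi> x)) has_derivative (\<lambda>v. \<Sum>b\<in>Basis. D1 (\<lambda>x. \<Phi> x \<bullet> b) x v * D1 f (\<Phi> x) b)) (at x)"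
      by (simp add: linear_sum linear_cmul)
  next
    show "Ck_on k U (\<lambda>x. \<Sum>b\<in>Basis. D1 (\<lambda>x. \<Phi> x \<bullet> b) x v * D1 f (\<Phi> x) b)" for v
    proof (intro Ck_on_sum Ck_on_mult assms(1) Ck_on_SucD(2)[OF Suc.prems(1)])
      fix b :: 'b assume "b \<in> Basis"
      show "Ck_on k U (\<lambda>x. D1 f (\<Phi> x) b)"
        by (rule Suc.IH[OF Ck_on_Suc_imp[OF Suc.prems(1)] Ck_on_SucD(2)[OF Suc.prems(2)]])
    qed
  qed
qed

lemma Ck_on_compose_real:
  assumes "open U" "Ck_on k U g" "Ck_on k W f" "\<And>x. x \<in> U \<Longrightarrow> g x \<in> W"
  shows "Ck_on k U (\<lambda>x. f (g x :: real))"
  by (rule Ck_on_compose[OF assms(1) _ assms(3,4)]) (use assms(2) in simp)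

lemma has_derivative_of_real_derivative:
  "(f has_real_derivative D) (at x) \<Longrightarrow> (f has_derivative (\<lambda>v. D * v)) (at x)"
  by (simp add: has_field_derivative_def)

lemma Ck_on_exp: "Ck_on k UNIV (exp :: real \<Rightarrow> real)"
proof (induction k)
  case 0
  show ?case by (auto intro: continuous_intros)
next
  case (Suc k)
  show ?case
    by (rule Ck_on_SucI[OF open_UNIV has_derivative_of_real_derivative[OF DERIV_exp]])
      (rule Ck_on_mult[OF open_UNIV Suc Ck_on_const])
qed

lemma Ck_on_powr: "Ck_on k {0<..} (\<lambda>x::real. x powr a)"
proof (induction k arbitrary: a)
  case 0
  show ?case by (auto intro!: continuous_intros)
next
  case (Suc k)
  show ?case
  proof (rule Ck_on_SucI)
    fix x :: real assume "x \<in> {0<..}"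
    then have "((\<lambda>x. x powr a) has_real_derivative a * x powr (a - 1)) (at x)"
      by (auto intro!: derivative_eq_intros)
    then show "((\<lambda>x. x powr a) has_derivative (\<lambda>v. a * x powr (a - 1) * v)) (at x)"
      by (rule has_derivative_of_real_derivative)
  next
    show "Ck_on k {0<..} (\<lambda>x. a * x powr (a - 1) * v)" for v
      by (rule Ck_on_mult[OF open_greaterThan Ck_on_cmult[OF open_greaterThan Suc] Ck_on_const])
  qed simp
qed

lemma Ck_on_ln: "Ck_on k {0<..} (ln :: real \<Rightarrow> real)"
proof (cases k)
  case 0
  then show ?thesis by (auto intro!: continuous_intros)
next
  case (Suc j)
  have "Ck_on (Suc j) {0<..} (ln :: real \<Rightarrow> real)"
  proof (rule Ck_on_SucI)
    fix x :: real assume x: "x \<in> {0<..}"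
    then have "(ln has_real_derivative x powr (-1)) (at x)"
      by (auto intro!: derivative_eq_intros simp: powr_minus inverse_eq_divide)
    then show "(ln has_derivative (\<lambda>v. x powr (-1) * v)) (at x)"
      by (rule has_derivative_of_real_derivative)
  next
    show "Ck_on j {0<..} (\<lambda>x. x powr (-1) * v)" for v
      by (rule Ck_on_mult[OF open_greaterThan Ck_on_powr Ck_on_const])
  qed simp
  then show ?thesis by (simp add: Suc)
qed

lemma has_derivative_pos_part_power:
  "((\<lambda>x. max 0 x ^ Suc (Suc n)) has_real_derivative real (Suc (Suc n)) * max 0 x ^ Suc n) (at (x::real))"
proof (cases x "0::real" rule: linorder_cases)
  case less
  have "((\<lambda>x. 0) has_real_derivative 0) (at x)" by simp
  then have "((\<lambda>x. max 0 x ^ Suc (Suc n)) has_real_derivative 0) (at x)"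
    by (rule has_field_derivative_transform_within_open[where S="{..<0}"]) (use less in auto)
  then show ?thesis using less by simp
next
  case greater
  have "((\<lambda>x. x ^ Suc (Suc n)) has_real_derivative real (Suc (Suc n)) * x ^ Suc n) (at x)"
    using DERIV_pow[of "Suc (Suc n)" x] by simp
  then have "((\<lambda>x. max 0 x ^ Suc (Suc n)) has_real_derivative real (Suc (Suc n)) * x ^ Suc n) (at x)"
    by (rule has_field_derivative_transform_within_open[where S="{0<..}"]) (use greater in auto)
  then show ?thesis using greater by simp
next
  case equal
  have "((\<lambda>h::real. max 0 h ^ Suc (Suc n) / h) \<longlongrightarrow> 0) (at 0)"
  proof (rule Lim_null_comparison)
    have "norm (max 0 h ^ Suc (Suc n) / h) \<le> \<bar>h\<bar> ^ Suc n" if "h \<noteq> 0" for h :: real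
      using that by (cases "h > 0") (auto simp: max_def power_abs intro!: mult_nonpos_nonneg)
    then show "\<forall>\<^sub>F h in at 0. norm (max 0 h ^ Suc (Suc n) / h) \<le> \<bar>h\<bar> ^ Suc n"
      by (auto simp: eventually_at intro: exI[of _ 1])
    have "((\<lambda>h::real. \<bar>h\<bar> ^ Suc n) \<longlongrightarrow> \<bar>0\<bar> ^ Suc n) (at 0)"
      by (intro tendsto_intros)
    then show "((\<lambda>h::real. \<bar>h\<bar> ^ Suc n) \<longlongrightarrow> 0) (at 0)" by simp
  qed
  then show ?thesis using equal by (simp add: has_field_derivative_iff)
qed

text \<open>Each derivative lowers the exponent by one, so \<open>k\<close> of them still leave a
  positive power, which is continuous. These functions of finite smoothness serve as building blocks
  for the bumps and cutoffs below.\<close>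

lemma Ck_on_pos_part_power: "Ck_on k UNIV (\<lambda>x::real. max 0 x ^ (k + Suc n))"
proof (induction k arbitrary: n)
  case 0
  show ?case by (auto intro!: continuous_intros)
next
  case (Suc k)
  have "Ck_on (Suc k) UNIV (\<lambda>x::real. max 0 x ^ Suc (Suc (k + n)))"
  proof (rule Ck_on_SucI[OF open_UNIV has_derivative_of_real_derivative[OF has_derivative_pos_part_power]])
    have "Ck_on k UNIV (\<lambda>x::real. max 0 x ^ Suc (k + n))" using Suc[of n] by simp
    then show "Ck_on k UNIV (\<lambda>x::real. real (Suc (Suc (k + n))) * max 0 x ^ Suc (k + n) * v)" for v
      by (intro Ck_on_mult Ck_on_const open_UNIV)
  qed
  then show ?case by simp
qed

section \<open>Second derivatives: linearity, uniform bounds and symmetry\<close>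

lemma has_derivative_along_line:
  assumes "f differentiable (at (x + s *\<^sub>R v))"
  shows "((\<lambda>s. f (x + s *\<^sub>R v)) has_real_derivative D1 f (x + s *\<^sub>R v) v) (at s)"
proof -
  have "(f has_derivative D1 f (x + s *\<^sub>R v)) (at (x + s *\<^sub>R v))"
    using assms frechet_derivative_works by blast
  moreover have "((\<lambda>s. x + s *\<^sub>R v) has_derivative (\<lambda>h. h *\<^sub>R v)) (at s)"
    by (auto intro!: derivative_eq_intros)
  ultimately have "((\<lambda>s. f (x + s *\<^sub>R v)) has_derivative (\<lambda>h. D1 f (x + s *\<^sub>R v) (h *\<^sub>R v))) (at s)"
    using has_derivative_compose by blast
  moreover have "(\<lambda>h. D1 f (x + s *\<^sub>R v) (h *\<^sub>R v)) = (*) (D1 f (x + s *\<^sub>R v) v)"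
    using linear_frechet_derivative[OF assms] by (auto simp: linear_cmul)
  ultimately show ?thesis by (simp add: has_field_derivative_def)
qed

lemma Ck2D:
  assumes "Ck_on 2 U f" "x \<in> U"
  shows "f differentiable (at x)" "(\<lambda>y. D1 f y v) differentiable (at x)"
    "linear (D1 f x)" "linear (D2 f x v)"
  using assms Ck_on_SucD(3)[of 1 U f x] Ck_on_SucD(2)[of 1 U f v]
    Ck_on_SucD(3)[of 0 U "\<lambda>y. D1 f y v" x]
  by (auto simp: numeral_2_eq_2 intro: linear_frechet_derivative)

lemma Ck2_continuous:
  assumes "Ck_on 2 U f"
  shows "continuous_on U f" "continuous_on U (\<lambda>x. D1 f x v)" "continuous_on U (\<lambda>x. D2 f x v w)"
  using Ck_on_continuous[OF assms] assms Ck_on_continuous[of 1 U "\<lambda>x. D1 f x v"]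
  by (auto simp: numeral_2_eq_2)

text \<open>The first slot is the direction of the inner derivative, so linearity of
  \<open>D1 f y\<close> is used for all \<open>y\<close> near \<open>x\<close> and not only at
  \<open>x\<close>; this is where \<open>open U\<close> enters.\<close>

lemma D2_linear_left:
  assumes "Ck_on 2 U f" "open U" "x \<in> U"
  shows "linear (\<lambda>v. D2 f x v w)"
proof (rule linearI)
  note d = Ck2D(2)[OF assms(1,3)] and l = Ck2D(3)[OF assms(1)]
  have hd: "((\<lambda>y. D1 f y v) has_derivative D2 f x v) (at x)" for v
    using d[of v] frechet_derivative_works by blast
  show "D2 f x (v + v') w = D2 f x v w + D2 f x v' w" for v v'
  proof -
    have "((\<lambda>y. D1 f y (v + v')) has_derivative (\<lambda>w. D2 f x v w + D2 f x v' w)) (at x)"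
      by (rule has_derivative_transform_within_open[OF has_derivative_add[OF hd hd] assms(2,3)])
        (simp add: linear_add[OF l])
    then show ?thesis by (rule D1_eqI)
  qed
  show "D2 f x (c *\<^sub>R v) w = c *\<^sub>R D2 f x v w" for c v
  proof -
    have "((\<lambda>y. D1 f y (c *\<^sub>R v)) has_derivative (\<lambda>w. c * D2 f x v w)) (at x)"
      by (rule has_derivative_transform_within_open[OF has_derivative_mult_right[OF hd] assms(2,3)])
        (simp add: linear_cmul[OF l])
    then show ?thesis by (simp add: D1_eqI)
  qed
qed

text \<open>Reduces bounds, moduli of continuity and limits over all directions to the finitely many
  continuous functions \<open>D2 f x b c\<close>.\<close>

lemma D2_expand:
  fixes f :: "'a::euclidean_space \<Rightarrow> real"
  assumes "Ck_on 2 U f" "open U" "x \<in> U"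
  shows "D2 f x v w = (\<Sum>b\<in>Basis. \<Sum>c\<in>Basis. (v \<bullet> b) * (w \<bullet> c) * D2 f x b c)"
  unfolding linear_basis_expansion[OF D2_linear_left[OF assms], of v]
    linear_basis_expansion[OF Ck2D(4)[OF assms(1,3)], of _ w]
  by (simp add: sum_distrib_left mult.assoc)

lemma D1_expand:
  fixes f :: "'a::euclidean_space \<Rightarrow> real"
  assumes "f differentiable (at x)"
  shows "D1 f x v = (\<Sum>b\<in>Basis. (v \<bullet> b) * D1 f x b)"
  using linear_basis_expansion[OF linear_frechet_derivative[OF assms]] .

lemma sum_Basis_bound:
  fixes F :: "'a::euclidean_space \<Rightarrow> real"
  assumes "\<And>b. b \<in> Basis \<Longrightarrow> \<bar>F b\<bar> \<le> C"
  shows "\<bar>\<Sum>b\<in>Basis. (v \<bullet> b) * F b\<bar> \<le> real DIM('a) * C * norm v"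
proof -
  have "\<bar>\<Sum>b\<in>Basis. (v \<bullet> b) * F b\<bar> \<le> (\<Sum>b\<in>(Basis::'a set). norm v * C)"
    by (rule order_trans[OF sum_abs sum_mono])
      (auto simp: abs_mult intro!: mult_mono Basis_le_norm assms)
  then show ?thesis by (simp add: mult_ac)
qed

lemma sum_Basis_bound2:
  fixes F :: "'a::euclidean_space \<Rightarrow> 'a \<Rightarrow> real"
  assumes "\<And>b c. b \<in> Basis \<Longrightarrow> c \<in> Basis \<Longrightarrow> \<bar>F b c\<bar> \<le> C"
  shows "\<bar>\<Sum>b\<in>Basis. \<Sum>c\<in>Basis. (v \<bullet> b) * (w \<bullet> c) * F b c\<bar> \<le> real DIM('a) ^ 2 * C * norm v * norm w"
proof -
  have "\<bar>\<Sum>b\<in>Basis. (v \<bullet> b) * (\<Sum>c\<in>Basis. (w \<bullet> c) * F b c)\<bar> \<le> real DIM('a) * (real DIM('a) * C * norm w) * norm v"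
    by (rule sum_Basis_bound, rule sum_Basis_bound, rule assms)
  then show ?thesis by (simp add: sum_distrib_left mult.assoc power2_eq_square mult_ac)
qed

lemma finite_uniform_bound:
  fixes F :: "'i \<Rightarrow> 'x::topological_space \<Rightarrow> real"
  assumes "finite I" "compact K" "\<And>i. i \<in> I \<Longrightarrow> continuous_on K (F i)"
  shows "\<exists>C>0. \<forall>i\<in>I. \<forall>x\<in>K. \<bar>F i x\<bar> \<le> C"
  using assms(1,3)
proof (induction I)
  case empty
  then show ?case by (auto intro: exI[of _ 1])
next
  case (insert i I)
  then obtain C where C: "C > 0" "\<forall>i\<in>I. \<forall>x\<in>K. \<bar>F i x\<bar> \<le> C" by auto
  have "compact (F i ` K)" by (rule compact_continuous_image[OF _ assms(2)]) (use insert in auto)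
  then obtain E where E: "\<And>x. x \<in> K \<Longrightarrow> \<bar>F i x\<bar> \<le> E"
    using compact_imp_bounded bounded_iff by (metis imageI real_norm_def)
  show ?case
    by (rule exI[of _ "max C E"]) (use C E in \<open>auto simp: le_max_iff_disj\<close>)
qed

lemma finite_uniform_modulus:
  fixes F :: "'i \<Rightarrow> 'x::metric_space \<Rightarrow> real"
  assumes "finite I" "compact K" "\<And>i. i \<in> I \<Longrightarrow> continuous_on K (F i)" "\<epsilon> > 0"
  shows "\<exists>d>0. \<forall>i\<in>I. \<forall>x\<in>K. \<forall>y\<in>K. dist x y < d \<longrightarrow> \<bar>F i x - F i y\<bar> < \<epsilon>"
  using assms(1,3)
proof (induction I)
  case empty
  then show ?case by (auto intro: exI[of _ 1])
next
  case (insert i I)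
  then obtain C where C: "C > 0" "\<forall>i\<in>I. \<forall>x\<in>K. \<forall>y\<in>K. dist x y < C \<longrightarrow> \<bar>F i x - F i y\<bar> < \<epsilon>" by auto
  have "uniformly_continuous_on K (F i)"
    by (rule compact_uniformly_continuous[OF _ assms(2)]) (use insert in auto)
  then obtain E where E: "E > 0" "\<And>x y. x \<in> K \<Longrightarrow> y \<in> K \<Longrightarrow> dist x y < E \<Longrightarrow> \<bar>F i x - F i y\<bar> < \<epsilon>"
    unfolding uniformly_continuous_on_def dist_real_def using assms(4) by (metis abs_minus_commute dist_commute)
  show ?case
    by (rule exI[of _ "min C E"]) (use C E in auto)
qed

lemma D1_bounded:
  fixes f :: "'a::euclidean_space \<Rightarrow> real"
  assumes "Ck_on (Suc k) U f" "compact K" "K \<subseteq> U"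
  shows "\<exists>C>0. \<forall>x\<in>K. \<forall>v. \<bar>D1 f x v\<bar> \<le> C * norm v"
proof -
  obtain C where C: "C > 0" "\<forall>b\<in>Basis. \<forall>x\<in>K. \<bar>D1 f x b\<bar> \<le> C"
    using finite_uniform_bound[OF finite_Basis assms(2), of "\<lambda>b x. D1 f x b"]
      continuous_on_subset[OF Ck_on_continuous[OF Ck_on_SucD(2)[OF assms(1)]] assms(3)] by auto
  show ?thesis
  proof (intro exI[of _ "real DIM('a) * C"] conjI ballI allI)
    fix x v assume x: "x \<in> K"
    then have "f differentiable (at x)" using Ck_on_SucD(3)[OF assms(1)] assms(3) by blast
    from D1_expand[OF this, of v] show "\<bar>D1 f x v\<bar> \<le> real DIM('a) * C * norm v"
      using sum_Basis_bound[of "D1 f x" C v] C(2) x by simp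
  qed (use C in simp)
qed

lemma D1_modulus:
  fixes f :: "'a::euclidean_space \<Rightarrow> real"
  assumes "Ck_on (Suc k) U f" "compact K" "K \<subseteq> U" "\<epsilon> > 0"
  shows "\<exists>d>0. \<forall>x\<in>K. \<forall>y\<in>K. dist x y < d \<longrightarrow> (\<forall>v. \<bar>D1 f x v - D1 f y v\<bar> \<le> \<epsilon> * norm v)"
proof -
  define e where "e = \<epsilon> / DIM('a)"
  have e: "e > 0" using assms(4) by (simp add: e_def)
  obtain d where d: "d > 0" "\<forall>b\<in>Basis. \<forall>x\<in>K. \<forall>y\<in>K. dist x y < d \<longrightarrow> \<bar>D1 f x b - D1 f y b\<bar> < e"
    using finite_uniform_modulus[OF finite_Basis assms(2) _ e, of "\<lambda>b x. D1 f x b"]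
      continuous_on_subset[OF Ck_on_continuous[OF Ck_on_SucD(2)[OF assms(1)]] assms(3)] by auto
  show ?thesis
  proof (intro exI[of _ d] conjI ballI allI impI)
    fix x y v assume x: "x \<in> K" "y \<in> K" "dist x y < d"
    then have "f differentiable (at x)" "f differentiable (at y)"
      using Ck_on_SucD(3)[OF assms(1)] assms(3) by auto
    then have "D1 f x v - D1 f y v = (\<Sum>b\<in>Basis. (v \<bullet> b) * (D1 f x b - D1 f y b))"
      using D1_expand[of f x v] D1_expand[of f y v] by (simp add: sum_subtractf algebra_simps)
    also have "\<bar>\<dots>\<bar> \<le> real DIM('a) * e * norm v"
      by (rule sum_Basis_bound) (use d x in force)
    finally show "\<bar>D1 f x v - D1 f y v\<bar> \<le> \<epsilon> * norm v" by (simp add: e_def)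
  qed (use d in simp)
qed

lemma D2_bounded:
  fixes f :: "'a::euclidean_space \<Rightarrow> real"
  assumes "Ck_on 2 U f" "open U" "compact K" "K \<subseteq> U"
  shows "\<exists>C>0. \<forall>x\<in>K. \<forall>v w. \<bar>D2 f x v w\<bar> \<le> C * norm v * norm w"
proof -
  obtain C where C: "C > 0" "\<forall>b\<in>Basis\<times>Basis. \<forall>x\<in>K. \<bar>D2 f x (fst b) (snd b)\<bar> \<le> C"
    using finite_uniform_bound[of "Basis\<times>Basis" K "\<lambda>b x. D2 f x (fst b) (snd b)"] assms(3)
      continuous_on_subset[OF Ck2_continuous(3)[OF assms(1)] assms(4)] by auto
  show ?thesis
  proof (intro exI[of _ "real DIM('a) ^ 2 * C"] conjI ballI allI)
    fix x v w assume x: "x \<in> K"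
    then have "x \<in> U" using assms by auto
    from D2_expand[OF assms(1,2) this, of v w] show "\<bar>D2 f x v w\<bar> \<le> real DIM('a) ^ 2 * C * norm v * norm w"
      using sum_Basis_bound2[of "D2 f x" C v w] C(2) x by simp
  qed (use C in simp)
qed

lemma D2_modulus:
  fixes f :: "'a::euclidean_space \<Rightarrow> real"
  assumes "Ck_on 2 U f" "open U" "compact K" "K \<subseteq> U" "\<epsilon> > 0"
  shows "\<exists>d>0. \<forall>x\<in>K. \<forall>y\<in>K. dist x y < d \<longrightarrow> (\<forall>v w. \<bar>D2 f x v w - D2 f y v w\<bar> \<le> \<epsilon> * norm v * norm w)"
proof -
  define e where "e = \<epsilon> / real DIM('a) ^ 2"
  have e: "e > 0" using assms(5) by (simp add: e_def)
  obtain d where d: "d > 0" "\<forall>b\<in>Basis\<times>Basis. \<forall>x\<in>K. \<forall>y\<in>K. dist x y < d \<longrightarrow> \<bar>D2 f x (fst b) (snd b) - D2 f y (fst b) (snd b)\<bar> < e"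
    using finite_uniform_modulus[of "Basis\<times>Basis" K "\<lambda>b x. D2 f x (fst b) (snd b)" e] assms(3) e
      continuous_on_subset[OF Ck2_continuous(3)[OF assms(1)] assms(4)] by auto
  show ?thesis
  proof (intro exI[of _ d] conjI ballI allI impI)
    fix x y v w assume x: "x \<in> K" "y \<in> K" "dist x y < d"
    then have xy: "x \<in> U" "y \<in> U" using assms by auto
    have "D2 f x v w - D2 f y v w = (\<Sum>b\<in>Basis. \<Sum>c\<in>Basis. (v \<bullet> b) * (w \<bullet> c) * (D2 f x b c - D2 f y b c))"
      using D2_expand[OF assms(1,2) xy(1), of v w] D2_expand[OF assms(1,2) xy(2), of v w]
      by (simp add: sum_subtractf algebra_simps)
    also have "\<bar>\<dots>\<bar> \<le> real DIM('a) ^ 2 * e * norm v * norm w"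
      by (rule sum_Basis_bound2) (use d x in force)
    finally show "\<bar>D2 f x v w - D2 f y v w\<bar> \<le> \<epsilon> * norm v * norm w" by (simp add: e_def)
  qed (use d in simp)
qed

lemma D1_along_line:
  assumes "Ck_on 2 U f" "x + s *\<^sub>R v \<in> U"
  shows "((\<lambda>s. f (x + s *\<^sub>R v)) has_real_derivative D1 f (x + s *\<^sub>R v) v) (at s)"
    "((\<lambda>s. D1 f (x + s *\<^sub>R v) u) has_real_derivative D2 f (x + s *\<^sub>R v) u v) (at s)"
  using has_derivative_along_line[OF Ck2D(1)[OF assms]] has_derivative_along_line[OF Ck2D(2)[OF assms]] by auto

text \<open>The mean value theorem along \<open>v\<close> and then along \<open>w\<close> expresses
  the second difference by a mixed derivative in that order. The second difference does not depend
  on the order, so comparing the two orders gives \<open>D2_symmetric\<close>.\<close>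

lemma D2_mean_value:
  fixes f :: "'a::euclidean_space \<Rightarrow> real"
  assumes f: "Ck_on 2 U f" and h: "h > 0"
    and inU: "\<And>s k. 0 \<le> s \<Longrightarrow> s \<le> h \<Longrightarrow> 0 \<le> k \<Longrightarrow> k \<le> h \<Longrightarrow> x + s *\<^sub>R v + k *\<^sub>R w \<in> U"
  shows "\<exists>s k. 0 \<le> s \<and> s \<le> h \<and> 0 \<le> k \<and> k \<le> h \<and>
     f (x + h *\<^sub>R v + h *\<^sub>R w) - f (x + h *\<^sub>R v) - f (x + h *\<^sub>R w) + f x = h * h * D2 f (x + s *\<^sub>R v + k *\<^sub>R w) v w"
proof -
  define \<phi> where "\<phi> s = f (x + h *\<^sub>R w + s *\<^sub>R v) - f (x + s *\<^sub>R v)" for s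
  have in1: "x + h *\<^sub>R w + s *\<^sub>R v \<in> U" if "0 \<le> s" "s \<le> h" for s
    using inU[of s h] that h by (simp add: algebra_simps)
  have in2: "x + s *\<^sub>R v \<in> U" if "0 \<le> s" "s \<le> h" for s using inU[of s 0] that h by simp
  have "(\<phi> has_real_derivative D1 f (x + h *\<^sub>R w + s *\<^sub>R v) v - D1 f (x + s *\<^sub>R v) v) (at s)" if "0 \<le> s" "s \<le> h" for s
    unfolding \<phi>_def by (intro DERIV_diff D1_along_line(1)[OF f in1[OF that]] D1_along_line(1)[OF f in2[OF that]])
  from MVT2[OF h this] obtain s where s: "0 < s" "s < h"
    "\<phi> h - \<phi> 0 = h * (D1 f (x + h *\<^sub>R w + s *\<^sub>R v) v - D1 f (x + s *\<^sub>R v) v)" by auto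
  have "((\<lambda>k. D1 f (x + s *\<^sub>R v + k *\<^sub>R w) v) has_real_derivative D2 f (x + s *\<^sub>R v + k *\<^sub>R w) v w) (at k)"
    if "0 \<le> k" "k \<le> h" for k
    by (rule D1_along_line(2)[OF f inU]) (use that s in auto)
  from MVT2[OF h this] obtain k where k: "0 < k" "k < h"
    "D1 f (x + s *\<^sub>R v + h *\<^sub>R w) v - D1 f (x + s *\<^sub>R v) v = h * D2 f (x + s *\<^sub>R v + k *\<^sub>R w) v w" by auto
  have "f (x + h *\<^sub>R v + h *\<^sub>R w) - f (x + h *\<^sub>R v) - f (x + h *\<^sub>R w) + f x = \<phi> h - \<phi> 0"
    by (simp add: \<phi>_def algebra_simps)
  also have "\<dots> = h * h * D2 f (x + s *\<^sub>R v + k *\<^sub>R w) v w"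
    using s(3) k(3) by (simp add: algebra_simps)
  finally show ?thesis using s k by (intro exI[of _ s] exI[of _ k]) auto
qed

lemma D2_symmetric:
  fixes f :: "'a::euclidean_space \<Rightarrow> real"
  assumes f: "Ck_on 2 U f" and U: "open U" "x \<in> U"
  shows "D2 f x v w = D2 f x w v"
proof (rule ccontr)
  define e where "e = \<bar>D2 f x v w - D2 f x w v\<bar> / 2"
  assume "D2 f x v w \<noteq> D2 f x w v"
  then have e: "e > 0" by (simp add: e_def)
  have c: "isCont (\<lambda>y. D2 f y v w) x" "isCont (\<lambda>y. D2 f y w v) x"
    using Ck2_continuous(3)[OF f] U by (auto simp: continuous_on_eq_continuous_at)
  obtain d1 where d1: "d1 > 0" "\<And>y. dist y x < d1 \<Longrightarrow> \<bar>D2 f y v w - D2 f x v w\<bar> < e"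
    using c(1) e unfolding continuous_at_eps_delta dist_real_def by blast
  obtain d2 where d2: "d2 > 0" "\<And>y. dist y x < d2 \<Longrightarrow> \<bar>D2 f y w v - D2 f x w v\<bar> < e"
    using c(2) e unfolding continuous_at_eps_delta dist_real_def by blast
  obtain d3 where d3: "d3 > 0" "ball x d3 \<subseteq> U" using U open_contains_ball by blast
  define d where "d = min d1 (min d2 d3)"
  define h where "h = d / (2 * (1 + norm v + norm w))"
  have d: "d > 0" using d1 d2 d3 by (simp add: d_def)
  have nn: "1 + norm v + norm w > 0" by (simp add: add_pos_nonneg)
  have h: "h > 0" using d nn by (simp add: h_def)
  have near: "dist (x + s *\<^sub>R a + k *\<^sub>R b) x < d"
    if "0 \<le> s" "s \<le> h" "0 \<le> k" "k \<le> h" "a = v \<and> b = w \<or> a = w \<and> b = v" for s k a b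
  proof -
    have "dist (x + s *\<^sub>R a + k *\<^sub>R b) x \<le> s * norm a + k * norm b"
      using norm_triangle_ineq[of "s *\<^sub>R a" "k *\<^sub>R b"] that by (simp add: dist_norm add.assoc)
    also have "\<dots> \<le> h * norm a + h * norm b" using that by (intro add_mono mult_right_mono) auto
    also have "\<dots> \<le> h * (1 + norm v + norm w)" using that h by (auto simp: algebra_simps)
    also have "\<dots> = d / 2" using nn unfolding h_def by (simp add: field_simps)
    also have "\<dots> < d" using d by simp
    finally show ?thesis .
  qed
  have inU: "x + s *\<^sub>R a + k *\<^sub>R b \<in> U" if "0 \<le> s" "s \<le> h" "0 \<le> k" "k \<le> h" "a = v \<and> b = w \<or> a = w \<and> b = v" for s k a b
  proof -
    have "x + s *\<^sub>R a + k *\<^sub>R b \<in> ball x d3" using near[OF that] unfolding d_def by (simp add: dist_commute)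
    then show ?thesis using d3 by blast
  qed
  obtain s k where 1: "0 \<le> s" "s \<le> h" "0 \<le> k" "k \<le> h"
     "f (x + h *\<^sub>R v + h *\<^sub>R w) - f (x + h *\<^sub>R v) - f (x + h *\<^sub>R w) + f x = h * h * D2 f (x + s *\<^sub>R v + k *\<^sub>R w) v w"
    using D2_mean_value[OF f h, of x v w] inU by blast
  obtain s' k' where 2: "0 \<le> s'" "s' \<le> h" "0 \<le> k'" "k' \<le> h"
     "f (x + h *\<^sub>R w + h *\<^sub>R v) - f (x + h *\<^sub>R w) - f (x + h *\<^sub>R v) + f x = h * h * D2 f (x + s' *\<^sub>R w + k' *\<^sub>R v) w v"
    using D2_mean_value[OF f h, of x w v] inU by blast
  have "h * h * D2 f (x + s *\<^sub>R v + k *\<^sub>R w) v w = h * h * D2 f (x + s' *\<^sub>R w + k' *\<^sub>R v) w v"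
    using 1(5) 2(5) by (simp add: algebra_simps)
  then have "D2 f (x + s *\<^sub>R v + k *\<^sub>R w) v w = D2 f (x + s' *\<^sub>R w + k' *\<^sub>R v) w v" using h by simp
  moreover have "\<bar>D2 f (x + s *\<^sub>R v + k *\<^sub>R w) v w - D2 f x v w\<bar> < e"
    by (rule d1(2)) (use near[OF 1(1-4)] in \<open>simp add: d_def\<close>)
  moreover have "\<bar>D2 f (x + s' *\<^sub>R w + k' *\<^sub>R v) w v - D2 f x w v\<bar> < e"
    by (rule d2(2)) (use near[OF 2(1-4)] in \<open>simp add: d_def\<close>)
  ultimately show False unfolding e_def by (simp add: abs_if split: if_splits)
qed

section \<open>Approximating \<open>C\<^sup>2\<close> functions by \<open>C\<^sup>k\<close> functions\<close>

text \<open>The one-sided Steklov mean in one direction. It takes the role of convolution with a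
  mollifier: a gain of one derivative per round of averaging is enough, since rounds can be
  iterated.\<close>

definition steklov :: "real \<Rightarrow> 'a::euclidean_space \<Rightarrow> ('a \<Rightarrow> real) \<Rightarrow> 'a \<Rightarrow> real" where
  "steklov s e f x = integral {0..1} (\<lambda>t. f (x + (t * s) *\<^sub>R e))"

text \<open>Neighbourhoods are indexed by a radius because every averaging consumes \<open>s\<close>
  of it.\<close>

definition nbhd :: "'a::euclidean_space set \<Rightarrow> real \<Rightarrow> 'a set" where
  "nbhd K d = {x. infdist x K < d}"

lemma open_nbhd: "open (nbhd K d)"
  unfolding nbhd_def by (intro open_Collect_less continuous_intros)

lemma nbhd_add: "x \<in> nbhd K d \<Longrightarrow> norm y \<le> s \<Longrightarrow> x + y \<in> nbhd K (d + s)"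
  using infdist_triangle[of "x + y" K x] by (simp add: nbhd_def dist_norm)

lemma nbhd_mono: "d \<le> d' \<Longrightarrow> nbhd K d \<subseteq> nbhd K d'"
  by (auto simp: nbhd_def)

lemma nbhd_segment:
  assumes "x \<in> nbhd K d" "norm e \<le> 1" "s > 0" "t \<in> {0..1}"
  shows "x + (t * s) *\<^sub>R e \<in> nbhd K (d + s)"
proof (rule nbhd_add[OF assms(1)])
  have "\<bar>t * s\<bar> * norm e \<le> (1 * s) * 1" using assms by (intro mult_mono) (auto simp: abs_mult)
  then show "norm ((t * s) *\<^sub>R e) \<le> s" by simp
qed

context
  fixes K :: "'a::euclidean_space set" and d s :: real and e :: 'a
  assumes e: "norm e = 1" and s: "s > 0"
begin

lemma continuous_on_segment_map:
  assumes "continuous_on (nbhd K (d + s)) f"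
  shows "continuous_on (nbhd K d \<times> cbox 0 1) (\<lambda>(x, t). f (x + (t * s) *\<^sub>R e))"
  unfolding split_def
  by (rule continuous_on_compose2[OF assms])
    (auto intro!: continuous_intros nbhd_segment simp: e s)

lemma steklov_integrable:
  fixes f :: "'a \<Rightarrow> real"
  assumes "continuous_on (nbhd K (d + s)) f" "x \<in> nbhd K d"
  shows "(\<lambda>t. f (x + (t * s) *\<^sub>R e)) integrable_on {0..1}"
  by (intro integrable_continuous_real continuous_on_compose2[OF assms(1)])
    (auto intro!: continuous_intros nbhd_segment[OF assms(2)] simp: e s)

lemma steklov_close:
  assumes "continuous_on (nbhd K (d + s)) f" "x \<in> nbhd K d"
    and "\<And>t. t \<in> {0..1} \<Longrightarrow> \<bar>f (x + (t * s) *\<^sub>R e) - c\<bar> \<le> \<epsilon>"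
  shows "\<bar>steklov s e f x - c\<bar> \<le> \<epsilon>"
proof -
  note i = steklov_integrable[OF assms(1,2)]
  have b: "c - \<epsilon> \<le> f (x + (t * s) *\<^sub>R e)" "f (x + (t * s) *\<^sub>R e) \<le> c + \<epsilon>" if "t \<in> {0..1}" for t
    using assms(3)[OF that] by linarith+
  have k: "(\<lambda>_. k) integrable_on {0..1::real}" for k :: real by (rule integrable_const_ivl)
  have "integral {0..1::real} (\<lambda>_. c - \<epsilon>) \<le> steklov s e f x"
    unfolding steklov_def by (rule integral_le[OF k i b(1)])
  moreover have "steklov s e f x \<le> integral {0..1::real} (\<lambda>_. c + \<epsilon>)"
    unfolding steklov_def by (rule integral_le[OF i k b(2)])
  ultimately have "c - \<epsilon> \<le> steklov s e f x" "steklov s e f x \<le> c + \<epsilon>" by simp_all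
  then show ?thesis by auto
qed

lemma steklov_has_derivative:
  assumes f: "Ck_on (Suc m) (nbhd K (d + s)) f" and x: "x \<in> nbhd K d"
  shows "(steklov s e f has_derivative (\<lambda>v. steklov s e (\<lambda>y. D1 f y v) x)) (at x)"
proof -
  obtain r where r: "r > 0" "ball x r \<subseteq> nbhd K d"
    using x open_nbhd open_contains_ball by blast
  \<comment> \<open>The Leibniz rule integrates derivatives as elements of the space of bounded
    linear maps, so \<open>D1 f\<close> is wrapped; continuity of the wrapped map is checked on
    basis vectors.\<close>
  define F where "F y t = Blinfun (D1 f (y + (t * s) *\<^sub>R e))" for y t
  have inW: "y + (t * s) *\<^sub>R e \<in> nbhd K (d + s)" if "y \<in> ball x r" "t \<in> cbox 0 1" for y t
    using nbhd_segment[of y K d e s t] that r e s by (auto simp: subset_iff)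
  have bl: "bounded_linear (D1 f y)" if "y \<in> nbhd K (d + s)" for y
    using Ck_on_SucD(1)[OF f that] has_derivative_bounded_linear by blast
  have F: "blinfun_apply (F y t) v = D1 f (y + (t * s) *\<^sub>R e) v" if "y \<in> ball x r" "t \<in> cbox 0 1" for y t v
    unfolding F_def using bounded_linear_Blinfun_apply[OF bl[OF inW[OF that]]] by simp
  have contF: "continuous_on (ball x r \<times> cbox 0 1) (\<lambda>(y, t). F y t)"
    unfolding split_def
  proof (rule continuous_on_blinfun_componentwise)
    fix b :: 'a assume "b \<in> Basis"
    have "continuous_on (ball x r \<times> cbox 0 1) (\<lambda>(y, t). D1 f (y + (t * s) *\<^sub>R e) b)"
      by (rule continuous_on_subset[OF continuous_on_segment_map[OF Ck_on_continuous[OF Ck_on_SucD(2)[OF f]]]])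
        (use r in auto)
    then show "continuous_on (ball x r \<times> cbox 0 1) (\<lambda>p. blinfun_apply (F (fst p) (snd p)) b)"
      by (rule continuous_on_cong[THEN iffD1, OF refl, rotated]) (auto simp: F)
  qed
  have "((\<lambda>y. integral (cbox 0 1) (\<lambda>t. f (y + (t * s) *\<^sub>R e))) has_derivative integral (cbox 0 1) (F x)) (at x within ball x r)"
  proof (rule leibniz_rule)
    fix y and t :: real assume yt: "y \<in> ball x r" "t \<in> cbox 0 1"
    have "(f has_derivative D1 f (y + (t * s) *\<^sub>R e)) (at (y + (t * s) *\<^sub>R e))"
      by (rule Ck_on_SucD(1)[OF f inW[OF yt]])
    moreover have "((\<lambda>y. y + (t * s) *\<^sub>R e) has_derivative (\<lambda>v. v)) (at y within ball x r)"
      by (auto intro!: derivative_eq_intros)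
    ultimately have "((\<lambda>y. f (y + (t * s) *\<^sub>R e)) has_derivative (\<lambda>v. D1 f (y + (t * s) *\<^sub>R e) v)) (at y within ball x r)"
      using has_derivative_compose by blast
    then show "((\<lambda>y. f (y + (t * s) *\<^sub>R e)) has_derivative blinfun_apply (F y t)) (at y within ball x r)"
    proof -
      have "blinfun_apply (F y t) = D1 f (y + (t * s) *\<^sub>R e)" by (rule ext) (rule F[OF yt])
      with \<open>((\<lambda>y. f (y + (t * s) *\<^sub>R e)) has_derivative _) _\<close> show ?thesis by simp
    qed
  next
    fix y assume "y \<in> ball x r"
    then show "(\<lambda>t. f (y + (t * s) *\<^sub>R e)) integrable_on cbox 0 1"
      using steklov_integrable[OF Ck_on_Suc_continuous[OF f]] r by auto
  qed (use contF r in auto)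
  then have "(steklov s e f has_derivative integral (cbox 0 1) (F x)) (at x)"
    using r(1) unfolding steklov_def by (simp add: at_within_open[of x "ball x r"])
  moreover have "blinfun_apply (integral (cbox 0 1) (F x)) v = steklov s e (\<lambda>y. D1 f y v) x" for v
  proof -
    have "continuous_on (cbox 0 1) (F x)"
    proof -
      have "continuous_on (cbox 0 1) (\<lambda>t. case (x, t) of (y, t) \<Rightarrow> F y t)"
        by (rule continuous_on_compose2[OF contF]) (use r in \<open>auto intro!: continuous_intros\<close>)
      then show ?thesis by simp
    qed
    then have "F x integrable_on cbox 0 1" by (rule integrable_continuous)
    then have "blinfun_apply (integral (cbox 0 1) (F x)) v = integral (cbox 0 1) (\<lambda>t. blinfun_apply (F x t) v)"
      using integral_linear[OF \<open>F x integrable_on cbox 0 1\<close> blinfun.bounded_linear_left[of v]] by (simp add: o_def)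
    also have "\<dots> = steklov s e (\<lambda>y. D1 f y v) x"
      unfolding steklov_def by (auto intro!: integral_cong simp: F r)
    finally show ?thesis .
  qed
  then have "blinfun_apply (integral (cbox 0 1) (F x)) = (\<lambda>v. steklov s e (\<lambda>y. D1 f y v) x)" by (rule ext)
  ultimately show ?thesis by simp
qed

lemma steklov_Ck:
  assumes "Ck_on m (nbhd K (d + s)) f"
  shows "Ck_on m (nbhd K d) (steklov s e f)"
  using assms
proof (induction m arbitrary: f)
  case 0
  show ?case
    using integral_continuous_on_param[OF continuous_on_segment_map] 0
    unfolding steklov_def[abs_def] by simp
next
  case (Suc m)
  show ?case
    by (rule Ck_on_SucI[OF open_nbhd steklov_has_derivative[OF Suc.prems]])
      (auto intro: Suc.IH Ck_on_SucD(2)[OF Suc.prems])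
qed

lemma steklov_D1:
  assumes "Ck_on (Suc m) (nbhd K (d + s)) f" "x \<in> nbhd K d"
  shows "D1 (steklov s e f) x v = steklov s e (\<lambda>y. D1 f y v) x"
  by (rule D1_eqI[OF steklov_has_derivative[OF assms]])

lemma steklov_D1_self:
  assumes f: "Ck_on (Suc m) (nbhd K (d + s)) f" and x: "x \<in> nbhd K d"
  shows "steklov s e (\<lambda>y. D1 f y e) x = (f (x + s *\<^sub>R e) - f x) / s"
proof -
  have "((\<lambda>t. D1 f (x + (t * s) *\<^sub>R e) e) has_integral (f (x + (1 * s) *\<^sub>R e) / s - f (x + (0 * s) *\<^sub>R e) / s)) {0..1}"
  proof (rule fundamental_theorem_of_calculus)
    fix t :: real assume t: "t \<in> {0..1}"
    have "f differentiable (at (x + (t * s) *\<^sub>R e))"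
      using Ck_on_SucD(3)[OF f nbhd_segment[OF x _ s t]] e by simp
    then have "((\<lambda>u. f (x + u *\<^sub>R e)) has_real_derivative D1 f (x + (t * s) *\<^sub>R e) e) (at (t * s))"
      by (rule has_derivative_along_line)
    then have "((\<lambda>t. f (x + (t * s) *\<^sub>R e)) has_real_derivative D1 f (x + (t * s) *\<^sub>R e) e * s) (at t)"
      by (rule DERIV_chain2[where f="\<lambda>u. f (x + u *\<^sub>R e)" and g="\<lambda>t. t * s"])
        (auto intro!: derivative_eq_intros)
    from DERIV_cdivide[OF this, of s]
    show "((\<lambda>t. f (x + (t * s) *\<^sub>R e) / s) has_vector_derivative D1 f (x + (t * s) *\<^sub>R e) e) (at t within {0..1})"
      using s by (simp add: has_real_derivative_iff_has_vector_derivative has_vector_derivative_at_within)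
  qed simp
  then show ?thesis unfolding steklov_def by (simp add: integral_unique diff_divide_distrib)
qed

end

fun smooth_along :: "real \<Rightarrow> 'a::euclidean_space list \<Rightarrow> ('a \<Rightarrow> real) \<Rightarrow> 'a \<Rightarrow> real" where
  "smooth_along s [] f = f"
| "smooth_along s (e # es) f = steklov s e (smooth_along s es f)"

lemma smooth_along_Ck:
  assumes "s > 0" "\<And>e. e \<in> set es \<Longrightarrow> norm e = 1" "Ck_on m (nbhd K (d + real (length es) * s)) f"
  shows "Ck_on m (nbhd K d) (smooth_along s es f)"
  using assms(2,3)
proof (induction es arbitrary: d)
  case (Cons e es)
  have "Ck_on m (nbhd K (d + s)) (smooth_along s es f)"
    using Cons by (intro Cons.IH) (auto simp: algebra_simps)
  then show ?case using steklov_Ck[of e s m K d] Cons.prems(1) assms(1) by simp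
qed simp

text \<open>Each averaging moves the evaluation point by at most \<open>s\<close>, so only values of
  \<open>f\<close> within \<open>length es * s\<close> of \<open>x\<close> contribute, and averaging
  values close to a constant keeps them close to it.\<close>

lemma smooth_along_close:
  assumes "s > 0" "\<And>e. e \<in> set es \<Longrightarrow> norm e = 1" "continuous_on (nbhd K (d + real (length es) * s)) f"
    and "x \<in> nbhd K d" "\<And>y. norm y \<le> real (length es) * s \<Longrightarrow> \<bar>f (x + y) - c\<bar> \<le> \<epsilon>"
  shows "\<bar>smooth_along s es f x - c\<bar> \<le> \<epsilon>"
  using assms(2-5)
proof (induction es arbitrary: d x)
  case Nil
  then show ?case using Nil.prems(4)[of 0] by simp
next
  case (Cons e es)
  have e: "norm e = 1" using Cons.prems(1) by simp
  have c: "Ck_on 0 (nbhd K (d + s + real (length es) * s)) f" using Cons.prems(2) by (simp add: algebra_simps)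
  have c2: "Ck_on 0 (nbhd K (d + s)) (smooth_along s es f)"
    by (rule smooth_along_Ck[OF assms(1) _ c]) (use Cons.prems(1) in auto)
  show ?case unfolding smooth_along.simps
  proof (rule steklov_close[OF e assms(1) _ Cons.prems(3)])
    show "continuous_on (nbhd K (d + s)) (smooth_along s es f)" using c2 by simp
    fix t :: real assume t: "t \<in> {0..1}"
    show "\<bar>smooth_along s es f (x + (t * s) *\<^sub>R e) - c\<bar> \<le> \<epsilon>"
    proof (rule Cons.IH[of "d + s"])
      show "x + (t * s) *\<^sub>R e \<in> nbhd K (d + s)"
        using nbhd_segment[OF Cons.prems(3) _ assms(1) t] e by simp
      fix y :: 'a assume y: "norm y \<le> real (length es) * s"
      have "\<bar>t * s\<bar> \<le> 1 * s" using t assms(1) by (auto simp: abs_mult)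
      then have "norm ((t * s) *\<^sub>R e + y) \<le> real (length (e # es)) * s"
        using norm_triangle_ineq[of "(t * s) *\<^sub>R e" y] y e by (simp add: algebra_simps)
      from Cons.prems(4)[OF this] show "\<bar>f (x + (t * s) *\<^sub>R e + y) - c\<bar> \<le> \<epsilon>" by (simp add: add.assoc)
    qed (use c Cons.prems(1) in auto)
  qed
qed

text \<open>Since averages commute with derivatives, \<open>smooth_along_close\<close> can be
  applied to the derivatives too; this is how closeness in \<open>C\<^sup>2\<close> is
  obtained.\<close>

lemma smooth_along_D1:
  assumes "s > 0" "\<And>e. e \<in> set es \<Longrightarrow> norm e = 1" "Ck_on (Suc m) (nbhd K (d + real (length es) * s)) f"
    "x \<in> nbhd K d"
  shows "D1 (smooth_along s es f) x v = smooth_along s es (\<lambda>y. D1 f y v) x"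
  using assms(2-4)
proof (induction es arbitrary: d x)
  case (Cons e es)
  have c: "Ck_on (Suc m) (nbhd K (d + s + real (length es) * s)) f" using Cons.prems(2) by (simp add: algebra_simps)
  have c2: "Ck_on (Suc m) (nbhd K (d + s)) (smooth_along s es f)"
    by (rule smooth_along_Ck[OF assms(1) _ c]) (use Cons.prems(1) in auto)
  have e: "norm e = 1" using Cons.prems(1) by simp
  have "D1 (smooth_along s (e # es) f) x v = steklov s e (\<lambda>y. D1 (smooth_along s es f) y v) x"
    using steklov_D1[OF e assms(1) c2 Cons.prems(3)] by simp
  also have "\<dots> = steklov s e (smooth_along s es (\<lambda>y. D1 f y v)) x"
    unfolding steklov_def
  proof (rule integral_cong)
    fix t :: real assume "t \<in> {0..1}"
    then have "x + (t * s) *\<^sub>R e \<in> nbhd K (d + s)"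
      using nbhd_segment[OF Cons.prems(3) _ assms(1)] e by simp
    then show "D1 (smooth_along s es f) (x + (t * s) *\<^sub>R e) v = smooth_along s es (\<lambda>y. D1 f y v) (x + (t * s) *\<^sub>R e)"
      using Cons.IH[OF _ c] Cons.prems(1) by auto
  qed
  finally show ?case by simp
qed simp

text \<open>Averaging along \<open>e\<close> turns the derivative along \<open>e\<close> into a difference quotient, so averaging
  along all basis vectors gains one derivative.\<close>

lemma smooth_along_gain_direction:
  assumes "s > 0" "\<And>e. e \<in> set es \<Longrightarrow> norm e = 1" "Ck_on (Suc m) (nbhd K (d + real (length es) * s)) f"
    "e0 \<in> set es"
  shows "Ck_on (Suc m) (nbhd K d) (\<lambda>x. D1 (smooth_along s es f) x e0)"
  using assms(2-4)
proof (induction es arbitrary: d)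
  case (Cons e es)
  have c: "Ck_on (Suc m) (nbhd K (d + s + real (length es) * s)) f" using Cons.prems(2) by (simp add: algebra_simps)
  have c2: "Ck_on (Suc m) (nbhd K (d + s)) (smooth_along s es f)"
    by (rule smooth_along_Ck[OF assms(1) _ c]) (use Cons.prems(1) in auto)
  have e: "norm e = 1" using Cons.prems(1) by simp
  have eq: "D1 (smooth_along s (e # es) f) x e0 = steklov s e (\<lambda>y. D1 (smooth_along s es f) y e0) x"
    if "x \<in> nbhd K d" for x
    using steklov_D1[OF e assms(1) c2 that] by simp
  show ?case
  proof (cases "e0 = e")
    case True
    have shift: "Ck_on (Suc m) (nbhd K d) (\<lambda>x. smooth_along s es f (x + s *\<^sub>R e))"
    proof (rule Ck_on_compose[OF open_nbhd _ c2])
      show "x + s *\<^sub>R e \<in> nbhd K (d + s)" if "x \<in> nbhd K d" for x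
        using nbhd_add[OF that, of "s *\<^sub>R e" s] e assms(1) by simp
      show "Ck_on (Suc m) (nbhd K d) (\<lambda>x. (x + s *\<^sub>R e) \<bullet> b)" for b
        unfolding inner_add_left
        by (intro Ck_on_add[OF open_nbhd] Ck_on_const Ck_on_linear bounded_linear_inner_left)
    qed
    have "Ck_on (Suc m) (nbhd K d) (\<lambda>x. (1 / s) * (smooth_along s es f (x + s *\<^sub>R e) - smooth_along s es f x))"
      by (intro Ck_on_cmult Ck_on_diff open_nbhd shift Ck_on_subset[OF c2] nbhd_mono) (use assms(1) in simp)
    then show ?thesis
      by (rule Ck_on_cong[OF open_nbhd]) (simp add: eq[unfolded True] True steklov_D1_self[OF e assms(1) c2] del: smooth_along.simps)
  next
    case False
    then have "Ck_on (Suc m) (nbhd K (d + s)) (\<lambda>x. D1 (smooth_along s es f) x e0)"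
      using Cons.IH[OF _ c] Cons.prems by auto
    from steklov_Ck[OF e assms(1) this]
    show ?thesis by (rule Ck_on_cong[OF open_nbhd]) (simp add: eq del: smooth_along.simps)
  qed
qed simp

lemma smooth_along_gain:
  fixes f :: "'a::euclidean_space \<Rightarrow> real"
  assumes "s > 0" "set es = Basis" "Ck_on (Suc m) (nbhd K (d + real (length es) * s)) f"
  shows "Ck_on (Suc (Suc m)) (nbhd K d) (smooth_along s es f)"
proof -
  have e: "norm e = 1" if "e \<in> set es" for e using that assms(2) by simp
  have c: "Ck_on (Suc m) (nbhd K d) (smooth_along s es f)"
    by (rule smooth_along_Ck[OF assms(1) e assms(3)])
  show ?thesis
  proof (rule Ck_on_SucI[OF open_nbhd])
    fix x assume x: "x \<in> nbhd K d"
    have "(smooth_along s es f has_derivative D1 (smooth_along s es f) x) (at x)"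
      by (rule Ck_on_SucD(1)[OF c x])
    then show "(smooth_along s es f has_derivative (\<lambda>v. \<Sum>b\<in>Basis. (v \<bullet> b) * D1 (smooth_along s es f) x b)) (at x)"
      using D1_expand[OF Ck_on_SucD(3)[OF c x]] by (metis (no_types, lifting) ext has_derivative_eq_rhs)
  next
    show "Ck_on (Suc m) (nbhd K d) (\<lambda>x. \<Sum>b\<in>Basis. (v \<bullet> b) * D1 (smooth_along s es f) x b)" for v
      by (intro Ck_on_sum Ck_on_cmult open_nbhd smooth_along_gain_direction[OF assms(1) e assms(3)])
        (use assms(2) in auto)
  qed
qed

lemma compact_nbhd_subset:
  fixes K :: "'a::euclidean_space set"
  assumes "compact K" "open W" "K \<subseteq> W" "K \<noteq> {}"
  obtains d where "d > 0" "nbhd K (2 * d) \<subseteq> W" "compact {x. infdist x K \<le> d}" "{x. infdist x K \<le> d} \<subseteq> W"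
proof -
  obtain d0 where d0: "d0 > 0" "(\<Union>x\<in>K. ball x d0) \<subseteq> W"
    using compact_subset_open_imp_ball_epsilon_subset[OF assms(1-3)] by blast
  define d where "d = d0 / 2"
  have d: "d > 0" using d0 by (simp add: d_def)
  have 1: "nbhd K (2 * d) \<subseteq> W"
  proof
    fix x assume x: "x \<in> nbhd K (2 * d)"
    obtain y where "y \<in> K" "infdist x K = dist x y"
      using infdist_attains_inf[OF compact_imp_closed[OF assms(1)] assms(4)] by blast
    then have "x \<in> ball y d0" using x by (simp add: nbhd_def d_def dist_commute)
    then show "x \<in> W" using d0 \<open>y \<in> K\<close> by blast
  qed
  moreover have "{x. infdist x K \<le> d} \<subseteq> W" using 1 d by (force simp: nbhd_def)
  moreover have "compact {x. infdist x K \<le> d}" by (rule compact_infdist_le[OF assms(4,1) d])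
  ultimately show ?thesis using that d by blast
qed

text \<open>One round of averaging along all basis vectors gains one order. Closeness comes from
  uniform continuity of \<open>f\<close>, \<open>D1 f\<close> and \<open>D2 f\<close> on the compact
  neighbourhood \<open>L\<close>; \<open>m \<ge> 1\<close> makes \<open>f\<close> at least
  \<open>C\<^sup>2\<close>.\<close>

lemma C2_approximation_step:
  fixes f :: "'a::euclidean_space \<Rightarrow> real"
  assumes f: "Ck_on (Suc m) W f" and m: "m \<ge> 1" and W: "open W" and K: "compact K" "K \<subseteq> W" "K \<noteq> {}" and \<epsilon>: "\<epsilon> > 0"
  shows "\<exists>W' g. open W' \<and> K \<subseteq> W' \<and> Ck_on (Suc (Suc m)) W' g \<and>
    (\<forall>x\<in>K. \<bar>g x - f x\<bar> \<le> \<epsilon> \<and> (\<forall>b\<in>Basis. \<bar>D1 g x b - D1 f x b\<bar> \<le> \<epsilon>) \<and>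
      (\<forall>b\<in>Basis. \<forall>c\<in>Basis. \<bar>D2 g x b c - D2 f x b c\<bar> \<le> \<epsilon>))"
proof -
  obtain d where d: "d > 0" "nbhd K (2 * d) \<subseteq> W" "compact {x. infdist x K \<le> d}" "{x. infdist x K \<le> d} \<subseteq> W"
    using compact_nbhd_subset[OF K(1) W K(2,3)] by blast
  define L where "L = {x. infdist x K \<le> d}"
  have f2: "Ck_on 2 W f" using Ck_on_mono[OF f, of 2] m by simp
  note c = Ck2_continuous[OF f2, THEN continuous_on_subset, OF d(4)]
  obtain d0 where d0: "d0 > 0" "\<forall>i\<in>{()}. \<forall>x\<in>L. \<forall>y\<in>L. dist x y < d0 \<longrightarrow> \<bar>f x - f y\<bar> < \<epsilon>"
    using finite_uniform_modulus[of "{()}" L "\<lambda>_. f" \<epsilon>] c(1) \<epsilon> d(3) unfolding L_def by auto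
  obtain d1 where d1: "d1 > 0" "\<forall>b\<in>Basis. \<forall>x\<in>L. \<forall>y\<in>L. dist x y < d1 \<longrightarrow> \<bar>D1 f x b - D1 f y b\<bar> < \<epsilon>"
    using finite_uniform_modulus[of Basis L "\<lambda>b x. D1 f x b" \<epsilon>] c(2) \<epsilon> d(3) unfolding L_def by auto
  obtain d2 where d2: "d2 > 0" "\<forall>b\<in>Basis\<times>Basis. \<forall>x\<in>L. \<forall>y\<in>L. dist x y < d2 \<longrightarrow> \<bar>D2 f x (fst b) (snd b) - D2 f y (fst b) (snd b)\<bar> < \<epsilon>"
    using finite_uniform_modulus[of "Basis \<times> Basis" L "\<lambda>b x. D2 f x (fst b) (snd b)" \<epsilon>] c(3) \<epsilon> d(3) unfolding L_def by auto
  have d2': "\<bar>D2 f x b c - D2 f y b c\<bar> < \<epsilon>" if "x \<in> L" "y \<in> L" "dist x y < d2" "b \<in> Basis" "c \<in> Basis" for x y b c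
    using d2(2)[rule_format, of "(b, c)" x y] that by simp
  obtain es :: "'a list" where es: "set es = Basis" using finite_list[OF finite_Basis] by blast
  then have "length es > 0" by (metis empty_set length_greater_0_conv nonempty_Basis)
  \<comment> \<open>Chosen so that the total displacement \<open>length es * s\<close> is half of
    the smallest admissible distance.\<close>
  define s where "s = min d (min d0 (min d1 d2)) / 2 / length es"
  have s: "s > 0" using d(1) d0(1) d1(1) d2(1) \<open>length es > 0\<close> by (simp add: s_def)
  have ls: "real (length es) * s = min d (min d0 (min d1 d2)) / 2" using \<open>length es > 0\<close> by (simp add: s_def)
  have e: "norm e = 1" if "e \<in> set es" for e using that es by simp
  define g where "g = smooth_along s es f"
  have sub: "nbhd K (d + real (length es) * s) \<subseteq> W"
  proof -
    have "d + real (length es) * s \<le> 2 * d" using ls d(1) by linarith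
    then show ?thesis using nbhd_mono d(2) by blast
  qed
  have fs: "Ck_on (Suc m) (nbhd K (d + real (length es) * s)) f" by (rule Ck_on_subset[OF f sub])
  have inK: "x \<in> nbhd K d" if "x \<in> K" for x using that d(1) by (simp add: nbhd_def)
  have near: "x + y \<in> L" "x \<in> L" "dist (x + y) x < d0" "dist (x + y) x < d1" "dist (x + y) x < d2"
    if "x \<in> K" "norm y \<le> real (length es) * s" for x y
    using that infdist_triangle[of "x + y" K x] ls d(1) d0(1) d1(1) d2(1) by (auto simp: L_def dist_norm)
  have g1: "D1 g x v = smooth_along s es (\<lambda>y. D1 f y v) x" if "x \<in> nbhd K d" for x v
    unfolding g_def by (rule smooth_along_D1[OF s e fs that])
  obtain m' where m': "m = Suc m'" using m by (cases m) auto
  have fs1: "Ck_on (Suc m') (nbhd K (d + real (length es) * s)) (\<lambda>y. D1 f y v)" for v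
    using Ck_on_SucD(2)[OF fs] m' by simp
  have g2: "D2 g x v w = smooth_along s es (\<lambda>y. D2 f y v w) x" if x: "x \<in> nbhd K d" for x v w
  proof -
    have cc: "Ck_on (Suc m') (nbhd K d) (smooth_along s es (\<lambda>y. D1 f y v))"
      by (rule smooth_along_Ck[OF s e fs1])
    have "D2 g x v w = D1 (smooth_along s es (\<lambda>y. D1 f y v)) x w"
      by (rule D1_cong(1)[OF open_nbhd x _ Ck_on_SucD(3)[OF cc x]]) (simp add: g1)
    also have "\<dots> = smooth_along s es (\<lambda>y. D2 f y v w) x"
      by (rule smooth_along_D1[OF s e fs1 x])
    finally show ?thesis .
  qed
  note close = smooth_along_close[OF s e]
  note cs = Ck2_continuous[OF f2, THEN continuous_on_subset, OF sub]
  show ?thesis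
  proof (intro exI[of _ "nbhd K d"] exI[of _ g] conjI ballI)
    show "Ck_on (Suc (Suc m)) (nbhd K d) g" unfolding g_def by (rule smooth_along_gain[OF s es fs])
    show "K \<subseteq> nbhd K d" using inK by blast
    fix x assume x: "x \<in> K"
    show "\<bar>g x - f x\<bar> \<le> \<epsilon>" unfolding g_def
      by (rule close[OF _ cs(1) inK[OF x]]) (use near[OF x] d0(2) in \<open>auto intro: less_imp_le\<close>)
    show "\<bar>D1 g x b - D1 f x b\<bar> \<le> \<epsilon>" if "b \<in> Basis" for b unfolding g1[OF inK[OF x]]
      by (rule close[OF _ cs(2) inK[OF x]]) (use near[OF x] d1(2) that in \<open>auto intro: less_imp_le\<close>)
    show "\<bar>D2 g x b c - D2 f x b c\<bar> \<le> \<epsilon>" if "b \<in> Basis" "c \<in> Basis" for b c unfolding g2[OF inK[OF x]]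
      by (rule close[OF _ cs(3) inK[OF x]]) (use near[OF x] d2' that in \<open>auto intro: less_imp_le\<close>)
  qed (rule open_nbhd)
qed

lemma C2_approximation_basis:
  fixes f :: "'a::euclidean_space \<Rightarrow> real"
  assumes "Ck_on 2 W f" and "open W" "compact K" "K \<subseteq> W" "K \<noteq> {}" and "\<epsilon> > 0"
  shows "\<exists>W' g. open W' \<and> K \<subseteq> W' \<and> Ck_on (k + 2) W' g \<and>
    (\<forall>x\<in>K. \<bar>g x - f x\<bar> \<le> \<epsilon> \<and> (\<forall>b\<in>Basis. \<bar>D1 g x b - D1 f x b\<bar> \<le> \<epsilon>) \<and>
      (\<forall>b\<in>Basis. \<forall>c\<in>Basis. \<bar>D2 g x b c - D2 f x b c\<bar> \<le> \<epsilon>))"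
  using assms(6)
proof (induction k arbitrary: \<epsilon>)
  case 0
  then show ?case using assms by (intro exI[of _ W] exI[of _ f]) (auto simp del: Ck_on.simps simp: numeral_2_eq_2)
next
  case (Suc k)
  \<comment> \<open>Half of the error is spent on the earlier rounds, half on the next one.\<close>
  have "\<epsilon> / 2 > 0" using Suc.prems by simp
  from Suc.IH[OF this] obtain W' g where g: "open W'" "K \<subseteq> W'" "Ck_on (k + 2) W' g"
    "\<And>x. x \<in> K \<Longrightarrow> \<bar>g x - f x\<bar> \<le> \<epsilon> / 2"
    "\<And>x b. x \<in> K \<Longrightarrow> b \<in> Basis \<Longrightarrow> \<bar>D1 g x b - D1 f x b\<bar> \<le> \<epsilon> / 2"
    "\<And>x b c. x \<in> K \<Longrightarrow> b \<in> Basis \<Longrightarrow> c \<in> Basis \<Longrightarrow> \<bar>D2 g x b c - D2 f x b c\<bar> \<le> \<epsilon> / 2" by blast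
  have "Ck_on (Suc (k + 1)) W' g" using g(3) by simp
  from C2_approximation_step[OF this _ g(1) assms(3) g(2) assms(5) \<open>\<epsilon> / 2 > 0\<close>]
  obtain W'' h where h: "open W''" "K \<subseteq> W''" "Ck_on (Suc (Suc (k + 1))) W'' h"
    "\<And>x. x \<in> K \<Longrightarrow> \<bar>h x - g x\<bar> \<le> \<epsilon> / 2"
    "\<And>x b. x \<in> K \<Longrightarrow> b \<in> Basis \<Longrightarrow> \<bar>D1 h x b - D1 g x b\<bar> \<le> \<epsilon> / 2"
    "\<And>x b c. x \<in> K \<Longrightarrow> b \<in> Basis \<Longrightarrow> c \<in> Basis \<Longrightarrow> \<bar>D2 h x b c - D2 g x b c\<bar> \<le> \<epsilon> / 2"
    by (metis le_add2)
  have tri: "\<bar>a - c\<bar> \<le> \<epsilon>" if "\<bar>a - b\<bar> \<le> \<epsilon> / 2" "\<bar>b - c\<bar> \<le> \<epsilon> / 2" for a b c :: real using that by linarith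
  have "\<forall>x\<in>K. \<bar>h x - f x\<bar> \<le> \<epsilon> \<and> (\<forall>b\<in>Basis. \<bar>D1 h x b - D1 f x b\<bar> \<le> \<epsilon>) \<and>
      (\<forall>b\<in>Basis. \<forall>c\<in>Basis. \<bar>D2 h x b c - D2 f x b c\<bar> \<le> \<epsilon>)"
    by (intro ballI conjI; rule tri, rule h(4-6), assumption+, rule g(4-6), assumption+)
  moreover have "Ck_on (Suc k + 2) W'' h" using h(3) by simp
  ultimately show ?case using h(1,2) by blast
qed

theorem C2_approximation:
  fixes f :: "'a::euclidean_space \<Rightarrow> real"
  assumes f: "Ck_on 2 W f" and W: "open W" and K: "compact K" "K \<subseteq> W" "K \<noteq> {}" and \<epsilon>: "\<epsilon> > 0" and k: "k \<ge> 2"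
  obtains W' g where "open W'" "K \<subseteq> W'" "Ck_on k W' g"
    "\<And>x. x \<in> K \<Longrightarrow> \<bar>g x - f x\<bar> \<le> \<epsilon>" "\<And>x v. x \<in> K \<Longrightarrow> \<bar>D1 g x v - D1 f x v\<bar> \<le> \<epsilon> * norm v"
    "\<And>x v. x \<in> K \<Longrightarrow> \<bar>D2 g x v v - D2 f x v v\<bar> \<le> \<epsilon> * (norm v)\<^sup>2"
proof -
  define n where "n = real DIM('a)"
  have n: "n \<ge> 1" using DIM_positive[where 'a='a] by (simp add: n_def)
  \<comment> \<open>Passing from basis vectors to arbitrary directions costs a factor
    \<open>n\<close> for first and \<open>n ^ 2\<close> for second derivatives.\<close>
  define \<delta> where "\<delta> = \<epsilon> / n ^ 2"
  have \<delta>: "\<delta> > 0" using \<epsilon> n by (simp add: \<delta>_def)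
  have n2: "n \<le> n ^ 2" using n by (simp add: power2_eq_square)
  have \<delta>2: "n ^ 2 * \<delta> = \<epsilon>" "n * \<delta> \<le> \<epsilon>" "\<delta> \<le> \<epsilon>"
  proof -
    show 1: "n ^ 2 * \<delta> = \<epsilon>" using n by (simp add: \<delta>_def)
    show "n * \<delta> \<le> \<epsilon>" using mult_right_mono[OF n2, of \<delta>] \<delta> 1 by linarith
    show "\<delta> \<le> \<epsilon>" using mult_right_mono[of 1 "n ^ 2" \<delta>] \<delta> 1 n n2 by linarith
  qed
  obtain k' where k': "k = k' + 2" using k by (metis add.commute le_Suc_ex)
  obtain W' g where g: "open W'" "K \<subseteq> W'" "Ck_on k W' g"
    "\<And>x. x \<in> K \<Longrightarrow> \<bar>g x - f x\<bar> \<le> \<delta>"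
    "\<And>x b. x \<in> K \<Longrightarrow> b \<in> Basis \<Longrightarrow> \<bar>D1 g x b - D1 f x b\<bar> \<le> \<delta>"
    "\<And>x b c. x \<in> K \<Longrightarrow> b \<in> Basis \<Longrightarrow> c \<in> Basis \<Longrightarrow> \<bar>D2 g x b c - D2 f x b c\<bar> \<le> \<delta>"
    using C2_approximation_basis[OF f W K \<delta>, of k'] unfolding k'[symmetric] by blast
  have g2: "Ck_on 2 W' g" by (rule Ck_on_mono[OF g(3) k])
  show ?thesis
  proof (rule that[OF g(1-3)])
    fix x v assume x: "x \<in> K"
    then have xW: "x \<in> W" "x \<in> W'" using K g by auto
    show "\<bar>g x - f x\<bar> \<le> \<epsilon>" using g(4)[OF x] \<delta>2 by linarith
    have "D1 g x v - D1 f x v = (\<Sum>b\<in>Basis. (v \<bullet> b) * (D1 g x b - D1 f x b))"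
      using D1_expand[OF Ck2D(1)[OF f xW(1)], of v] D1_expand[OF Ck2D(1)[OF g2 xW(2)], of v]
      by (simp add: sum_subtractf algebra_simps)
    also have "\<bar>\<dots>\<bar> \<le> n * \<delta> * norm v"
      unfolding n_def by (rule sum_Basis_bound) (rule g(5)[OF x])
    also have "\<dots> \<le> \<epsilon> * norm v" using \<delta>2 by (simp add: mult_right_mono)
    finally show "\<bar>D1 g x v - D1 f x v\<bar> \<le> \<epsilon> * norm v" .
    have "D2 g x v v - D2 f x v v = (\<Sum>b\<in>Basis. \<Sum>c\<in>Basis. (v \<bullet> b) * (v \<bullet> c) * (D2 g x b c - D2 f x b c))"
      using D2_expand[OF f W xW(1), of v v] D2_expand[OF g2 g(1) xW(2), of v v]
      by (simp add: sum_subtractf algebra_simps)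
    also have "\<bar>\<dots>\<bar> \<le> n ^ 2 * \<delta> * norm v * norm v"
      unfolding n_def by (rule sum_Basis_bound2) (rule g(6)[OF x])
    also have "\<dots> = \<epsilon> * (norm v)\<^sup>2" unfolding \<delta>2 by (simp add: power2_eq_square)
    finally show "\<bar>D2 g x v v - D2 f x v v\<bar> \<le> \<epsilon> * (norm v)\<^sup>2" .
  qed
qed

section \<open>Levi forms\<close>

lemma D1_tendsto:
  fixes f :: "'a::euclidean_space \<Rightarrow> real"
  assumes f: "Ck_on (Suc k) U f" "open U" "x \<in> U" and X: "(X \<longlongrightarrow> x) F" and V: "(V \<longlongrightarrow> v) F"
  shows "((\<lambda>n. D1 f (X n) (V n)) \<longlongrightarrow> D1 f x v) F"
proof -
  have "((\<lambda>n. \<Sum>b\<in>Basis. (V n \<bullet> b) * D1 f (X n) b) \<longlongrightarrow> (\<Sum>b\<in>Basis. (v \<bullet> b) * D1 f x b)) F"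
  proof (intro tendsto_sum tendsto_mult tendsto_inner V tendsto_const)
    fix b :: 'a
    have "isCont (\<lambda>x. D1 f x b) x"
      using Ck_on_continuous[OF Ck_on_SucD(2)[OF f(1)]] f by (simp add: continuous_on_eq_continuous_at)
    then show "((\<lambda>n. D1 f (X n) b) \<longlongrightarrow> D1 f x b) F" using X isCont_tendsto_compose by blast
  qed
  moreover have "\<forall>\<^sub>F n in F. X n \<in> U" using X f(2,3) by (rule topological_tendstoD)
  then have "\<forall>\<^sub>F n in F. (\<Sum>b\<in>Basis. (V n \<bullet> b) * D1 f (X n) b) = D1 f (X n) (V n)"
    by eventually_elim (metis D1_expand Ck_on_SucD(3)[OF f(1)])
  ultimately show ?thesis
    using D1_expand[OF Ck_on_SucD(3)[OF f(1,3)], of v] by (simp add: Lim_transform_eventually)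
qed

lemma D2_tendsto:
  fixes f :: "'a::euclidean_space \<Rightarrow> real"
  assumes f: "Ck_on 2 U f" "open U" "x \<in> U"
    and X: "(X \<longlongrightarrow> x) F" and V: "(V \<longlongrightarrow> v) F" and W: "(W \<longlongrightarrow> w) F"
  shows "((\<lambda>n. D2 f (X n) (V n) (W n)) \<longlongrightarrow> D2 f x v w) F"
proof -
  have "((\<lambda>n. \<Sum>b\<in>Basis. \<Sum>c\<in>Basis. (V n \<bullet> b) * (W n \<bullet> c) * D2 f (X n) b c) \<longlongrightarrow>
      (\<Sum>b\<in>Basis. \<Sum>c\<in>Basis. (v \<bullet> b) * (w \<bullet> c) * D2 f x b c)) F"
  proof (intro tendsto_sum tendsto_mult tendsto_inner V W tendsto_const)
    fix b c :: 'a
    have "isCont (\<lambda>x. D2 f x b c) x"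
      using Ck2_continuous(3)[OF f(1)] f by (simp add: continuous_on_eq_continuous_at)
    then show "((\<lambda>n. D2 f (X n) b c) \<longlongrightarrow> D2 f x b c) F" using X isCont_tendsto_compose by blast
  qed
  moreover have "\<forall>\<^sub>F n in F. X n \<in> U" using X f(2,3) by (rule topological_tendstoD)
  then have "\<forall>\<^sub>F n in F. (\<Sum>b\<in>Basis. \<Sum>c\<in>Basis. (V n \<bullet> b) * (W n \<bullet> c) * D2 f (X n) b c) = D2 f (X n) (V n) (W n)"
    by eventually_elim (simp add: D2_expand[OF f(1,2)])
  ultimately show ?thesis
    using D2_expand[OF f, of v w] by (simp add: Lim_transform_eventually)
qed

lemma D2_lin:
  fixes f :: "'a::euclidean_space \<Rightarrow> real"
  assumes f: "Ck_on 2 U f" "open U" "x \<in> U"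
  shows "D2 f x (u + v) w = D2 f x u w + D2 f x v w" "D2 f x (u - v) w = D2 f x u w - D2 f x v w"
    "D2 f x w (u + v) = D2 f x w u + D2 f x w v" "D2 f x w (u - v) = D2 f x w u - D2 f x w v"
    "D2 f x (k *\<^sub>R v) w = k * D2 f x v w" "D2 f x w (k *\<^sub>R v) = k * D2 f x w v"
    "D2 f x (- v) w = - D2 f x v w" "D2 f x w (- v) = - D2 f x w v"
proof -
  note l = D2_linear_left[OF f, of w] and r = Ck2D(4)[OF f(1,3), of w]
  show "D2 f x (u + v) w = D2 f x u w + D2 f x v w" "D2 f x (u - v) w = D2 f x u w - D2 f x v w"
    "D2 f x w (u + v) = D2 f x w u + D2 f x w v" "D2 f x w (u - v) = D2 f x w u - D2 f x w v"
    "D2 f x (k *\<^sub>R v) w = k * D2 f x v w" "D2 f x w (k *\<^sub>R v) = k * D2 f x w v"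
    "D2 f x (- v) w = - D2 f x v w" "D2 f x w (- v) = - D2 f x w v"
    using linear_add[OF l, of u v] linear_diff[OF l, of u v] linear_cmul[OF l, of k v] linear_neg[OF l, of v]
      linear_add[OF r, of u v] linear_diff[OF r, of u v] linear_cmul[OF r, of k v] linear_neg[OF r, of v]
    by simp_all
qed

lemma D1_lin:
  assumes "f differentiable (at x)"
  shows "D1 f x (u + v) = D1 f x u + D1 f x v" "D1 f x (u - v) = D1 f x u - D1 f x v"
    "D1 f x (k *\<^sub>R v) = k * D1 f x v" "D1 f x (- v) = - D1 f x v" "D1 f x 0 = 0"
  using linear_frechet_derivative[OF assms]
  by (simp_all add: linear_add linear_diff linear_cmul linear_neg linear_0)

text \<open>On unit vectors \<open>4 * D2 f x v w\<close> is the difference of the diagonal values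
  at \<open>v + w\<close> and \<open>v - w\<close>, and the parallelogram law bounds it by
  \<open>4 * K\<close>.\<close>

lemma D2_polarization:
  fixes f :: "'a::euclidean_space \<Rightarrow> real"
  assumes f: "Ck_on 2 U f" "open U" "x \<in> U" and K: "\<And>v. \<bar>D2 f x v v\<bar> \<le> K * (norm v)\<^sup>2"
  shows "\<bar>D2 f x v w\<bar> \<le> K * norm v * norm w"
proof -
  have unit: "\<bar>D2 f x v w\<bar> \<le> K" if "norm v = 1" "norm w = 1" for v w
  proof -
    have "4 * D2 f x v w = D2 f x (v + w) (v + w) - D2 f x (v - w) (v - w)"
      using D2_symmetric[OF f, of v w] by (simp add: D2_lin[OF f])
    also have "\<bar>\<dots>\<bar> \<le> K * (norm (v + w))\<^sup>2 + K * (norm (v - w))\<^sup>2"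
      using K[of "v + w"] K[of "v - w"] by linarith
    also have "\<dots> = K * ((norm (v + w))\<^sup>2 + (norm (v - w))\<^sup>2)" by (simp add: algebra_simps)
    also have "(norm (v + w))\<^sup>2 + (norm (v - w))\<^sup>2 = 4"
      using that unfolding power2_norm_eq_inner by (simp add: inner_simps norm_eq_1)
    finally show ?thesis by simp
  qed
  show ?thesis
  proof (cases "v = 0 \<or> w = 0")
    case True
    then show ?thesis using linear_0[OF Ck2D(4)[OF f(1,3), of v]] linear_0[OF D2_linear_left[OF f, of w]] by auto
  next
    case False
    have "D2 f x v w = D2 f x (norm v *\<^sub>R (v /\<^sub>R norm v)) (norm w *\<^sub>R (w /\<^sub>R norm w))" using False by simp
    also have "\<dots> = norm v * norm w * D2 f x (v /\<^sub>R norm v) (w /\<^sub>R norm w)"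
      by (simp only: D2_lin[OF f] mult_ac)
    finally have "\<bar>D2 f x v w\<bar> = norm v * norm w * \<bar>D2 f x (v /\<^sub>R norm v) (w /\<^sub>R norm w)\<bar>"
      by (simp add: abs_mult)
    also have "\<dots> \<le> norm v * norm w * K"
      by (intro mult_left_mono unit) (use False in auto)
    finally show ?thesis by (simp add: mult_ac)
  qed
qed

text \<open>By symmetry the difference factors as \<open>D2 f x (v - w) (v + w)\<close>. In the
  application \<open>v - w\<close> has the order of the shift, which offsets the growth of
  \<open>K\<close> near the boundary.\<close>

lemma D2_diag_diff:
  fixes f :: "'a::euclidean_space \<Rightarrow> real"
  assumes f: "Ck_on 2 U f" "open U" "x \<in> U" and K: "\<And>v. \<bar>D2 f x v v\<bar> \<le> K * (norm v)\<^sup>2"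
  shows "\<bar>D2 f x v v - D2 f x w w\<bar> \<le> K * norm (v - w) * norm (v + w)"
proof -
  have "D2 f x v v - D2 f x w w = D2 f x (v - w) (v + w)"
    using D2_symmetric[OF f, of v w] by (simp add: D2_lin[OF f])
  then show ?thesis using D2_polarization[OF f K] by simp
qed

lemma chain_rule_real:
  fixes f :: "'a::euclidean_space \<Rightarrow> real"
  assumes U: "open U" and f: "Ck_on 2 U f"
    and \<phi>: "\<And>x. x \<in> U \<Longrightarrow> (\<phi> has_real_derivative \<phi>' (f x)) (at (f x))"
    and \<phi>': "\<And>x. x \<in> U \<Longrightarrow> (\<phi>' has_real_derivative \<phi>'' (f x)) (at (f x))"
    and x: "x \<in> U"
  shows "D1 (\<lambda>x. \<phi> (f x)) x v = \<phi>' (f x) * D1 f x v"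
    "D2 (\<lambda>x. \<phi> (f x)) x v w = \<phi>'' (f x) * D1 f x v * D1 f x w + \<phi>' (f x) * D2 f x v w"
proof -
  have hd: "(f has_derivative D1 f y) (at y)" if "y \<in> U" for y
    using Ck2D(1)[OF f that] frechet_derivative_works by blast
  have d: "((\<lambda>x. \<phi> (f x)) has_derivative (\<lambda>v. \<phi>' (f y) * D1 f y v)) (at y)" if "y \<in> U" for y
    by (rule has_derivative_compose[OF hd[OF that] has_derivative_of_real_derivative[OF \<phi>[OF that]]])
  have d': "((\<lambda>x. \<phi>' (f x)) has_derivative (\<lambda>v. \<phi>'' (f y) * D1 f y v)) (at y)" if "y \<in> U" for y
    by (rule has_derivative_compose[OF hd[OF that] has_derivative_of_real_derivative[OF \<phi>'[OF that]]])
  show "D1 (\<lambda>x. \<phi> (f x)) x v = \<phi>' (f x) * D1 f x v" by (rule D1_eqI[OF d[OF x]])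
  have hd2: "((\<lambda>y. D1 f y v) has_derivative D2 f x v) (at x)"
    using Ck2D(2)[OF f x] frechet_derivative_works by blast
  have "((\<lambda>y. D1 (\<lambda>x. \<phi> (f x)) y v) has_derivative (\<lambda>w. \<phi>' (f x) * D2 f x v w + \<phi>'' (f x) * D1 f x w * D1 f x v)) (at x)"
    by (rule has_derivative_transform_within_open[OF has_derivative_mult[OF d'[OF x] hd2] U x])
      (simp add: D1_eqI[OF d])
  from D1_eqI[OF this]
  show "D2 (\<lambda>x. \<phi> (f x)) x v w = \<phi>'' (f x) * D1 f x v * D1 f x w + \<phi>' (f x) * D2 f x v w"
    by (simp add: algebra_simps)
qed

lemma D12_add:
  fixes f g :: "'a::euclidean_space \<Rightarrow> real"
  assumes U: "open U" and f: "Ck_on 2 U f" and g: "Ck_on 2 U g" and x: "x \<in> U"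
  shows "D1 (\<lambda>x. f x + c * g x) x v = D1 f x v + c * D1 g x v"
    "D2 (\<lambda>x. f x + c * g x) x v w = D2 f x v w + c * D2 g x v w"
proof -
  have hd: "(f has_derivative D1 f y) (at y)" "(g has_derivative D1 g y) (at y)" if "y \<in> U" for y
    using Ck2D(1)[OF f that] Ck2D(1)[OF g that] frechet_derivative_works by blast+
  have d: "((\<lambda>x. f x + c * g x) has_derivative (\<lambda>v. D1 f y v + c * D1 g y v)) (at y)" if "y \<in> U" for y
    by (intro has_derivative_add has_derivative_mult_right hd[OF that])
  show "D1 (\<lambda>x. f x + c * g x) x v = D1 f x v + c * D1 g x v" by (rule D1_eqI[OF d[OF x]])
  have hd2: "((\<lambda>y. D1 f y v) has_derivative D2 f x v) (at x)" "((\<lambda>y. D1 g y v) has_derivative D2 g x v) (at x)"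
    using Ck2D(2)[OF f x] Ck2D(2)[OF g x] frechet_derivative_works by blast+
  have "((\<lambda>y. D1 (\<lambda>x. f x + c * g x) y v) has_derivative (\<lambda>w. D2 f x v w + c * D2 g x v w)) (at x)"
    by (rule has_derivative_transform_within_open[OF has_derivative_add[OF hd2(1) has_derivative_mult_right[OF hd2(2)]] U x])
      (simp add: D1_eqI[OF d])
  from D1_eqI[OF this] show "D2 (\<lambda>x. f x + c * g x) x v w = D2 f x v w + c * D2 g x v w" .
qed

lemma chain_rule_map:
  fixes \<Phi> :: "'a::euclidean_space \<Rightarrow> 'b::euclidean_space"
  assumes U: "open U" "open W" and \<Phi>: "\<And>b. b \<in> Basis \<Longrightarrow> Ck_on 2 U (\<lambda>x. \<Phi> x \<bullet> b)"
    and f: "Ck_on 2 W f" and UW: "\<And>x. x \<in> U \<Longrightarrow> \<Phi> x \<in> W" and x: "x \<in> U"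
  defines "M \<equiv> (\<lambda>x v. \<Sum>b\<in>Basis. D1 (\<lambda>x. \<Phi> x \<bullet> b) x v *\<^sub>R b)"
  shows "D1 (\<lambda>x. f (\<Phi> x)) x v = D1 f (\<Phi> x) (M x v)"
    "D2 (\<lambda>x. f (\<Phi> x)) x v v = D2 f (\<Phi> x) (M x v) (M x v) + D1 f (\<Phi> x) (\<Sum>b\<in>Basis. D2 (\<lambda>x. \<Phi> x \<bullet> b) x v v *\<^sub>R b)"
proof -
  have hdb: "((\<lambda>x. \<Phi> x \<bullet> b) has_derivative D1 (\<lambda>x. \<Phi> x \<bullet> b) y) (at y)" if "b \<in> Basis" "y \<in> U" for b y
    using Ck2D(1)[OF \<Phi>[OF that(1)] that(2)] frechet_derivative_works by blast
  have \<Phi>': "(\<Phi> has_derivative M y) (at y)" if "y \<in> U" for y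
    unfolding M_def by (subst has_derivative_componentwise_within) (use hdb[OF _ that] in simp)
  have hdf: "(f has_derivative D1 f y) (at y)" "\<And>b. ((\<lambda>y. D1 f y b) has_derivative D2 f y b) (at y)" if "y \<in> W" for y
    using Ck2D(1,2)[OF f that] frechet_derivative_works by blast+
  have d: "((\<lambda>x. f (\<Phi> x)) has_derivative (\<lambda>v. D1 f (\<Phi> y) (M y v))) (at y)" if "y \<in> U" for y
    by (rule has_derivative_compose[OF \<Phi>'[OF that] hdf(1)[OF UW[OF that]]])
  show "D1 (\<lambda>x. f (\<Phi> x)) x v = D1 f (\<Phi> x) (M x v)" by (rule D1_eqI[OF d[OF x]])
  have lin: "D1 f z (\<Sum>b\<in>Basis. k b *\<^sub>R b) = (\<Sum>b\<in>Basis. k b * D1 f z b)" if "z \<in> W" for z k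
    using Ck2D(3)[OF f that] by (simp add: linear_sum linear_cmul)
  have lin2: "D2 f z (\<Sum>b\<in>Basis. k b *\<^sub>R b) w = (\<Sum>b\<in>Basis. k b * D2 f z b w)" if "z \<in> W" for z k w
    using linear_sum[OF D2_linear_left[OF f U(2) that, of w], of "\<lambda>b. k b *\<^sub>R b" Basis]
    by (simp add: D2_lin[OF f U(2) that])
  have key: "D2 f (\<Phi> x) (M x v) w = (\<Sum>b\<in>Basis. D1 (\<lambda>x. \<Phi> x \<bullet> b) x v * D2 f (\<Phi> x) b w)" for w
    unfolding M_def by (rule lin2[OF UW[OF x]])
  have "((\<lambda>y. \<Sum>b\<in>Basis. D1 (\<lambda>x. \<Phi> x \<bullet> b) y v * D1 f (\<Phi> y) b) has_derivative
     (\<lambda>w. \<Sum>b\<in>Basis. D1 (\<lambda>x. \<Phi> x \<bullet> b) x v * D2 f (\<Phi> x) b (M x w) + D2 (\<lambda>x. \<Phi> x \<bullet> b) x v w * D1 f (\<Phi> x) b)) (at x)"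
  proof (intro has_derivative_sum has_derivative_mult)
    fix b :: 'b assume b: "b \<in> Basis"
    show "((\<lambda>y. D1 (\<lambda>x. \<Phi> x \<bullet> b) y v) has_derivative D2 (\<lambda>x. \<Phi> x \<bullet> b) x v) (at x)"
      using Ck2D(2)[OF \<Phi>[OF b] x] frechet_derivative_works by blast
    show "((\<lambda>y. D1 f (\<Phi> y) b) has_derivative (\<lambda>w. D2 f (\<Phi> x) b (M x w))) (at x)"
      by (rule has_derivative_compose[OF \<Phi>'[OF x] hdf(2)[OF UW[OF x]]])
  qed
  then have "((\<lambda>y. D1 (\<lambda>x. f (\<Phi> x)) y v) has_derivative
     (\<lambda>w. \<Sum>b\<in>Basis. D1 (\<lambda>x. \<Phi> x \<bullet> b) x v * D2 f (\<Phi> x) b (M x w) + D2 (\<lambda>x. \<Phi> x \<bullet> b) x v w * D1 f (\<Phi> x) b)) (at x)"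
    by (rule has_derivative_transform_within_open[OF _ U(1) x])
      (simp add: D1_eqI[OF d] M_def lin[OF UW])
  from D1_eqI[OF this, of v]
  show "D2 (\<lambda>x. f (\<Phi> x)) x v v = D2 f (\<Phi> x) (M x v) (M x v) + D1 f (\<Phi> x) (\<Sum>b\<in>Basis. D2 (\<lambda>x. \<Phi> x \<bullet> b) x v v *\<^sub>R b)"
    unfolding lin[OF UW[OF x]] sum.distrib by (simp add: key)
qed

section \<open>Complex structure and Levi forms on slices\<close>

abbreviation J :: "complex ^ 'n \<Rightarrow> complex ^ 'n" where "J w \<equiv> \<i> *s w"

text \<open>With this normalisation \<open>levi\<close> is four times the Levi form and \<open>dd f x w\<close> is twice \<open>\<partial>f(w)\<close>.\<close>

definition levi :: "(complex ^ 'n \<Rightarrow> real) \<Rightarrow> complex ^ 'n \<Rightarrow> complex ^ 'n \<Rightarrow> real" where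
  "levi f x w = D2 f x w w + D2 f x (J w) (J w)"

definition dd :: "(complex ^ 'n \<Rightarrow> real) \<Rightarrow> complex ^ 'n \<Rightarrow> complex ^ 'n \<Rightarrow> complex" where
  "dd f x w = Complex (D1 f x w) (- D1 f x (J w))"

lemma complex_scalar_mult_eq: "c *s (w :: complex ^ 'n) = Re c *\<^sub>R w + Im c *\<^sub>R J w"
  by (simp add: vec_eq_iff complex_eq_iff)

lemma J_scaleR: "J (k *\<^sub>R w) = k *\<^sub>R J (w :: complex ^ 'n)"
  by (simp add: vec_eq_iff)

lemma norm_J: "norm (J w) = norm (w :: complex ^ 'n)"
  by (simp add: norm_complex_scalar_mult)

lemma dd_linear:
  assumes "f differentiable (at x)"
  shows "dd f x (v + w) = dd f x v + dd f x w" "dd f x (v - w) = dd f x v - dd f x w"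
    "dd f x (c *s v) = c * dd f x v"
proof -
  show "dd f x (v + w) = dd f x v + dd f x w" "dd f x (v - w) = dd f x v - dd f x w"
    by (simp_all add: dd_def D1_lin[OF assms] complex_eq_iff vector_add_ldistrib vector_ssub_ldistrib)
  have "J (c *s v) = Re c *\<^sub>R J v - Im c *\<^sub>R v"
    by (simp add: vec_eq_iff complex_eq_iff)
  then show "dd f x (c *s v) = c * dd f x v"
    by (simp add: dd_def D1_lin[OF assms] complex_scalar_mult_eq[of c v] complex_eq_iff)
qed

lemma norm_dd_sq: "(norm (dd f x w))\<^sup>2 = (D1 f x w)\<^sup>2 + (D1 f x (J w))\<^sup>2"
  by (simp add: dd_def cmod_power2)

lemma norm_dd_le:
  assumes "\<And>v. \<bar>D1 f x v\<bar> \<le> C * norm v"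
  shows "norm (dd f x w) \<le> 2 * C * norm w"
  using norm_complex_def cmod_le[of "dd f x w"] assms[of w] assms[of "J w"]
  by (simp add: dd_def norm_J)

lemma second_deriv_slice:
  fixes u :: "complex ^ 'n \<Rightarrow> real"
  assumes u: "Ck_on 2 U u" "open U" and z: "z + \<tau> *s w \<in> U"
  shows "second_deriv (\<lambda>\<tau>. u (z + \<tau> *s w)) \<tau> v (D2 u (z + \<tau> *s w) (v *s w) (v *s w))"
proof -
  define y where "y = z + \<tau> *s w"
  have e: "z + (\<tau> + of_real s * v) *s w = y + s *\<^sub>R (v *s w)" for s
    by (simp add: y_def vec_eq_iff complex_eq_iff algebra_simps)
  have "continuous_on UNIV (\<lambda>s::real. y + s *\<^sub>R (v *s w))" by (intro continuous_intros)
  then have "open ((\<lambda>s::real. y + s *\<^sub>R (v *s w)) -` U)" using u(2) by (simp add: open_vimage)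
  moreover have "0 \<in> (\<lambda>s::real. y + s *\<^sub>R (v *s w)) -` U" using z by (simp add: y_def)
  ultimately obtain d where d: "d > 0" "ball 0 d \<subseteq> (\<lambda>s::real. y + s *\<^sub>R (v *s w)) -` U"
    using open_contains_ball by blast
  have inU: "y + s *\<^sub>R (v *s w) \<in> U" if "\<bar>s\<bar> < d" for s using d(2) that by (auto simp: subset_iff)
  show ?thesis unfolding second_deriv_def e y_def[symmetric]
  proof (intro exI[of _ d] conjI exI[of _ "\<lambda>s. D1 u (y + s *\<^sub>R (v *s w)) (v *s w)"] allI impI)
    show "((\<lambda>s. u (y + s *\<^sub>R (v *s w))) has_real_derivative D1 u (y + s *\<^sub>R (v *s w)) (v *s w)) (at s)" if "\<bar>s\<bar> < d" for s
      by (rule D1_along_line(1)[OF u(1) inU[OF that]])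
    show "((\<lambda>s. D1 u (y + s *\<^sub>R (v *s w)) (v *s w)) has_real_derivative D2 u y (v *s w) (v *s w)) (at 0)"
      using D1_along_line(2)[OF u(1) inU, of 0 "v *s w"] d(1) by simp
  qed (use d in simp)
qed

lemma slice_ball:
  fixes z w :: "complex ^ 'n"
  assumes "open U" "z \<in> U"
  obtains d where "d > 0" "\<And>\<tau>. norm \<tau> < d \<Longrightarrow> z + \<tau> *s w \<in> U"
proof -
  have "0 \<in> {\<tau>. z + \<tau> *s w \<in> U}" using assms by simp
  then obtain d where "d > 0" "ball 0 d \<subseteq> {\<tau>. z + \<tau> *s w \<in> U}"
    using open_slice[OF assms(1), of z w] open_contains_ball by blast
  then show ?thesis using that[of d] by (auto simp: subset_iff)
qed

text \<open>By \<open>second_deriv_slice\<close> with \<open>v = 1\<close> and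
  \<open>v = \<i>\<close>, \<open>levi u x w\<close> is the Laplacian at \<open>x\<close> of the
  slice in direction \<open>w\<close>.\<close>

lemma submean_of_levi_nonneg:
  fixes u :: "complex ^ 'n \<Rightarrow> real"
  assumes u: "Ck_on 2 U u" "open U" "z \<in> U" and levi: "\<And>x. x \<in> U \<Longrightarrow> levi u x w \<ge> 0"
  shows "\<exists>d>0. \<forall>s. 0 < s \<and> s < d \<longrightarrow> u z \<le> cmean (\<lambda>\<tau>. u (z + \<tau> *s w)) 0 s"
proof -
  obtain d where d: "d > 0" "\<And>\<tau>. norm \<tau> < d \<Longrightarrow> z + \<tau> *s w \<in> U"
    using slice_ball[OF u(2,3)] by blast
  have "u (z + 0 *s w) \<le> cmean (\<lambda>\<tau>. u (z + \<tau> *s w)) 0 s" if s: "0 < s" "s < d" for s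
  proof (rule submean_of_laplacian_nonneg[OF s(1), where D="\<lambda>\<tau>. D2 u (z + \<tau> *s w) w w" and E="\<lambda>\<tau>. D2 u (z + \<tau> *s w) (J w) (J w)"])
    show "continuous_on (cball 0 s) (\<lambda>\<tau>. u (z + \<tau> *s w))"
      by (rule continuous_on_compose2[OF Ck2_continuous(1)[OF u(1)] continuous_on_slice_map])
        (use d s in auto)
    fix \<tau> :: complex assume "\<tau> \<in> ball 0 s"
    then have "z + \<tau> *s w \<in> U" using d s by auto
    then show "second_deriv (\<lambda>\<tau>. u (z + \<tau> *s w)) \<tau> 1 (D2 u (z + \<tau> *s w) w w) \<and>
        second_deriv (\<lambda>\<tau>. u (z + \<tau> *s w)) \<tau> \<i> (D2 u (z + \<tau> *s w) (J w) (J w)) \<and>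
        0 \<le> D2 u (z + \<tau> *s w) w w + D2 u (z + \<tau> *s w) (J w) (J w)"
      using second_deriv_slice[OF u(1,2), of z \<tau> w 1] second_deriv_slice[OF u(1,2), of z \<tau> w \<i>] levi
      by (simp add: levi_def)
  qed
  then show ?thesis using d(1) by (intro exI[of _ d]) auto
qed

text \<open>By continuity a negative value persists on a small disc of the slice, where
  \<open>laplacian_nonneg_of_submean\<close> contradicts the sub-mean inequality.\<close>

lemma levi_nonneg_of_psh:
  fixes u :: "complex ^ 'n \<Rightarrow> real"
  assumes psh: "psh_on \<Omega> u" and u: "Ck_on 2 \<Omega> u" "open \<Omega>" and z: "z \<in> \<Omega>"
  shows "levi u z w \<ge> 0"
proof (rule ccontr)
  assume "\<not> levi u z w \<ge> 0"
  define e where "e = - levi u z w / 2"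
  have e: "e > 0" using \<open>\<not> levi u z w \<ge> 0\<close> by (simp add: e_def)
  have c: "continuous_on \<Omega> (\<lambda>x. levi u x w)"
    unfolding levi_def by (intro continuous_on_add Ck2_continuous(3)[OF u(1)])
  have "open (\<Omega> \<inter> (\<lambda>x. levi u x w) -` {..<- e})"
    using c u(2) by (simp add: continuous_open_preimage)
  moreover have "z \<in> \<Omega> \<inter> (\<lambda>x. levi u x w) -` {..<- e}" using z e by (simp add: e_def)
  ultimately obtain d where d: "d > 0" "\<And>\<tau>. norm \<tau> < d \<Longrightarrow> z + \<tau> *s w \<in> \<Omega> \<inter> (\<lambda>x. levi u x w) -` {..<- e}"
    using slice_ball by blast
  define r where "r = d / 2"
  have r: "r > 0" "r < d" using d by (auto simp: r_def)
  have in\<Omega>: "z + \<tau> *s w \<in> \<Omega>" "levi u (z + \<tau> *s w) w \<le> - e" if "norm \<tau> \<le> r" for \<tau>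
    using d(2)[of \<tau>] that r by auto
  have "cmean (\<lambda>\<tau>. u (z + \<tau> *s w)) 0 r < u (z + 0 *s w)"
  proof (rule laplacian_nonneg_of_submean[OF _ r(1), where D="\<lambda>\<tau>. D2 u (z + \<tau> *s w) w w" and E="\<lambda>\<tau>. D2 u (z + \<tau> *s w) (J w) (J w)" and e=e])
    show "continuous_on (cball 0 r) (\<lambda>\<tau>. u (z + \<tau> *s w))"
      by (rule continuous_on_compose2[OF Ck2_continuous(1)[OF u(1)] continuous_on_slice_map])
        (use in\<Omega> in auto)
    fix \<tau> :: complex assume "\<tau> \<in> ball 0 r"
    then have \<tau>: "norm \<tau> \<le> r" by simp
    show "second_deriv (\<lambda>\<tau>. u (z + \<tau> *s w)) \<tau> 1 (D2 u (z + \<tau> *s w) w w) \<and>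
        second_deriv (\<lambda>\<tau>. u (z + \<tau> *s w)) \<tau> \<i> (D2 u (z + \<tau> *s w) (J w) (J w))"
      using second_deriv_slice[OF u in\<Omega>(1)[OF \<tau>], of 1] second_deriv_slice[OF u in\<Omega>(1)[OF \<tau>], of \<i>] by simp
    show "D2 u (z + \<tau> *s w) w w + D2 u (z + \<tau> *s w) (J w) (J w) \<le> - e"
      using in\<Omega>(2)[OF \<tau>] by (simp add: levi_def)
  qed (use e in simp)
  moreover have "u z \<le> cmean (\<lambda>\<tau>. u (z + \<tau> *s w)) 0 r"
    by (rule psh_on_submean(2)[OF psh r(1)]) (use in\<Omega> in auto)
  ultimately show False by simp
qed

text \<open>For \<open>u = - ln (- \<rho>)\<close> the function \<open>- exp (- \<eta> * u)\<close>
  is \<open>- ((- \<rho>) powr \<eta>)\<close>. The prefactor is positive for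
  \<open>\<eta> > 0\<close>, so plurisubharmonicity of the power becomes
  \<open>\<eta> * (norm (dd u x w))\<^sup>2 \<le> levi u x w\<close>, the form in which the exponent
  is handled from here on.\<close>

lemma levi_neg_exp:
  fixes u :: "complex ^ 'n \<Rightarrow> real"
  assumes u: "Ck_on 2 U u" "open U" "x \<in> U"
  shows "levi (\<lambda>x. - exp (- \<eta> * u x)) x w = \<eta> * exp (- \<eta> * u x) * (levi u x w - \<eta> * (norm (dd u x w))\<^sup>2)"
proof -
  have "D2 (\<lambda>x. - exp (- \<eta> * u x)) x v v = \<eta> * exp (- \<eta> * u x) * (D2 u x v v - \<eta> * (D1 u x v)\<^sup>2)" for v
  proof -
    have "D2 (\<lambda>x. - exp (- \<eta> * u x)) x v v = - (\<eta>\<^sup>2 * exp (- \<eta> * u x)) * D1 u x v * D1 u x v + \<eta> * exp (- \<eta> * u x) * D2 u x v v"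
      by (rule chain_rule_real(2)[OF u(2,1) _ _ u(3), where \<phi>="\<lambda>t. - exp (- \<eta> * t)" and \<phi>'="\<lambda>t. \<eta> * exp (- \<eta> * t)"])
        (auto intro!: derivative_eq_intros simp: power2_eq_square)
    then show ?thesis by (simp add: power2_eq_square algebra_simps)
  qed
  then show ?thesis unfolding levi_def norm_dd_sq by (simp add: algebra_simps)
qed

lemma neg_log_derivs:
  fixes f :: "complex ^ 'n \<Rightarrow> real"
  assumes f: "Ck_on 2 U f" "open U" "x \<in> U" and neg: "\<And>y. y \<in> U \<Longrightarrow> f y < 0"
  shows "D1 (\<lambda>x. - ln (- f x)) x v = D1 f x v / (- f x)"
    "D2 (\<lambda>x. - ln (- f x)) x v v = D2 f x v v / (- f x) + (D1 f x v / (- f x))\<^sup>2"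
proof -
  have 1: "((\<lambda>t. - ln (- t)) has_real_derivative inverse (- f y)) (at (f y))" if "y \<in> U" for y
    using neg[OF that] by (auto intro!: derivative_eq_intros simp: field_simps)
  have 2: "((\<lambda>t. inverse (- t)) has_real_derivative inverse ((f y)\<^sup>2)) (at (f y))" if "y \<in> U" for y
    using neg[OF that] by (auto intro!: derivative_eq_intros simp: power2_eq_square)
  note c = chain_rule_real[OF f(2,1), where \<phi>="\<lambda>t. - ln (- t)" and \<phi>'="\<lambda>t. inverse (- t)" and \<phi>''="\<lambda>t. inverse (t\<^sup>2)", OF 1 2 f(3)]
  show "D1 (\<lambda>x. - ln (- f x)) x v = D1 f x v / (- f x)"
    using c(1) by (simp add: divide_inverse mult.commute)
  show "D2 (\<lambda>x. - ln (- f x)) x v v = D2 f x v v / (- f x) + (D1 f x v / (- f x))\<^sup>2"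
    using c(2)[of v v] neg[OF f(3)] by (simp add: divide_inverse power2_eq_square algebra_simps)
qed

lemma Ck_neg_log:
  assumes "Ck_on k U f" "open U" "\<And>y. y \<in> U \<Longrightarrow> f y < 0"
  shows "Ck_on k U (\<lambda>x. - ln (- f x))"
  by (intro Ck_on_uminus assms Ck_on_compose_real[OF _ _ Ck_on_ln]) (use assms in auto)

lemma levi_neg_log:
  fixes f :: "complex ^ 'n \<Rightarrow> real"
  assumes f: "Ck_on 2 U f" "open U" "x \<in> U" and neg: "\<And>y. y \<in> U \<Longrightarrow> f y < 0"
  shows "dd (\<lambda>x. - ln (- f x)) x w = dd f x w / of_real (- f x)"
    "levi (\<lambda>x. - ln (- f x)) x w = levi f x w / (- f x) + (norm (dd f x w / of_real (- f x)))\<^sup>2"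
proof -
  have d: "D1 (\<lambda>x. - ln (- f x)) x v = D1 f x v / (- f x)"
    "D2 (\<lambda>x. - ln (- f x)) x v v = D2 f x v v / (- f x) + (D1 f x v / (- f x))\<^sup>2" for v
    by (rule neg_log_derivs[OF f neg]; assumption)+
  show 1: "dd (\<lambda>x. - ln (- f x)) x w = dd f x w / of_real (- f x)"
    unfolding dd_def d(1) by (simp add: complex_eq_iff)
  show "levi (\<lambda>x. - ln (- f x)) x w = levi f x w / (- f x) + (norm (dd f x w / of_real (- f x)))\<^sup>2"
    unfolding 1[symmetric] norm_dd_sq d(1) unfolding levi_def d(2) by (simp add: add_divide_distrib)
qed

section \<open>A collar of the boundary\<close>

lemma IVT_segment:
  fixes f :: "'a::euclidean_space \<Rightarrow> real"
  assumes "continuous_on (closed_segment a b) f" "f a \<le> y" "y \<le> f b"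
  shows "\<exists>x\<in>closed_segment a b. f x = y"
proof -
  have "connected (f ` closed_segment a b)" by (rule connected_continuous_image[OF assms(1) connected_segment(1)])
  then have "y \<in> f ` closed_segment a b"
    using assms(2,3) by (meson connected_contains_Icc atLeastAtMost_iff ends_in_segment imageI subsetD)
  then show ?thesis by auto
qed

lemma MVT_line:
  fixes f :: "'a::euclidean_space \<Rightarrow> real"
  assumes "s > 0" "\<And>\<sigma>. 0 \<le> \<sigma> \<Longrightarrow> \<sigma> \<le> s \<Longrightarrow> f differentiable (at (x + \<sigma> *\<^sub>R v))"
  shows "\<exists>\<sigma>. 0 < \<sigma> \<and> \<sigma> < s \<and> f (x + s *\<^sub>R v) - f x = s * D1 f (x + \<sigma> *\<^sub>R v) v"
proof -
  have "((\<lambda>\<sigma>. f (x + \<sigma> *\<^sub>R v)) has_real_derivative D1 f (x + \<sigma> *\<^sub>R v) v) (at \<sigma>)" if "0 \<le> \<sigma>" "\<sigma> \<le> s" for \<sigma>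
    by (rule has_derivative_along_line[OF assms(2)[OF that]])
  from MVT2[OF assms(1) this] show ?thesis by simp
qed

text \<open>\<open>r\<close> is \<open>C\<^sup>3\<close> because the field \<open>nu\<close>, built
  from its gradient, has to be \<open>C\<^sup>2\<close>, and its Levi form has to be
  \<open>C\<^sup>1\<close>. \<open>u_psh\<close> is the condition on \<open>\<rho>\<close> and
  \<open>\<eta>\<close> in the form given by \<open>levi_neg_exp\<close>.\<close>

locale defining_pair =
  fixes \<Omega> :: "(complex ^ 'n) set" and V :: "(complex ^ 'n) set" and r \<rho> :: "complex ^ 'n \<Rightarrow> real" and c \<eta> :: real
  assumes \<Omega>: "open \<Omega>" "bounded \<Omega>" "\<Omega> \<noteq> {}"
    and V: "open V" "frontier \<Omega> \<subseteq> V"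
    and r3: "Ck_on 3 V r"
    and r_neg: "\<And>z. z \<in> V \<Longrightarrow> z \<in> \<Omega> \<longleftrightarrow> r z < 0"
    and r_grad: "\<And>z. z \<in> V \<Longrightarrow> \<exists>v. D1 r z v \<noteq> 0"
    and \<rho>2: "Ck_on 2 V \<rho>"
    and \<rho>_bounds: "\<And>z. z \<in> V \<inter> closure \<Omega> \<Longrightarrow> - c * bdist \<Omega> z \<le> \<rho> z \<and> \<rho> z \<le> - bdist \<Omega> z"
    and \<eta>: "0 < \<eta>"
    and u_psh: "\<And>z w. z \<in> \<Omega> \<inter> V \<Longrightarrow>
      \<eta> * (norm (dd (\<lambda>x. - ln (- \<rho> x)) z w))\<^sup>2 \<le> levi (\<lambda>x. - ln (- \<rho> x)) z w"
begin

lemma r2: "Ck_on 2 V r" by (rule Ck_on_mono[OF r3]) simp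

lemma r_differentiable: "z \<in> V \<Longrightarrow> r differentiable (at z)"
  by (rule Ck2D(1)[OF r2])

text \<open>One direction is continuity. For the other, if \<open>r z = 0\<close> and
  \<open>z\<close> were outside the closure, \<open>r\<close> would be non-negative near
  \<open>z\<close>, so \<open>z\<close> would be a minimum, against the non-vanishing
  gradient.\<close>

lemma frontier_iff:
  assumes z: "z \<in> V"
  shows "z \<in> frontier \<Omega> \<longleftrightarrow> r z = 0"
proof
  assume "z \<in> frontier \<Omega>"
  then have cl: "z \<in> closure \<Omega>" "z \<notin> \<Omega>" using \<Omega> by (auto simp: frontier_def interior_open)
  then have "r z \<ge> 0" using r_neg[OF z] by force
  moreover have "r z \<le> 0"
  proof (rule ccontr)
    assume "\<not> r z \<le> 0"
    then have "z \<in> V \<inter> r -` {0<..}" using z by simp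
    moreover have "open (V \<inter> r -` {0<..})"
      using Ck2_continuous(1)[OF r2] V(1) by (simp add: continuous_open_preimage)
    ultimately have "\<Omega> \<inter> (V \<inter> r -` {0<..}) \<noteq> {}"
      using cl(1) by (metis Int_commute closure_iff_nhds_not_empty order_refl)
    then show False using r_neg by force
  qed
  ultimately show "r z = 0" by simp
next
  assume r0: "r z = 0"
  then have nz: "z \<notin> \<Omega>" using r_neg[OF z] by simp
  have "z \<in> closure \<Omega>"
  proof (rule ccontr)
    assume "z \<notin> closure \<Omega>"
    then have op: "open (V - closure \<Omega>)" "z \<in> V - closure \<Omega>" using V z by auto
    have "r y \<ge> r z" if "y \<in> V - closure \<Omega>" for y
      using r_neg[of y] that r0 closure_subset[of \<Omega>] by force
    then have "D1 r z = (\<lambda>v. 0)"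
      using differential_zero_maxmin[OF op(2,1), of r "D1 r z"] r_differentiable[OF z] frechet_derivative_works
      by blast
    then show False using r_grad[OF z] by metis
  qed
  then show "z \<in> frontier \<Omega>" using nz \<Omega> by (simp add: frontier_def interior_open)
qed

lemma \<rho>_frontier: "p \<in> frontier \<Omega> \<Longrightarrow> \<rho> p = 0"
  using \<rho>_bounds[of p] V(2) by (auto simp: bdist_def frontier_def)

text \<open>A substitute for curves in the boundary. For small \<open>s\<close> the directions
  \<open>\<tau> + \<epsilon> *\<^sub>R N\<close> and \<open>\<tau> - \<epsilon> *\<^sub>R N\<close>
  lead to opposite signs of \<open>r\<close>, so a zero of \<open>r\<close> lies on the segment
  between the two end points. Only \<open>p\<close> and this point are known to be on the boundary,
  which is enough for mean value arguments.\<close>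

lemma tangent_sequence:
  assumes p: "p \<in> frontier \<Omega>" and N: "D1 r p N < 0" and \<tau>: "D1 r p \<tau> = 0"
  obtains s e :: "nat \<Rightarrow> real" where "s \<longlonglongrightarrow> 0" "e \<longlonglongrightarrow> 0" "\<And>n. s n > 0"
    "\<And>n. p + s n *\<^sub>R (\<tau> + e n *\<^sub>R N) \<in> frontier \<Omega>"
    "\<And>n \<sigma>. 0 \<le> \<sigma> \<Longrightarrow> \<sigma> \<le> s n \<Longrightarrow> p + \<sigma> *\<^sub>R (\<tau> + e n *\<^sub>R N) \<in> V"
proof -
  have pV: "p \<in> V" using p V by auto
  obtain d where d: "d > 0" "ball p d \<subseteq> V" using pV V(1) open_contains_ball by blast
  have rp: "r p = 0" using frontier_iff[OF pV] p by simp
  have main: "\<exists>s e. s > 0 \<and> s \<le> \<epsilon> \<and> \<bar>e\<bar> \<le> \<epsilon> \<and> p + s *\<^sub>R (\<tau> + e *\<^sub>R N) \<in> frontier \<Omega> \<and>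
      (\<forall>\<sigma>. 0 \<le> \<sigma> \<and> \<sigma> \<le> s \<longrightarrow> p + \<sigma> *\<^sub>R (\<tau> + e *\<^sub>R N) \<in> V)" if \<epsilon>: "\<epsilon> > 0" for \<epsilon>
  proof -
    define W where "W e = \<tau> + e *\<^sub>R N" for e
    have line: "((\<lambda>s. r (p + s *\<^sub>R W e)) has_real_derivative e * D1 r p N) (at 0)" for e
      using has_derivative_along_line[of r p 0 "W e"] r_differentiable[OF pV] \<tau>
      by (simp add: W_def D1_lin)
    have neg: "\<epsilon> * D1 r p N < 0" "(- \<epsilon>) * D1 r p N > 0" using \<epsilon> N by (auto simp: mult_pos_neg)
    obtain d1 where d1: "d1 > 0" "\<And>h. 0 < h \<Longrightarrow> h < d1 \<Longrightarrow> r (p + h *\<^sub>R W \<epsilon>) < 0"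
      using DERIV_neg_dec_right[OF line neg(1)] rp by auto
    obtain d2 where d2: "d2 > 0" "\<And>h. 0 < h \<Longrightarrow> h < d2 \<Longrightarrow> r (p + h *\<^sub>R W (- \<epsilon>)) > 0"
      using DERIV_pos_inc_right[OF line neg(2)] rp by auto
    define B where "B = norm \<tau> + \<epsilon> * norm N + 1"
    have B: "B > 0" using \<epsilon> by (simp add: B_def add_nonneg_pos)
    define s where "s = min \<epsilon> (min (d1 / 2) (min (d2 / 2) (d / (2 * B))))"
    have s: "s > 0" "s \<le> \<epsilon>" "s < d1" "s < d2" "s * B < d"
    proof -
      show "s > 0" using \<epsilon> d1 d2 d B by (simp add: s_def)
      have "s \<le> d / (2 * B)" by (simp add: s_def)
      then have "s * B \<le> d / (2 * B) * B" by (rule mult_right_mono) (use B in simp)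
      then show "s * B < d" using B d by simp
    qed (use d1 d2 in \<open>auto simp: s_def\<close>)
    have inV: "p + \<sigma> *\<^sub>R W e \<in> V" if "0 \<le> \<sigma>" "\<sigma> \<le> s" "\<bar>e\<bar> \<le> \<epsilon>" for \<sigma> e
    proof -
      have "norm (W e) \<le> B" using norm_triangle_ineq[of \<tau> "e *\<^sub>R N"] mult_right_mono[OF that(3), of "norm N"]
        by (simp add: W_def B_def)
      then have "\<sigma> * norm (W e) \<le> s * B" using that s by (intro mult_mono) auto
      then show ?thesis using s(5) that d(2) by (auto simp: dist_norm subset_iff)
    qed
    have "\<exists>x\<in>closed_segment (p + s *\<^sub>R W \<epsilon>) (p + s *\<^sub>R W (- \<epsilon>)). r x = 0"
    proof (rule IVT_segment)
      have seg: "x \<in> V" if xs: "x \<in> closed_segment (p + s *\<^sub>R W \<epsilon>) (p + s *\<^sub>R W (- \<epsilon>))" for x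
      proof -
        obtain u where u: "0 \<le> u" "u \<le> 1" "x = (1 - u) *\<^sub>R (p + s *\<^sub>R W \<epsilon>) + u *\<^sub>R (p + s *\<^sub>R W (- \<epsilon>))"
          using xs by (auto simp: in_segment)
        have "x = p + s *\<^sub>R W ((1 - 2 * u) * \<epsilon>)"
          unfolding u(3) W_def by (rule euclidean_eqI, simp only: inner_add_left inner_scaleR_left, simp add: algebra_simps) 
        moreover have "\<bar>(1 - 2 * u) * \<epsilon>\<bar> \<le> 1 * \<epsilon>"
          unfolding abs_mult using u \<epsilon> by (intro mult_mono) auto
        ultimately show ?thesis using inV[of s "(1 - 2 * u) * \<epsilon>"] s by simp
      qed
      then show "continuous_on (closed_segment (p + s *\<^sub>R W \<epsilon>) (p + s *\<^sub>R W (- \<epsilon>))) r"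
        using continuous_on_subset[OF Ck2_continuous(1)[OF r2]] by blast
    qed (use d1(2)[of s] d2(2)[of s] s in auto)
    then obtain x where x: "x \<in> closed_segment (p + s *\<^sub>R W \<epsilon>) (p + s *\<^sub>R W (- \<epsilon>))" "r x = 0" by blast
    then obtain u where u: "0 \<le> u" "u \<le> 1" "x = (1 - u) *\<^sub>R (p + s *\<^sub>R W \<epsilon>) + u *\<^sub>R (p + s *\<^sub>R W (- \<epsilon>))"
      by (auto simp: in_segment)
    define e where "e = (1 - 2 * u) * \<epsilon>"
    have xe: "x = p + s *\<^sub>R W e"
      unfolding u(3) W_def e_def by (rule euclidean_eqI, simp only: inner_add_left inner_scaleR_left, simp add: algebra_simps)
    have e: "\<bar>e\<bar> \<le> \<epsilon>"
    proof -
      have "\<bar>(1 - 2 * u)\<bar> * \<bar>\<epsilon>\<bar> \<le> 1 * \<epsilon>" using u \<epsilon> by (intro mult_mono) auto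
      then show ?thesis by (simp add: e_def abs_mult)
    qed
    have "x \<in> frontier \<Omega>" using frontier_iff[of x] x(2) inV[of s e] e s xe by simp
    then show ?thesis using xe e s inV[of _ e] unfolding W_def by (intro exI[of _ s] exI[of _ e]) auto
  qed
  have "\<forall>n. \<exists>s e. s > 0 \<and> s \<le> 1 / real (Suc n) \<and> \<bar>e\<bar> \<le> 1 / real (Suc n) \<and> p + s *\<^sub>R (\<tau> + e *\<^sub>R N) \<in> frontier \<Omega> \<and>
      (\<forall>\<sigma>. 0 \<le> \<sigma> \<and> \<sigma> \<le> s \<longrightarrow> p + \<sigma> *\<^sub>R (\<tau> + e *\<^sub>R N) \<in> V)"
    by (intro allI main) simp
  then obtain s e where se: "\<And>n. s n > 0" "\<And>n. s n \<le> 1 / real (Suc n)" "\<And>n. \<bar>e n\<bar> \<le> 1 / real (Suc n)"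
    "\<And>n. p + s n *\<^sub>R (\<tau> + e n *\<^sub>R N) \<in> frontier \<Omega>"
    "\<And>n \<sigma>. 0 \<le> \<sigma> \<Longrightarrow> \<sigma> \<le> s n \<Longrightarrow> p + \<sigma> *\<^sub>R (\<tau> + e n *\<^sub>R N) \<in> V" by metis
  have lim: "(\<lambda>n. 1 / real (Suc n)) \<longlonglongrightarrow> 0" using LIMSEQ_inverse_real_of_nat by (simp add: inverse_eq_divide)
  have "s \<longlonglongrightarrow> 0"
    by (rule Lim_null_comparison[OF always_eventually lim]) (use se(1,2) in \<open>auto simp: less_imp_le\<close>)
  moreover have "e \<longlonglongrightarrow> 0"
    by (rule Lim_null_comparison[OF always_eventually lim]) (use se(3) in auto)
  ultimately show ?thesis using that se by blast
qed

lemma shrinking_point: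
  assumes "s \<longlonglongrightarrow> (0::real)" "\<And>n. 0 < \<theta> n \<and> \<theta> n < s n" "w \<longlonglongrightarrow> (\<tau> :: 'a::real_normed_vector)"
  shows "(\<lambda>n. p + \<theta> n *\<^sub>R w n) \<longlonglongrightarrow> p"
proof -
  have "\<theta> \<longlonglongrightarrow> 0"
    by (rule Lim_null_comparison[OF always_eventually assms(1)]) (use assms(2) in \<open>auto simp: less_imp_le\<close>)
  from tendsto_add[OF tendsto_const[of p] tendsto_scaleR[OF this assms(3)]] show ?thesis by simp
qed

text \<open>\<open>F\<close> vanishes at \<open>p\<close> and at the points of
  \<open>tangent_sequence\<close>, so Rolle's theorem gives zeros of its derivative in directions
  tending to \<open>\<tau>\<close>.\<close>

lemma tangential_D1:
  assumes p: "p \<in> frontier \<Omega>" and N: "D1 r p N < 0" and \<tau>: "D1 r p \<tau> = 0"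
    and F: "Ck_on 2 V F" "\<And>x. x \<in> frontier \<Omega> \<Longrightarrow> F x = 0"
  shows "D1 F p \<tau> = 0"
proof -
  obtain s e where se: "s \<longlonglongrightarrow> 0" "e \<longlonglongrightarrow> 0" "\<And>n. s n > 0"
    "\<And>n. p + s n *\<^sub>R (\<tau> + e n *\<^sub>R N) \<in> frontier \<Omega>"
    "\<And>n \<sigma>. 0 \<le> \<sigma> \<Longrightarrow> \<sigma> \<le> s n \<Longrightarrow> p + \<sigma> *\<^sub>R (\<tau> + e n *\<^sub>R N) \<in> V"
    using tangent_sequence[OF p N \<tau>] by blast
  define w where "w n = \<tau> + e n *\<^sub>R N" for n
  have w: "w \<longlonglongrightarrow> \<tau>"
    unfolding w_def using tendsto_add[OF tendsto_const tendsto_scaleR[OF se(2) tendsto_const]] by fastforce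
  have "\<exists>\<sigma>. 0 < \<sigma> \<and> \<sigma> < s n \<and> D1 F (p + \<sigma> *\<^sub>R w n) (w n) = 0" for n
    using MVT_line[OF se(3), of n F p "w n"] Ck2D(1)[OF F(1) se(5)] F(2)[OF se(4)] F(2)[OF p] se(3)[of n]
    by (force simp: w_def)
  then obtain \<theta> where \<theta>: "\<And>n. 0 < \<theta> n \<and> \<theta> n < s n" "\<And>n. D1 F (p + \<theta> n *\<^sub>R w n) (w n) = 0" by metis
  have "(\<lambda>n. D1 F (p + \<theta> n *\<^sub>R w n) (w n)) \<longlonglongrightarrow> D1 F p \<tau>"
    by (rule D1_tendsto[OF _ V(1) _ shrinking_point[OF se(1) \<theta>(1) w] w, of 1])
      (use F(1) p V in \<open>auto simp: numeral_2_eq_2\<close>)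
  then show ?thesis unfolding \<theta>(2) by (simp add: LIMSEQ_const_iff)
qed

text \<open>Rolle's theorem gives a zero of the first derivative inside the segment; the gradient
  also vanishes at \<open>p\<close>, so Rolle's theorem applies a second time.\<close>

lemma tangential_D2:
  assumes p: "p \<in> frontier \<Omega>" and N: "D1 r p N < 0" and \<tau>: "D1 r p \<tau> = 0"
    and F: "Ck_on 2 V F" "\<And>x. x \<in> frontier \<Omega> \<Longrightarrow> F x = 0" "\<And>v. D1 F p v = 0"
  shows "D2 F p \<tau> \<tau> = 0"
proof -
  obtain s e where se: "s \<longlonglongrightarrow> 0" "e \<longlonglongrightarrow> 0" "\<And>n. s n > 0"
    "\<And>n. p + s n *\<^sub>R (\<tau> + e n *\<^sub>R N) \<in> frontier \<Omega>"
    "\<And>n \<sigma>. 0 \<le> \<sigma> \<Longrightarrow> \<sigma> \<le> s n \<Longrightarrow> p + \<sigma> *\<^sub>R (\<tau> + e n *\<^sub>R N) \<in> V"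
    using tangent_sequence[OF p N \<tau>] by blast
  define w where "w n = \<tau> + e n *\<^sub>R N" for n
  have w: "w \<longlonglongrightarrow> \<tau>"
    unfolding w_def using tendsto_add[OF tendsto_const tendsto_scaleR[OF se(2) tendsto_const]] by fastforce
  have "\<exists>\<sigma>. 0 < \<sigma> \<and> \<sigma> < s n \<and> D2 F (p + \<sigma> *\<^sub>R w n) (w n) (w n) = 0" for n
  proof -
    obtain \<sigma> where \<sigma>: "0 < \<sigma>" "\<sigma> < s n" "D1 F (p + \<sigma> *\<^sub>R w n) (w n) = 0"
      using MVT_line[OF se(3), of n F p "w n"] Ck2D(1)[OF F(1) se(5)] F(2)[OF se(4)] F(2)[OF p] se(3)[of n]
      by (force simp: w_def)
    have "\<exists>\<sigma>'. 0 < \<sigma>' \<and> \<sigma>' < \<sigma> \<and> D1 F (p + \<sigma> *\<^sub>R w n) (w n) - D1 F p (w n) = \<sigma> * D2 F (p + \<sigma>' *\<^sub>R w n) (w n) (w n)"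
      by (rule MVT_line[OF \<sigma>(1)]) (use Ck2D(2)[OF F(1) se(5)[of _ n]] \<sigma> in \<open>auto simp: w_def\<close>)
    then show ?thesis using \<sigma> F(3) by force
  qed
  then obtain \<theta> where \<theta>: "\<And>n. 0 < \<theta> n \<and> \<theta> n < s n" "\<And>n. D2 F (p + \<theta> n *\<^sub>R w n) (w n) (w n) = 0" by metis
  have "(\<lambda>n. D2 F (p + \<theta> n *\<^sub>R w n) (w n) (w n)) \<longlonglongrightarrow> D2 F p \<tau> \<tau>"
    by (rule D2_tendsto[OF F(1) V(1) _ shrinking_point[OF se(1) \<theta>(1) w] w w]) (use p V in auto)
  then show ?thesis unfolding \<theta>(2) by (simp add: LIMSEQ_const_iff)
qed

text \<open>Minus the gradient of \<open>r\<close>, hence pointing inwards at the boundary. It is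
  left unnormalised; upper and lower bounds of its length on a compact set are all that is
  used.\<close>

definition nu :: "complex ^ 'n \<Rightarrow> complex ^ 'n" where
  "nu x = - (\<Sum>b\<in>Basis. D1 r x b *\<^sub>R b)"

lemma nu_inner: "b \<in> Basis \<Longrightarrow> nu x \<bullet> b = - D1 r x b"
  by (simp add: nu_def inner_sum_left inner_Basis if_distrib sum.delta cong: if_cong)

lemma D1_nu:
  assumes "x \<in> V"
  shows "D1 r x v = - (nu x \<bullet> v)"
proof -
  have "D1 r x v = (\<Sum>b\<in>Basis. (v \<bullet> b) * D1 r x b)" by (rule D1_expand[OF r_differentiable[OF assms]])
  also have "\<dots> = - (nu x \<bullet> v)"
    by (subst euclidean_inner) (simp add: nu_inner sum_negf mult.commute)
  finally show ?thesis .
qed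

lemma nu_nonzero: "x \<in> V \<Longrightarrow> nu x \<noteq> 0"
  using r_grad[of x] D1_nu[of x] by auto

lemma nu_Ck: "b \<in> Basis \<Longrightarrow> Ck_on 2 V (\<lambda>x. nu x \<bullet> b)"
  unfolding nu_inner using r3 by (intro Ck_on_uminus V(1)) (simp add: numeral_3_eq_3 numeral_2_eq_2)

lemma continuous_on_nu: "continuous_on V nu"
  by (subst continuous_on_componentwise) (auto intro: Ck2_continuous(1)[OF nu_Ck])

end

text \<open>The direction of the segment in \<open>foot\<close> is the inner normal at the interior point \<open>z\<close>, not at the foot point
  \<open>p\<close>. This dispenses with a tubular neighbourhood theorem, and \<open>z + t *\<^sub>R nu z\<close> stays on the segment.\<close>

locale collar = defining_pair \<Omega> V r \<rho> c \<eta>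
  for \<Omega> V :: "(complex ^ 'n) set" and r \<rho> :: "complex ^ 'n \<Rightarrow> real" and c \<eta> :: real +
  fixes K :: "(complex ^ 'n) set" and C c1 T :: real
  assumes K: "compact K" "K \<subseteq> V"
    and pos: "C > 0" "c1 > 0" "T > 0"
    and D1r: "\<And>x v. x \<in> K \<Longrightarrow> \<bar>D1 r x v\<bar> \<le> C * norm v"
    and r_le: "\<And>x. x \<in> K \<inter> \<Omega> \<Longrightarrow> - r x \<le> C * bdist \<Omega> x"
    and foot: "\<And>\<epsilon>. \<epsilon> > 0 \<Longrightarrow> \<exists>d>0. \<forall>z\<in>\<Omega>. bdist \<Omega> z < d \<longrightarrow> (\<exists>s p. 0 < s \<and> s < \<epsilon> \<and> z = p + s *\<^sub>R nu z \<and>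
        p \<in> frontier \<Omega> \<and> norm (nu z) \<le> C \<and> (\<forall>\<sigma>\<in>{0..T}. p + \<sigma> *\<^sub>R nu z \<in> K \<and> D1 r (p + \<sigma> *\<^sub>R nu z) (nu z) \<le> - c1))"

context defining_pair
begin

text \<open>On a compact neighbourhood of the boundary the squared gradient has a positive minimum
  \<open>m\<close>. The slope of \<open>r\<close> along \<open>nu x\<close> is at most
  \<open>- m\<close> at \<open>x\<close>, and by uniform continuity of the gradient it stays below
  \<open>- m / 2\<close> on a short segment.\<close>

lemma collar_exists: "\<exists>K C c1 T. collar \<Omega> V r \<rho> c \<eta> K C c1 T"
proof -
  have fr: "compact (frontier \<Omega>)" "frontier \<Omega> \<noteq> {}"
    using \<Omega> frontier_ne compact_frontier_bounded by auto
  obtain d where d: "d > 0" "compact {x. infdist x (frontier \<Omega>) \<le> d}" "{x. infdist x (frontier \<Omega>) \<le> d} \<subseteq> V"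
    using compact_nbhd_subset[OF fr(1) V fr(2)] by metis
  define K where "K = {x. infdist x (frontier \<Omega>) \<le> d}"
  have K: "compact K" "K \<subseteq> V" using d by (auto simp: K_def)
  have "frontier \<Omega> \<subseteq> K" using d(1) by (auto simp: K_def)
  then have Kne: "K \<noteq> {}" using fr(2) by blast
  obtain C where C: "C > 0" "\<And>x v. x \<in> K \<Longrightarrow> \<bar>D1 r x v\<bar> \<le> C * norm v"
    using D1_bounded[of 1 V r K] r2 K by (auto simp: numeral_2_eq_2 simp del: Ck_on.simps)
  have nuC: "norm (nu x) \<le> C" if "x \<in> K" for x
  proof -
    have "norm (nu x) * norm (nu x) \<le> C * norm (nu x)"
      using C(2)[OF that, of "nu x"] D1_nu[of x "nu x"] that K by (auto simp: dot_square_norm power2_eq_square)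
    then show ?thesis using nu_nonzero[of x] that K by auto
  qed
  obtain x0 where x0: "x0 \<in> K" "\<And>x. x \<in> K \<Longrightarrow> norm (nu x0) \<le> norm (nu x)"
    using continuous_attains_inf[OF K(1) Kne, of "\<lambda>x. norm (nu x)"] continuous_on_subset[OF continuous_on_nu K(2)]
    by (auto intro: continuous_intros)
  define m where "m = (norm (nu x0))\<^sup>2"
  have m: "m > 0" using nu_nonzero[of x0] x0 K by (auto simp: m_def)
  have mle: "m \<le> (norm (nu x))\<^sup>2" if "x \<in> K" for x
    unfolding m_def using x0(2)[OF that] by (intro power_mono) auto
  have "m / (2 * C) > 0" using m C by simp
  then obtain d' where d': "d' > 0" "\<And>x y v. x \<in> K \<Longrightarrow> y \<in> K \<Longrightarrow> dist x y < d' \<Longrightarrow> \<bar>D1 r x v - D1 r y v\<bar> \<le> m / (2 * C) * norm v"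
    using D1_modulus[of 1 V r K "m / (2 * C)"] r2 K by (auto simp: numeral_2_eq_2 simp del: Ck_on.simps)
  define c1 where "c1 = m / 2"
  have c1: "c1 > 0" using m by (simp add: c1_def)
  have slope: "D1 r y (nu x) \<le> - c1" if "x \<in> K" "y \<in> K" "dist x y < d'" for x y
  proof -
    have "D1 r y (nu x) \<le> D1 r x (nu x) + m / (2 * C) * norm (nu x)"
      using d'(2)[OF that, of "nu x"] by linarith
    also have "D1 r x (nu x) \<le> - m"
      using mle[OF that(1)] D1_nu[of x "nu x"] that(1) K by (auto simp: dot_square_norm)
    also have "m / (2 * C) * norm (nu x) \<le> m / (2 * C) * C"
      using nuC[OF that(1)] m C by (intro mult_left_mono) auto
    also have "m / (2 * C) * C = m / 2" using C by simp
    finally show ?thesis by (simp add: c1_def)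
  qed
  define T where "T = min (d / 2) (d' / 2) / C"
  have T: "T > 0" "T * C \<le> d / 2" "T * C < d'" using d(1) d'(1) C by (auto simp: T_def)
  have along: "z + \<tau> *\<^sub>R nu z \<in> K" "D1 r (z + \<tau> *\<^sub>R nu z) (nu z) \<le> - c1"
    if z: "bdist \<Omega> z \<le> d / 2" and \<tau>: "\<bar>\<tau>\<bar> \<le> T" for z \<tau>
  proof -
    have zK: "z \<in> K" using z d(1) by (simp add: K_def bdist_def)
    have n: "norm (\<tau> *\<^sub>R nu z) \<le> T * C" using \<tau> nuC[OF zK] T by (auto intro!: mult_mono)
    show 1: "z + \<tau> *\<^sub>R nu z \<in> K"
      using infdist_triangle[of "z + \<tau> *\<^sub>R nu z" "frontier \<Omega>" z] n T(2) z by (simp add: K_def bdist_def dist_norm)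
    show "D1 r (z + \<tau> *\<^sub>R nu z) (nu z) \<le> - c1"
      by (rule slope[OF zK 1]) (use n T(3) in \<open>simp add: dist_norm\<close>)
  qed
  have r_le: "- r x \<le> C * bdist \<Omega> x" if x: "x \<in> K \<inter> \<Omega>" for x
  proof -
    obtain y where y: "y \<in> frontier \<Omega>" "infdist x (frontier \<Omega>) = dist x y"
      using infdist_attains_inf[OF frontier_closed fr(2)] by blast
    have seg: "y + \<sigma> *\<^sub>R (x - y) \<in> K" if "0 \<le> \<sigma>" "\<sigma> \<le> 1" for \<sigma>
    proof -
      have "infdist (y + \<sigma> *\<^sub>R (x - y)) (frontier \<Omega>) \<le> dist (y + \<sigma> *\<^sub>R (x - y)) y" by (rule infdist_le[OF y(1)])
      also have "\<dots> = \<sigma> * dist x y" using that by (simp add: dist_norm)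
      also have "\<dots> \<le> 1 * dist x y" using that by (intro mult_right_mono) auto
      also have "\<dots> \<le> d" using x y(2) by (simp add: K_def)
      finally show ?thesis by (simp add: K_def)
    qed
    obtain \<sigma> where \<sigma>: "0 < \<sigma>" "\<sigma> < 1" "r (y + 1 *\<^sub>R (x - y)) - r y = 1 * D1 r (y + \<sigma> *\<^sub>R (x - y)) (x - y)"
      using MVT_line[of 1 r y "x - y"] r_differentiable seg K by auto
    have "r y = 0" using frontier_iff[of y] y(1) V by auto
    moreover have "\<bar>D1 r (y + \<sigma> *\<^sub>R (x - y)) (x - y)\<bar> \<le> C * norm (x - y)"
      by (rule C(2)[OF seg]) (use \<sigma> in auto)
    ultimately show ?thesis using \<sigma>(3) y(2) by (simp add: bdist_def dist_norm)
  qed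
  have "collar \<Omega> V r \<rho> c \<eta> K C c1 T"
  proof unfold_locales
    fix \<epsilon> :: real assume \<epsilon>: "\<epsilon> > 0"
    define s1 where "s1 = min \<epsilon> T / 2"
    have s1: "s1 > 0" "s1 < \<epsilon>" "s1 \<le> T" using \<epsilon> T by (auto simp: s1_def)
    show "\<exists>d>0. \<forall>z\<in>\<Omega>. bdist \<Omega> z < d \<longrightarrow> (\<exists>s p. 0 < s \<and> s < \<epsilon> \<and> z = p + s *\<^sub>R nu z \<and>
        p \<in> frontier \<Omega> \<and> norm (nu z) \<le> C \<and> (\<forall>\<sigma>\<in>{0..T}. p + \<sigma> *\<^sub>R nu z \<in> K \<and> D1 r (p + \<sigma> *\<^sub>R nu z) (nu z) \<le> - c1))"
    \<comment> \<open>At so small a distance \<open>- r z < c1 * s1\<close>, whereas going backwards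
      along the normal by \<open>s1\<close> raises \<open>r\<close> by at least
      \<open>c1 * s1\<close>. So \<open>r\<close> vanishes on the way, which gives the foot
      point.\<close>
    proof (rule exI[of _ "min (d / 2) (c1 * s1 / C)"], intro conjI ballI impI)
      show "min (d / 2) (c1 * s1 / C) > 0" using d(1) c1 s1 C by simp
      fix z assume z: "z \<in> \<Omega>" "bdist \<Omega> z < min (d / 2) (c1 * s1 / C)"
      then have zd: "bdist \<Omega> z \<le> d / 2" by simp
      have zK: "z \<in> K" using along(1)[OF zd, of 0] T by simp
      have "- r z \<le> C * bdist \<Omega> z" using r_le zK z by simp
      also have "\<dots> < c1 * s1" using z(2) C by (simp add: pos_less_divide_eq mult.commute)
      finally have rz: "r z > - (c1 * s1)" by simp
      have bk: "z + (- \<sigma>) *\<^sub>R nu z \<in> K" "D1 r (z + (- \<sigma>) *\<^sub>R nu z) (nu z) \<le> - c1" if "0 \<le> \<sigma>" "\<sigma> \<le> s1" for \<sigma>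
        using along[OF zd, of "- \<sigma>"] that s1 by auto
      obtain \<sigma>1 where \<sigma>1: "0 < \<sigma>1" "\<sigma>1 < s1" "r (z + s1 *\<^sub>R (- nu z)) - r z = s1 * D1 r (z + \<sigma>1 *\<^sub>R (- nu z)) (- nu z)"
        using MVT_line[OF s1(1), of r z "- nu z"] r_differentiable bk(1) K by (auto simp: subset_iff)
      have "D1 r (z + \<sigma>1 *\<^sub>R (- nu z)) (- nu z) \<ge> c1"
        using bk[of \<sigma>1] \<sigma>1 D1_lin(4)[OF r_differentiable, of "z + (- \<sigma>1) *\<^sub>R nu z" "nu z"] K by auto
      then have "s1 * D1 r (z + \<sigma>1 *\<^sub>R (- nu z)) (- nu z) \<ge> s1 * c1" using s1 by simp
      then have r1: "r (z + s1 *\<^sub>R (- nu z)) > 0" using \<sigma>1(3) rz by (simp add: mult.commute)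
      have rz0: "r z < 0" using r_neg zK K z by auto
      have cont: "continuous_on {0..s1} (\<lambda>s. r (z + (- s) *\<^sub>R nu z))"
        by (rule continuous_on_compose2[OF Ck2_continuous(1)[OF r2]]) (use bk(1) K in \<open>auto intro!: continuous_intros\<close>)
      obtain s where s: "0 \<le> s" "s \<le> s1" "r (z + (- s) *\<^sub>R nu z) = 0"
        using IVT'[of "\<lambda>s. r (z + (- s) *\<^sub>R nu z)" 0 0 s1] cont r1 rz0 s1 by (auto simp: less_imp_le)
      define p where "p = z + (- s) *\<^sub>R nu z"
      have "s \<noteq> 0" using s(3) rz0 by auto
      have zp: "z = p + s *\<^sub>R nu z" by (simp add: p_def)
      have "p \<in> frontier \<Omega>" using frontier_iff[of p] s(3) bk(1)[OF s(1,2)] K by (auto simp: p_def)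
      moreover have "p + \<sigma> *\<^sub>R nu z \<in> K \<and> D1 r (p + \<sigma> *\<^sub>R nu z) (nu z) \<le> - c1" if "\<sigma> \<in> {0..T}" for \<sigma>
      proof -
        \<comment> \<open>Seen from \<open>z\<close> the parameter is \<open>\<sigma> - s\<close>,
          which has absolute value at most \<open>T\<close> because
          \<open>s \<le> T\<close>.\<close>
        have "p + \<sigma> *\<^sub>R nu z = z + (\<sigma> - s) *\<^sub>R nu z" by (simp add: p_def algebra_simps)
        moreover have "\<bar>\<sigma> - s\<bar> \<le> T" using that s s1 by auto
        ultimately show ?thesis using along[OF zd] by metis
      qed
      ultimately show "\<exists>s p. 0 < s \<and> s < \<epsilon> \<and> z = p + s *\<^sub>R nu z \<and> p \<in> frontier \<Omega> \<and> norm (nu z) \<le> C \<and>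
        (\<forall>\<sigma>\<in>{0..T}. p + \<sigma> *\<^sub>R nu z \<in> K \<and> D1 r (p + \<sigma> *\<^sub>R nu z) (nu z) \<le> - c1)"
        using s s1 \<open>s \<noteq> 0\<close> zp nuC[OF zK] by (intro exI[of _ s] exI[of _ p]) auto
    qed
  qed (use K C c1 T r_le in auto)
  then show ?thesis by blast
qed

end

section \<open>The logarithm of the ratio of two defining functions\<close>

context collar
begin

text \<open>The conclusion of \<open>foot\<close> with \<open>nu z\<close> replaced by a free vector
  \<open>N\<close>, so that the estimates below are uniform in the foot point and the
  direction.\<close>

definition adm :: "complex ^ 'n \<Rightarrow> complex ^ 'n \<Rightarrow> bool" where
  "adm p N \<longleftrightarrow> p \<in> frontier \<Omega> \<and> norm N \<le> C \<and> (\<forall>\<sigma>\<in>{0..T}. p + \<sigma> *\<^sub>R N \<in> K \<and> D1 r (p + \<sigma> *\<^sub>R N) N \<le> - c1)"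

lemma adm_point:
  assumes "adm p N" "0 \<le> \<sigma>" "\<sigma> \<le> T"
  shows "p + \<sigma> *\<^sub>R N \<in> K" "p + \<sigma> *\<^sub>R N \<in> V" "D1 r (p + \<sigma> *\<^sub>R N) N \<le> - c1"
  using assms K(2) by (auto simp: adm_def)

lemma adm_base:
  assumes "adm p N"
  shows "p \<in> frontier \<Omega>" "norm N \<le> C" "p \<in> K" "p \<in> V" "D1 r p N \<le> - c1" "D1 r p N < 0" "r p = 0" "\<rho> p = 0"
  using assms adm_point[of p N 0] pos frontier_iff[of p] \<rho>_frontier[of p] by (auto simp: adm_def)

lemma adm_r:
  assumes "adm p N" "0 < \<sigma>" "\<sigma> \<le> T"
  shows "r (p + \<sigma> *\<^sub>R N) \<le> - (c1 * \<sigma>)" "- (C\<^sup>2 * \<sigma>) \<le> r (p + \<sigma> *\<^sub>R N)"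
proof -
  obtain \<theta> where \<theta>: "0 < \<theta>" "\<theta> < \<sigma>" "r (p + \<sigma> *\<^sub>R N) - r p = \<sigma> * D1 r (p + \<theta> *\<^sub>R N) N"
    using MVT_line[OF assms(2), of r p N] r_differentiable adm_point(2)[OF assms(1)] assms(3) by force
  have 1: "D1 r (p + \<theta> *\<^sub>R N) N \<le> - c1" using adm_point(3)[OF assms(1), of \<theta>] \<theta> assms by simp
  have "\<bar>D1 r (p + \<theta> *\<^sub>R N) N\<bar> \<le> C * norm N" by (rule D1r) (use adm_point(1)[OF assms(1), of \<theta>] \<theta> assms in simp)
  also have "\<dots> \<le> C\<^sup>2" using adm_base(2)[OF assms(1)] pos by (simp add: power2_eq_square)
  finally have 2: "- C\<^sup>2 \<le> D1 r (p + \<theta> *\<^sub>R N) N" by linarith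
  show "r (p + \<sigma> *\<^sub>R N) \<le> - (c1 * \<sigma>)"
    using mult_left_mono[OF 1, of \<sigma>] \<theta>(3) assms(2) adm_base(7)[OF assms(1)] by (simp add: mult.commute)
  show "- (C\<^sup>2 * \<sigma>) \<le> r (p + \<sigma> *\<^sub>R N)"
    using mult_left_mono[OF 2, of \<sigma>] \<theta>(3) assms(2) adm_base(7)[OF assms(1)] by (simp add: mult.commute)
qed

lemma adm_in:
  assumes "adm p N" "0 < \<sigma>" "\<sigma> \<le> T"
  shows "p + \<sigma> *\<^sub>R N \<in> \<Omega>"
proof -
  have "c1 * \<sigma> > 0" using pos assms by simp
  then show ?thesis using adm_r(1)[OF assms] r_neg[of "p + \<sigma> *\<^sub>R N"] adm_point(2)[OF assms(1), of \<sigma>] assms by simp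
qed

definition c2 :: real where "c2 = c1 / C"

lemma c2_pos: "c2 > 0" using pos by (simp add: c2_def)

lemma adm_rho:
  assumes "adm p N" "0 < \<sigma>" "\<sigma> \<le> T"
  shows "\<rho> (p + \<sigma> *\<^sub>R N) \<le> - (c2 * \<sigma>)"
proof -
  have x: "p + \<sigma> *\<^sub>R N \<in> \<Omega>" "p + \<sigma> *\<^sub>R N \<in> K" "p + \<sigma> *\<^sub>R N \<in> V"
    using adm_in[OF assms] adm_point[OF assms(1), of \<sigma>] assms by auto
  have "c1 * \<sigma> \<le> C * bdist \<Omega> (p + \<sigma> *\<^sub>R N)" using adm_r(1)[OF assms] r_le[of "p + \<sigma> *\<^sub>R N"] x by simp
  then have "c2 * \<sigma> \<le> bdist \<Omega> (p + \<sigma> *\<^sub>R N)" using pos by (simp add: c2_def field_simps)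
  moreover have "\<rho> (p + \<sigma> *\<^sub>R N) \<le> - bdist \<Omega> (p + \<sigma> *\<^sub>R N)"
    using \<rho>_bounds[of "p + \<sigma> *\<^sub>R N"] x closure_subset by blast
  ultimately show ?thesis by linarith
qed

lemma interior_set:
  shows "open (\<Omega> \<inter> V)" "Ck_on 2 (\<Omega> \<inter> V) r" "Ck_on 2 (\<Omega> \<inter> V) \<rho>"
    "\<And>y. y \<in> \<Omega> \<inter> V \<Longrightarrow> r y < 0" "\<And>y. y \<in> \<Omega> \<inter> V \<Longrightarrow> \<rho> y < 0"
proof -
  show "open (\<Omega> \<inter> V)" using \<Omega> V by auto
  show "Ck_on 2 (\<Omega> \<inter> V) r" by (rule Ck_on_subset[OF r2]) auto
  show "Ck_on 2 (\<Omega> \<inter> V) \<rho>" by (rule Ck_on_subset[OF \<rho>2]) auto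
  show "r y < 0" if "y \<in> \<Omega> \<inter> V" for y using r_neg[of y] that by auto
  show "\<rho> y < 0" if "y \<in> \<Omega> \<inter> V" for y
  proof -
    have "bdist \<Omega> y > 0" using bdist_pos \<Omega> that by blast
    then show ?thesis using \<rho>_bounds[of y] that closure_subset by force
  qed
qed

text \<open>This is \<open>ln (r / \<rho>)\<close>, written with the factor \<open>-1\<close> to
  match \<open>D12_add\<close>.\<close>

definition g :: "complex ^ 'n \<Rightarrow> real" where
  "g x = - ln (- \<rho> x) + (-1) * (- ln (- r x))"

lemma g_Ck: "Ck_on 2 (\<Omega> \<inter> V) g"
  unfolding g_def[abs_def]
  by (intro Ck_on_add Ck_on_cmult Ck_neg_log interior_set)

lemma g_derivs:
  assumes "x \<in> \<Omega> \<inter> V"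
  shows "D1 g x v = D1 \<rho> x v / (- \<rho> x) - D1 r x v / (- r x)"
    "D2 g x v v = D2 \<rho> x v v / (- \<rho> x) + (D1 \<rho> x v / (- \<rho> x))\<^sup>2 - (D2 r x v v / (- r x) + (D1 r x v / (- r x))\<^sup>2)"
proof -
  note i = interior_set
  have a: "D1 (\<lambda>x. - ln (- \<rho> x)) x v = D1 \<rho> x v / (- \<rho> x)"
      "D2 (\<lambda>x. - ln (- \<rho> x)) x v v = D2 \<rho> x v v / (- \<rho> x) + (D1 \<rho> x v / (- \<rho> x))\<^sup>2"
    by (rule neg_log_derivs[OF i(3,1) assms i(5)]; assumption)+
  have b: "D1 (\<lambda>x. - ln (- r x)) x v = D1 r x v / (- r x)"
      "D2 (\<lambda>x. - ln (- r x)) x v v = D2 r x v v / (- r x) + (D1 r x v / (- r x))\<^sup>2"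
    by (rule neg_log_derivs[OF i(2,1) assms i(4)]; assumption)+
  have ck: "Ck_on 2 (\<Omega> \<inter> V) (\<lambda>x. - ln (- \<rho> x))" "Ck_on 2 (\<Omega> \<inter> V) (\<lambda>x. - ln (- r x))"
    by (intro Ck_neg_log i; assumption)+
  show "D1 g x v = D1 \<rho> x v / (- \<rho> x) - D1 r x v / (- r x)"
    unfolding g_def[abs_def] D12_add(1)[OF i(1) ck assms] a b by simp
  show "D2 g x v v = D2 \<rho> x v v / (- \<rho> x) + (D1 \<rho> x v / (- \<rho> x))\<^sup>2 - (D2 r x v v / (- r x) + (D1 r x v / (- r x))\<^sup>2)"
    unfolding g_def[abs_def] D12_add(2)[OF i(1) ck assms] a b by simp
qed

text \<open>Up to the boundary the quotient \<open>\<rho> / r\<close> is in general only \<open>C\<^sup>1\<close>. Subtracting the multiple \<open>h0 p N * r\<close> instead gives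
  a \<open>C\<^sup>2\<close> function whose first derivatives and tangential second derivatives vanish at \<open>p\<close>.\<close>

definition h0 :: "complex ^ 'n \<Rightarrow> complex ^ 'n \<Rightarrow> real" where
  "h0 p N = D1 \<rho> p N / D1 r p N"

definition f0 :: "complex ^ 'n \<Rightarrow> complex ^ 'n \<Rightarrow> complex ^ 'n \<Rightarrow> real" where
  "f0 p N x = \<rho> x + (- h0 p N) * r x"

lemma f0_derivs:
  assumes "x \<in> V"
  shows "D1 (f0 p N) x v = D1 \<rho> x v - h0 p N * D1 r x v" "D2 (f0 p N) x v w = D2 \<rho> x v w - h0 p N * D2 r x v w"
  using D12_add[OF V(1) \<rho>2 r2 assms, of "- h0 p N"] unfolding f0_def[abs_def] by auto

lemma f0_Ck: "Ck_on 2 V (f0 p N)"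
  unfolding f0_def[abs_def] by (intro Ck_on_add Ck_on_cmult V(1) \<rho>2 r2)

lemma f0_frontier: "x \<in> frontier \<Omega> \<Longrightarrow> f0 p N x = 0"
  using \<rho>_frontier[of x] frontier_iff[of x] V(2) by (auto simp: f0_def)

text \<open>\<open>f0 p N\<close> vanishes on the boundary, which settles tangent directions, and
  \<open>h0 p N\<close> is chosen to settle the transversal direction \<open>N\<close>.\<close>

lemma f0_D1_base:
  assumes "adm p N"
  shows "D1 (f0 p N) p v = 0"
proof -
  note b = adm_base[OF assms]
  note d = Ck2D(1)[OF f0_Ck[of p N] b(4)]
  define \<gamma> where "\<gamma> = D1 r p v / D1 r p N"
  have t: "D1 r p (v - \<gamma> *\<^sub>R N) = 0"
    using b(6) by (simp add: D1_lin[OF r_differentiable[OF b(4)]] \<gamma>_def)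
  have "D1 (f0 p N) p (v - \<gamma> *\<^sub>R N) = 0"
    by (rule tangential_D1[OF b(1,6) t f0_Ck f0_frontier])
  moreover have "D1 (f0 p N) p N = 0" using b(6) by (simp add: f0_derivs[OF b(4)] h0_def)
  ultimately show ?thesis by (simp add: D1_lin[OF d])
qed

lemma f0_D2_base:
  assumes "adm p N" "D1 r p \<tau> = 0"
  shows "D2 (f0 p N) p \<tau> \<tau> = 0"
  by (rule tangential_D2[OF adm_base(1,6)[OF assms(1)] assms(2) f0_Ck f0_frontier f0_D1_base[OF assms(1)]])

lemma sigma_seq:
  obtains s :: "nat \<Rightarrow> real" where "\<And>n. 0 < s n" "\<And>n. s n \<le> T" "s \<longlonglongrightarrow> 0"
proof (rule that[of "\<lambda>n. T * (1 / real (Suc n))"])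
  show "(\<lambda>n. T * (1 / real (Suc n))) \<longlonglongrightarrow> 0"
    using tendsto_mult_right_zero[OF LIMSEQ_inverse_real_of_nat, of T] by (simp add: inverse_eq_divide)
  show "0 < T * (1 / real (Suc n))" for n using pos by simp
  show "T * (1 / real (Suc n)) \<le> T" for n using pos by (simp add: field_simps)
qed

text \<open>The linear bound \<open>adm_rho\<close> passes to the derivative by the mean value
  theorem and a limit. It is what makes \<open>h0\<close> positive.\<close>

lemma D1_rho_N:
  assumes "adm p N"
  shows "D1 \<rho> p N \<le> - c2"
proof -
  note b = adm_base[OF assms]
  obtain s where s: "\<And>n. 0 < s n" "\<And>n. s n \<le> T" "s \<longlonglongrightarrow> 0" using sigma_seq by blast
  have "\<exists>\<theta>. 0 < \<theta> \<and> \<theta> < s n \<and> D1 \<rho> (p + \<theta> *\<^sub>R N) N \<le> - c2" for n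
  proof -
    obtain \<theta> where \<theta>: "0 < \<theta>" "\<theta> < s n" "\<rho> (p + s n *\<^sub>R N) - \<rho> p = s n * D1 \<rho> (p + \<theta> *\<^sub>R N) N"
      using MVT_line[OF s(1), of n \<rho> p N] Ck2D(1)[OF \<rho>2] adm_point(2)[OF assms] s(2)[of n] by force
    then have "s n * D1 \<rho> (p + \<theta> *\<^sub>R N) N \<le> s n * (- c2)"
      using adm_rho[OF assms s(1,2), of n] b(8) by (simp add: mult.commute)
    then have "D1 \<rho> (p + \<theta> *\<^sub>R N) N \<le> - c2" using s(1)[of n] by (rule mult_left_le_imp_le)
    then show ?thesis using \<theta> by blast
  qed
  then obtain \<theta> where \<theta>: "\<And>n. 0 < \<theta> n \<and> \<theta> n < s n" "\<And>n. D1 \<rho> (p + \<theta> n *\<^sub>R N) N \<le> - c2" by metis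
  have "(\<lambda>n. D1 \<rho> (p + \<theta> n *\<^sub>R N) N) \<longlonglongrightarrow> D1 \<rho> p N"
    by (rule D1_tendsto[OF _ V(1) b(4) shrinking_point[OF s(3) \<theta>(1) tendsto_const] tendsto_const, of 1])
      (use \<rho>2 in \<open>auto simp: numeral_2_eq_2\<close>)
  then show ?thesis using LIMSEQ_le_const2 \<theta>(2) by blast
qed

lemma h0_pos: "adm p N \<Longrightarrow> h0 p N > 0"
  using D1_rho_N[of p N] c2_pos adm_base(6)[of p N] by (auto simp: h0_def divide_neg_neg)

lemma rho_f0: "\<rho> x = h0 p N * r x + f0 p N x"
  by (simp add: f0_def)

text \<open>The slope of \<open>r\<close> along \<open>N\<close> is at most \<open>- c1\<close>, so
  \<open>h0 p N\<close> is bounded independently of \<open>p\<close> and \<open>N\<close>, and with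
  it the second derivatives of \<open>f0 p N\<close>.\<close>

lemma uniform_bounds:
  obtains M H where "M > 0" "H > 0" "\<And>p N. adm p N \<Longrightarrow> h0 p N \<le> H"
    "\<And>x v w. x \<in> K \<Longrightarrow> \<bar>D2 r x v w\<bar> \<le> M * norm v * norm w"
    "\<And>p N x v w. adm p N \<Longrightarrow> x \<in> K \<Longrightarrow> \<bar>D2 (f0 p N) x v w\<bar> \<le> M * norm v * norm w"
proof -
  obtain A where A: "A > 0" "\<And>x v. x \<in> K \<Longrightarrow> \<bar>D1 \<rho> x v\<bar> \<le> A * norm v"
    using D1_bounded[of 1 V \<rho> K] \<rho>2 K by (auto simp: numeral_2_eq_2 simp del: Ck_on.simps)
  obtain B where B: "B > 0" "\<And>x v w. x \<in> K \<Longrightarrow> \<bar>D2 \<rho> x v w\<bar> \<le> B * norm v * norm w"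
    using D2_bounded[OF \<rho>2 V(1) K] by auto
  obtain E where E: "E > 0" "\<And>x v w. x \<in> K \<Longrightarrow> \<bar>D2 r x v w\<bar> \<le> E * norm v * norm w"
    using D2_bounded[OF r2 V(1) K] by auto
  define H where "H = A * C / c1"
  have H: "H > 0" using A pos by (simp add: H_def)
  have h: "h0 p N \<le> H" if "adm p N" for p N
  proof -
    note b = adm_base[OF that]
    have "\<bar>D1 \<rho> p N\<bar> \<le> A * C" using A(2)[OF b(3), of N] mult_left_mono[OF b(2), of A] A(1) by linarith
    then have "\<bar>D1 \<rho> p N\<bar> / \<bar>D1 r p N\<bar> \<le> A * C / c1" using b(5) pos A by (intro frac_le) auto
    then show ?thesis by (simp add: h0_def H_def abs_le_iff flip: abs_divide)
  qed
  show ?thesis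
  proof (rule that[of "B + H * E + E" H])
    show "B + H * E + E > 0" using B E H by (simp add: add_pos_pos)
    fix x v w :: "complex ^ 'n" assume x: "x \<in> K"
    have nn: "0 \<le> norm v * norm w" by simp
    have "B + H * E \<ge> 0" using B H E by (simp add: less_imp_le)
    then have "E * (norm v * norm w) \<le> (B + H * E + E) * (norm v * norm w)" by (intro mult_right_mono nn) simp
    then show "\<bar>D2 r x v w\<bar> \<le> (B + H * E + E) * norm v * norm w" using E(2)[OF x, of v w] by (simp add: mult.assoc)
  next
    fix p N x v w :: "complex ^ 'n" assume a: "adm p N" and x: "x \<in> K"
    then have xV: "x \<in> V" using K by auto
    have "\<bar>D2 (f0 p N) x v w\<bar> \<le> \<bar>D2 \<rho> x v w\<bar> + h0 p N * \<bar>D2 r x v w\<bar>"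
      unfolding f0_derivs[OF xV] using h0_pos[OF a] abs_triangle_ineq4[of "D2 \<rho> x v w" "h0 p N * D2 r x v w"] by (simp add: abs_mult)
    also have "\<dots> \<le> B * norm v * norm w + H * (E * norm v * norm w)"
      using B(2)[OF x] E(2)[OF x] h[OF a] h0_pos[OF a] H by (intro add_mono mult_mono) auto
    also have "\<dots> \<le> (B + H * E + E) * norm v * norm w" using E(1) by (simp add: algebra_simps)
    finally show "\<bar>D2 (f0 p N) x v w\<bar> \<le> (B + H * E + E) * norm v * norm w" .
  qed (use H h in auto)
qed

lemma uniform_modulus:
  assumes "\<epsilon> > 0"
  obtains d where "d > 0" "\<And>x y v. x \<in> K \<Longrightarrow> y \<in> K \<Longrightarrow> dist x y < d \<Longrightarrow> \<bar>D1 r x v - D1 r y v\<bar> \<le> \<epsilon> * norm v"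
    "\<And>p N x y v w. adm p N \<Longrightarrow> x \<in> K \<Longrightarrow> y \<in> K \<Longrightarrow> dist x y < d \<Longrightarrow> \<bar>D2 (f0 p N) x v w - D2 (f0 p N) y v w\<bar> \<le> \<epsilon> * norm v * norm w"
proof -
  obtain M H where H: "H > 0" "\<And>p N. adm p N \<Longrightarrow> h0 p N \<le> H" using uniform_bounds by metis
  obtain d1 where d1: "d1 > 0" "\<And>x y v. x \<in> K \<Longrightarrow> y \<in> K \<Longrightarrow> dist x y < d1 \<Longrightarrow> \<bar>D1 r x v - D1 r y v\<bar> \<le> \<epsilon> * norm v"
    using D1_modulus[of 1 V r K \<epsilon>] r2 K assms by (auto simp: numeral_2_eq_2 simp del: Ck_on.simps)
  define e where "e = \<epsilon> / (1 + H)"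
  have "1 + H \<noteq> 0" using H(1) by linarith
  moreover have "e + H * e = e * (1 + H)" by (simp add: algebra_simps)
  ultimately have e: "e > 0" "e + H * e = \<epsilon>" using assms H(1) by (simp_all add: e_def)
  obtain d2 where d2: "d2 > 0" "\<And>x y v w. x \<in> K \<Longrightarrow> y \<in> K \<Longrightarrow> dist x y < d2 \<Longrightarrow> \<bar>D2 \<rho> x v w - D2 \<rho> y v w\<bar> \<le> e * norm v * norm w"
    using D2_modulus[OF \<rho>2 V(1) K e(1)] by auto
  obtain d3 where d3: "d3 > 0" "\<And>x y v w. x \<in> K \<Longrightarrow> y \<in> K \<Longrightarrow> dist x y < d3 \<Longrightarrow> \<bar>D2 r x v w - D2 r y v w\<bar> \<le> e * norm v * norm w"
    using D2_modulus[OF r2 V(1) K e(1)] by auto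
  show ?thesis
  proof (rule that[of "min d1 (min d2 d3)"])
    fix p N x y v w :: "complex ^ 'n" assume a: "adm p N" and x: "x \<in> K" "y \<in> K" "dist x y < min d1 (min d2 d3)"
    have xd: "dist x y < d1" "dist x y < d2" "dist x y < d3" using x(3) by simp_all
    have xV: "x \<in> V" "y \<in> V" using x(1,2) K(2) by blast+
    have eq: "D2 (f0 p N) x v w - D2 (f0 p N) y v w = (D2 \<rho> x v w - D2 \<rho> y v w) - h0 p N * (D2 r x v w - D2 r y v w)"
      by (simp add: f0_derivs[OF xV(1)] f0_derivs[OF xV(2)] algebra_simps)
    have "\<bar>D2 (f0 p N) x v w - D2 (f0 p N) y v w\<bar> \<le> \<bar>D2 \<rho> x v w - D2 \<rho> y v w\<bar> + h0 p N * \<bar>D2 r x v w - D2 r y v w\<bar>"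
      unfolding eq using h0_pos[OF a] abs_triangle_ineq4[of "D2 \<rho> x v w - D2 \<rho> y v w" "h0 p N * (D2 r x v w - D2 r y v w)"]
      by (simp add: abs_mult)
    also have "\<dots> \<le> e * norm v * norm w + H * (e * norm v * norm w)"
    proof (rule add_mono)
      show "\<bar>D2 \<rho> x v w - D2 \<rho> y v w\<bar> \<le> e * norm v * norm w" by (rule d2(2)[OF x(1,2) xd(2)])
      have "\<bar>D2 r x v w - D2 r y v w\<bar> \<le> e * norm v * norm w" by (rule d3(2)[OF x(1,2) xd(3)])
      from mult_mono[OF H(2)[OF a] this]
      show "h0 p N * \<bar>D2 r x v w - D2 r y v w\<bar> \<le> H * (e * norm v * norm w)" using H(1) by simp
    qed
    also have "\<dots> = (e + H * e) * norm v * norm w" by (simp add: algebra_simps)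
    finally show "\<bar>D2 (f0 p N) x v w - D2 (f0 p N) y v w\<bar> \<le> \<epsilon> * norm v * norm w" unfolding e(2) .
  qed (use d1 d2(1) d3(1) in auto)
qed

text \<open>Taylor expansion from \<open>p\<close>, where \<open>f0 p N\<close> and its gradient
  vanish. The intermediate points are kept because the second derivatives there are later compared
  with those at \<open>p\<close>.\<close>

lemma f0_estimates:
  assumes a: "adm p N" and \<sigma>: "0 < \<sigma>" "\<sigma> \<le> T"
    and M: "\<And>x v w. x \<in> K \<Longrightarrow> \<bar>D2 (f0 p N) x v w\<bar> \<le> M * norm v * norm w" "M > 0"
  shows "\<exists>\<theta>. 0 < \<theta> \<and> \<theta> < \<sigma> \<and> D1 (f0 p N) (p + \<sigma> *\<^sub>R N) v = \<sigma> * D2 (f0 p N) (p + \<theta> *\<^sub>R N) v N"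
    "\<bar>D1 (f0 p N) (p + \<sigma> *\<^sub>R N) v\<bar> \<le> \<sigma> * (M * C * norm v)"
    "\<exists>\<theta>. 0 < \<theta> \<and> \<theta> < \<sigma> \<and> f0 p N (p + \<sigma> *\<^sub>R N) = \<sigma>\<^sup>2 / 2 * D2 (f0 p N) (p + \<theta> *\<^sub>R N) N N"
    "\<bar>f0 p N (p + \<sigma> *\<^sub>R N)\<bar> \<le> \<sigma>\<^sup>2 * (M * C\<^sup>2)"
proof -
  note b = adm_base[OF a]
  have seg: "p + \<theta> *\<^sub>R N \<in> K" "p + \<theta> *\<^sub>R N \<in> V" if "0 \<le> \<theta>" "\<theta> \<le> \<sigma>" for \<theta> using adm_point[OF a, of \<theta>] that \<sigma> by auto
  show 1: "\<exists>\<theta>. 0 < \<theta> \<and> \<theta> < \<sigma> \<and> D1 (f0 p N) (p + \<sigma> *\<^sub>R N) v = \<sigma> * D2 (f0 p N) (p + \<theta> *\<^sub>R N) v N" for v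
    using MVT_line[OF \<sigma>(1), of "\<lambda>y. D1 (f0 p N) y v" p N] Ck2D(2)[OF f0_Ck seg(2)] f0_D1_base[OF a, of v] by auto
  show "\<bar>D1 (f0 p N) (p + \<sigma> *\<^sub>R N) v\<bar> \<le> \<sigma> * (M * C * norm v)"
  proof -
    obtain \<theta> where \<theta>: "0 < \<theta>" "\<theta> < \<sigma>" "D1 (f0 p N) (p + \<sigma> *\<^sub>R N) v = \<sigma> * D2 (f0 p N) (p + \<theta> *\<^sub>R N) v N" using 1 by blast
    have "\<bar>D2 (f0 p N) (p + \<theta> *\<^sub>R N) v N\<bar> \<le> M * norm v * norm N" by (rule M(1)[OF seg(1)]) (use \<theta> in auto)
    also have "\<dots> \<le> M * norm v * C" using b(2) M(2) by (intro mult_left_mono) auto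
    finally show ?thesis unfolding \<theta>(3) using \<sigma> by (simp add: abs_mult mult_ac)
  qed
  show 2: "\<exists>\<theta>. 0 < \<theta> \<and> \<theta> < \<sigma> \<and> f0 p N (p + \<sigma> *\<^sub>R N) = \<sigma>\<^sup>2 / 2 * D2 (f0 p N) (p + \<theta> *\<^sub>R N) N N"
  proof -
    define \<phi> where "\<phi> s = f0 p N (p + s *\<^sub>R N)" for s
    define \<phi>1 where "\<phi>1 s = D1 (f0 p N) (p + s *\<^sub>R N) N" for s
    define \<phi>2 where "\<phi>2 s = D2 (f0 p N) (p + s *\<^sub>R N) N N" for s
    define diff where "diff m = (if m = 0 then \<phi> else if m = 1 then \<phi>1 else \<phi>2)" for m :: nat
    have der: "(diff m has_real_derivative diff (Suc m) t) (at t)" if "m < 2" "0 \<le> t" "t \<le> \<sigma>" for m t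
      using D1_along_line(1)[OF f0_Ck[of p N] seg(2)[OF that(2,3)]]
        D1_along_line(2)[OF f0_Ck[of p N] seg(2)[OF that(2,3)], of N] that(1)
      by (cases "m = 0") (auto simp: diff_def \<phi>_def[abs_def] \<phi>1_def[abs_def] \<phi>2_def[abs_def])
    obtain t where t: "0 < t" "t < \<sigma>" "\<phi> \<sigma> = (\<Sum>m<2. diff m 0 / fact m * \<sigma> ^ m) + diff 2 t / fact 2 * \<sigma> ^ 2"
      using Maclaurin[of \<sigma> 2 diff \<phi>] \<sigma> der by (auto simp: diff_def)
    moreover have "diff 0 0 = 0" "diff 1 0 = 0"
      using f0_frontier[OF b(1)] f0_D1_base[OF a] by (auto simp: diff_def \<phi>_def \<phi>1_def)
    ultimately have "\<phi> \<sigma> = \<sigma>\<^sup>2 / 2 * \<phi>2 t" by (simp add: numeral_2_eq_2 diff_def)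
    then show ?thesis using t(1,2) unfolding \<phi>_def \<phi>2_def by blast
  qed
  show "\<bar>f0 p N (p + \<sigma> *\<^sub>R N)\<bar> \<le> \<sigma>\<^sup>2 * (M * C\<^sup>2)"
  proof -
    obtain \<theta> where \<theta>: "0 < \<theta>" "\<theta> < \<sigma>" "f0 p N (p + \<sigma> *\<^sub>R N) = \<sigma>\<^sup>2 / 2 * D2 (f0 p N) (p + \<theta> *\<^sub>R N) N N" using 2 by blast
    have "\<bar>D2 (f0 p N) (p + \<theta> *\<^sub>R N) N N\<bar> \<le> M * norm N * norm N" by (rule M(1)[OF seg(1)]) (use \<theta> in auto)
    also have "\<dots> \<le> M * (C * C)" using b(2) M(2) pos by (simp add: mult.assoc mult_mono)
    finally have "\<bar>D2 (f0 p N) (p + \<theta> *\<^sub>R N) N N\<bar> \<le> M * C\<^sup>2" by (simp add: power2_eq_square)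
    then have "\<sigma>\<^sup>2 / 2 * \<bar>D2 (f0 p N) (p + \<theta> *\<^sub>R N) N N\<bar> \<le> \<sigma>\<^sup>2 * (M * C\<^sup>2)"
      by (intro mult_mono) auto
    then show ?thesis unfolding \<theta>(3) by (simp add: abs_mult)
  qed
qed

text \<open>\<open>D1 g\<close> equals \<open>(f0 * D1 r / r - D1 f0) / \<rho>\<close>: the
  numerator is of order \<open>\<sigma>\<close> by the Taylor estimates, and \<open>- \<rho>\<close>
  is at least \<open>c2 * \<sigma>\<close>.\<close>

lemma g_D1_bound:
  obtains Cg where "Cg > 0" "\<And>p N \<sigma> v. adm p N \<Longrightarrow> 0 < \<sigma> \<Longrightarrow> \<sigma> \<le> T \<Longrightarrow> \<bar>D1 g (p + \<sigma> *\<^sub>R N) v\<bar> \<le> Cg * norm v"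
proof -
  obtain M H where M: "M > 0" "\<And>p N x v w. adm p N \<Longrightarrow> x \<in> K \<Longrightarrow> \<bar>D2 (f0 p N) x v w\<bar> \<le> M * norm v * norm w"
    using uniform_bounds by metis
  define Cg where "Cg = (M * C\<^sup>2 * C / c1 + M * C) / c2"
  have "Cg > 0" using M pos c2_pos by (simp add: Cg_def add_pos_pos)
  moreover have "\<bar>D1 g (p + \<sigma> *\<^sub>R N) v\<bar> \<le> Cg * norm v" if a: "adm p N" and \<sigma>: "0 < \<sigma>" "\<sigma> \<le> T" for p N \<sigma> v
  proof -
    define x where "x = p + \<sigma> *\<^sub>R N"
    have x: "x \<in> \<Omega> \<inter> V" "x \<in> K" "x \<in> V" using adm_in[OF a \<sigma>] adm_point[OF a, of \<sigma>] \<sigma> by (auto simp: x_def)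
    have neg: "r x < 0" "\<rho> x < 0" using interior_set(4,5) x by auto
    have rx: "- r x \<ge> c1 * \<sigma>" "- \<rho> x \<ge> c2 * \<sigma>" using adm_r[OF a \<sigma>] adm_rho[OF a \<sigma>] by (auto simp: x_def)
    have e: "D1 g x v = (f0 p N x * D1 r x v / r x - D1 (f0 p N) x v) / \<rho> x"
      unfolding g_derivs[OF x(1)] f0_derivs[OF x(3)] f0_def using neg by (simp add: field_simps)
    note fe = f0_estimates[OF a \<sigma> M(2)[OF a] M(1)]
    have 1: "\<bar>f0 p N x * D1 r x v / r x\<bar> \<le> \<sigma> * (M * C\<^sup>2 * C / c1 * norm v)"
    proof -
      have "\<bar>f0 p N x * D1 r x v / r x\<bar> = \<bar>f0 p N x\<bar> * \<bar>D1 r x v\<bar> / (- r x)" using neg by (simp add: abs_mult)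
      also have "\<dots> \<le> \<sigma>\<^sup>2 * (M * C\<^sup>2) * (C * norm v) / (c1 * \<sigma>)"
        using fe(4) D1r[OF x(2), of v] rx pos \<sigma> M unfolding x_def[symmetric]
        by (intro frac_le mult_mono) auto
      also have "\<dots> = \<sigma> * (M * C\<^sup>2 * C / c1 * norm v)" using \<sigma> by (simp add: power2_eq_square field_simps)
      finally show ?thesis .
    qed
    have "\<bar>D1 g x v\<bar> \<le> (\<sigma> * (M * C\<^sup>2 * C / c1 * norm v) + \<sigma> * (M * C * norm v)) / (c2 * \<sigma>)"
      unfolding e abs_divide
    proof (rule frac_le)
      show "\<bar>f0 p N x * D1 r x v / r x - D1 (f0 p N) x v\<bar> \<le> \<sigma> * (M * C\<^sup>2 * C / c1 * norm v) + \<sigma> * (M * C * norm v)"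
        using 1 fe(2)[of v] unfolding x_def[symmetric] by linarith
    qed (use rx neg c2_pos \<sigma> M pos in auto)
    also have "\<dots> = (\<sigma> * ((M * C\<^sup>2 * C / c1 + M * C) * norm v)) / (\<sigma> * c2)" by (simp add: algebra_simps)
    also have "\<dots> = Cg * norm v" using \<sigma> by (simp add: Cg_def)
    finally show ?thesis unfolding x_def .
  qed
  ultimately show ?thesis using that by blast
qed

end

lemma abs_combination_le:
  assumes "\<bar>x\<bar> \<le> a" "\<bar>y\<bar> \<le> b" "\<bar>z\<bar> \<le> (c::real)"
  shows "\<bar>x - 2 * y + z\<bar> \<le> a + 2 * b + c"
  using assms by linarith

context collar
begin

text \<open>Multiplied by \<open>\<rho>\<close>, the second derivative of \<open>g\<close> splits
  into \<open>BR\<close> and two terms of order \<open>\<sigma>\<close>. Up to moduli of continuity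
  \<open>BR\<close> is the second derivative of \<open>f0 p N\<close> at \<open>p\<close> along the
  tangent vector \<open>v - \<gamma> *\<^sub>R N\<close>, which is zero by
  \<open>f0_D2_base\<close>. Both \<open>\<rho>\<close> and \<open>r\<close> are comparable to
  \<open>\<sigma>\<close>, so the smallness carries over to the product with
  \<open>- r\<close>.\<close>

lemma g_D2_small:
  assumes \<epsilon>: "\<epsilon> > 0"
  obtains T1 where "0 < T1" "T1 \<le> T" "\<And>p N \<sigma> v. adm p N \<Longrightarrow> 0 < \<sigma> \<Longrightarrow> \<sigma> \<le> T1 \<Longrightarrow>
     \<bar>D2 g (p + \<sigma> *\<^sub>R N) v v\<bar> * (- r (p + \<sigma> *\<^sub>R N)) \<le> \<epsilon> * (norm v)\<^sup>2"
proof -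
  obtain M H where M: "M > 0" "H > 0" "\<And>p N. adm p N \<Longrightarrow> h0 p N \<le> H"
    "\<And>x v w. x \<in> K \<Longrightarrow> \<bar>D2 r x v w\<bar> \<le> M * norm v * norm w"
    "\<And>p N x v w. adm p N \<Longrightarrow> x \<in> K \<Longrightarrow> \<bar>D2 (f0 p N) x v w\<bar> \<le> M * norm v * norm w"
    using uniform_bounds by metis
  obtain Cg where Cg: "Cg > 0" "\<And>p N \<sigma> v. adm p N \<Longrightarrow> 0 < \<sigma> \<Longrightarrow> \<sigma> \<le> T \<Longrightarrow> \<bar>D1 g (p + \<sigma> *\<^sub>R N) v\<bar> \<le> Cg * norm v"
    using g_D1_bound by metis
  \<comment> \<open>\<open>Q\<close> collects the coefficients of \<open>\<epsilon>0\<close> in the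
    bound for \<open>BR\<close>, and \<open>Q2\<close> those of \<open>\<sigma>\<close> in the other
    two terms. Each group is allotted half of \<open>\<epsilon> * c2 / C\<^sup>2\<close>.\<close>
  define Q where "Q = 1 + 2 * (C / c1 * C + 2 * C\<^sup>2 / c1\<^sup>2 * (M * C)) + ((C / c1)\<^sup>2 * C\<^sup>2 + 2 * C\<^sup>2 / c1\<^sup>2 * (2 * (C / c1)) * (M * C\<^sup>2))"
  define Q2 where "Q2 = M * C\<^sup>2 / c1 * M + (H * C\<^sup>2 + T * (M * C\<^sup>2)) * Cg\<^sup>2"
  have Q: "Q > 0" using pos M(1) unfolding Q_def by (intro add_pos_nonneg) auto
  have Q2: "Q2 > 0" using pos M(1,2) Cg(1) unfolding Q2_def by (intro add_pos_pos mult_pos_pos) auto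
  define \<epsilon>0 where "\<epsilon>0 = \<epsilon> * c2 / (2 * C\<^sup>2 * Q)"
  have \<epsilon>0: "\<epsilon>0 > 0" using \<epsilon> c2_pos pos Q by (simp add: \<epsilon>0_def)
  obtain d where d: "d > 0" "\<And>x y v. x \<in> K \<Longrightarrow> y \<in> K \<Longrightarrow> dist x y < d \<Longrightarrow> \<bar>D1 r x v - D1 r y v\<bar> \<le> \<epsilon>0 * norm v"
    "\<And>p N x y v w. adm p N \<Longrightarrow> x \<in> K \<Longrightarrow> y \<in> K \<Longrightarrow> dist x y < d \<Longrightarrow> \<bar>D2 (f0 p N) x v w - D2 (f0 p N) y v w\<bar> \<le> \<epsilon>0 * norm v * norm w"
    using uniform_modulus[OF \<epsilon>0] by metis
  define T1 where "T1 = min T (min (d / (2 * C)) (\<epsilon> * c2 / (2 * C\<^sup>2 * Q2)))"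
  have T1: "0 < T1" "T1 \<le> T" "T1 * C < d" "T1 * Q2 \<le> \<epsilon> * c2 / (2 * C\<^sup>2)"
  proof -
    show "0 < T1" using pos d(1) \<epsilon> c2_pos Q2 by (simp add: T1_def)
    have "T1 \<le> d / (2 * C)" by (simp add: T1_def)
    then have "T1 * C \<le> d / (2 * C) * C" by (rule mult_right_mono) (use pos in simp)
    then show "T1 * C < d" using d(1) pos by simp
    have "T1 \<le> \<epsilon> * c2 / (2 * C\<^sup>2 * Q2)" by (simp add: T1_def)
    then have "T1 * Q2 \<le> \<epsilon> * c2 / (2 * C\<^sup>2 * Q2) * Q2" by (rule mult_right_mono) (use Q2 in simp)
    then show "T1 * Q2 \<le> \<epsilon> * c2 / (2 * C\<^sup>2)" using Q2 by simp
  qed (simp add: T1_def)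
  have "\<bar>D2 g (p + \<sigma> *\<^sub>R N) v v\<bar> * (- r (p + \<sigma> *\<^sub>R N)) \<le> \<epsilon> * (norm v)\<^sup>2"
    if a: "adm p N" and \<sigma>: "0 < \<sigma>" "\<sigma> \<le> T1" for p N \<sigma> v
  proof -
    have \<sigma>T: "\<sigma> \<le> T" using \<sigma> T1 by simp
    define x where "x = p + \<sigma> *\<^sub>R N"
    define f where "f = f0 p N"
    define h where "h = h0 p N"
    define n where "n = norm v"
    note b = adm_base[OF a]
    have n: "n \<ge> 0" by (simp add: n_def)
    have x: "x \<in> \<Omega> \<inter> V" "x \<in> K" "x \<in> V"
      using adm_in[OF a \<sigma>(1) \<sigma>T] adm_point[OF a, of \<sigma>] \<sigma> \<sigma>T by (auto simp: x_def)
    have neg: "r x < 0" "\<rho> x < 0" using interior_set(4,5) x by auto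
    have rx: "c1 * \<sigma> \<le> - r x" "- r x \<le> C\<^sup>2 * \<sigma>" "c2 * \<sigma> \<le> - \<rho> x"
      using adm_r[OF a \<sigma>(1) \<sigma>T] adm_rho[OF a \<sigma>(1) \<sigma>T] by (auto simp: x_def)
    have seg: "p + \<theta> *\<^sub>R N \<in> K" "p + \<theta> *\<^sub>R N \<in> V" "dist (p + \<theta> *\<^sub>R N) p < d" "D1 r (p + \<theta> *\<^sub>R N) N \<le> - c1"
      if "0 \<le> \<theta>" "\<theta> \<le> \<sigma>" for \<theta>
    proof -
      show "p + \<theta> *\<^sub>R N \<in> K" "p + \<theta> *\<^sub>R N \<in> V" "D1 r (p + \<theta> *\<^sub>R N) N \<le> - c1"
        using adm_point[OF a, of \<theta>] that \<sigma>T by auto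
      have "\<theta> * norm N \<le> T1 * C" using that \<sigma> b(2) by (intro mult_mono) auto
      then show "dist (p + \<theta> *\<^sub>R N) p < d" using T1(3) that by (simp add: dist_norm)
    qed
    have xd: "dist x p < d" using seg(3)[of \<sigma>] \<sigma> by (simp add: x_def)
    note fe = f0_estimates[OF a \<sigma>(1) \<sigma>T M(5)[OF a] M(1)]
    obtain \<theta>1 where \<theta>1: "0 < \<theta>1" "\<theta>1 < \<sigma>" "D1 f x v = \<sigma> * D2 f (p + \<theta>1 *\<^sub>R N) v N"
      using fe(1)[of v] unfolding f_def x_def by blast
    obtain \<theta>2 where \<theta>2: "0 < \<theta>2" "\<theta>2 < \<sigma>" "f x = \<sigma>\<^sup>2 / 2 * D2 f (p + \<theta>2 *\<^sub>R N) N N"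
      using fe(3) unfolding f_def x_def by blast
    obtain \<theta>3 where \<theta>3: "0 < \<theta>3" "\<theta>3 < \<sigma>" "r x = \<sigma> * D1 r (p + \<theta>3 *\<^sub>R N) N"
      using MVT_line[OF \<sigma>(1), of r p N] r_differentiable seg(2) b(7) unfolding x_def by auto
    define d3 where "d3 = D1 r (p + \<theta>3 *\<^sub>R N) N"
    define dp where "dp = D1 r p N"
    have d3: "d3 \<le> - c1" using seg(4)[of \<theta>3] \<theta>3 by (simp add: d3_def)
    have dp: "dp \<le> - c1" using b(5) by (simp add: dp_def)
    \<comment> \<open>\<open>\<gamma>\<close> makes \<open>v - \<gamma> *\<^sub>R N\<close> tangent
      at \<open>p\<close>. \<open>\<gamma>'\<close> is its counterpart at \<open>x\<close>: with the
      mean value form of \<open>r x\<close> it equals \<open>\<sigma> * (D1 r x v / r x)\<close>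
      exactly.\<close>
    define \<gamma> where "\<gamma> = D1 r p v / dp"
    define \<gamma>' where "\<gamma>' = D1 r x v / d3"
    have Drx: "\<bar>D1 r x v\<bar> \<le> C * n" "\<bar>D1 r p v\<bar> \<le> C * n" using D1r[OF x(2), of v] D1r[OF b(3), of v] by (auto simp: n_def)
    have \<gamma>: "\<bar>\<gamma>\<bar> \<le> C / c1 * n" 
      unfolding \<gamma>_def abs_divide using frac_le[OF _ Drx(2) _, of c1 "\<bar>dp\<bar>"] dp pos n by simp
    have \<gamma>': "\<bar>\<gamma>'\<bar> \<le> C / c1 * n" 
      unfolding \<gamma>'_def abs_divide using frac_le[OF _ Drx(1) _, of c1 "\<bar>d3\<bar>"] d3 pos n by simp
    have \<gamma>\<gamma>: "\<bar>\<gamma>' - \<gamma>\<bar> \<le> \<epsilon>0 * (2 * C\<^sup>2 / c1\<^sup>2) * n"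
    proof -
      have ne: "d3 \<noteq> 0" "dp \<noteq> 0" using d3 dp pos by auto
      have e: "\<gamma>' - \<gamma> = ((D1 r x v - D1 r p v) * dp + D1 r p v * (dp - d3)) / (d3 * dp)"
        unfolding \<gamma>_def \<gamma>'_def using ne by (simp add: field_simps)
      have 1: "\<bar>D1 r x v - D1 r p v\<bar> \<le> \<epsilon>0 * n" using d(2)[OF x(2) b(3) xd] by (simp add: n_def)
      have "\<bar>d3 - dp\<bar> \<le> \<epsilon>0 * norm N" unfolding d3_def dp_def
        by (rule d(2)[OF seg(1) b(3) seg(3)]) (use \<theta>3 in auto)
      also have "\<dots> \<le> \<epsilon>0 * C" using b(2) \<epsilon>0 by simp
      finally have 2: "\<bar>dp - d3\<bar> \<le> \<epsilon>0 * C" by linarith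
      have "\<bar>dp\<bar> \<le> C * norm N" unfolding dp_def by (rule D1r[OF b(3)])
      also have "\<dots> \<le> C * C" using b(2) pos by simp
      finally have 3: "\<bar>dp\<bar> \<le> C * C" .
      have "\<bar>(D1 r x v - D1 r p v) * dp + D1 r p v * (dp - d3)\<bar> \<le> (\<epsilon>0 * n) * (C * C) + (C * n) * (\<epsilon>0 * C)"
        using mult_mono[OF 1 3] mult_mono[OF Drx(2) 2] n \<epsilon>0 pos
        by (intro order_trans[OF abs_triangle_ineq add_mono]) (auto simp: abs_mult)
      moreover have "c1\<^sup>2 \<le> \<bar>d3 * dp\<bar>"
        unfolding abs_mult power2_eq_square using d3 dp pos by (intro mult_mono) auto
      ultimately have "\<bar>\<gamma>' - \<gamma>\<bar> \<le> ((\<epsilon>0 * n) * (C * C) + (C * n) * (\<epsilon>0 * C)) / c1\<^sup>2"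
        unfolding e abs_divide using pos n \<epsilon>0 by (intro frac_le) auto
      then show ?thesis by (simp add: power2_eq_square algebra_simps)
    qed
    have fD: "\<bar>D2 f y w w' - D2 f p w w'\<bar> \<le> \<epsilon>0 * norm w * norm w'" if "y \<in> K" "dist y p < d" for y w w'
      unfolding f_def by (rule d(3)[OF a that(1) b(3) that(2)])
    define A where "A = D2 f p v N"
    define A' where "A' = D2 f (p + \<theta>1 *\<^sub>R N) v N"
    define B where "B = D2 f p N N"
    define B' where "B' = D2 f (p + \<theta>2 *\<^sub>R N) N N"
    have nC: "norm N \<le> C" by (rule b(2))
    have AA: "\<bar>A' - A\<bar> \<le> \<epsilon>0 * n * C"
    proof -
      have "\<bar>A' - A\<bar> \<le> \<epsilon>0 * n * norm N" unfolding A_def A'_def n_def by (rule fD[OF seg(1,3)]) (use \<theta>1 in auto)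
      also have "\<dots> \<le> \<epsilon>0 * n * C" by (rule mult_left_mono[OF nC]) (use n \<epsilon>0 in simp)
      finally show ?thesis .
    qed
    have BB: "\<bar>B' - B\<bar> \<le> \<epsilon>0 * C\<^sup>2"
    proof -
      have "\<bar>B' - B\<bar> \<le> \<epsilon>0 * norm N * norm N" using fD[OF seg(1,3), of \<theta>2 N N] \<theta>2 unfolding B_def B'_def by simp
      also have "\<dots> \<le> \<epsilon>0 * (C * C)" using nC \<epsilon>0 pos by (simp add: mult.assoc mult_mono)
      finally show ?thesis by (simp add: power2_eq_square)
    qed
    have Ab: "\<bar>A\<bar> \<le> M * C * n"
    proof -
      have "\<bar>A\<bar> \<le> M * n * norm N" using M(5)[OF a b(3), of v N] unfolding A_def n_def f_def .
      also have "\<dots> \<le> M * n * C" by (rule mult_left_mono[OF nC]) (use n M(1) in simp)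
      finally show ?thesis by (simp add: mult_ac)
    qed
    have Bb: "\<bar>B\<bar> \<le> M * C\<^sup>2"
    proof -
      have "\<bar>B\<bar> \<le> M * norm N * norm N" using M(5)[OF a b(3), of N N] unfolding B_def f_def .
      also have "\<dots> \<le> M * (C * C)" using nC M(1) pos by (simp add: mult.assoc mult_mono)
      finally show ?thesis by (simp add: power2_eq_square)
    qed
    define BR where "BR = D2 f x v v - 2 * \<gamma>' * A' + \<gamma>'\<^sup>2 * B'"
    have base0: "D2 f p v v - 2 * \<gamma> * A + \<gamma>\<^sup>2 * B = 0"
    proof -
      have "D1 r p (v - \<gamma> *\<^sub>R N) = 0"
        using b(6) by (simp add: D1_lin[OF r_differentiable[OF b(4)]] \<gamma>_def dp_def)
      then have "D2 f p (v - \<gamma> *\<^sub>R N) (v - \<gamma> *\<^sub>R N) = 0" unfolding f_def by (rule f0_D2_base[OF a])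
      then show ?thesis
        using D2_symmetric[OF f0_Ck V(1) b(4), of p N v N] unfolding A_def B_def f_def
        by (simp add: D2_lin[OF f0_Ck V(1) b(4)] power2_eq_square algebra_simps)
    qed
    have BRb: "\<bar>BR\<bar> \<le> \<epsilon>0 * Q * n\<^sup>2"
    proof -
      have 1: "\<bar>D2 f x v v - D2 f p v v\<bar> \<le> \<epsilon>0 * n\<^sup>2"
        using fD[OF x(2) xd, of v v] by (simp add: n_def power2_eq_square)
      have "\<bar>\<gamma>' * (A' - A)\<bar> \<le> (C / c1 * n) * (\<epsilon>0 * n * C)" "\<bar>(\<gamma>' - \<gamma>) * A\<bar> \<le> (\<epsilon>0 * (2 * C\<^sup>2 / c1\<^sup>2) * n) * (M * C * n)"
        unfolding abs_mult
        by (rule mult_mono[OF \<gamma>' AA]; use n pos \<epsilon>0 in simp) (rule mult_mono[OF \<gamma>\<gamma> Ab]; use n pos \<epsilon>0 in simp)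
      moreover have "\<gamma>' * A' - \<gamma> * A = \<gamma>' * (A' - A) + (\<gamma>' - \<gamma>) * A" by (simp add: algebra_simps)
      ultimately have 2: "\<bar>\<gamma>' * A' - \<gamma> * A\<bar> \<le> (C / c1 * n) * (\<epsilon>0 * n * C) + (\<epsilon>0 * (2 * C\<^sup>2 / c1\<^sup>2) * n) * (M * C * n)"
        by linarith
      have "\<bar>\<gamma>'\<^sup>2 * (B' - B)\<bar> \<le> (C / c1 * n)\<^sup>2 * (\<epsilon>0 * C\<^sup>2)"
      proof -
        have "\<gamma>'\<^sup>2 \<le> (C / c1 * n)\<^sup>2" using power_mono[OF \<gamma>', of 2] by simp
        from mult_mono[OF this BB] show ?thesis by (simp add: abs_mult)
      qed
      moreover have "\<bar>(\<gamma>' - \<gamma>) * (\<gamma>' + \<gamma>) * B\<bar> \<le> (\<epsilon>0 * (2 * C\<^sup>2 / c1\<^sup>2) * n) * (2 * (C / c1 * n)) * (M * C\<^sup>2)"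
        unfolding abs_mult using \<gamma>\<gamma> \<gamma> \<gamma>' Bb n pos \<epsilon>0 by (intro mult_mono) auto
      moreover have "\<gamma>'\<^sup>2 * B' - \<gamma>\<^sup>2 * B = \<gamma>'\<^sup>2 * (B' - B) + (\<gamma>' - \<gamma>) * (\<gamma>' + \<gamma>) * B"
        by (simp add: power2_eq_square algebra_simps)
      ultimately have 3: "\<bar>\<gamma>'\<^sup>2 * B' - \<gamma>\<^sup>2 * B\<bar> \<le> (C / c1 * n)\<^sup>2 * (\<epsilon>0 * C\<^sup>2) + (\<epsilon>0 * (2 * C\<^sup>2 / c1\<^sup>2) * n) * (2 * (C / c1 * n)) * (M * C\<^sup>2)"
        by linarith
      have "BR = (D2 f x v v - D2 f p v v) - 2 * (\<gamma>' * A' - \<gamma> * A) + (\<gamma>'\<^sup>2 * B' - \<gamma>\<^sup>2 * B)"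
        using base0 by (simp add: BR_def)
      then have "\<bar>BR\<bar> \<le> \<epsilon>0 * n\<^sup>2 + 2 * ((C / c1 * n) * (\<epsilon>0 * n * C) + (\<epsilon>0 * (2 * C\<^sup>2 / c1\<^sup>2) * n) * (M * C * n))
         + ((C / c1 * n)\<^sup>2 * (\<epsilon>0 * C\<^sup>2) + (\<epsilon>0 * (2 * C\<^sup>2 / c1\<^sup>2) * n) * (2 * (C / c1 * n)) * (M * C\<^sup>2))"
        using abs_combination_le[OF 1 2 3] by (simp only:)
      also have "\<dots> = \<epsilon>0 * Q * n\<^sup>2" by (simp add: Q_def power2_eq_square algebra_simps)
      finally show ?thesis .
    qed
    define k1 where "k1 = D1 r x v / r x"
    define k2 where "k2 = D1 \<rho> x v / \<rho> x"
    have kr: "D1 r x v = k1 * r x" "D1 \<rho> x v = k2 * \<rho> x" using neg by (auto simp: k1_def k2_def)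
    have gd: "D1 g x v = k1 - k2" "D2 g x v v = - D2 \<rho> x v v / \<rho> x + k2\<^sup>2 + D2 r x v v / r x - k1\<^sup>2"
      unfolding g_derivs[OF x(1)] k1_def k2_def by simp_all
    \<comment> \<open>The mean value forms of \<open>r x\<close>, \<open>D1 f x v\<close> and
      \<open>f x\<close> carry the factors \<open>\<sigma>\<close>, \<open>\<sigma>\<close> and
      \<open>\<sigma>\<^sup>2 / 2\<close>, which cancel the powers of \<open>k1\<close> up to
      \<open>\<gamma>'\<close>.\<close>
    have BR': "BR = D2 f x v v - 2 * D1 f x v * k1 + 2 * f x * k1\<^sup>2"
    proof -
      have k: "\<sigma> * k1 = \<gamma>'" using \<sigma>(1) d3 pos unfolding k1_def \<gamma>'_def \<theta>3(3) d3_def[symmetric] by simp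
      have "2 * D1 f x v * k1 = 2 * \<gamma>' * A'" unfolding \<theta>1(3) k[symmetric] A'_def by simp
      moreover have "2 * f x * k1\<^sup>2 = \<gamma>'\<^sup>2 * B'" unfolding \<theta>2(3) k[symmetric] B'_def by (simp add: power2_eq_square)
      ultimately show ?thesis by (simp add: BR_def)
    qed
    have fr: "\<rho> x = h * r x + f x" "D1 \<rho> x v = h * D1 r x v + D1 f x v" "D2 \<rho> x v v = h * D2 r x v v + D2 f x v v"
      using rho_f0[of x p N] f0_derivs[OF x(3), of p N] by (auto simp: f_def h_def)
    \<comment> \<open>Separately the squares of \<open>k1\<close> and \<open>k2\<close> may be as
      large as \<open>1 / \<sigma>\<^sup>2\<close>. Inserting \<open>\<rho> = h * r + f\<close>
      combines them into the bounded \<open>(D1 g x v)\<^sup>2\<close> and the terms of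
      \<open>BR\<close>.\<close>
    have main: "\<rho> x * D2 g x v v = - BR + f x / r x * D2 r x v v + \<rho> x * (D1 g x v)\<^sup>2"
    proof -
      have "\<rho> x * D2 g x v v = - D2 \<rho> x v v + \<rho> x * k2\<^sup>2 + \<rho> x * (D2 r x v v / r x) - \<rho> x * k1\<^sup>2"
        unfolding gd using neg by (simp add: field_simps)
      also have "\<rho> x * (D2 r x v v / r x) = h * D2 r x v v + f x / r x * D2 r x v v"
        unfolding fr(1) using neg by (simp add: field_simps)
      finally have 1: "\<rho> x * D2 g x v v = - D2 f x v v + \<rho> x * k2\<^sup>2 + f x / r x * D2 r x v v - \<rho> x * k1\<^sup>2"
        unfolding fr(3) by simp
      have Df: "D1 f x v = k2 * \<rho> x - h * (k1 * r x)" using fr(2) kr by simp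
      have fx: "f x = \<rho> x - h * r x" using fr(1) by simp
      have alg: "- D + R * k2\<^sup>2 + Y - R * k1\<^sup>2 = - (D - 2 * (k2 * R - h * (k1 * r')) * k1 + 2 * (R - h * r') * k1\<^sup>2) + Y + R * (k1 - k2)\<^sup>2"
        for D Y R r' :: real by (simp add: power2_eq_square algebra_simps)
      show ?thesis unfolding 1 BR' gd(1) alg[of _ _ _ "r x"] unfolding Df[symmetric] fx[symmetric] by simp
    qed
    have t1: "\<bar>f x / r x * D2 r x v v\<bar> \<le> \<sigma> * (M * C\<^sup>2 / c1 * M) * n\<^sup>2"
    proof -
      have "\<bar>f x\<bar> / \<bar>r x\<bar> \<le> \<sigma>\<^sup>2 * (M * C\<^sup>2) / (c1 * \<sigma>)"
        using fe(4) rx(1) neg pos \<sigma> M(1) unfolding f_def x_def by (intro frac_le) auto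
      also have "\<dots> = \<sigma> * (M * C\<^sup>2 / c1)" using \<sigma> by (simp add: power2_eq_square)
      finally have "\<bar>f x / r x\<bar> * \<bar>D2 r x v v\<bar> \<le> \<sigma> * (M * C\<^sup>2 / c1) * (M * n * n)"
        using M(4)[OF x(2), of v v] \<sigma> M(1) pos unfolding abs_divide n_def by (intro mult_mono) auto
      then show ?thesis by (simp add: abs_mult power2_eq_square mult_ac)
    qed
    have t2: "\<bar>\<rho> x * (D1 g x v)\<^sup>2\<bar> \<le> \<sigma> * ((H * C\<^sup>2 + T * (M * C\<^sup>2)) * Cg\<^sup>2) * n\<^sup>2"
    proof -
      have "\<bar>\<rho> x\<bar> \<le> h * \<bar>r x\<bar> + \<bar>f x\<bar>" unfolding fr(1) using h0_pos[OF a] abs_triangle_ineq[of "h * r x" "f x"] by (simp add: abs_mult h_def)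
      also have "\<dots> \<le> H * (C\<^sup>2 * \<sigma>) + \<sigma> * (T * (M * C\<^sup>2))"
      proof (intro add_mono mult_mono)
        show "h \<le> H" using M(3)[OF a] by (simp add: h_def)
        show "\<bar>r x\<bar> \<le> C\<^sup>2 * \<sigma>" using rx(2) neg by simp
        have "\<sigma>\<^sup>2 * (M * C\<^sup>2) \<le> \<sigma> * T * (M * C\<^sup>2)"
          using \<sigma> \<sigma>T M(1) pos unfolding power2_eq_square by (intro mult_right_mono mult_left_mono) auto
        then show "\<bar>f x\<bar> \<le> \<sigma> * (T * (M * C\<^sup>2))" using fe(4) unfolding f_def x_def by (simp add: mult.assoc)
      qed (use M(2) in auto)
      finally have 1: "\<bar>\<rho> x\<bar> \<le> \<sigma> * (H * C\<^sup>2 + T * (M * C\<^sup>2))" by (simp add: algebra_simps)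
      have "\<bar>D1 g x v\<bar> \<le> Cg * n" using Cg(2)[OF a \<sigma>(1) \<sigma>T, of v] by (simp add: x_def n_def)
      then have "(D1 g x v)\<^sup>2 \<le> (Cg * n)\<^sup>2" using power_mono[of "\<bar>D1 g x v\<bar>" "Cg * n" 2] by simp
      then have "\<bar>\<rho> x\<bar> * (D1 g x v)\<^sup>2 \<le> (\<sigma> * (H * C\<^sup>2 + T * (M * C\<^sup>2))) * (Cg * n)\<^sup>2"
        using 1 \<sigma> M pos by (intro mult_mono) auto
      then show ?thesis by (simp add: abs_mult power_mult_distrib mult_ac)
    qed
    have "\<bar>\<rho> x * D2 g x v v\<bar> \<le> \<epsilon>0 * Q * n\<^sup>2 + \<sigma> * (M * C\<^sup>2 / c1 * M) * n\<^sup>2 + \<sigma> * ((H * C\<^sup>2 + T * (M * C\<^sup>2)) * Cg\<^sup>2) * n\<^sup>2"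
      unfolding main using BRb t1 t2 by linarith
    also have "\<dots> = (\<epsilon>0 * Q + \<sigma> * Q2) * n\<^sup>2" by (simp add: Q2_def algebra_simps)
    also have "\<dots> \<le> (\<epsilon> * c2 / C\<^sup>2) * n\<^sup>2"
    proof (rule mult_right_mono)
      have "\<sigma> * Q2 \<le> T1 * Q2" using \<sigma> Q2 by simp
      moreover have "\<epsilon>0 * Q = \<epsilon> * c2 / (2 * C\<^sup>2)" using Q by (simp add: \<epsilon>0_def)
      ultimately show "\<epsilon>0 * Q + \<sigma> * Q2 \<le> \<epsilon> * c2 / C\<^sup>2" using T1(4) by simp
    qed simp
    finally have fin: "\<bar>\<rho> x\<bar> * \<bar>D2 g x v v\<bar> \<le> \<epsilon> * c2 / C\<^sup>2 * n\<^sup>2" by (simp add: abs_mult)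
    have "c2 * \<sigma> * \<bar>D2 g x v v\<bar> \<le> \<bar>\<rho> x\<bar> * \<bar>D2 g x v v\<bar>" using rx(3) neg by (intro mult_right_mono) auto
    then have "c2 * (\<sigma> * \<bar>D2 g x v v\<bar>) \<le> c2 * (\<epsilon> / C\<^sup>2 * n\<^sup>2)" using fin by (simp add: mult_ac)
    then have "\<sigma> * \<bar>D2 g x v v\<bar> \<le> \<epsilon> / C\<^sup>2 * n\<^sup>2" using c2_pos by (rule mult_left_le_imp_le)
    then have "C\<^sup>2 * (\<sigma> * \<bar>D2 g x v v\<bar>) \<le> C\<^sup>2 * (\<epsilon> / C\<^sup>2 * n\<^sup>2)" by (rule mult_left_mono) simp
    then have "C\<^sup>2 * \<sigma> * \<bar>D2 g x v v\<bar> \<le> \<epsilon> * n\<^sup>2" using pos by (simp add: mult.assoc)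
    moreover have "\<bar>D2 g x v v\<bar> * (- r x) \<le> \<bar>D2 g x v v\<bar> * (C\<^sup>2 * \<sigma>)" using rx(2) by (intro mult_left_mono) auto
    ultimately show ?thesis unfolding x_def n_def by (simp add: mult.commute)
  qed
  then show ?thesis using that T1(1,2) by blast
qed

lemma dd_tendsto:
  fixes f :: "complex ^ 'n \<Rightarrow> real"
  assumes "Ck_on 2 U f" "open U" "x \<in> U" "(X \<longlongrightarrow> x) F" "(W \<longlongrightarrow> w) F"
  shows "((\<lambda>n. dd f (X n) (W n)) \<longlongrightarrow> dd f x w) F"
proof -
  have J: "((\<lambda>n. J (W n)) \<longlongrightarrow> J w) F"
    unfolding vector_scalar_mult_def by (intro vec_tendstoI) (auto intro!: tendsto_intros assms(5))
  have f: "Ck_on (Suc 1) U f" using assms(1) by (simp add: numeral_2_eq_2)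
  show ?thesis unfolding dd_def
    by (intro tendsto_Complex tendsto_minus D1_tendsto[OF f assms(2-4)] assms(5) J)
qed

text \<open>Inside \<open>\<Omega>\<close>, \<open>u_psh\<close> gives
  \<open>levi \<rho> \<ge> 0\<close> on vectors annihilated by \<open>dd \<rho>\<close>, and
  correcting \<open>v\<close> by a multiple of \<open>N\<close> gives such vectors tending to
  \<open>v\<close>. In the limit \<open>levi \<rho> p v\<close> is \<open>h0 p N\<close> times
  \<open>levi r p v\<close>, since \<open>f0_D2_base\<close> applies to \<open>v\<close> and to
  \<open>J v\<close>.\<close>

lemma levi_base_nonneg:
  assumes a: "adm p N" and v: "dd r p v = 0"
  shows "levi r p v \<ge> 0"
proof -
  note b = adm_base[OF a]
  obtain s where s: "\<And>n. 0 < s n" "\<And>n. s n \<le> T" "s \<longlonglongrightarrow> 0" using sigma_seq by blast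
  define X where "X n = p + s n *\<^sub>R N" for n
  define W where "W n = v - (dd \<rho> (X n) v / dd \<rho> (X n) N) *s N" for n
  have XV: "X n \<in> \<Omega> \<inter> V" for n using adm_in[OF a s(1,2)] adm_point(2)[OF a _ s(2)] s(1)[of n] by (auto simp: X_def)
  have X: "X \<longlonglongrightarrow> p" unfolding X_def using tendsto_add[OF tendsto_const tendsto_scaleR[OF s(3) tendsto_const]] by fastforce
  have h: "D1 \<rho> p w = h0 p N * D1 r p w" for w
    using f0_D1_base[OF a, of w] f0_derivs(1)[OF b(4), of p N w] by simp
  have v0: "D1 r p v = 0" "D1 r p (J v) = 0" using v by (auto simp: dd_def complex_eq_iff)
  have dv: "dd \<rho> p v = 0" using v0 by (simp add: dd_def h complex_eq_iff)
  have dN: "dd \<rho> p N \<noteq> 0" using h[of N] h0_pos[OF a] b(6) by (auto simp: dd_def complex_eq_iff)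
  have quot: "(\<lambda>n. dd \<rho> (X n) v / dd \<rho> (X n) N) \<longlonglongrightarrow> 0"
    using tendsto_divide[OF dd_tendsto[OF \<rho>2 V(1) b(4) X tendsto_const[of v]] dd_tendsto[OF \<rho>2 V(1) b(4) X tendsto_const[of N]] dN] dv by simp
  have W: "W \<longlonglongrightarrow> v"
  proof -
    have "(\<lambda>n. (dd \<rho> (X n) v / dd \<rho> (X n) N) *s N) \<longlonglongrightarrow> 0 *s N"
    proof (rule vec_tendstoI)
      fix i
      show "(\<lambda>n. ((dd \<rho> (X n) v / dd \<rho> (X n) N) *s N) $ i) \<longlonglongrightarrow> (0 *s N) $ i"
        unfolding vector_smult_component by (rule tendsto_mult[OF quot tendsto_const])
    qed
    then show ?thesis unfolding W_def using tendsto_diff[OF tendsto_const] by fastforce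
  qed
  have JW: "(\<lambda>n. J (W n)) \<longlonglongrightarrow> J v"
    unfolding vector_scalar_mult_def by (intro vec_tendstoI) (auto intro!: tendsto_intros W)
  have ev: "\<forall>\<^sub>F n in sequentially. 0 \<le> levi \<rho> (X n) (W n)"
  proof -
    have "\<forall>\<^sub>F n in sequentially. dd \<rho> (X n) N \<noteq> 0"
      by (rule tendsto_imp_eventually_ne[OF dd_tendsto[OF \<rho>2 V(1) b(4) X tendsto_const] dN])
    then show ?thesis
    proof eventually_elim
      case (elim n)
      have d: "\<rho> differentiable (at (X n))" using Ck2D(1)[OF \<rho>2] XV by blast
      have 0: "dd \<rho> (X n) (W n) = 0" unfolding W_def dd_linear[OF d] using elim by simp
      have neg: "\<rho> (X n) < 0" using interior_set(5)[OF XV] .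
      have "dd (\<lambda>x. - ln (- \<rho> x)) (X n) (W n) = dd \<rho> (X n) (W n) / of_real (- \<rho> (X n))"
        "levi (\<lambda>x. - ln (- \<rho> x)) (X n) (W n) = levi \<rho> (X n) (W n) / (- \<rho> (X n)) + (norm (dd \<rho> (X n) (W n) / of_real (- \<rho> (X n))))\<^sup>2"
        by (rule levi_neg_log[OF interior_set(3,1) XV interior_set(5)]; assumption)+
      then have "0 \<le> levi \<rho> (X n) (W n) / (- \<rho> (X n))" using u_psh[OF XV[of n], of "W n"] 0 by simp
      then show ?case using neg by (simp add: divide_le_0_iff)
    qed
  qed
  have "(\<lambda>n. levi \<rho> (X n) (W n)) \<longlonglongrightarrow> levi \<rho> p v"
    unfolding levi_def by (intro tendsto_add D2_tendsto[OF \<rho>2 V(1) b(4) X] W JW)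
  then have "0 \<le> levi \<rho> p v" using ev tendsto_lowerbound trivial_limit_sequentially by blast
  moreover have "levi \<rho> p v = h0 p N * levi r p v"
    using f0_D2_base[OF a v0(1)] f0_D2_base[OF a v0(2)] unfolding f0_derivs(2)[OF b(4)] levi_def by (simp add: algebra_simps)
  ultimately show ?thesis using h0_pos[OF a] by (simp add: zero_le_mult_iff)
qed

end

section \<open>Levi forms along transversal segments\<close>

lemma Ck_linear_comp:
  fixes G :: "'x::real_normed_vector \<Rightarrow> 'a::euclidean_space" and L :: "'a \<Rightarrow> 'b::euclidean_space"
  assumes "open U" "linear L" "\<And>b. b \<in> Basis \<Longrightarrow> Ck_on k U (\<lambda>X. G X \<bullet> b)"
  shows "Ck_on k U (\<lambda>X. L (G X) \<bullet> c)"
proof -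
  have "linear (\<lambda>y. L y \<bullet> c)"
    by (rule linearI) (simp_all add: linear_add[OF assms(2)] linear_cmul[OF assms(2)] inner_add_left)
  then have "L (G X) \<bullet> c = (\<Sum>b\<in>Basis. (G X \<bullet> b) * (L b \<bullet> c))" for X
    using linear_basis_expansion[of "\<lambda>y. L y \<bullet> c" "G X"] by simp
  then show ?thesis
    by (simp only:) (intro Ck_on_sum Ck_on_mult Ck_on_const assms)
qed

lemma Ck_D1_comp:
  fixes F G :: "'x::real_normed_vector \<Rightarrow> 'a::euclidean_space"
  assumes U: "open U" and f: "Ck_on (Suc k) V f" and FV: "\<And>X. X \<in> U \<Longrightarrow> F X \<in> V"
    and F: "\<And>b. b \<in> Basis \<Longrightarrow> Ck_on k U (\<lambda>X. F X \<bullet> b)" and G: "\<And>b. b \<in> Basis \<Longrightarrow> Ck_on k U (\<lambda>X. G X \<bullet> b)"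
  shows "Ck_on k U (\<lambda>X. D1 f (F X) (G X))"
proof (rule Ck_on_cong[OF U])
  show "Ck_on k U (\<lambda>X. \<Sum>b\<in>Basis. (G X \<bullet> b) * D1 f (F X) b)"
    by (intro Ck_on_sum Ck_on_mult U G Ck_on_compose[OF U F Ck_on_SucD(2)[OF f] FV])
  show "(\<Sum>b\<in>Basis. (G X \<bullet> b) * D1 f (F X) b) = D1 f (F X) (G X)" if "X \<in> U" for X
    using D1_expand[OF Ck_on_SucD(3)[OF f FV[OF that]], of "G X"] by simp
qed

lemma Ck_D2_comp:
  fixes F G H :: "'x::real_normed_vector \<Rightarrow> 'a::euclidean_space"
  assumes U: "open U" "open V" and f: "Ck_on (Suc (Suc k)) V f" and FV: "\<And>X. X \<in> U \<Longrightarrow> F X \<in> V"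
    and F: "\<And>b. b \<in> Basis \<Longrightarrow> Ck_on k U (\<lambda>X. F X \<bullet> b)" and G: "\<And>b. b \<in> Basis \<Longrightarrow> Ck_on k U (\<lambda>X. G X \<bullet> b)"
    and H: "\<And>b. b \<in> Basis \<Longrightarrow> Ck_on k U (\<lambda>X. H X \<bullet> b)"
  shows "Ck_on k U (\<lambda>X. D2 f (F X) (G X) (H X))"
proof (rule Ck_on_cong[OF U(1)])
  have f2: "Ck_on 2 V f" by (rule Ck_on_mono[OF f]) simp
  show "Ck_on k U (\<lambda>X. \<Sum>b\<in>Basis. \<Sum>c\<in>Basis. (G X \<bullet> b) * (H X \<bullet> c) * D2 f (F X) b c)"
    by (intro Ck_on_sum Ck_on_mult U G H Ck_on_compose[OF U(1) F _ FV] Ck_on_SucD(2)[OF Ck_on_SucD(2)[OF f]])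
  show "(\<Sum>b\<in>Basis. \<Sum>c\<in>Basis. (G X \<bullet> b) * (H X \<bullet> c) * D2 f (F X) b c) = D2 f (F X) (G X) (H X)" if "X \<in> U" for X
    using D2_expand[OF f2 U(2) FV[OF that], of "G X" "H X"] by simp
qed

lemma continuous_on_D1_field:
  fixes f :: "'a::euclidean_space \<Rightarrow> real"
  assumes f: "Ck_on (Suc k) U f" and L: "continuous_on U L"
  shows "continuous_on U (\<lambda>x. D1 f x (L x))"
proof -
  have "continuous_on U (\<lambda>x. \<Sum>b\<in>Basis. (L x \<bullet> b) * D1 f x b)"
    by (intro continuous_on_sum continuous_on_mult continuous_on_inner L continuous_on_const Ck_on_continuous[OF Ck_on_SucD(2)[OF f]])
  then show ?thesis
    by (rule continuous_on_cong[THEN iffD1, OF refl, rotated]) (metis D1_expand Ck_on_SucD(3)[OF f])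
qed

lemma linear_J: "linear (J :: complex ^ 'n \<Rightarrow> complex ^ 'n)"
  by (rule linearI) (simp_all add: vector_add_ldistrib J_scaleR)

lemma levi_scale:
  fixes f :: "complex ^ 'n \<Rightarrow> real"
  assumes "Ck_on 2 U f" "open U" "x \<in> U"
  shows "levi f x (k *\<^sub>R w) = k\<^sup>2 * levi f x w"
  unfolding levi_def J_scaleR by (simp add: D2_lin[OF assms] power2_eq_square algebra_simps)

lemma Ck_on_inverse:
  assumes "open U" "Ck_on k U f" "\<And>X. X \<in> U \<Longrightarrow> f X > (0::real)"
  shows "Ck_on k U (\<lambda>X. inverse (f X))"
proof (rule Ck_on_cong[OF assms(1)])
  show "Ck_on k U (\<lambda>X. f X powr (-1))"
    by (rule Ck_on_compose_real[OF assms(1,2) Ck_on_powr]) (use assms(3) in simp)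
  show "f X powr (-1) = inverse (f X)" if "X \<in> U" for X
    using assms(3)[OF that] by (simp add: powr_minus)
qed

context collar
begin

text \<open>Corrects \<open>w\<close> by a complex multiple of \<open>N\<close> so that \<open>dd r x\<close> divided by \<open>- r x\<close> takes the prescribed value \<open>a\<close>.
  At a boundary point the corrected vector is complex tangential, where pseudoconvexity applies.\<close>

definition adjust :: "complex ^ 'n \<Rightarrow> complex ^ 'n \<Rightarrow> complex ^ 'n \<Rightarrow> complex \<Rightarrow> complex ^ 'n" where
  "adjust x N w a = w - ((dd r x w + a * of_real (r x)) / dd r x N) *s N"

lemma dd_adjust:
  assumes "x \<in> V" "D1 r x N < 0"
  shows "dd r x (adjust x N w a) = a * of_real (- r x)"
proof -
  have "dd r x N \<noteq> 0" using assms(2) by (auto simp: dd_def complex_eq_iff)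
  then show ?thesis unfolding adjust_def dd_linear[OF r_differentiable[OF assms(1)]] by simp
qed

text \<open>Real homogeneity reduces the comparison of Levi forms to \<open>norm w \<le> 1\<close>
  and \<open>norm a \<le> 1\<close>, that is, to compact data.\<close>

lemma adjust_scale:
  assumes "x \<in> V"
  shows "adjust x N (k *\<^sub>R w) (of_real k * a) = k *\<^sub>R adjust x N w a"
proof -
  have e: "k *\<^sub>R w = of_real k *s w" for k and w :: "complex ^ 'n" by (simp add: vec_eq_iff complex_eq_iff)
  have "of_real k * dd r x w + of_real k * a * of_real (r x) = of_real k * (dd r x w + a * of_real (r x))"
    by (simp add: algebra_simps)
  then show ?thesis unfolding adjust_def e dd_linear[OF r_differentiable[OF assms]]
    by (simp only: vector_ssub_ldistrib vector_smult_assoc times_divide_eq_right)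
qed

type_synonym 'm quad = "(complex ^ 'm) \<times> (complex ^ 'm) \<times> (complex ^ 'm) \<times> complex"

text \<open>All data are variables here, so that compactness yields estimates that are uniform in them.\<close>

definition Psi :: "'n quad \<Rightarrow> real" where
  "Psi X = (case X of (x, N, w, a) \<Rightarrow> levi r x (adjust x N w a))"

definition dom :: "'n quad set" where
  "dom = {X. fst X \<in> V \<and> D1 r (fst X) (fst (snd X)) < 0}"

lemma Ck_linear_component: "bounded_linear L \<Longrightarrow> Ck_on k U (\<lambda>X. L X \<bullet> b)"
  by (rule Ck_on_linear[OF bounded_linear_inner_left_comp])

lemma blins: "bounded_linear (\<lambda>X :: 'n quad. fst X)" "bounded_linear (\<lambda>X :: 'n quad. fst (snd X))"
   "bounded_linear (\<lambda>X :: 'n quad. fst (snd (snd X)))" "bounded_linear (\<lambda>X :: 'n quad. Re (snd (snd (snd X))))"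
   "bounded_linear (\<lambda>X :: 'n quad. Im (snd (snd (snd X))))"
proof -
  note s1 = bounded_linear_snd and s2 = bounded_linear_snd_comp[OF bounded_linear_snd]
  note s3 = bounded_linear_snd_comp[OF s2]
  show "bounded_linear (\<lambda>X :: 'n quad. fst X)" by (rule bounded_linear_fst)
  show "bounded_linear (\<lambda>X :: 'n quad. fst (snd X))" by (rule bounded_linear_fst_comp[OF s1])
  show "bounded_linear (\<lambda>X :: 'n quad. fst (snd (snd X)))" by (rule bounded_linear_fst_comp[OF s2])
  show "bounded_linear (\<lambda>X :: 'n quad. Re (snd (snd (snd X))))" by (rule bounded_linear_compose[OF bounded_linear_Re s3])
  show "bounded_linear (\<lambda>X :: 'n quad. Im (snd (snd (snd X))))" by (rule bounded_linear_compose[OF bounded_linear_Im s3])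
qed

lemma slope_Ck: "Ck_on 2 {X. fst X \<in> V} (\<lambda>X :: 'n quad. D1 r (fst X) (fst (snd X)))"
proof (rule Ck_D1_comp)
  show "open {X :: 'n quad. fst X \<in> V}"
    using open_vimage[OF V(1), of "fst :: 'n quad \<Rightarrow> _"] by (simp add: vimage_def continuous_intros)
  show "Ck_on (Suc 2) V r" using r3 by (simp add: numeral_3_eq_3 numeral_2_eq_2)
qed (auto intro: Ck_linear_component[OF blins(1)] Ck_linear_component[OF blins(2)])

lemma open_dom: "open dom"
proof -
  have 1: "open {X :: 'n quad. fst X \<in> V}"
    using open_vimage[OF V(1), of "fst :: 'n quad \<Rightarrow> _"] by (simp add: vimage_def continuous_intros)
  have "open ({X :: 'n quad. fst X \<in> V} \<inter> (\<lambda>X. D1 r (fst X) (fst (snd X))) -` {..<0})"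
    by (rule continuous_open_preimage[OF Ck_on_continuous[OF slope_Ck] 1]) simp
  moreover have "dom = {X :: 'n quad. fst X \<in> V} \<inter> (\<lambda>X. D1 r (fst X) (fst (snd X))) -` {..<0}"
    by (auto simp: dom_def)
  ultimately show ?thesis by simp
qed

text \<open>The Levi form consumes two of the three derivatives of \<open>r\<close>. The complex
  quotient in \<open>adjust\<close> is written out as real and imaginary parts \<open>q1\<close> and
  \<open>q2\<close>, because \<open>Ck_on\<close> covers real-valued functions only.\<close>

lemma Psi_Ck: "Ck_on 1 dom Psi"
proof -
  have r3': "Ck_on (Suc (Suc 1)) V r" using r3 by (simp add: numeral_3_eq_3)
  have r2': "Ck_on (Suc 1) V r" using r2 by (simp add: numeral_2_eq_2)
  note Lc = Ck_linear_component[OF blins(1)] Ck_linear_component[OF blins(2)] Ck_linear_component[OF blins(3)]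
  note Jc = Ck_linear_comp[OF open_dom linear_J Lc(2)] Ck_linear_comp[OF open_dom linear_J Lc(3)]
  have inV: "fst X \<in> V" if "X \<in> dom" for X using that by (simp add: dom_def)
  define A where "A X = D1 r (fst X) (fst (snd (snd X))) + Re (snd (snd (snd X))) * r (fst X)" for X :: "'n quad"
  define B where "B X = - D1 r (fst X) (J (fst (snd (snd X)))) + Im (snd (snd (snd X))) * r (fst X)" for X :: "'n quad"
  define E where "E X = D1 r (fst X) (fst (snd X))" for X :: "'n quad"
  define F where "F X = - D1 r (fst X) (J (fst (snd X)))" for X :: "'n quad"
  have rc: "Ck_on 1 dom (\<lambda>X. r (fst X))"
    by (rule Ck_on_compose[OF open_dom Lc(1) Ck_on_Suc_imp[OF r2'] inV])
  have AB: "Ck_on 1 dom A" "Ck_on 1 dom B" "Ck_on 1 dom E" "Ck_on 1 dom F"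
    unfolding A_def B_def E_def F_def
    by (intro Ck_on_add Ck_on_mult Ck_on_uminus open_dom rc Ck_D1_comp[OF open_dom r2' inV Lc(1)] Lc Jc Ck_on_linear blins; assumption)+
  define P where "P X = inverse (E X * E X + F X * F X)" for X
  have P: "Ck_on 1 dom P"
    unfolding P_def
  proof (intro Ck_on_inverse Ck_on_add Ck_on_mult AB open_dom)
    fix X assume "X \<in> dom"
    then have "E X \<noteq> 0" by (auto simp: dom_def E_def)
    then show "E X * E X + F X * F X > 0" by (intro add_pos_nonneg) (auto simp: zero_less_mult_iff linorder_neq_iff)
  qed
  define q1 where "q1 X = (A X * E X + B X * F X) * P X" for X
  define q2 where "q2 X = (B X * E X - A X * F X) * P X" for X
  have q: "Ck_on 1 dom q1" "Ck_on 1 dom q2"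
    unfolding q1_def q2_def by (intro Ck_on_mult Ck_on_add Ck_on_diff AB P open_dom)+
  define W where "W X = fst (snd (snd X)) - (q1 X *\<^sub>R fst (snd X) + q2 X *\<^sub>R J (fst (snd X)))" for X :: "'n quad"
  have Wadj: "W (x, N, w, a) = adjust x N w a" for x N w a
  proof -
    let ?X = "(x, N, w, a) :: 'n quad"
    have 1: "dd r x w + a * of_real (r x) = Complex (A ?X) (B ?X)" "dd r x N = Complex (E ?X) (F ?X)"
      by (auto simp: dd_def A_def B_def E_def F_def complex_eq_iff)
    have "Complex (A ?X) (B ?X) / Complex (E ?X) (F ?X) = Complex (q1 ?X) (q2 ?X)"
      by (simp add: complex_eq_iff Re_divide Im_divide q1_def q2_def P_def divide_inverse power2_eq_square algebra_simps)
    then show ?thesis unfolding adjust_def 1 W_def by (simp add: complex_scalar_mult_eq[of "Complex _ _"])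
  qed
  have Wc: "Ck_on 1 dom (\<lambda>X. W X \<bullet> b)" for b
    unfolding W_def inner_diff_left inner_add_left inner_scaleR_left
    by (intro Ck_on_diff Ck_on_add Ck_on_mult q open_dom Lc Jc)
  have PsiW: "Psi = (\<lambda>X. D2 r (fst X) (W X) (W X) + D2 r (fst X) (J (W X)) (J (W X)))"
    unfolding Psi_def levi_def by (auto simp: fun_eq_iff Wadj)
  show ?thesis unfolding PsiW
    by (intro Ck_on_add open_dom Ck_D2_comp[OF open_dom V(1) r3' inV Lc(1)] Wc Ck_linear_comp[OF open_dom linear_J Wc]; assumption)
qed

text \<open>By Cauchy's mean value theorem the quotient at \<open>\<sigma>\<close> is \<open>\<Psi>(0) / R(\<sigma>) + \<Gamma>(\<xi>)\<close> with \<open>R = - r\<close> and \<open>\<xi> < \<sigma>\<close>. As \<open>\<Psi>(0) \<ge> 0\<close>,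
  the first term decreases in \<open>\<sigma>\<close>, and \<open>\<Gamma>\<close> is uniformly continuous.\<close>

lemma levi_comparison:
  assumes \<epsilon>: "\<epsilon> > 0"
  obtains T2 where "0 < T2" "T2 \<le> T" "\<And>p N s1 s2 w a. adm p N \<Longrightarrow> 0 < s1 \<Longrightarrow> s1 \<le> s2 \<Longrightarrow> s2 \<le> T2 \<Longrightarrow>
     levi r (p + s2 *\<^sub>R N) (adjust (p + s2 *\<^sub>R N) N w a) / (- r (p + s2 *\<^sub>R N)) \<le>
     levi r (p + s1 *\<^sub>R N) (adjust (p + s1 *\<^sub>R N) N w a) / (- r (p + s1 *\<^sub>R N)) + \<epsilon> * (norm w + norm a)\<^sup>2"
proof -
  define Q :: "'n quad set" where "Q = {X \<in> K \<times> (cball 0 C \<times> (cball 0 1 \<times> cball (0::complex) 1)). D1 r (fst X) (fst (snd X)) \<le> - c1}"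
  have Qdom: "Q \<subseteq> dom" using K(2) pos by (auto simp: Q_def dom_def)
  have Qc: "compact Q"
  proof -
    have KC: "compact (K \<times> (cball (0::complex ^ 'n) C \<times> (cball (0::complex ^ 'n) 1 \<times> cball (0::complex) 1)))"
      by (intro compact_Times K(1) compact_cball)
    have "closedin (top_of_set (K \<times> (cball (0::complex ^ 'n) C \<times> (cball (0::complex ^ 'n) 1 \<times> cball (0::complex) 1))))
        (K \<times> (cball 0 C \<times> (cball 0 1 \<times> cball 0 1)) \<inter> (\<lambda>X. D1 r (fst X) (fst (snd X))) -` {.. - c1})"
      by (rule continuous_closedin_preimage[OF continuous_on_subset[OF Ck_on_continuous[OF slope_Ck]]]) (use K(2) in auto)
    from closedin_compact[OF KC this] show ?thesis by (simp add: Q_def Int_def vimage_def)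
  qed
  \<comment> \<open>The derivative of \<open>Psi\<close> along the segment divided by that of
    \<open>- r\<close>.\<close>
  define \<Gamma> where "\<Gamma> X = D1 Psi X (fst (snd X), 0, 0, 0) / (- D1 r (fst X) (fst (snd X)))" for X :: "'n quad"
  have "continuous_on dom \<Gamma>"
    unfolding \<Gamma>_def
  proof (intro continuous_on_divide continuous_on_minus)
    show "continuous_on dom (\<lambda>X. D1 Psi X (fst (snd X), 0, 0, 0))"
      by (rule continuous_on_D1_field[of 0]) (use Psi_Ck in \<open>auto intro!: continuous_intros\<close>)
    show "continuous_on dom (\<lambda>X. D1 r (fst X) (fst (snd X)))"
      by (rule continuous_on_subset[OF Ck_on_continuous[OF slope_Ck]]) (auto simp: dom_def)
  qed (auto simp: dom_def)
  then have "uniformly_continuous_on Q \<Gamma>"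
    by (intro compact_uniformly_continuous Qc continuous_on_subset[OF _ Qdom])
  then obtain d where d: "d > 0" "\<And>X Y. X \<in> Q \<Longrightarrow> Y \<in> Q \<Longrightarrow> dist Y X < d \<Longrightarrow> dist (\<Gamma> Y) (\<Gamma> X) < \<epsilon>"
    unfolding uniformly_continuous_on_def using \<epsilon> by metis
  define T2 where "T2 = min T (d / (2 * C))"
  have T2: "T2 > 0" "T2 \<le> T" "T2 * C < d"
  proof -
    show "T2 > 0" using pos d(1) by (simp add: T2_def)
    have "T2 \<le> d / (2 * C)" by (simp add: T2_def)
    then have "T2 * C \<le> d / (2 * C) * C" by (rule mult_right_mono) (use pos in simp)
    then show "T2 * C < d" using d(1) pos by simp
  qed (simp add: T2_def)
  have unit: "levi r (p + s2 *\<^sub>R N) (adjust (p + s2 *\<^sub>R N) N w a) / (- r (p + s2 *\<^sub>R N)) \<le>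
     levi r (p + s1 *\<^sub>R N) (adjust (p + s1 *\<^sub>R N) N w a) / (- r (p + s1 *\<^sub>R N)) + \<epsilon>"
    if a: "adm p N" and s: "0 < s1" "s1 \<le> s2" "s2 \<le> T2" and wa: "norm w \<le> 1" "norm a \<le> 1" for p N s1 s2 w a
  proof -
    note b = adm_base[OF a]
    define X where "X s = (p + s *\<^sub>R N, N, w, a)" for s
    define R where "R s = - r (p + s *\<^sub>R N)" for s
    have Xs: "X s = X 0 + s *\<^sub>R (N, 0, 0, 0)" for s by (simp add: X_def)
    have XQ: "X s \<in> Q" if "0 \<le> s" "s \<le> s2" for s
      using adm_point[OF a, of s] that s T2(2) b(2) wa by (auto simp: Q_def X_def)
    have dPsi: "((\<lambda>s. Psi (X s)) has_real_derivative D1 Psi (X s) (N, 0, 0, 0)) (at s)" if "0 \<le> s" "s \<le> s2" for s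
    proof -
      have "Psi differentiable (at (X 0 + s *\<^sub>R (N, 0, 0, 0)))"
        using Psi_Ck XQ[OF that] Qdom unfolding Xs[of s] by auto
      from has_derivative_along_line[OF this] show ?thesis unfolding Xs[symmetric] .
    qed
    have dR: "(R has_real_derivative - D1 r (p + s *\<^sub>R N) N) (at s)" if "0 \<le> s" "s \<le> s2" for s
      unfolding R_def[abs_def]
      by (intro DERIV_minus has_derivative_along_line r_differentiable adm_point(2)[OF a]) (use that s T2(2) in auto)
    have R0: "R 0 = 0" using b(7) by (simp add: R_def)
    have Rpos: "R s > 0" if "0 < s" "s \<le> s2" for s
    proof -
      have "c1 * s > 0" using pos that by simp
      then show ?thesis using adm_r(1)[OF a that(1)] that s T2(2) by (simp add: R_def)
    qed
    have gm: "\<exists>\<xi>. 0 < \<xi> \<and> \<xi> < s \<and> Psi (X s) / R s = Psi (X 0) / R s + \<Gamma> (X \<xi>)" if "0 < s" "s \<le> s2" for s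
    proof -
      have "\<exists>\<xi>. 0 < \<xi> \<and> \<xi> < s \<and> (Psi (X s) - Psi (X 0)) * (- D1 r (p + \<xi> *\<^sub>R N) N) = (R s - R 0) * D1 Psi (X \<xi>) (N, 0, 0, 0)"
      proof (rule GMVT'[OF that(1)])
        fix z assume "0 \<le> z" "z \<le> s"
        then have z: "0 \<le> z" "z \<le> s2" using that by auto
        show "isCont (\<lambda>a. Psi (X a)) z" "isCont R z"
          using DERIV_isCont[OF dPsi[OF z]] DERIV_isCont[OF dR[OF z]] by auto
      qed (use dPsi dR that in auto)
      then obtain \<xi> where \<xi>: "0 < \<xi>" "\<xi> < s" "(Psi (X s) - Psi (X 0)) * (- D1 r (p + \<xi> *\<^sub>R N) N) = R s * D1 Psi (X \<xi>) (N, 0, 0, 0)"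
        using R0 by auto
      have ne: "- D1 r (p + \<xi> *\<^sub>R N) N \<noteq> 0" using adm_point(3)[OF a, of \<xi>] \<xi> that s T2(2) pos by auto
      have "Psi (X s) - Psi (X 0) = R s * \<Gamma> (X \<xi>)"
        using \<xi>(3) ne unfolding \<Gamma>_def by (simp add: X_def field_simps)
      then have "Psi (X s) = Psi (X 0) + R s * \<Gamma> (X \<xi>)" by simp
      then have "Psi (X s) / R s = Psi (X 0) / R s + \<Gamma> (X \<xi>)" using Rpos[OF that] by (simp add: add_divide_distrib)
      then show ?thesis using \<xi> by blast
    qed
    obtain \<xi>1 where \<xi>1: "0 < \<xi>1" "\<xi>1 < s1" "Psi (X s1) / R s1 = Psi (X 0) / R s1 + \<Gamma> (X \<xi>1)" using gm[of s1] s by auto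
    obtain \<xi>2 where \<xi>2: "0 < \<xi>2" "\<xi>2 < s2" "Psi (X s2) / R s2 = Psi (X 0) / R s2 + \<Gamma> (X \<xi>2)" using gm[of s2] s by auto
    have Psi0: "Psi (X 0) \<ge> 0"
      using levi_base_nonneg[OF a, of "adjust p N w a"] dd_adjust[OF b(4,6)] b(7) by (simp add: Psi_def X_def)
    have "R s1 \<le> R s2"
    proof (rule DERIV_nonneg_imp_nondecreasing[OF s(2)])
      fix x assume x: "s1 \<le> x" "x \<le> s2"
      show "\<exists>y. (R has_real_derivative y) (at x) \<and> 0 \<le> y"
        using dR[of x] adm_point(3)[OF a, of x] x s T2(2) pos by (intro exI[of _ "- D1 r (p + x *\<^sub>R N) N"]) auto
    qed
    then have "Psi (X 0) / R s2 \<le> Psi (X 0) / R s1" using Psi0 Rpos[of s1] s by (intro divide_left_mono) auto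
    moreover have "dist (\<Gamma> (X \<xi>2)) (\<Gamma> (X \<xi>1)) < \<epsilon>"
    proof (rule d(2))
      show "X \<xi>1 \<in> Q" "X \<xi>2 \<in> Q" using XQ \<xi>1 \<xi>2 s by auto
      have "dist (X \<xi>2) (X \<xi>1) = \<bar>\<xi>2 - \<xi>1\<bar> * norm N" by (simp add: X_def dist_Pair_Pair dist_norm flip: scaleR_left_diff_distrib)
      also have "\<dots> \<le> T2 * C" using \<xi>1 \<xi>2 s b(2) by (intro mult_mono) auto
      finally show "dist (X \<xi>2) (X \<xi>1) < d" using T2(3) by simp
    qed
    ultimately have "Psi (X s2) / R s2 \<le> Psi (X s1) / R s1 + \<epsilon>"
      using \<xi>1(3) \<xi>2(3) by (simp add: dist_real_def abs_less_iff)
    then show ?thesis by (simp add: Psi_def X_def R_def)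
  qed
  show ?thesis
  proof (rule that[OF T2(1,2)])
    fix p N w :: "complex ^ 'n" and s1 s2 :: real and a :: complex
    assume a: "adm p N" and s: "0 < s1" "s1 \<le> s2" "s2 \<le> T2"
    define k where "k = norm w + norm a"
    have xV: "p + s1 *\<^sub>R N \<in> V" "p + s2 *\<^sub>R N \<in> V" using adm_point(2)[OF a] s T2(2) by auto
    show "levi r (p + s2 *\<^sub>R N) (adjust (p + s2 *\<^sub>R N) N w a) / (- r (p + s2 *\<^sub>R N)) \<le>
     levi r (p + s1 *\<^sub>R N) (adjust (p + s1 *\<^sub>R N) N w a) / (- r (p + s1 *\<^sub>R N)) + \<epsilon> * (norm w + norm a)\<^sup>2"
    proof (cases "k = 0")
      case True
      then have "w = 0" "a = 0" by (auto simp: k_def add_nonneg_eq_0_iff)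
      then have "adjust x N w a = 0" if "x \<in> V" for x
        using adjust_scale[OF that, of N 0 w a] by simp
      moreover have "levi r x 0 = 0" if "x \<in> V" for x using levi_scale[OF r2 V(1) that, of 0 0] by simp
      ultimately show ?thesis using xV \<epsilon> by simp
    next
      case False
      then have k: "k > 0" by (simp add: k_def add_nonneg_nonneg less_le)
      define w' where "w' = w /\<^sub>R k"
      define a' where "a' = a / of_real k"
      have wk: "w = k *\<^sub>R w'" "a = of_real k * a'" using k by (auto simp: w'_def a'_def)
      have nk: "norm w' = norm w / k" "norm a' = norm a / k"
        using k by (simp_all add: w'_def a'_def norm_divide divide_inverse_commute[of "norm w"])
      have "norm w \<le> k" "norm a \<le> k" by (simp_all add: k_def)
      then have "norm w' \<le> 1" "norm a' \<le> 1" unfolding nk using k by simp_all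
      note u = unit[OF a s this]
      have "levi r x (adjust x N w a) = k\<^sup>2 * levi r x (adjust x N w' a')" if "x \<in> V" for x
        unfolding wk adjust_scale[OF that] levi_scale[OF r2 V(1) that] ..
      note l = this[OF xV(1)] this[OF xV(2)]
      have "k\<^sup>2 * (levi r (p + s2 *\<^sub>R N) (adjust (p + s2 *\<^sub>R N) N w' a') / (- r (p + s2 *\<^sub>R N))) \<le>
        k\<^sup>2 * (levi r (p + s1 *\<^sub>R N) (adjust (p + s1 *\<^sub>R N) N w' a') / (- r (p + s1 *\<^sub>R N)) + \<epsilon>)"
        by (rule mult_left_mono[OF u]) simp
      then show ?thesis unfolding l k_def[symmetric] by (simp only: distrib_left times_divide_eq_right mult.commute[of \<epsilon>])
    qed
  qed
qed

end

section \<open>The ratio pulled inwards\<close>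

text \<open>The real arithmetic behind \<open>main_estimate\<close>. \<open>Hq\<close> and
  \<open>Hz\<close> stand for the Levi form of \<open>r\<close> over \<open>- r\<close> at the
  shifted and the original point, \<open>Gq\<close> and \<open>Gz\<close> for the Levi forms of
  \<open>g\<close> and its pullback, \<open>A\<close> for \<open>(norm a)\<^sup>2\<close>,
  \<open>X\<close> and \<open>Y\<close> for the norms of the two gradient terms, \<open>S\<close>
  for \<open>norm w + norm a\<close>. Half of the gap \<open>\<eta> - \<eta>''\<close> pays for
  Young's inequality, and the other half absorbs the \<open>X\<^sup>2\<close> part of
  \<open>S\<^sup>2\<close>.\<close>

lemma estimate_assembly:
  fixes X Y S n A :: real
  assumes H: "\<eta> * X\<^sup>2 \<le> Hq + A + Gq" "Hq \<le> Hz + e2 * S\<^sup>2" "Gq - e' * S\<^sup>2 \<le> Gz"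
    and Y: "0 \<le> Y" "Y \<le> X + y * S" and \<kappa>: "\<kappa> > 0" "\<eta>'' > 0" "\<eta>'' * (1 + \<kappa>) = (\<eta> + \<eta>'') / 2"
    and es: "e2 + e' + \<eta>'' * (1 + 1 / \<kappa>) * y\<^sup>2 \<le> es" "es \<le> (\<eta> - \<eta>'') / 16" "es * (8 * k) \<le> \<tau>" "0 \<le> es"
    and S: "S\<^sup>2 \<le> 8 * X\<^sup>2 + 8 * k * n\<^sup>2"
  shows "- \<tau> * n\<^sup>2 \<le> Hz + A + Gz - \<eta>'' * Y\<^sup>2"
proof -
  have young: "(X + y * S)\<^sup>2 \<le> (1 + \<kappa>) * X\<^sup>2 + (1 + 1 / \<kappa>) * (y * S)\<^sup>2"
  proof -
    have "0 \<le> (sqrt \<kappa> * X - y * S / sqrt \<kappa>)\<^sup>2" by simp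
    also have "\<dots> = \<kappa> * X\<^sup>2 - 2 * X * (y * S) + (y * S)\<^sup>2 / \<kappa>"
      using \<kappa>(1) by (simp add: power2_diff power_mult_distrib power_divide)
    finally show ?thesis by (simp add: power2_sum algebra_simps)
  qed
  have "Y\<^sup>2 \<le> (X + y * S)\<^sup>2" using Y by (intro power_mono)
  then have "\<eta>'' * Y\<^sup>2 \<le> \<eta>'' * ((1 + \<kappa>) * X\<^sup>2 + (1 + 1 / \<kappa>) * (y * S)\<^sup>2)"
    using young \<kappa>(2) by (intro mult_left_mono) auto
  also have "\<dots> = (\<eta> + \<eta>'') / 2 * X\<^sup>2 + \<eta>'' * (1 + 1 / \<kappa>) * y\<^sup>2 * S\<^sup>2"
    unfolding \<kappa>(3)[symmetric] by (simp add: power_mult_distrib algebra_simps)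
  finally have 1: "\<eta>'' * Y\<^sup>2 \<le> (\<eta> + \<eta>'') / 2 * X\<^sup>2 + \<eta>'' * (1 + 1 / \<kappa>) * y\<^sup>2 * S\<^sup>2" .
  have "(e2 + e' + \<eta>'' * (1 + 1 / \<kappa>) * y\<^sup>2) * S\<^sup>2 \<le> es * S\<^sup>2" using es(1) by (rule mult_right_mono) simp
  also have "\<dots> \<le> es * (8 * X\<^sup>2 + 8 * k * n\<^sup>2)" using S es(4) by (rule mult_left_mono)
  also have "\<dots> = (es * 8) * X\<^sup>2 + es * (8 * k) * n\<^sup>2" by (simp add: algebra_simps)
  also have "\<dots> \<le> ((\<eta> - \<eta>'') / 2) * X\<^sup>2 + \<tau> * n\<^sup>2"
    using es(2,3) by (intro add_mono mult_right_mono) auto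
  finally have 2: "(e2 + e' + \<eta>'' * (1 + 1 / \<kappa>) * y\<^sup>2) * S\<^sup>2 \<le> ((\<eta> - \<eta>'') / 2) * X\<^sup>2 + \<tau> * n\<^sup>2" .
  have 3: "\<eta> * X\<^sup>2 = (\<eta> + \<eta>'') / 2 * X\<^sup>2 + ((\<eta> - \<eta>'') / 2) * X\<^sup>2" by (simp add: algebra_simps flip: add_divide_distrib)
  have "e2 * S\<^sup>2 + e' * S\<^sup>2 + \<eta>'' * (1 + 1 / \<kappa>) * y\<^sup>2 * S\<^sup>2 \<le> ((\<eta> - \<eta>'') / 2) * X\<^sup>2 + \<tau> * n\<^sup>2"
    using 2 by (simp only: distrib_right)
  then show ?thesis using H 1 3 by linarith
qed

lemma norm_dd_diff_le:
  assumes "\<bar>a - a'\<bar> \<le> e" "\<bar>b - b'\<bar> \<le> (e :: real)"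
  shows "norm (Complex a (- b) - Complex a' (- b')) \<le> 2 * e"
  using assms cmod_le[of "Complex a (- b) - Complex a' (- b')"] by simp

context collar
begin

definition DN :: "complex ^ 'n \<Rightarrow> complex ^ 'n \<Rightarrow> complex ^ 'n" where
  "DN x w = (\<Sum>b\<in>Basis. D1 (\<lambda>x. nu x \<bullet> b) x w *\<^sub>R b)"

definition DDN :: "complex ^ 'n \<Rightarrow> complex ^ 'n \<Rightarrow> complex ^ 'n" where
  "DDN x w = (\<Sum>b\<in>Basis. D2 (\<lambda>x. nu x \<bullet> b) x w w *\<^sub>R b)"

lemma DN_bounds:
  obtains M where "M > 0" "\<And>x w. x \<in> K \<Longrightarrow> norm (DN x w) \<le> M * norm w" "\<And>x w. x \<in> K \<Longrightarrow> norm (DDN x w) \<le> M * (norm w)\<^sup>2"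
proof -
  have "\<forall>b\<in>Basis. \<exists>A>0. \<forall>x\<in>K. \<forall>v. \<bar>D1 (\<lambda>x. nu x \<bullet> b) x v\<bar> \<le> A * norm v"
    using D1_bounded[of 1 V _ K] nu_Ck K by (auto simp: numeral_2_eq_2 simp del: Ck_on.simps)
  then obtain A where A: "\<And>b. b \<in> Basis \<Longrightarrow> A b > 0" "\<And>b x v. b \<in> Basis \<Longrightarrow> x \<in> K \<Longrightarrow> \<bar>D1 (\<lambda>x. nu x \<bullet> b) x v\<bar> \<le> A b * norm v" by metis
  have "\<forall>b\<in>Basis. \<exists>B>0. \<forall>x\<in>K. \<forall>v w. \<bar>D2 (\<lambda>x. nu x \<bullet> b) x v w\<bar> \<le> B * norm v * norm w"
    by (intro ballI D2_bounded[OF nu_Ck V(1) K])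
  then obtain B where B: "\<And>b. b \<in> Basis \<Longrightarrow> B b > 0" "\<And>b x v w. b \<in> Basis \<Longrightarrow> x \<in> K \<Longrightarrow> \<bar>D2 (\<lambda>x. nu x \<bullet> b) x v w\<bar> \<le> B b * norm v * norm w" by metis
  define M where "M = (\<Sum>b\<in>Basis. A b) + (\<Sum>b\<in>(Basis :: (complex ^ 'n) set). B b)"
  have p: "(\<Sum>b\<in>(Basis :: (complex ^ 'n) set). A b) > 0" "(\<Sum>b\<in>(Basis :: (complex ^ 'n) set). B b) > 0"
    using A(1) B(1) by (auto intro!: sum_pos)
  show ?thesis
  proof (rule that[of M])
    show "M > 0" using p by (simp add: M_def)
    fix x w assume x: "x \<in> K"
    have "norm (DN x w) \<le> (\<Sum>b\<in>Basis. A b * norm w)"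
      unfolding DN_def by (rule sum_norm_le) (use A(2)[OF _ x] in simp)
    also have "\<dots> \<le> M * norm w" unfolding M_def sum_distrib_right[symmetric] using p by (intro mult_right_mono) auto
    finally show "norm (DN x w) \<le> M * norm w" .
    have "norm (DDN x w) \<le> (\<Sum>b\<in>Basis. B b * (norm w)\<^sup>2)"
      unfolding DDN_def by (rule sum_norm_le) (use B(2)[OF _ x, of _ w w] in \<open>simp add: power2_eq_square mult.assoc\<close>)
    also have "\<dots> \<le> M * (norm w)\<^sup>2" unfolding M_def sum_distrib_right[symmetric] using p by (intro mult_right_mono) auto
    finally show "norm (DDN x w) \<le> M * (norm w)\<^sup>2" .
  qed
qed

text \<open>Only the shifted point has to lie in \<open>\<Omega>\<close>, so boundary points are
  included for suitable \<open>t\<close>. This is what makes the pullback of \<open>g\<close> a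
  \<open>C\<^sup>2\<close> function across the boundary.\<close>

definition shiftdom :: "real \<Rightarrow> (complex ^ 'n) set" where
  "shiftdom t = {x \<in> V. x + t *\<^sub>R nu x \<in> \<Omega> \<inter> V}"

lemma open_shiftdom: "open (shiftdom t)"
proof -
  have "open (V \<inter> (\<lambda>x. x + t *\<^sub>R nu x) -` (\<Omega> \<inter> V))"
    by (intro continuous_open_preimage continuous_intros continuous_on_nu V(1) open_Int \<Omega>(1))
  then show ?thesis by (simp add: shiftdom_def vimage_def Int_def)
qed

lemma shift_component_Ck: "b \<in> Basis \<Longrightarrow> Ck_on 2 V (\<lambda>x. (x + t *\<^sub>R nu x) \<bullet> b)"
  unfolding inner_add_left inner_scaleR_left
  by (rule Ck_on_add[OF V(1) Ck_on_linear[OF bounded_linear_inner_left] Ck_on_cmult[OF V(1) nu_Ck]])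

lemma gt_Ck: "Ck_on 2 (shiftdom t) (\<lambda>x. g (x + t *\<^sub>R nu x))"
  by (rule Ck_on_compose[OF open_shiftdom Ck_on_subset[OF shift_component_Ck] g_Ck]) (auto simp: shiftdom_def)

lemma gt_derivs:
  assumes z: "z \<in> shiftdom t"
  shows "D1 (\<lambda>x. g (x + t *\<^sub>R nu x)) z w = D1 g (z + t *\<^sub>R nu z) (w + t *\<^sub>R DN z w)"
    "D2 (\<lambda>x. g (x + t *\<^sub>R nu x)) z w w = D2 g (z + t *\<^sub>R nu z) (w + t *\<^sub>R DN z w) (w + t *\<^sub>R DN z w) + t * D1 g (z + t *\<^sub>R nu z) (DDN z w)"
proof -
  have zV: "z \<in> V" and q: "z + t *\<^sub>R nu z \<in> \<Omega> \<inter> V" using z by (auto simp: shiftdom_def)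
  have c: "Ck_on 2 V (\<lambda>x::complex ^ 'n. x \<bullet> b)" for b by (intro Ck_on_linear bounded_linear_inner_left)
  have lin1: "D1 (\<lambda>x::complex ^ 'n. x \<bullet> b) y v = v \<bullet> b" for b y v
    by (rule D1_eqI) (intro bounded_linear_imp_has_derivative bounded_linear_inner_left)
  have lin2: "D2 (\<lambda>x::complex ^ 'n. x \<bullet> b) y v w = 0" for b y v w
    unfolding lin1 by (simp add: frechet_derivative_const)
  have 1: "D1 (\<lambda>x. (x + t *\<^sub>R nu x) \<bullet> b) z v = v \<bullet> b + t * D1 (\<lambda>x. nu x \<bullet> b) z v"
    "D2 (\<lambda>x. (x + t *\<^sub>R nu x) \<bullet> b) z v v' = t * D2 (\<lambda>x. nu x \<bullet> b) z v v'" if b: "b \<in> Basis" for b v v'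
    using D12_add[OF V(1) c[of b] nu_Ck[OF b] zV, of t] by (simp_all add: inner_add_left lin1 lin2)
  have M: "(\<Sum>b\<in>Basis. D1 (\<lambda>x. (x + t *\<^sub>R nu x) \<bullet> b) z w *\<^sub>R b) = w + t *\<^sub>R DN z w"
    unfolding DN_def scaleR_sum_right
    by (simp add: 1 scaleR_add_left sum.distrib euclidean_representation)
  have M2: "(\<Sum>b\<in>Basis. D2 (\<lambda>x. (x + t *\<^sub>R nu x) \<bullet> b) z w w *\<^sub>R b) = t *\<^sub>R DDN z w"
    unfolding DDN_def scaleR_sum_right by (simp add: 1)
  note op = open_shiftdom open_Int[OF \<Omega>(1) V(1)]
  have sc: "Ck_on 2 (shiftdom t) (\<lambda>x. (x + t *\<^sub>R nu x) \<bullet> b)" if "b \<in> Basis" for b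
    by (rule Ck_on_subset[OF shift_component_Ck[OF that]]) (auto simp: shiftdom_def)
  have im: "x + t *\<^sub>R nu x \<in> \<Omega> \<inter> V" if "x \<in> shiftdom t" for x using that by (simp add: shiftdom_def)
  note ch = chain_rule_map[OF op sc g_Ck im z, of w]
  show "D1 (\<lambda>x. g (x + t *\<^sub>R nu x)) z w = D1 g (z + t *\<^sub>R nu z) (w + t *\<^sub>R DN z w)"
    using ch(1) unfolding M by simp
  show "D2 (\<lambda>x. g (x + t *\<^sub>R nu x)) z w w = D2 g (z + t *\<^sub>R nu z) (w + t *\<^sub>R DN z w) (w + t *\<^sub>R DN z w) + t * D1 g (z + t *\<^sub>R nu z) (DDN z w)"
    using ch(2) unfolding M M2 by (simp add: D1_lin[OF Ck2D(1)[OF g_Ck q]])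
qed

text \<open>\<open>- ln (- \<rho>)\<close> is \<open>g - ln (- r)\<close>; the split isolates the
  part \<open>dd r x v / (- r x)\<close> that is prescribed by \<open>adjust\<close>.\<close>

lemma levi_u_split:
  assumes "x \<in> \<Omega> \<inter> V"
  shows "dd (\<lambda>x. - ln (- \<rho> x)) x v = dd g x v + dd r x v / of_real (- r x)"
    "levi (\<lambda>x. - ln (- \<rho> x)) x v = levi g x v + levi r x v / (- r x) + (norm (dd r x v / of_real (- r x)))\<^sup>2"
proof -
  note i = interior_set
  have ck: "Ck_on 2 (\<Omega> \<inter> V) (\<lambda>x. - ln (- \<rho> x))" "Ck_on 2 (\<Omega> \<inter> V) (\<lambda>x. - ln (- r x))"
    by (intro Ck_neg_log i; assumption)+
  note d = D12_add[OF i(1) ck assms, of "-1", folded g_def[abs_def]]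
  have R: "dd (\<lambda>x. - ln (- r x)) x v = dd r x v / of_real (- r x)"
    "levi (\<lambda>x. - ln (- r x)) x v = levi r x v / (- r x) + (norm (dd r x v / of_real (- r x)))\<^sup>2"
    by (rule levi_neg_log[OF i(2,1) assms i(4)]; assumption)+
  show "dd (\<lambda>x. - ln (- \<rho> x)) x v = dd g x v + dd r x v / of_real (- r x)"
    unfolding R(1)[symmetric] by (simp add: dd_def d complex_eq_iff)
  show "levi (\<lambda>x. - ln (- \<rho> x)) x v = levi g x v + levi r x v / (- r x) + (norm (dd r x v / of_real (- r x)))\<^sup>2"
    using R(2) by (simp add: levi_def d)
qed

text \<open>Compares \<open>(z, w)\<close> with \<open>(q, v)\<close>, where \<open>q\<close> is the
  shifted point and \<open>v\<close> is \<open>w\<close> adjusted so that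
  \<open>dd r q v / (- r q)\<close> has the value \<open>a\<close> taken at \<open>(z, w)\<close>.
  By \<open>levi_comparison\<close> the Levi quotient of \<open>r\<close> hardly increases on the
  way to \<open>q\<close>. The differential of the shift maps \<open>w\<close> to a vector at
  distance of order \<open>t * S\<close> from \<open>v\<close>, while \<open>D2 g\<close> at
  \<open>q\<close> is at most \<open>\<epsilon>1 / (c1 * t)\<close>, so \<open>t\<close> cancels.
  Errors in \<open>norm w\<close> are charged to \<open>\<tau>\<close>, errors in
  \<open>norm a\<close> to the gap between \<open>\<eta>''\<close> and
  \<open>\<eta>\<close>.\<close>

lemma main_estimate:
  assumes \<eta>'': "0 < \<eta>''" "\<eta>'' < \<eta>" and \<tau>: "\<tau> > 0"
  obtains t \<epsilon>3 where "t > 0" "\<epsilon>3 > 0"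
    "\<And>z. z \<in> closure \<Omega> \<Longrightarrow> bdist \<Omega> z < \<epsilon>3 \<Longrightarrow> z \<in> shiftdom t"
    "\<And>z w. z \<in> \<Omega> \<Longrightarrow> bdist \<Omega> z < \<epsilon>3 \<Longrightarrow>
       - \<tau> * (norm w)\<^sup>2 \<le> levi r z w / (- r z) + (norm (dd r z w / of_real (- r z)))\<^sup>2 + levi (\<lambda>x. g (x + t *\<^sub>R nu x)) z w
         - \<eta>'' * (norm (dd (\<lambda>x. g (x + t *\<^sub>R nu x)) z w + dd r z w / of_real (- r z)))\<^sup>2"
proof -

  \<comment> \<open>Constants and the size of the shift\<close>
  obtain Cg where Cg: "Cg > 0" "\<And>p N \<sigma> v. adm p N \<Longrightarrow> 0 < \<sigma> \<Longrightarrow> \<sigma> \<le> T \<Longrightarrow> \<bar>D1 g (p + \<sigma> *\<^sub>R N) v\<bar> \<le> Cg * norm v"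
    using g_D1_bound by metis
  obtain CM where CM: "CM > 0" "\<And>x w. x \<in> K \<Longrightarrow> norm (DN x w) \<le> CM * norm w" "\<And>x w. x \<in> K \<Longrightarrow> norm (DDN x w) \<le> CM * (norm w)\<^sup>2"
    using DN_bounds by metis
  obtain M where M: "M > 0" "\<And>x v w. x \<in> K \<Longrightarrow> \<bar>D2 r x v w\<bar> \<le> M * norm v * norm w"
    using uniform_bounds by metis
  define k where "k = (1 + 2 * Cg)\<^sup>2"
  have k: "k > 0" using Cg(1) by (simp add: k_def add_pos_pos)
  \<comment> \<open>The total error allowed in units of \<open>S\<^sup>2\<close>. A quarter each
    goes to \<open>levi_comparison\<close>, to the change of the quadratic form \<open>D2 g\<close>,
    to the second derivative of the shift, and to Young's inequality.\<close>
  define es where "es = min ((\<eta> - \<eta>'') / 16) (\<tau> / (8 * k))"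
  have es: "es > 0" "es \<le> (\<eta> - \<eta>'') / 16" "es * (8 * k) \<le> \<tau>"
  proof -
    show "es > 0" using \<eta>'' \<tau> k by (simp add: es_def)
    show "es \<le> (\<eta> - \<eta>'') / 16" unfolding es_def by (rule min.cobounded1)
    have "es \<le> \<tau> / (8 * k)" unfolding es_def by (rule min.cobounded2)
    then have "es * (8 * k) \<le> \<tau> / (8 * k) * (8 * k)" by (rule mult_right_mono) (use k in simp)
    then show "es * (8 * k) \<le> \<tau>" using k by simp
  qed
  define \<kappa> where "\<kappa> = (\<eta> - \<eta>'') / (2 * \<eta>'')"
  have \<kappa>: "\<kappa> > 0" "\<eta>'' * (1 + \<kappa>) = (\<eta> + \<eta>'') / 2" using \<eta>'' by (auto simp: \<kappa>_def field_simps)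
  \<comment> \<open>\<open>t * C5 * S\<close> bounds \<open>norm (v - w)\<close>. \<open>C7\<close>
    also includes the differential of the shift, \<open>C6\<close> bounds the sums of the vectors
    whose differences are bounded by \<open>C7\<close>, and \<open>C8\<close> the resulting change
    of the gradient term.\<close>
  define C5 where "C5 = C / c1 * (2 * M * C + C\<^sup>2)"
  define C7 where "C7 = CM + C5"
  define C6 where "C6 = C7 + 2"
  define C8 where "C8 = 2 * Cg * C7"
  have C5: "C5 > 0" unfolding C5_def by (intro mult_pos_pos add_pos_pos divide_pos_pos zero_less_power) (use pos M(1) in auto)
  have Cs: "C7 > 0" "C6 > 0" "C8 > 0" using C5 CM(1) Cg(1) by (auto simp: C7_def C6_def C8_def intro: add_pos_pos)
  define \<epsilon>1 where "\<epsilon>1 = es * c1 / (8 * C7 * C6)"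
  have \<epsilon>1: "\<epsilon>1 > 0" "2 * (\<epsilon>1 / c1 * C7 * C6) = es / 4"
    using es(1) pos Cs by (auto simp: \<epsilon>1_def)
  obtain T1 where T1: "0 < T1" "T1 \<le> T" "\<And>p N \<sigma> v. adm p N \<Longrightarrow> 0 < \<sigma> \<Longrightarrow> \<sigma> \<le> T1 \<Longrightarrow>
     \<bar>D2 g (p + \<sigma> *\<^sub>R N) v v\<bar> * (- r (p + \<sigma> *\<^sub>R N)) \<le> \<epsilon>1 * (norm v)\<^sup>2"
    using g_D2_small[OF \<epsilon>1(1)] by metis
  have "es / 4 > 0" using es by simp
  then obtain T2 where T2: "0 < T2" "T2 \<le> T" "\<And>p N s1 s2 w a. adm p N \<Longrightarrow> 0 < s1 \<Longrightarrow> s1 \<le> s2 \<Longrightarrow> s2 \<le> T2 \<Longrightarrow>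
     levi r (p + s2 *\<^sub>R N) (adjust (p + s2 *\<^sub>R N) N w a) / (- r (p + s2 *\<^sub>R N)) \<le>
     levi r (p + s1 *\<^sub>R N) (adjust (p + s1 *\<^sub>R N) N w a) / (- r (p + s1 *\<^sub>R N)) + es / 4 * (norm w + norm a)\<^sup>2"
    using levi_comparison by metis
  define Tm where "Tm = min T1 T2"
  have Tm: "0 < Tm" "Tm \<le> T1" "Tm \<le> T2" "Tm \<le> T" using T1 T2 by (auto simp: Tm_def)
  \<comment> \<open>The three summands are the smallness conditions on \<open>t\<close> that become
    \<open>tA\<close>, \<open>tB\<close> and \<open>tC\<close>.\<close>
  define Kt where "Kt = 8 * Cg * CM / es + 4 * \<eta>'' * (1 + 1 / \<kappa>) * C8\<^sup>2 / es + 4 * Cg * C5"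
  have Kt: "8 * Cg * CM / es > 0" "4 * \<eta>'' * (1 + 1 / \<kappa>) * C8\<^sup>2 / es > 0" "4 * Cg * C5 > 0"
    using Cg CM es Cs C5 \<eta>'' \<kappa> by (auto intro!: mult_pos_pos divide_pos_pos add_pos_pos)
  define t where "t = min (Tm / 2) (min 1 (1 / Kt))"
  have KtP: "Kt > 0" using Kt by (simp add: Kt_def add_pos_pos)
  have t: "t > 0" "t \<le> Tm / 2" "t \<le> 1" "t * Kt \<le> 1"
  proof -
    show "t > 0" using Tm KtP by (simp add: t_def)
    have "t \<le> 1 / Kt" by (simp add: t_def)
    then have "t * Kt \<le> 1 / Kt * Kt" by (rule mult_right_mono) (use KtP in simp)
    then show "t * Kt \<le> 1" using KtP by simp
  qed (auto simp: t_def)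
  have le1: "t * x \<le> 1" if "x \<le> Kt" for x using mult_left_mono[OF that, of t] t by linarith
  have tA: "2 * Cg * CM * t \<le> es / 4"
  proof -
    have "t * (8 * Cg * CM / es) \<le> 1" by (rule le1) (use Kt in \<open>unfold Kt_def, linarith\<close>)
    then show ?thesis using es(1) by (simp add: field_simps)
  qed
  have tB: "\<eta>'' * (1 + 1 / \<kappa>) * (t * C8)\<^sup>2 \<le> es / 4"
  proof -
    have "t * (4 * \<eta>'' * (1 + 1 / \<kappa>) * C8\<^sup>2 / es) \<le> 1" by (rule le1) (use Kt in \<open>unfold Kt_def, linarith\<close>)
    then have "\<eta>'' * (1 + 1 / \<kappa>) * C8\<^sup>2 * t \<le> es / 4" using es(1) by (simp add: field_simps)
    moreover have "t * t \<le> t" using t by (simp add: mult_left_le)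
    then have "\<eta>'' * (1 + 1 / \<kappa>) * C8\<^sup>2 * (t * t) \<le> \<eta>'' * (1 + 1 / \<kappa>) * C8\<^sup>2 * t"
      by (rule mult_left_mono) (use \<eta>'' \<kappa>(1) in simp)
    moreover have "\<eta>'' * (1 + 1 / \<kappa>) * (t * C8)\<^sup>2 = \<eta>'' * (1 + 1 / \<kappa>) * C8\<^sup>2 * (t * t)"
      by (simp only: power2_eq_square mult_ac)
    ultimately show ?thesis by linarith
  qed
  have tC: "2 * Cg * C5 * t \<le> 1 / 2"
  proof -
    have "t * (4 * Cg * C5) \<le> 1" by (rule le1) (use Kt in \<open>unfold Kt_def, linarith\<close>)
    then show ?thesis by (simp add: mult_ac)
  qed
  \<comment> \<open>One half is for the distance \<open>s\<close> from the foot point and one for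
    the shift, so that \<open>s + t\<close> stays below \<open>Tm\<close>.\<close>
  have "Tm / 2 > 0" using Tm by simp
  then obtain \<epsilon>3 where \<epsilon>3: "\<epsilon>3 > 0" "\<And>z. z \<in> \<Omega> \<Longrightarrow> bdist \<Omega> z < \<epsilon>3 \<Longrightarrow> \<exists>s p. 0 < s \<and> s < Tm / 2 \<and> z = p + s *\<^sub>R nu z \<and> adm p (nu z)"
    using foot[of "Tm / 2"] unfolding adm_def by metis
  have inner: "z \<in> K \<and> z + t *\<^sub>R nu z \<in> K \<and> r (z + t *\<^sub>R nu z) \<le> - (c1 * t)" if "z \<in> \<Omega>" "bdist \<Omega> z < \<epsilon>3" for z
  proof -
    obtain s p where sp: "0 < s" "s < Tm / 2" "z = p + s *\<^sub>R nu z" "adm p (nu z)" using \<epsilon>3(2)[OF \<open>z \<in> \<Omega>\<close> \<open>bdist \<Omega> z < \<epsilon>3\<close>] by blast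
    have e: "z + t *\<^sub>R nu z = p + (s + t) *\<^sub>R nu z" using sp(3) by (simp add: scaleR_add_left add.assoc[symmetric])
    have st: "0 < s + t" "s + t \<le> T" using sp t Tm by auto
    have "z \<in> K" using adm_point(1)[OF sp(4), of s] sp Tm by auto
    moreover have "z + t *\<^sub>R nu z \<in> K" unfolding e using adm_point(1)[OF sp(4)] st by auto
    moreover have "c1 * t \<le> c1 * (s + t)" using sp pos by simp
    then have "r (z + t *\<^sub>R nu z) \<le> - (c1 * t)" unfolding e using adm_r(1)[OF sp(4) st] by linarith
    ultimately show ?thesis by blast
  qed
  \<comment> \<open>The bound \<open>r \<le> - (c1 * t)\<close> at shifted interior points is
    uniform, so it survives the limit to boundary points and keeps their shifts inside
    \<open>\<Omega>\<close>.\<close>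
  have A: "z \<in> shiftdom t" if z: "z \<in> closure \<Omega>" "bdist \<Omega> z < \<epsilon>3" for z
  proof -
    obtain X where X: "\<And>n. X n \<in> \<Omega>" "X \<longlonglongrightarrow> z" using z(1) closure_sequential by blast
    have ev: "\<forall>\<^sub>F n in sequentially. bdist \<Omega> (X n) < \<epsilon>3"
    proof -
      have "(\<lambda>n. bdist \<Omega> (X n)) \<longlonglongrightarrow> bdist \<Omega> z" unfolding bdist_def by (intro tendsto_intros X)
      then show ?thesis using z(2) by (rule order_tendstoD)
    qed
    then have ev2: "\<forall>\<^sub>F n in sequentially. X n \<in> K \<and> X n + t *\<^sub>R nu (X n) \<in> K \<and> r (X n + t *\<^sub>R nu (X n)) \<le> - (c1 * t)"
      by eventually_elim (use inner X in blast)
    have zK: "z \<in> K"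
      by (rule Lim_in_closed_set[OF compact_imp_closed[OF K(1)] _ _ X(2)]) (use ev2 in \<open>auto elim: eventually_mono\<close>)
    then have zV: "z \<in> V" using K by auto
    have nuX: "(\<lambda>n. X n + t *\<^sub>R nu (X n)) \<longlonglongrightarrow> z + t *\<^sub>R nu z"
    proof -
      have "isCont nu z" using continuous_on_nu V(1) zV by (simp add: continuous_on_eq_continuous_at)
      then show ?thesis by (intro tendsto_intros X isCont_tendsto_compose[of z nu])
    qed
    have qK: "z + t *\<^sub>R nu z \<in> K"
      by (rule Lim_in_closed_set[OF compact_imp_closed[OF K(1)] _ _ nuX]) (use ev2 in \<open>auto elim: eventually_mono\<close>)
    then have qV: "z + t *\<^sub>R nu z \<in> V" using K by auto
    have "isCont r (z + t *\<^sub>R nu z)" using Ck2_continuous(1)[OF r2] V(1) qV by (simp add: continuous_on_eq_continuous_at)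
    then have "(\<lambda>n. r (X n + t *\<^sub>R nu (X n))) \<longlonglongrightarrow> r (z + t *\<^sub>R nu z)" by (rule isCont_tendsto_compose[OF _ nuX])
    then have "r (z + t *\<^sub>R nu z) \<le> - (c1 * t)"
      by (rule tendsto_upperbound) (use ev2 in \<open>auto elim: eventually_mono\<close>)
    moreover have "c1 * t > 0" using pos t by simp
    ultimately show ?thesis using r_neg[OF qV] qV zV by (simp add: shiftdom_def)
  qed
  show ?thesis
  proof (rule that[OF t(1) \<epsilon>3(1) A])

    \<comment> \<open>The estimate at a fixed point and vector\<close>
    fix z w :: "complex ^ 'n" assume z: "z \<in> \<Omega>" "bdist \<Omega> z < \<epsilon>3"
    have zs: "z \<in> shiftdom t" using A[OF subsetD[OF closure_subset z(1)] z(2)] .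
    define N where "N = nu z"
    obtain s p where sp: "0 < s" "s < Tm / 2" "z = p + s *\<^sub>R N" "adm p N" using \<epsilon>3(2)[OF z] unfolding N_def by blast
    note b = adm_base[OF sp(4)]
    define q where "q = z + t *\<^sub>R N"
    have qp: "q = p + (s + t) *\<^sub>R N" using sp(3) by (simp add: q_def scaleR_add_left add.assoc)
    have st: "0 < s + t" "s + t \<le> T" "s + t \<le> T1" "s + t \<le> T2" "s \<le> s + t" using sp t Tm by auto
    have zK: "z \<in> K" "z \<in> \<Omega> \<inter> V" "z \<in> V" using inner[OF z] z K by auto
    have qK: "q \<in> K" "q \<in> \<Omega> \<inter> V" "q \<in> V" using inner[OF z] zs K unfolding q_def N_def shiftdom_def by auto
    have neg: "r z < 0" "r q < 0" using interior_set(4) zK qK by auto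
    have slope: "D1 r z N \<le> - c1" "D1 r q N \<le> - c1"
      using adm_point(3)[OF sp(4), of s] adm_point(3)[OF sp(4), of "s + t"] sp(1-3) st qp by auto
    have slope0: "D1 r z N < 0" "D1 r q N < 0" using slope pos by auto
    define a where "a = dd r z w / of_real (- r z)"
    define v where "v = adjust q N w a"
    have az: "dd r z w = a * of_real (- r z)" using neg by (simp add: a_def)
    then have wz: "adjust z N w a = w" by (simp add: adjust_def)
    have aq: "dd r q v = a * of_real (- r q)" unfolding v_def by (rule dd_adjust[OF qK(3) slope0(2)])
    then have aq': "dd r q v / of_real (- r q) = a" using neg by simp
    define n where "n = norm w"
    define S where "S = n + norm a"
    have n0: "n \<ge> 0" "S \<ge> 0" "n \<le> S" "norm a \<le> S" by (auto simp: n_def S_def)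
    have Levi: "levi r q v / (- r q) \<le> levi r z w / (- r z) + es / 4 * S\<^sup>2"
      using T2(3)[OF sp(4) sp(1) st(5,4), of w a] unfolding qp[symmetric] sp(3)[symmetric] wz v_def[symmetric] S_def n_def .
    \<comment> \<open>The numerator of the correction in \<open>adjust\<close> is zero at
      \<open>z\<close>, by the choice of \<open>a\<close>, and changes by order \<open>t * S\<close>
      between \<open>z\<close> and \<open>q\<close>.\<close>
    have vw: "norm (v - w) \<le> t * C5 * S"
    proof -
      have seg: "z + \<sigma> *\<^sub>R N \<in> K" "z + \<sigma> *\<^sub>R N \<in> V" if "0 \<le> \<sigma>" "\<sigma> \<le> t" for \<sigma>
        using adm_point[OF sp(4), of "s + \<sigma>"] that sp(1,3) st by (auto simp: scaleR_add_left add.assoc)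
      have 1: "\<bar>D1 r q x - D1 r z x\<bar> \<le> t * (M * C * norm x)" for x
      proof -
        obtain \<sigma> where \<sigma>: "0 < \<sigma>" "\<sigma> < t" "D1 r (z + t *\<^sub>R N) x - D1 r z x = t * D2 r (z + \<sigma> *\<^sub>R N) x N"
          using MVT_line[OF t(1), of "\<lambda>y. D1 r y x" z N] Ck2D(2)[OF r2 seg(2)] by blast
        have "\<bar>D2 r (z + \<sigma> *\<^sub>R N) x N\<bar> \<le> M * norm x * norm N" by (rule M(2)[OF seg(1)]) (use \<sigma> in auto)
        also have "\<dots> \<le> M * norm x * C" by (rule mult_left_mono[OF b(2)]) (use M(1) in simp)
        finally show ?thesis using \<sigma>(3) t(1) by (simp add: q_def abs_mult mult_ac)
      qed
      have 2: "\<bar>r q - r z\<bar> \<le> t * C\<^sup>2"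
      proof -
        obtain \<sigma> where \<sigma>: "0 < \<sigma>" "\<sigma> < t" "r (z + t *\<^sub>R N) - r z = t * D1 r (z + \<sigma> *\<^sub>R N) N"
          using MVT_line[OF t(1), of r z N] r_differentiable seg(2) by blast
        have "\<bar>D1 r (z + \<sigma> *\<^sub>R N) N\<bar> \<le> C * norm N" by (rule D1r[OF seg(1)]) (use \<sigma> in auto)
        also have "\<dots> \<le> C * C" by (rule mult_left_mono[OF b(2)]) (use pos in simp)
        finally show ?thesis using \<sigma>(3) t(1) by (simp add: q_def abs_mult power2_eq_square)
      qed
      have num: "norm (dd r q w + a * of_real (r q)) \<le> t * (2 * M * C * n + C\<^sup>2 * norm a)"
      proof -
        have e: "dd r q w + a * of_real (r q) = (dd r q w - dd r z w) + a * of_real (r q - r z)"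
          using az by (simp add: algebra_simps)
        have "norm (dd r q w - dd r z w) \<le> 2 * (t * (M * C * n))"
          unfolding dd_def by (rule norm_dd_diff_le) (use 1[of w] 1[of "J w"] in \<open>auto simp: norm_J n_def\<close>)
        moreover have "norm (a * of_real (r q - r z)) \<le> norm a * (t * C\<^sup>2)"
          unfolding norm_mult norm_of_real using 2 by (intro mult_left_mono) auto
        ultimately show ?thesis unfolding e
          using norm_triangle_ineq[of "dd r q w - dd r z w" "a * of_real (r q - r z)"] by (simp add: algebra_simps)
      qed
      have den: "c1 \<le> norm (dd r q N)"
        using abs_Re_le_cmod[of "dd r q N"] slope(2) by (simp add: dd_def)
      have "norm (v - w) = norm (dd r q w + a * of_real (r q)) / norm (dd r q N) * norm N"
        unfolding v_def adjust_def by (simp add: norm_complex_scalar_mult norm_divide)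
      also have "\<dots> \<le> t * (2 * M * C * n + C\<^sup>2 * norm a) / c1 * C"
        using num den b(2) pos M(1) t(1) n0 by (intro mult_mono frac_le) auto
      also have "\<dots> \<le> t * ((2 * M * C + C\<^sup>2) * S) / c1 * C"
      proof -
        have "2 * M * C * n + C\<^sup>2 * norm a \<le> 2 * M * C * S + C\<^sup>2 * S"
          using n0 M(1) pos by (intro add_mono mult_left_mono) auto
        then show ?thesis using t(1) pos by (intro mult_right_mono divide_right_mono mult_left_mono) (auto simp: distrib_right)
      qed
      also have "\<dots> = t * C5 * S" by (simp add: C5_def mult_ac)
      finally show ?thesis .
    qed
    have Jvw: "norm (J v - J w) \<le> t * C5 * S"
      using vw by (simp add: norm_J flip: vector_ssub_ldistrib)
    define Mw where "Mw x = x + t *\<^sub>R DN z x" for x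
    have Mwx: "norm (Mw x - x) \<le> t * (CM * norm x)" for x
      using CM(2)[OF zK(1), of x] t(1) by (simp add: Mw_def)
    have Mb: "norm (Mw x - y) \<le> t * C7 * S \<and> norm (Mw x + y) \<le> C6 * S"
      if "norm x = n" "norm (y - x) \<le> t * C5 * S" for x y
    proof -
      have 1: "norm (Mw x - x) \<le> t * CM * S"
      proof -
        have "t * (CM * norm x) \<le> t * (CM * S)" using that n0 CM(1) t(1) by (intro mult_left_mono) auto
        then show ?thesis using Mwx[of x] by (simp add: mult.assoc)
      qed
      have 2: "norm (Mw x - y) \<le> norm (Mw x - x) + norm (y - x)"
        using norm_triangle_ineq4[of "Mw x - x" "y - x"] by simp
      have 3: "norm (Mw x + y) \<le> norm (Mw x - x) + norm (y - x) + 2 * n"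
      proof -
        have "Mw x + y = (Mw x - x) + (y - x) + 2 *\<^sub>R x" by (simp add: scaleR_2)
        then have "norm (Mw x + y) \<le> norm ((Mw x - x) + (y - x)) + norm (2 *\<^sub>R x)" by (metis norm_triangle_ineq)
        also have "norm ((Mw x - x) + (y - x)) \<le> norm (Mw x - x) + norm (y - x)" by (rule norm_triangle_ineq)
        finally show ?thesis using that by simp
      qed
      have sum: "norm (Mw x - x) + norm (y - x) \<le> t * C7 * S" using 1 that(2) by (simp add: C7_def algebra_simps)
      have "t * C7 * S \<le> 1 * C7 * S" using t n0 Cs by (intro mult_right_mono) auto
      then have "norm (Mw x + y) \<le> C6 * S" using 3 sum n0(3) by (simp add: C6_def algebra_simps)
      then show ?thesis using 2 sum by linarith
    qed
    have Mv: "norm (Mw w - v) \<le> t * C7 * S" "norm (Mw w + v) \<le> C6 * S" "norm (Mw (J w) - J v) \<le> t * C7 * S" "norm (Mw (J w) + J v) \<le> C6 * S"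
      using Mb[of w v] Mb[of "J w" "J v"] vw Jvw by (auto simp: n_def norm_J)
    have Dg: "\<bar>D1 g q x\<bar> \<le> Cg * norm x" for x using Cg(2)[OF sp(4) st(1,2)] unfolding qp .
    define Kq where "Kq = \<epsilon>1 / (- r q)"
    have D2g: "\<bar>D2 g q x x\<bar> \<le> Kq * (norm x)\<^sup>2" for x
    proof -
      have "0 < - r q" using neg by simp
      moreover have "\<bar>D2 g q x x\<bar> * (- r q) \<le> \<epsilon>1 * (norm x)\<^sup>2"
        using T1(3)[OF sp(4) st(1,3), of x] unfolding qp[symmetric] .
      ultimately have "\<bar>D2 g q x x\<bar> \<le> \<epsilon>1 * (norm x)\<^sup>2 / (- r q)" by (simp only: pos_le_divide_eq)
      then show ?thesis by (simp add: Kq_def)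
    qed
    have Kq: "0 \<le> Kq" "Kq * t \<le> \<epsilon>1 / c1"
    proof -
      show "0 \<le> Kq" unfolding Kq_def by (rule divide_nonneg_nonneg) (use \<epsilon>1(1) neg(2) in auto)
      have "c1 * t \<le> - r q" using inner[OF z] by (simp add: q_def N_def)
      then have "\<epsilon>1 / (- r q) * t \<le> \<epsilon>1 / (c1 * t) * t"
        using \<epsilon>1(1) pos t(1) neg(2) by (intro mult_right_mono divide_left_mono mult_pos_pos) auto
      then show "Kq * t \<le> \<epsilon>1 / c1" using t(1) by (simp add: Kq_def)
    qed
    have quad: "\<bar>D2 g q x x - D2 g q y y\<bar> \<le> \<epsilon>1 / c1 * C7 * C6 * S\<^sup>2"
      if "norm (x - y) \<le> t * C7 * S" "norm (x + y) \<le> C6 * S" for x y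
    proof -
      have "\<bar>D2 g q x x - D2 g q y y\<bar> \<le> Kq * norm (x - y) * norm (x + y)"
        by (rule D2_diag_diff[OF g_Ck interior_set(1) qK(2) D2g])
      also have "\<dots> \<le> Kq * (t * C7 * S) * (C6 * S)"
        using that Kq(1) n0 Cs t(1) by (intro mult_mono mult_left_mono) auto
      also have "\<dots> = Kq * t * (C7 * C6 * S\<^sup>2)" by (simp add: power2_eq_square)
      also have "\<dots> \<le> \<epsilon>1 / c1 * (C7 * C6 * S\<^sup>2)" using Kq(2) Cs by (intro mult_right_mono) auto
      finally show ?thesis by (simp add: mult.assoc)
    qed
    define gt where "gt = (\<lambda>x. g (x + t *\<^sub>R nu x))"
    have gd1: "D1 gt z x = D1 g q (Mw x)" for x
      using gt_derivs(1)[OF zs, of x] by (simp add: gt_def q_def N_def Mw_def)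
    have gd2: "D2 gt z x x = D2 g q (Mw x) (Mw x) + t * D1 g q (DDN z x)" for x
      using gt_derivs(2)[OF zs, of x] by (simp add: gt_def q_def N_def Mw_def)
    have ddn: "\<bar>t * D1 g q (DDN z x)\<bar> \<le> Cg * CM * t * S\<^sup>2" if "norm x = n" for x
    proof -
      have "\<bar>D1 g q (DDN z x)\<bar> \<le> Cg * (CM * n\<^sup>2)"
        using order_trans[OF Dg[of "DDN z x"] mult_left_mono[OF CM(3)[OF zK(1), of x] less_imp_le[OF Cg(1)]]] that by simp
      also have "\<dots> \<le> Cg * (CM * S\<^sup>2)" using n0 Cg(1) CM(1) by (intro mult_left_mono power_mono) auto
      finally show ?thesis using t(1) by (simp add: abs_mult mult_ac)
    qed
    have Gz: "levi g q v - (es / 4 + es / 4) * S\<^sup>2 \<le> levi gt z w"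
    proof -
      have "levi g q v - 2 * (\<epsilon>1 / c1 * C7 * C6 * S\<^sup>2) - 2 * (Cg * CM * t * S\<^sup>2) \<le> levi gt z w"
        unfolding levi_def gd2
        using quad[OF Mv(1,2)] quad[OF Mv(3,4)] ddn[of w] ddn[of "J w"] by (simp add: n_def norm_J abs_le_iff)
      moreover have "2 * (\<epsilon>1 / c1 * C7 * C6 * S\<^sup>2) = es / 4 * S\<^sup>2" using \<epsilon>1(2) by (metis mult.assoc)
      moreover have "2 * (Cg * CM * t * S\<^sup>2) \<le> es / 4 * S\<^sup>2"
        using mult_right_mono[OF tA, of "S\<^sup>2"] by (simp add: mult.assoc)
      ultimately show ?thesis by (simp add: algebra_simps)
    qed
    define X where "X = dd g q v + a"
    define Y where "Y = dd gt z w + a"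
    have dgq: "g differentiable (at q)" by (rule Ck2D(1)[OF g_Ck qK(2)])
    have YX: "norm Y \<le> norm X + t * C8 * S"
    proof -
      have e: "\<bar>D1 g q x - D1 g q y\<bar> \<le> Cg * (t * C7 * S)" if "norm (x - y) \<le> t * C7 * S" for x y
        using order_trans[OF Dg[of "x - y"] mult_left_mono[OF that less_imp_le[OF Cg(1)]]] by (simp only: D1_lin[OF dgq])
      have "norm (dd gt z w - dd g q v) \<le> 2 * (Cg * (t * C7 * S))"
        unfolding dd_def gd1 by (rule norm_dd_diff_le) (rule e[OF Mv(1)], rule e[OF Mv(3)])
      then have "norm (Y - X) \<le> t * C8 * S" by (simp add: X_def Y_def C8_def mult_ac)
      then show ?thesis using norm_triangle_sub[of Y X] by linarith
    qed
    \<comment> \<open>\<open>a\<close> is recovered from \<open>X = dd g q v + a\<close> because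
      \<open>dd g\<close> is bounded; \<open>tC\<close> allows the remaining multiple of
      \<open>S\<close> to be moved to the left-hand side.\<close>
    have S2: "S\<^sup>2 \<le> 8 * (norm X)\<^sup>2 + 8 * k * n\<^sup>2"
    proof -
      have "norm v \<le> n + t * C5 * S" using vw norm_triangle_sub[of v w] by (simp add: n_def)
      then have "norm (dd g q v) \<le> 2 * Cg * (n + t * C5 * S)"
        using norm_dd_le[of g q Cg v, OF Dg] mult_left_mono[of "norm v" "n + t * C5 * S" "2 * Cg"] Cg(1) by linarith
      moreover have "norm a \<le> norm X + norm (dd g q v)"
        using norm_triangle_ineq4[of X "dd g q v"] by (simp add: X_def)
      ultimately have "S \<le> norm X + (1 + 2 * Cg) * n + 2 * Cg * C5 * t * S" by (simp add: S_def algebra_simps)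
      moreover have "2 * Cg * C5 * t * S \<le> 1 / 2 * S" using tC n0 by (intro mult_right_mono)
      ultimately have "S \<le> 2 * norm X + 2 * ((1 + 2 * Cg) * n)" by linarith
      then have "S\<^sup>2 \<le> (2 * norm X + 2 * ((1 + 2 * Cg) * n))\<^sup>2" using n0 by (intro power_mono)
      also have "\<dots> \<le> 2 * (2 * norm X)\<^sup>2 + 2 * (2 * ((1 + 2 * Cg) * n))\<^sup>2"
        using sum_squares_bound[of "2 * norm X" "2 * ((1 + 2 * Cg) * n)"] by (simp add: power2_sum)
      also have "\<dots> = 8 * (norm X)\<^sup>2 + 8 * k * n\<^sup>2" by (simp add: k_def power_mult_distrib)
      finally show ?thesis .
    qed
    have atq: "\<eta> * (norm X)\<^sup>2 \<le> levi r q v / (- r q) + (norm a)\<^sup>2 + levi g q v"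
      using u_psh[OF qK(2), of v] unfolding levi_u_split[OF qK(2)] aq' X_def by linarith
    have "- \<tau> * n\<^sup>2 \<le> levi r z w / (- r z) + (norm a)\<^sup>2 + levi gt z w - \<eta>'' * (norm Y)\<^sup>2"
    proof (rule estimate_assembly[OF atq Levi Gz norm_ge_zero YX \<kappa>(1) \<eta>''(1) \<kappa>(2) _ es(2,3) less_imp_le[OF es(1)] S2])
      show "es / 4 + (es / 4 + es / 4) + \<eta>'' * (1 + 1 / \<kappa>) * (t * C8)\<^sup>2 \<le> es" using tB by linarith
    qed
    then show "- \<tau> * (norm w)\<^sup>2 \<le> levi r z w / (- r z) + (norm (dd r z w / of_real (- r z)))\<^sup>2 + levi (\<lambda>x. g (x + t *\<^sub>R nu x)) z w
         - \<eta>'' * (norm (dd (\<lambda>x. g (x + t *\<^sub>R nu x)) z w + dd r z w / of_real (- r z)))\<^sup>2"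
      unfolding n_def a_def Y_def gt_def .
  qed
qed

end

section \<open>Bump functions and a global defining function\<close>

lemma Ck_norm_sq: "Ck_on k U (\<lambda>x::'a::euclidean_space. x \<bullet> x)"
proof -
  have "Ck_on k UNIV (\<lambda>x::'a. \<Sum>b\<in>Basis. (x \<bullet> b) * (x \<bullet> b))"
    by (rule Ck_on_sum[OF open_UNIV], rule Ck_on_mult[OF open_UNIV]; rule Ck_on_linear[OF bounded_linear_inner_left])
  then have "Ck_on k UNIV (\<lambda>x::'a. x \<bullet> x)"
    by (rule Ck_on_cong[OF open_UNIV]) (rule euclidean_inner[symmetric])
  then show ?thesis by (rule Ck_on_subset) simp
qed

lemma norm_sq_derivs:
  fixes x :: "'a::euclidean_space"
  shows "D1 (\<lambda>x. x \<bullet> x) x v = 2 * (x \<bullet> v)" "D2 (\<lambda>x. x \<bullet> x) x v v = 2 * (v \<bullet> v)"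
proof -
  have 1: "D1 (\<lambda>x. x \<bullet> x) y v = 2 * (y \<bullet> v)" for y :: 'a
    by (rule D1_eqI) (auto intro!: derivative_eq_intros simp: inner_commute)
  show "D1 (\<lambda>x. x \<bullet> x) x v = 2 * (x \<bullet> v)" by (rule 1)
  have "((\<lambda>y. 2 * (y \<bullet> v)) has_derivative (\<lambda>w. 2 * (w \<bullet> v))) (at x)"
    by (auto intro!: derivative_eq_intros)
  then show "D2 (\<lambda>x. x \<bullet> x) x v v = 2 * (v \<bullet> v)" unfolding 1 by (rule D1_eqI)
qed

definition bump :: "nat \<Rightarrow> 'a::euclidean_space \<Rightarrow> real \<Rightarrow> 'a \<Rightarrow> real" where
  "bump k p e z = max 0 (e\<^sup>2 - (z - p) \<bullet> (z - p)) ^ (k + Suc 0)"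

lemma bump_Ck: "Ck_on k UNIV (bump k p e)"
  unfolding bump_def[abs_def]
proof (rule Ck_on_compose_real[OF open_UNIV _ Ck_on_pos_part_power])
  have "Ck_on k UNIV (\<lambda>z. (z - p) \<bullet> (z - p))"
  proof (rule Ck_on_compose[OF open_UNIV _ Ck_norm_sq])
    show "Ck_on k UNIV (\<lambda>x. (x - p) \<bullet> b)" for b
      unfolding inner_diff_left
      by (rule Ck_on_diff[OF open_UNIV Ck_on_linear[OF bounded_linear_inner_left] Ck_on_const])
  qed auto
  then show "Ck_on k UNIV (\<lambda>z. e\<^sup>2 - (z - p) \<bullet> (z - p))"
    by (rule Ck_on_diff[OF open_UNIV Ck_on_const])
qed simp

lemma bump_pos_iff:
  assumes "e > 0"
  shows "bump k p e z > 0 \<longleftrightarrow> z \<in> ball p e" "bump k p e z \<ge> 0" "z \<notin> ball p e \<Longrightarrow> bump k p e z = 0"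
proof -
  have "(z - p) \<bullet> (z - p) < e\<^sup>2 \<longleftrightarrow> dist p z < e"
  proof -
    have "(z - p) \<bullet> (z - p) = (dist p z)\<^sup>2" by (simp add: dist_norm norm_minus_commute flip: power2_norm_eq_inner)
    then show ?thesis
      using power_strict_mono[of "dist p z" e 2] power2_less_imp_less[of "dist p z" e] assms by auto
  qed
  then show "bump k p e z > 0 \<longleftrightarrow> z \<in> ball p e" "z \<notin> ball p e \<Longrightarrow> bump k p e z = 0"
    by (auto simp: bump_def zero_less_mult_iff max_def)
  show "bump k p e z \<ge> 0" by (simp add: bump_def)
qed

text \<open>All local defining functions are negative exactly on \<open>\<Omega>\<close>, so in a
  sum with non-negative weights no signs cancel. At boundary points the gradient is non-zero by
  comparison with one summand, and interior or exterior points with zero gradient are removed from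
  the neighbourhood.\<close>

theorem global_defining_function:
  fixes \<Omega> :: "(complex ^ 'n) set"
  assumes \<Omega>: "open \<Omega>" "bounded \<Omega>" "\<Omega> \<noteq> {}" and bd: "Ck_boundary k \<Omega>" and k: "k \<ge> 1"
  obtains V r where "open V" "frontier \<Omega> \<subseteq> V" "Ck_on k V r" "\<And>z. z \<in> V \<Longrightarrow> z \<in> \<Omega> \<longleftrightarrow> r z < 0"
    "\<And>z. z \<in> V \<Longrightarrow> \<exists>v. D1 r z v \<noteq> 0"
proof -
  have ex: "\<forall>p\<in>frontier \<Omega>. \<exists>U f. open U \<and> p \<in> U \<and> Ck_on k U f \<and> U \<inter> \<Omega> = {z \<in> U. f z < 0} \<and> (\<forall>z\<in>U. \<exists>v. D1 f z v \<noteq> 0)"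
    using bd by (simp only: Ck_boundary_def)
  from bchoice[OF ex] obtain U where "\<forall>p\<in>frontier \<Omega>. \<exists>f. open (U p) \<and> p \<in> U p \<and> Ck_on k (U p) f \<and>
      U p \<inter> \<Omega> = {z \<in> U p. f z < 0} \<and> (\<forall>z\<in>U p. \<exists>v. D1 f z v \<noteq> 0)" ..
  from bchoice[OF this] obtain f where all: "\<forall>p\<in>frontier \<Omega>. open (U p) \<and> p \<in> U p \<and> Ck_on k (U p) (f p) \<and>
      U p \<inter> \<Omega> = {z \<in> U p. f p z < 0} \<and> (\<forall>z\<in>U p. \<exists>v. D1 (f p) z v \<noteq> 0)" ..
  have Uf: "open (U p)" "p \<in> U p" "Ck_on k (U p) (f p)" "U p \<inter> \<Omega> = {z \<in> U p. f p z < 0}"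
      "z \<in> U p \<Longrightarrow> \<exists>v. D1 (f p) z v \<noteq> 0" if "p \<in> frontier \<Omega>" for p z
    using bspec[OF all that] by blast+
  have "\<forall>p\<in>frontier \<Omega>. \<exists>e. e > 0 \<and> cball p e \<subseteq> U p"
  proof
    fix p assume p: "p \<in> frontier \<Omega>"
    show "\<exists>e. e > 0 \<and> cball p e \<subseteq> U p" using Uf(1)[OF p] Uf(2)[OF p] open_contains_cball by blast
  qed
  from bchoice[OF this] obtain e where e': "\<forall>p\<in>frontier \<Omega>. e p > 0 \<and> cball p (e p) \<subseteq> U p" ..
  have e: "e p > 0" "cball p (e p) \<subseteq> U p" if "p \<in> frontier \<Omega>" for p using bspec[OF e' that] by simp_all
  have fr: "compact (frontier \<Omega>)" using \<Omega> compact_frontier_bounded by blast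
  have "frontier \<Omega> \<subseteq> (\<Union>p\<in>frontier \<Omega>. ball p (e p))" using e(1) by force
  then obtain P where P: "P \<subseteq> frontier \<Omega>" "finite P" "frontier \<Omega> \<subseteq> (\<Union>p\<in>P. ball p (e p))"
    by (rule compactE_image[OF fr, of "frontier \<Omega>" "\<lambda>p. ball p (e p)", rotated]) simp_all
  define \<theta> where "\<theta> p = bump k p (e p)" for p
  have \<theta>: "\<theta> p z > 0 \<longleftrightarrow> z \<in> ball p (e p)" "\<theta> p z \<ge> 0" "z \<notin> ball p (e p) \<Longrightarrow> \<theta> p z = 0" if "p \<in> P" for p z
    unfolding \<theta>_def using bump_pos_iff[OF e(1)[OF subsetD[OF P(1) that]]] by simp_all
  define R where "R z = (\<Sum>p\<in>P. \<theta> p z * f p z)" for z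
  have term_Ck: "Ck_on k UNIV (\<lambda>z. \<theta> p z * f p z)" if p: "p \<in> P" for p
  proof -
    have pf: "p \<in> frontier \<Omega>" using p P by auto
    have "Ck_on k (U p) (\<lambda>z. \<theta> p z * f p z)"
      unfolding \<theta>_def by (rule Ck_on_mult[OF Uf(1)[OF pf] Ck_on_subset[OF bump_Ck] Uf(3)[OF pf]]) simp
    moreover have "Ck_on k (- cball p (e p)) (\<lambda>z. \<theta> p z * f p z)"
      by (rule Ck_on_cong[OF _ Ck_on_const[of _ _ 0]]) (use \<theta>(3)[OF p] in auto)
    ultimately have "Ck_on k (U p \<union> - cball p (e p)) (\<lambda>z. \<theta> p z * f p z)"
      by (intro Ck_on_Un Uf(1)[OF pf]) auto
    moreover have "U p \<union> - cball p (e p) = UNIV" using e(2)[OF pf] by blast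
    ultimately show ?thesis by simp
  qed
  have R_Ck: "Ck_on k UNIV R" unfolding R_def[abs_def] by (rule Ck_on_sum[OF open_UNIV term_Ck])
  define V0 where "V0 = (\<Union>p\<in>P. ball p (e p))"
  have sign: "z \<in> U p \<Longrightarrow> z \<in> \<Omega> \<longleftrightarrow> f p z < 0" if "p \<in> P" for p z
    using Uf(4)[of p] that P(1) by blast
  have inU: "ball p (e p) \<subseteq> U p" if "p \<in> P" for p using e(2)[of p] that P(1) ball_subset_cball by blast
  have tneg: "\<theta> p z * f p z \<le> 0" if "p \<in> P" "z \<in> \<Omega>" for p z
    using \<theta>[OF that(1), of z] sign[OF that(1), of z] inU[OF that(1)] that(2)
    by (cases "z \<in> ball p (e p)") (auto simp: mult_le_0_iff)
  have tpos: "\<theta> p z * f p z \<ge> 0" if "p \<in> P" "z \<notin> \<Omega>" for p z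
    using \<theta>[OF that(1), of z] sign[OF that(1), of z] subsetD[OF inU[OF that(1)], of z] that(2)
    by (cases "z \<in> ball p (e p)") (auto simp: zero_le_mult_iff not_less)
  have le_one: "R z \<le> \<theta> p z * f p z" if "p \<in> P" "z \<in> \<Omega>" for p z
  proof -
    have "R z = \<theta> p z * f p z + (\<Sum>q\<in>P - {p}. \<theta> q z * f q z)" unfolding R_def by (rule sum.remove[OF P(2) that(1)])
    moreover have "(\<Sum>q\<in>P - {p}. \<theta> q z * f q z) \<le> 0" by (rule sum_nonpos) (use tneg that in auto)
    ultimately show ?thesis by simp
  qed
  have R_sign: "z \<in> \<Omega> \<longleftrightarrow> R z < 0" if "z \<in> V0" for z
  proof
    obtain p where p: "p \<in> P" "z \<in> ball p (e p)" using \<open>z \<in> V0\<close> V0_def by blast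
    assume z: "z \<in> \<Omega>"
    have "f p z < 0" using sign[OF p(1), of z] inU[OF p(1)] p(2) z by blast
    then have "\<theta> p z * f p z < 0" using \<theta>(1)[OF p(1)] p(2) by (simp add: mult_pos_neg)
    then show "R z < 0" using le_one[OF p(1) z] by simp
  next
    assume R: "R z < 0"
    show "z \<in> \<Omega>"
    proof (rule ccontr)
      assume "z \<notin> \<Omega>"
      then have "R z \<ge> 0" unfolding R_def by (intro sum_nonneg tpos)
      then show False using R by simp
    qed
  qed
  have V0: "open V0" "frontier \<Omega> \<subseteq> V0" using P(3) by (auto simp: V0_def)
  obtain k' where k': "k = Suc k'" using k by (cases k) auto
  have Rdiff: "R differentiable (at z)" for z using Ck_on_SucD(3)[OF R_Ck[unfolded k']] by blast
  have grad: "\<exists>v. D1 R z v \<noteq> 0" if z: "z \<in> frontier \<Omega>" for z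
  proof -
    obtain p where p: "p \<in> P" "z \<in> ball p (e p)" using P(3) z by blast
    have pf: "p \<in> frontier \<Omega>" and zU: "z \<in> U p" using p P(1) inU[OF p(1)] by auto
    have zn: "z \<notin> \<Omega>" "z \<in> closure \<Omega>" using z \<Omega> by (auto simp: frontier_def interior_open)
    have fc: "continuous_on (U p) (f p)" by (rule Ck_on_continuous[OF Uf(3)[OF pf]])
    have f0: "f p z = 0"
    proof (rule antisym)
      show "0 \<le> f p z" using sign[OF p(1) zU] zn by simp
      show "f p z \<le> 0"
      proof (rule ccontr)
        assume "\<not> f p z \<le> 0"
        then have "z \<in> U p \<inter> f p -` {0<..}" using zU by simp
        moreover have "open (U p \<inter> f p -` {0<..})" using fc Uf(1)[OF pf] by (simp add: continuous_open_preimage)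
        ultimately have "\<Omega> \<inter> (U p \<inter> f p -` {0<..}) \<noteq> {}"
          using zn(2) by (metis Int_commute closure_iff_nhds_not_empty order_refl)
        then show False using sign[OF p(1)] by force
      qed
    qed
    have fd: "f p differentiable (at z)" using Ck_on_SucD(3)[OF Uf(3)[OF pf, unfolded k']] zU by blast
    obtain v where "D1 (f p) z v \<noteq> 0" using Uf(5)[OF pf zU] by blast
    then obtain N where N: "D1 (f p) z N < 0"
      using D1_lin(4)[OF fd, of v] by (metis neg_less_0_iff_less not_less_iff_gr_or_eq)
    have dR: "((\<lambda>s. R (z + s *\<^sub>R N)) has_real_derivative D1 R z N) (at 0)"
      using has_derivative_along_line[of R z 0 N] Rdiff by simp
    have df: "((\<lambda>s. f p (z + s *\<^sub>R N)) has_real_derivative D1 (f p) z N) (at 0)"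
      using has_derivative_along_line[of "f p" z 0 N] fd by simp
    have "\<theta> p differentiable (at (z + 0 *\<^sub>R N))"
      unfolding \<theta>_def using Ck_on_SucD(3)[OF bump_Ck[of k p "e p", unfolded k']] unfolding k' by blast
    from has_derivative_along_line[OF this]
    have d\<theta>: "((\<lambda>s. \<theta> p (z + s *\<^sub>R N)) has_real_derivative D1 (\<theta> p) z N) (at 0)" by simp
    have dd: "((\<lambda>s. \<theta> p (z + s *\<^sub>R N) * f p (z + s *\<^sub>R N) - R (z + s *\<^sub>R N)) has_real_derivative
        (\<theta> p z * D1 (f p) z N - D1 R z N)) (at 0)"
      using DERIV_diff[OF DERIV_mult[OF d\<theta> df] dR] f0 by (simp add: mult.commute)
    have R0: "R z = 0"
    proof (rule antisym)
      show "0 \<le> R z" unfolding R_def by (intro sum_nonneg tpos zn)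
      have "isCont R z" using Ck_on_continuous[OF R_Ck] by (simp add: continuous_on_eq_continuous_at)
      obtain X where X: "\<And>n. X n \<in> \<Omega>" "X \<longlonglongrightarrow> z" using zn(2) closure_sequential by blast
      have "(\<lambda>n. R (X n)) \<longlonglongrightarrow> R z" by (rule isCont_tendsto_compose[OF \<open>isCont R z\<close> X(2)])
      then show "R z \<le> 0"
        by (rule LIMSEQ_le_const2) (use tneg X in \<open>auto simp: R_def intro!: sum_nonpos\<close>)
    qed
    \<comment> \<open>\<open>R\<close> and the summand both vanish at \<open>z\<close>. Small steps
      along \<open>N\<close> enter \<open>\<Omega>\<close>, where \<open>R\<close> lies below the
      summand, so its slope cannot be larger.\<close>
    have "D1 R z N \<le> \<theta> p z * D1 (f p) z N"
    proof (rule ccontr)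
      assume "\<not> ?thesis"
      then have "\<theta> p z * D1 (f p) z N - D1 R z N < 0" by simp
      from DERIV_neg_dec_right[OF dd this] obtain d1 where d1: "d1 > 0"
        "\<And>h. 0 < h \<Longrightarrow> h < d1 \<Longrightarrow> \<theta> p (z + h *\<^sub>R N) * f p (z + h *\<^sub>R N) - R (z + h *\<^sub>R N) < 0" using f0 R0 by auto
      obtain d2 where d2: "d2 > 0" "\<And>h. 0 < h \<Longrightarrow> h < d2 \<Longrightarrow> f p (z + h *\<^sub>R N) < 0"
        using DERIV_neg_dec_right[OF df N] f0 by auto
      obtain d3 where d3: "d3 > 0" "ball z d3 \<subseteq> U p" using zU Uf(1)[OF pf] open_contains_ball by blast
      define h where "h = min d1 (min d2 (d3 / (1 + norm N))) / 2"
      have nN: "1 + norm N > 0" by (simp add: add_pos_nonneg)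
      have h: "0 < h" "h < d1" "h < d2" using d1 d2 d3 nN by (auto simp: h_def)
      have "z + h *\<^sub>R N \<in> U p"
      proof -
        have "min d1 (min d2 (d3 / (1 + norm N))) \<le> d3 / (1 + norm N)" by (auto intro: min.coboundedI2)
        then have "2 * h \<le> d3 / (1 + norm N)" unfolding h_def by (simp only: mult_2 field_sum_of_halves)
        then have "2 * h * (1 + norm N) \<le> d3" using nN by (simp only: pos_le_divide_eq)
        then have "h * norm N \<le> d3 / 2" using h by (simp add: algebra_simps)
        then show ?thesis using d3 h by (auto simp: dist_norm subset_iff)
      qed
      then have "z + h *\<^sub>R N \<in> \<Omega>" using sign[OF p(1)] d2(2)[OF h(1,3)] by blast
      then show False using le_one[OF p(1)] d1(2)[OF h(1,2)] by force
    qed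
    moreover have "\<theta> p z * D1 (f p) z N < 0" using \<theta>(1)[OF p(1)] p(2) N by (simp add: mult_pos_neg)
    ultimately show ?thesis by (intro exI[of _ N]) linarith
  qed
  define V where "V = {z \<in> V0. \<exists>v. D1 R z v \<noteq> 0}"
  have "V = (\<Union>v. V0 \<inter> (\<lambda>z. D1 R z v) -` (- {0}))" by (auto simp: V_def)
  moreover have "open (V0 \<inter> (\<lambda>z. D1 R z v) -` (- {0}))" for v
    by (rule continuous_open_preimage[OF continuous_on_subset[OF Ck_on_continuous[OF Ck_on_SucD(2)[OF R_Ck[unfolded k']]]] V0(1)]) auto
  then have "open (\<Union>v. V0 \<inter> (\<lambda>z. D1 R z v) -` (- {0}))" by (intro open_UN ballI)
  ultimately have "open V" by (simp only:)
  show ?thesis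
  proof (rule that[of V R])
    show "open V" by fact
    show "frontier \<Omega> \<subseteq> V" using V0(2) grad by (auto simp: V_def)
    show "Ck_on k V R" by (rule Ck_on_subset[OF R_Ck]) simp
    show "z \<in> \<Omega> \<longleftrightarrow> R z < 0" if "z \<in> V" for z by (rule R_sign) (use that V_def in simp)
    show "\<exists>v. D1 R z v \<noteq> 0" if "z \<in> V" for z using that unfolding V_def by simp
  qed
qed

section \<open>Cutoffs\<close>

lemma psh_on_cong:
  fixes u :: "complex ^ 'n \<Rightarrow> real"
  assumes "psh_on \<Omega> u" "\<And>z. z \<in> \<Omega> \<Longrightarrow> u z = v z"
  shows "psh_on \<Omega> v"
proof -
  have usc: "usc_on T g" if "usc_on T f" "\<And>x. x \<in> T \<Longrightarrow> f x = g x" for T :: "'x::topological_space set" and f g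
  proof -
    have "{x \<in> T. f x < a} = {x \<in> T. g x < a}" for a using that(2) by auto
    then show ?thesis using that(1) by (simp add: usc_on_def)
  qed
  have sub: "subharmonic_on S g" if f: "subharmonic_on S f" and e: "\<And>x. x \<in> S \<Longrightarrow> f x = g x" for S f g
    unfolding subharmonic_on_def
  proof (intro conjI allI impI)
    show "usc_on S g" by (rule usc[of S f]) (use f e in \<open>simp_all add: subharmonic_on_def\<close>)
    fix a and s :: real assume s: "0 < s" "cball a s \<subseteq> S"
    have eq: "f (a + complex_of_real s * cis t) = g (a + complex_of_real s * cis t)" for t
      by (rule e) (use s circle_point_sphere[of s a t] in auto)
    have "f a = g a" by (rule e) (use s in auto)
    then show "set_integrable lborel {0..2 * pi} (\<lambda>t. g (a + complex_of_real s * cis t))"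
      "g a \<le> 1 / (2 * pi) * (LBINT t:{0..2 * pi}. g (a + complex_of_real s * cis t))"
      using f[unfolded subharmonic_on_def, THEN conjunct2, rule_format, OF s, unfolded eq] by simp_all
  qed
  show ?thesis unfolding psh_on_def
  proof (intro conjI allI)
    show "usc_on \<Omega> v" by (rule usc[of \<Omega> u]) (use assms in \<open>simp_all add: psh_on_def\<close>)
    show "subharmonic_on {\<tau>. z + \<tau> *s w \<in> \<Omega>} (\<lambda>\<tau>. v (z + \<tau> *s w))" for z w
      by (rule sub[of _ "\<lambda>\<tau>. u (z + \<tau> *s w)"]) (use assms in \<open>simp_all add: psh_on_def\<close>)
  qed
qed

lemma psh_on_scale:
  fixes u :: "complex ^ 'n \<Rightarrow> real"
  assumes "psh_on \<Omega> u" "k > 0"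
  shows "psh_on \<Omega> (\<lambda>z. k * u z)"
proof -
  have usc: "usc_on T (\<lambda>x. k * f x)" if "usc_on T f" for T :: "'x::topological_space set" and f
  proof -
    have "{x \<in> T. k * f x < a} = {x \<in> T. f x < a / k}" for a using assms(2) by (auto simp: field_simps)
    then show ?thesis using that by (simp add: usc_on_def)
  qed
  have sub: "subharmonic_on S (\<lambda>x. k * f x)" if f: "subharmonic_on S f" for S f
    unfolding subharmonic_on_def
  proof (intro conjI allI impI)
    show "usc_on S (\<lambda>x. k * f x)" using usc[of S f] f by (simp add: subharmonic_on_def)
    fix a and s :: real assume s: "0 < s" "cball a s \<subseteq> S"
    have i: "set_integrable lborel {0..2 * pi} (\<lambda>t. f (a + complex_of_real s * cis t))"
      "f a \<le> 1 / (2 * pi) * (LBINT t:{0..2 * pi}. f (a + complex_of_real s * cis t))"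
      using f[unfolded subharmonic_on_def, THEN conjunct2, rule_format, OF s] by simp_all
    show "set_integrable lborel {0..2 * pi} (\<lambda>t. k * f (a + complex_of_real s * cis t))"
      using i(1) by simp
    show "k * f a \<le> 1 / (2 * pi) * (LBINT t:{0..2 * pi}. k * f (a + complex_of_real s * cis t))"
      using mult_left_mono[OF i(2), of k] assms(2) by simp
  qed
  show ?thesis using assms(1) usc sub unfolding psh_on_def by blast
qed

lemma submean_cong:
  fixes u v :: "complex ^ 'n \<Rightarrow> real"
  assumes "open U" "z \<in> U" "\<And>x. x \<in> U \<Longrightarrow> u x = v x"
    and "\<exists>d>0. \<forall>s. 0 < s \<and> s < d \<longrightarrow> v z \<le> cmean (\<lambda>\<tau>. v (z + \<tau> *s w)) 0 s"
  shows "\<exists>d>0. \<forall>s. 0 < s \<and> s < d \<longrightarrow> u z \<le> cmean (\<lambda>\<tau>. u (z + \<tau> *s w)) 0 s"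
proof -
  obtain d1 where d1: "d1 > 0" "\<And>s. 0 < s \<and> s < d1 \<Longrightarrow> v z \<le> cmean (\<lambda>\<tau>. v (z + \<tau> *s w)) 0 s" using assms(4) by blast
  obtain d2 where d2: "d2 > 0" "\<And>\<tau>. norm \<tau> < d2 \<Longrightarrow> z + \<tau> *s w \<in> U" using slice_ball[OF assms(1,2)] by blast
  have "u z \<le> cmean (\<lambda>\<tau>. u (z + \<tau> *s w)) 0 s" if s: "0 < s" "s < min d1 d2" for s
  proof -
    have "cmean (\<lambda>\<tau>. u (z + \<tau> *s w)) 0 s = cmean (\<lambda>\<tau>. v (z + \<tau> *s w)) 0 s"
      by (rule cmean_cong) (use s d2(2) assms(3) in auto)
    then show ?thesis using d1(2)[of s] s assms(2,3) by simp
  qed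
  then show ?thesis using d1(1) d2(1) by (intro exI[of _ "min d1 d2"]) auto
qed

lemma continuous_antiderivative_pos:
  fixes s :: "real \<Rightarrow> real"
  assumes "continuous_on UNIV s" "y > 0"
  shows "((\<lambda>y. integral {0..y} s) has_real_derivative s y) (at y)"
proof -
  have "((\<lambda>y. integral {0..y} s) has_vector_derivative s y) (at y within {0..y + 1})"
    by (rule integral_has_vector_derivative) (use assms continuous_on_subset in auto)
  then have "((\<lambda>y. integral {0..y} s) has_vector_derivative s y) (at y within {0<..<y + 1})"
    by (rule has_vector_derivative_within_subset) auto
  then show ?thesis
    using assms(2) by (simp add: at_within_open[of y "{0<..<y + 1}"] has_real_derivative_iff_has_vector_derivative)
qed

text \<open>\<open>F\<close> integrates a slope \<open>s\<close> that decreases from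
  \<open>1\<close> at \<open>y1\<close> to \<open>0\<close> at \<open>y2\<close>, which makes it
  concave. In the formula for \<open>s\<close> the inner positive-part power makes the contact with
  \<open>1\<close> flat and the outer one the contact with \<open>0\<close>.\<close>

lemma concave_cutoff:
  fixes y1 y2 :: real and k :: nat
  assumes y: "0 < y1" "y1 < y2"
  obtains F s s' where "\<And>y. 0 < y \<Longrightarrow> (F has_real_derivative s y) (at y)" "\<And>y. (s has_real_derivative s' y) (at y)"
    "\<And>y. 0 \<le> s y" "\<And>y. s' y \<le> 0" "Ck_on k {0<..} F"
    "\<And>y. 0 < y \<Longrightarrow> y \<le> y1 \<Longrightarrow> F y = y" "\<And>y. y2 \<le> y \<Longrightarrow> F y = F y2"
    "\<And>y. 0 < y \<Longrightarrow> F y \<le> y" "\<And>y. y1 \<le> y \<Longrightarrow> y1 \<le> F y"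
proof -
  define P where "P x = max 0 x ^ Suc (Suc k)" for x :: real
  have PCk: "Ck_on (Suc k) UNIV P" unfolding P_def[abs_def] using Ck_on_pos_part_power[of "Suc k" 0] by simp
  define s where "s y = P (1 - P ((y - y1) / (y2 - y1)))" for y
  define F where "F y = integral {0..y} s" for y
  have lin: "Ck_on (Suc k) UNIV (\<lambda>y. (y - y1) / (y2 - y1))"
  proof -
    have "Ck_on (Suc k) UNIV (\<lambda>y::real. (1 / (y2 - y1)) * (y - y1))"
      by (rule Ck_on_cmult[OF open_UNIV Ck_on_diff[OF open_UNIV Ck_on_linear[OF bounded_linear_ident] Ck_on_const]])
    then show ?thesis by simp
  qed
  have sCk: "Ck_on (Suc k) UNIV s" unfolding s_def[abs_def]
    by (rule Ck_on_compose_real[OF open_UNIV Ck_on_diff[OF open_UNIV Ck_on_const Ck_on_compose_real[OF open_UNIV lin PCk]] PCk]) auto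
  have sc: "continuous_on X s" for X by (rule continuous_on_subset[OF Ck_on_continuous[OF sCk]]) simp
  have P0: "P x \<ge> 0" for x by (simp add: P_def)
  have Pmono: "P x \<le> P x'" if "x \<le> x'" for x x' unfolding P_def by (rule power_mono) (use that in auto)
  have anti: "s y' \<le> s y" if "y \<le> y'" for y y'
    unfolding s_def by (intro Pmono diff_left_mono divide_right_mono) (use that y in auto)
  have s1: "s y' = 1" if "y' \<le> y1" for y'
  proof -
    have "(y' - y1) / (y2 - y1) \<le> 0" using that y by (simp add: divide_nonpos_pos)
    then show ?thesis by (simp add: s_def P_def max_def)
  qed
  have s2: "s y' = 0" if "y2 \<le> y'" for y'
  proof -
    have "1 \<le> (y' - y1) / (y2 - y1)" using that y by (simp add: le_divide_eq)
    then have "1 \<le> P ((y' - y1) / (y2 - y1))" unfolding P_def by (intro one_le_power) simp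
    then have "max 0 (1 - P ((y' - y1) / (y2 - y1))) = 0" by simp
    then show ?thesis by (simp only: s_def P_def[of "1 - _"]) simp
  qed
  have sle: "s y \<le> 1" for y using anti[of "min y y1" y] s1[of "min y y1"] by simp
  have s0: "s y \<ge> 0" for y by (simp add: s_def P0)
  have sd: "(s has_real_derivative D1 s y 1) (at y)" for y
    using has_derivative_along_line[of s 0 y 1] Ck_on_SucD(3)[OF sCk, of y] by simp
  have s'0: "D1 s y 1 \<le> 0" for y
  proof (rule ccontr)
    assume "\<not> D1 s y 1 \<le> 0"
    then have "0 < D1 s y 1" by simp
    from DERIV_pos_inc_right[OF sd this] obtain d where d: "d > 0" "\<And>h. 0 < h \<Longrightarrow> h < d \<Longrightarrow> s y < s (y + h)" by auto
    then have "s y < s (y + d / 2)" by simp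
    then show False using anti[of y "y + d / 2"] d(1) by simp
  qed
  have Fd: "(F has_real_derivative s y) (at y)" if "0 < y" for y
    unfolding F_def[abs_def] by (rule continuous_antiderivative_pos[OF sc that])
  have si: "s integrable_on {a..b}" for a b by (rule integrable_continuous_real[OF sc])
  have Flow: "F y = y" if "0 < y" "y \<le> y1" for y
  proof -
    have "F y = integral {0..y} (\<lambda>_. 1)" unfolding F_def by (rule integral_cong) (use s1 that in auto)
    then show ?thesis using that by simp
  qed
  have Fadd: "F y' = F y + integral {y..y'} s" if "0 \<le> y" "y \<le> y'" for y y'
    unfolding F_def by (rule Henstock_Kurzweil_Integration.integral_combine[symmetric, OF that si])
  have Fhigh: "F y = F y2" if "y2 \<le> y" for y
  proof -
    have "integral {y2..y} s = integral {y2..y} (\<lambda>_. 0)" by (rule integral_cong) (use s2 in auto)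
    then show ?thesis using Fadd[of y2 y] that y by simp
  qed
  have Fle: "F y \<le> y" if "0 < y" for y
  proof -
    have "F y \<le> integral {0..y} (\<lambda>_. 1)" unfolding F_def
      by (rule integral_le[OF si integrable_const_ivl]) (use sle in auto)
    then show ?thesis using that by simp
  qed
  have Fge: "y1 \<le> F y" if "y1 \<le> y" for y
  proof -
    have "0 \<le> integral {y1..y} s" by (rule integral_nonneg[OF si]) (use s0 in auto)
    then show ?thesis using Fadd[of y1 y] Flow[of y1] that y by simp
  qed
  have FCk: "Ck_on k {0<..} F"
  proof (rule Ck_on_Suc_imp, rule Ck_on_SucI)
    show "(F has_derivative (\<lambda>v. s x * v)) (at x)" if "x \<in> {0<..}" for x
      by (rule has_derivative_of_real_derivative[OF Fd]) (use that in simp)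
    show "Ck_on k {0<..} (\<lambda>x. s x * v)" for v
      by (rule Ck_on_mult[OF open_greaterThan Ck_on_subset[OF Ck_on_Suc_imp[OF sCk]] Ck_on_const]) simp
  qed simp
  show ?thesis
    by (rule that[OF Fd sd s0 s'0 FCk Flow Fhigh Fle Fge])
qed

text \<open>The added term \<open>L * \<bar>z\<bar>\<^sup>2\<close> gains
  \<open>4 * L * N\<^sup>2\<close> in the Levi form. Of this, \<open>L\<close> covers the defect
  left by \<open>main_estimate\<close>, \<open>2 * e \<le> L\<close> the approximation error, and
  \<open>2 * L\<close> the change of the gradient term through Young's inequality; that change is
  quadratic in \<open>L\<close>, so the last hypothesis holds for small \<open>L\<close>.\<close>

lemma levi_perturbation:
  fixes Y Y2 :: complex
  assumes "- L * N\<^sup>2 \<le> P + Lt - \<eta>' * (1 + \<kappa>) * (norm Y)\<^sup>2" "Lt + (4 * L - 2 * e) * N\<^sup>2 \<le> L2"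
    "norm (Y2 - Y) \<le> 6 * (L * R * N)" "0 < \<kappa>" "0 < \<eta>'" "0 \<le> L" "2 * e \<le> L" "18 * \<eta>' * (1 + 1 / \<kappa>) * R\<^sup>2 * L \<le> 1"
  shows "\<eta>' * (norm Y2)\<^sup>2 \<le> P + L2"
proof -
  define a where "a = norm Y"
  define b where "b = norm (Y2 - Y)"
  have n: "norm Y2 \<le> a + b" unfolding a_def b_def using norm_triangle_ineq[of Y "Y2 - Y"] by simp
  have "0 \<le> (\<kappa> * a - b)\<^sup>2 / \<kappa>" using assms(4) by simp
  also have "\<dots> = \<kappa> * a\<^sup>2 - 2 * a * b + b\<^sup>2 / \<kappa>" using assms(4) by (simp add: power2_eq_square field_simps)
  finally have y: "2 * a * b \<le> \<kappa> * a\<^sup>2 + b\<^sup>2 / \<kappa>" by simp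
  have "(norm Y2)\<^sup>2 \<le> (a + b)\<^sup>2" by (rule power_mono[OF n]) simp
  also have "\<dots> = a\<^sup>2 + b\<^sup>2 + 2 * a * b" by (simp add: power2_eq_square algebra_simps)
  also have "\<dots> \<le> (1 + \<kappa>) * a\<^sup>2 + (1 + 1 / \<kappa>) * b\<^sup>2" using y by (simp add: algebra_simps)
  finally have 1: "\<eta>' * (norm Y2)\<^sup>2 \<le> \<eta>' * ((1 + \<kappa>) * a\<^sup>2 + (1 + 1 / \<kappa>) * b\<^sup>2)"
    by (rule mult_left_mono) (use assms(5) in simp)
  have "b\<^sup>2 \<le> (6 * (L * R * N))\<^sup>2" by (rule power_mono[OF assms(3)[folded b_def]]) (simp add: b_def)
  then have "\<eta>' * (1 + 1 / \<kappa>) * b\<^sup>2 \<le> \<eta>' * (1 + 1 / \<kappa>) * (6 * (L * R * N))\<^sup>2"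
    by (rule mult_left_mono) (use assms in simp)
  also have "\<dots> = (18 * \<eta>' * (1 + 1 / \<kappa>) * R\<^sup>2 * L) * (2 * L * N\<^sup>2)" by (simp add: power2_eq_square)
  also have "\<dots> \<le> 1 * (2 * L * N\<^sup>2)" by (rule mult_right_mono[OF assms(8)]) (use assms(6) in simp)
  finally have 2: "\<eta>' * (1 + 1 / \<kappa>) * b\<^sup>2 \<le> 2 * L * N\<^sup>2" by simp
  have 3: "2 * e * N\<^sup>2 \<le> L * N\<^sup>2" by (rule mult_right_mono[OF assms(7)]) simp
  have 4: "\<eta>' * ((1 + \<kappa>) * a\<^sup>2 + (1 + 1 / \<kappa>) * b\<^sup>2) = \<eta>' * (1 + \<kappa>) * a\<^sup>2 + \<eta>' * (1 + 1 / \<kappa>) * b\<^sup>2"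
    by (subst distrib_left) (simp only: mult.assoc)
  have 5: "(4 * L - 2 * e) * N\<^sup>2 = 4 * (L * N\<^sup>2) - 2 * e * N\<^sup>2" by (simp add: algebra_simps)
  show ?thesis using 1[unfolded 4, unfolded a_def] 2 3 assms(1) assms(2)[unfolded 5] by linarith
qed

context collar
begin

text \<open>With \<open>z = p + s *\<^sub>R nu z\<close> as in \<open>foot\<close>, the boundary
  distance is at most \<open>s * C\<close> while \<open>- r z\<close> is at least
  \<open>c1 * s\<close>.\<close>

lemma r_comparable_bdist:
  obtains d where "d > 0" "\<And>z. z \<in> \<Omega> \<Longrightarrow> bdist \<Omega> z < d \<Longrightarrow> c2 * bdist \<Omega> z \<le> - r z \<and> - r z \<le> C * bdist \<Omega> z"
proof -
  obtain d where d: "d > 0" "\<forall>z\<in>\<Omega>. bdist \<Omega> z < d \<longrightarrow> (\<exists>s p. 0 < s \<and> s < T \<and> z = p + s *\<^sub>R nu z \<and>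
        p \<in> frontier \<Omega> \<and> norm (nu z) \<le> C \<and> (\<forall>\<sigma>\<in>{0..T}. p + \<sigma> *\<^sub>R nu z \<in> K \<and> D1 r (p + \<sigma> *\<^sub>R nu z) (nu z) \<le> - c1))"
    using foot[OF pos(3)] by blast
  show ?thesis
  proof (rule that[OF d(1)])
    fix z assume z: "z \<in> \<Omega>" "bdist \<Omega> z < d"
    obtain s p where s: "0 < s" "s < T" and zp: "z = p + s *\<^sub>R nu z" and adm: "adm p (nu z)"
      using d(2)[rule_format, OF z] unfolding adm_def by blast
    have zK: "z \<in> K" using adm_point(1)[OF adm, of s] s zp[symmetric] by simp
    have rz: "r z \<le> - (c1 * s)" using adm_r(1)[OF adm s(1)] s zp[symmetric] by simp
    have "bdist \<Omega> z \<le> dist z p" unfolding bdist_def by (rule infdist_le[OF adm_base(1)[OF adm]])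
    also have "dist z p = norm (z - p)" by (rule dist_norm)
    also have "z - p = s *\<^sub>R nu z" using zp by (metis add_diff_cancel_left')
    also have "norm (s *\<^sub>R nu z) \<le> s * C" using s adm_base(2)[OF adm] by simp
    finally have "c2 * bdist \<Omega> z \<le> c2 * (s * C)" using c2_pos by simp
    also have "\<dots> = c1 * s" using pos by (simp add: c2_def)
    finally have "c2 * bdist \<Omega> z \<le> - r z" using rz by linarith
    then show "c2 * bdist \<Omega> z \<le> - r z \<and> - r z \<le> C * bdist \<Omega> z" using r_le[of z] zK z by simp
  qed
qed

lemma smooth_collar_function:
  assumes rk: "Ck_on k V r" and k: "k \<ge> 2" and \<eta>': "0 < \<eta>'" "\<eta>' < \<eta>"
  obtains W \<rho>' u \<epsilon> B1 B2 where "open W" "\<epsilon> > 0" "\<And>z. z \<in> closure \<Omega> \<Longrightarrow> bdist \<Omega> z \<le> \<epsilon> \<Longrightarrow> z \<in> W"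
    "Ck_on k W \<rho>'" "B1 > 0" "B2 > 0"
    "\<And>z. z \<in> \<Omega> \<Longrightarrow> bdist \<Omega> z \<le> \<epsilon> \<Longrightarrow> B1 * bdist \<Omega> z \<le> - \<rho>' z \<and> - \<rho>' z \<le> B2 * bdist \<Omega> z"
    "Ck_on 2 (\<Omega> \<inter> W) u" "\<And>z. z \<in> \<Omega> \<inter> W \<Longrightarrow> - \<rho>' z = exp (- u z)"
    "\<And>z w. z \<in> \<Omega> \<Longrightarrow> bdist \<Omega> z \<le> \<epsilon> \<Longrightarrow> \<eta>' * (norm (dd u z w))\<^sup>2 \<le> levi u z w"
proof -
  obtain R where R: "R > 0" "\<And>z. z \<in> \<Omega> \<Longrightarrow> norm z \<le> R" using \<Omega>(2) bounded_pos by metis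
  \<comment> \<open>Puts \<open>\<eta>''\<close> half way between \<open>\<eta>'\<close> and
    \<open>\<eta>\<close>: the upper half of the gap is used by \<open>main_estimate\<close>, the
    lower half by \<open>levi_perturbation\<close>.\<close>
  define \<kappa> where "\<kappa> = (\<eta> - \<eta>') / (2 * \<eta>')"
  have \<kappa>: "\<kappa> > 0" using \<eta>' by (simp add: \<kappa>_def)
  define \<eta>'' where "\<eta>'' = \<eta>' * (1 + \<kappa>)"
  have "\<eta>'' = (\<eta> + \<eta>') / 2" using \<eta>' by (simp add: \<eta>''_def \<kappa>_def field_simps)
  then have \<eta>'': "0 < \<eta>''" "\<eta>'' < \<eta>" using \<eta>' by auto
  define Q where "Q = 18 * \<eta>' * (1 + 1 / \<kappa>) * R\<^sup>2"
  have Q: "Q > 0" using \<eta>' \<kappa> R(1) by (simp add: Q_def add_pos_pos)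
  \<comment> \<open>Makes the product in the last hypothesis of \<open>levi_perturbation\<close>
    equal to \<open>1\<close>; the same \<open>L\<close> is also the defect permitted in
    \<open>main_estimate\<close>.\<close>
  define L where "L = 1 / Q"
  have L: "L > 0" "Q * L \<le> 1" using Q by (simp_all add: L_def)
  define e where "e = min (L / 2) (L * R)"
  have e: "e > 0" "2 * e \<le> L" "e \<le> L * R" using L R by (auto simp: e_def)
  obtain t \<epsilon>3 where t: "t > 0" "\<epsilon>3 > 0" "\<And>z. z \<in> closure \<Omega> \<Longrightarrow> bdist \<Omega> z < \<epsilon>3 \<Longrightarrow> z \<in> shiftdom t"
    and est: "\<And>z w. z \<in> \<Omega> \<Longrightarrow> bdist \<Omega> z < \<epsilon>3 \<Longrightarrow>
       - L * (norm w)\<^sup>2 \<le> levi r z w / (- r z) + (norm (dd r z w / of_real (- r z)))\<^sup>2 + levi (\<lambda>x. g (x + t *\<^sub>R nu x)) z w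
         - \<eta>'' * (norm (dd (\<lambda>x. g (x + t *\<^sub>R nu x)) z w + dd r z w / of_real (- r z)))\<^sup>2"
    using main_estimate[OF \<eta>'' L(1)] by blast
  define gt where "gt x = g (x + t *\<^sub>R nu x)" for x
  obtain d where d: "d > 0" "\<And>z. z \<in> \<Omega> \<Longrightarrow> bdist \<Omega> z < d \<Longrightarrow> c2 * bdist \<Omega> z \<le> - r z \<and> - r z \<le> C * bdist \<Omega> z"
    using r_comparable_bdist by blast
  define \<epsilon> where "\<epsilon> = min \<epsilon>3 d / 2"
  have \<epsilon>: "\<epsilon> > 0" "\<epsilon> < \<epsilon>3" "\<epsilon> < d" using t d(1) by (auto simp: \<epsilon>_def)
  define K2 where "K2 = closure \<Omega> \<inter> bdist \<Omega> -` {..\<epsilon>}"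
  have K2_iff: "z \<in> K2 \<longleftrightarrow> z \<in> closure \<Omega> \<and> bdist \<Omega> z \<le> \<epsilon>" for z by (simp add: K2_def)
  have "closed K2" unfolding K2_def
    by (rule continuous_closed_preimage[OF continuous_on_bdist closed_closure closed_atMost])
  moreover have "bounded K2" by (rule bounded_subset[OF bounded_closure[OF \<Omega>(2)]]) (simp add: K2_def)
  ultimately have K2c: "compact K2" by (simp add: compact_eq_bounded_closed)
  obtain p where "p \<in> frontier \<Omega>" using frontier_ne[OF \<Omega>(3,2)] by blast
  then have "p \<in> K2" unfolding K2_iff using \<epsilon>(1) by (simp add: bdist_def frontier_def)
  then have K2n: "K2 \<noteq> {}" by blast
  have K2s: "K2 \<subseteq> shiftdom t" using t(3) \<epsilon>(2) by (auto simp: K2_iff)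
  obtain W' g1 where W': "open W'" "K2 \<subseteq> W'" "Ck_on k W' g1"
    and g1: "\<And>x v. x \<in> K2 \<Longrightarrow> \<bar>D1 g1 x v - D1 gt x v\<bar> \<le> e * norm v"
      "\<And>x v. x \<in> K2 \<Longrightarrow> \<bar>D2 g1 x v v - D2 gt x v v\<bar> \<le> e * (norm v)\<^sup>2"
    using C2_approximation[OF gt_Ck[of t, folded gt_def[abs_def]] open_shiftdom K2c K2s K2n e(1) k] by metis
  define W where "W = W' \<inter> V"
  have W: "open W" using W'(1) V(1) by (simp add: W_def open_Int)
  have K2W: "K2 \<subseteq> W" using W'(2) K2s by (auto simp: W_def shiftdom_def)
  have rW: "Ck_on k W r" by (rule Ck_on_subset[OF rk]) (simp add: W_def)
  have g1W: "Ck_on k W g1" by (rule Ck_on_subset[OF W'(3)]) (simp add: W_def)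
  define g2 where "g2 x = g1 x + L * (x \<bullet> x)" for x
  have g2W: "Ck_on k W g2" unfolding g2_def[abs_def] by (rule Ck_on_add[OF W g1W Ck_on_cmult[OF W Ck_norm_sq]])
  define \<rho>' where "\<rho>' x = r x * exp (- g2 x)" for x
  have \<rho>'W: "Ck_on k W \<rho>'" unfolding \<rho>'_def[abs_def]
    by (rule Ck_on_mult[OF W rW Ck_on_compose_real[OF W Ck_on_uminus[OF W g2W] Ck_on_exp]]) simp
  have "bounded (g2 ` K2)"
    by (rule compact_imp_bounded[OF compact_continuous_image[OF continuous_on_subset[OF Ck_on_continuous[OF g2W] K2W] K2c]])
  then obtain M where M: "\<And>z. z \<in> K2 \<Longrightarrow> \<bar>g2 z\<bar> \<le> M" unfolding bounded_iff by auto
  define u where "u x = - ln (- r x) + 1 * g2 x" for x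
  have \<Omega>W: "open (\<Omega> \<inter> W)" using \<Omega>(1) W by (rule open_Int)
  have r\<Omega>W: "Ck_on 2 (\<Omega> \<inter> W) r" by (rule Ck_on_subset[OF r2]) (auto simp: W_def)
  have rneg: "r y < 0" if "y \<in> \<Omega> \<inter> W" for y using r_neg[of y] that by (simp add: W_def)
  have g12: "Ck_on 2 (\<Omega> \<inter> W) g1" by (rule Ck_on_mono[OF Ck_on_subset[OF g1W] k]) simp
  have g22: "Ck_on 2 (\<Omega> \<inter> W) g2" by (rule Ck_on_mono[OF Ck_on_subset[OF g2W] k]) simp
  have lnr: "Ck_on 2 (\<Omega> \<inter> W) (\<lambda>x. - ln (- r x))" by (rule Ck_neg_log[OF r\<Omega>W \<Omega>W rneg])
  have u2: "Ck_on 2 (\<Omega> \<inter> W) u" unfolding u_def[abs_def]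
    by (rule Ck_on_add[OF \<Omega>W lnr Ck_on_cmult[OF \<Omega>W g22]])
  have in\<Omega>W: "z \<in> \<Omega> \<inter> W" "z \<in> K2" if "z \<in> \<Omega>" "bdist \<Omega> z \<le> \<epsilon>" for z
  proof -
    show "z \<in> K2" using that closure_subset[of \<Omega>] by (auto simp: K2_iff)
    then show "z \<in> \<Omega> \<inter> W" using K2W that(1) by auto
  qed
  show ?thesis
  proof (rule that[OF W \<epsilon>(1) _ \<rho>'W _ _ _ u2])
    show "z \<in> W" if "z \<in> closure \<Omega>" "bdist \<Omega> z \<le> \<epsilon>" for z using K2W that by (auto simp: K2_iff)
    show "c2 * exp (- M) > 0" "C * exp M > 0" using c2_pos pos by simp_all
    show "c2 * exp (- M) * bdist \<Omega> z \<le> - \<rho>' z \<and> - \<rho>' z \<le> C * exp M * bdist \<Omega> z"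
      if z: "z \<in> \<Omega>" "bdist \<Omega> z \<le> \<epsilon>" for z
    proof -
      have g: "- M \<le> - g2 z" "- g2 z \<le> M" using M[OF in\<Omega>W(2)[OF z]] by auto
      have b: "c2 * bdist \<Omega> z \<le> - r z" "- r z \<le> C * bdist \<Omega> z" using d(2)[of z] z \<epsilon>(3) by auto
      have n: "0 \<le> c2 * bdist \<Omega> z" "0 \<le> - r z" using c2_pos bdist_nonneg[of \<Omega> z] rneg[OF in\<Omega>W(1)[OF z]] by auto
      have "(c2 * bdist \<Omega> z) * exp (- M) \<le> - r z * exp (- g2 z)" by (rule mult_mono) (use g b n in simp_all)
      moreover have "- r z * exp (- g2 z) \<le> (C * bdist \<Omega> z) * exp M" by (rule mult_mono) (use g b n in simp_all)
      ultimately show ?thesis by (simp add: \<rho>'_def mult_ac)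
    qed
    show "- \<rho>' z = exp (- u z)" if z: "z \<in> \<Omega> \<inter> W" for z
    proof -
      have "exp (- u z) = exp (ln (- r z)) * exp (- g2 z)" by (simp add: u_def exp_diff exp_minus field_simps)
      then show ?thesis using rneg[OF z] by (simp add: \<rho>'_def)
    qed
    show "\<eta>' * (norm (dd u z w))\<^sup>2 \<le> levi u z w" if z: "z \<in> \<Omega>" "bdist \<Omega> z \<le> \<epsilon>" for z w
    proof -
      note zW = in\<Omega>W(1)[OF z] and zK = in\<Omega>W(2)[OF z]
      have d1: "D1 g2 z v = D1 g1 z v + L * (2 * (z \<bullet> v))" "D2 g2 z v v = D2 g1 z v v + L * (2 * (v \<bullet> v))" for v
        unfolding g2_def[abs_def] D12_add(1)[OF \<Omega>W g12 Ck_norm_sq zW] D12_add(2)[OF \<Omega>W g12 Ck_norm_sq zW]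
          norm_sq_derivs(2) by (simp_all only: norm_sq_derivs(1))
      have d2: "D1 u z v = D1 (\<lambda>x. - ln (- r x)) z v + D1 g2 z v" "D2 u z v v = D2 (\<lambda>x. - ln (- r x)) z v v + D2 g2 z v v" for v
        unfolding u_def[abs_def] D12_add[OF \<Omega>W lnr g22 zW] by simp_all
      define X where "X = dd r z w / of_real (- r z)"
      note nl = levi_neg_log[OF r\<Omega>W \<Omega>W zW rneg, of w, folded X_def]
      have ddu: "dd u z w = dd g2 z w + X" using nl(1) by (simp add: dd_def d2 complex_eq_iff)
      have lu: "levi u z w = (levi r z w / (- r z) + (norm X)\<^sup>2) + levi g2 z w"
        using nl(2) by (simp add: levi_def d2)
      have wJ: "J w \<bullet> J w = (norm w)\<^sup>2" "w \<bullet> w = (norm w)\<^sup>2" by (simp_all add: norm_J flip: power2_norm_eq_inner)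
      have lg: "levi gt z w + (4 * L - 2 * e) * (norm w)\<^sup>2 \<le> levi g2 z w"
        using g1(2)[OF zK, of w] g1(2)[OF zK, of "J w"] unfolding levi_def d1 wJ norm_J
        by (simp add: algebra_simps)
      have ip: "\<bar>z \<bullet> v\<bar> \<le> R * norm v" for v
        using Cauchy_Schwarz_ineq2[of z v] mult_right_mono[OF R(2)[OF z(1)] norm_ge_zero[of v]] by linarith
      have ab: "\<bar>D1 g2 z v - D1 gt z v\<bar> \<le> 3 * (L * R * norm v)" for v
      proof -
        have "\<bar>D1 g1 z v - D1 gt z v\<bar> \<le> L * R * norm v"
          by (rule order_trans[OF g1(1)[OF zK] mult_right_mono[OF e(3)]]) simp
        moreover have "\<bar>L * (2 * (z \<bullet> v))\<bar> \<le> 2 * (L * R * norm v)"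
          using mult_left_mono[OF ip[of v], of L] L(1) by (simp add: abs_mult)
        ultimately show ?thesis unfolding d1 by linarith
      qed
      have "norm (Complex (D1 g2 z w) (- D1 g2 z (J w)) - Complex (D1 gt z w) (- D1 gt z (J w))) \<le> 2 * (3 * (L * R * norm w))"
        by (rule norm_dd_diff_le[OF ab ab[of "J w", unfolded norm_J]])
      then have dY: "norm ((dd g2 z w + X) - (dd gt z w + X)) \<le> 6 * (L * R * norm w)" by (simp add: dd_def)
      show ?thesis unfolding ddu lu
      proof (rule levi_perturbation[OF _ lg dY \<kappa> \<eta>'(1) _ e(2) L(2)[unfolded Q_def]])
        show "0 \<le> L" using L by simp
        show "- L * (norm w)\<^sup>2 \<le> levi r z w / - r z + (norm X)\<^sup>2 + levi gt z w - \<eta>' * (1 + \<kappa>) * (norm (dd gt z w + X))\<^sup>2"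
          using est[OF z(1), of w, folded gt_def[abs_def] X_def \<eta>''_def] z(2) \<epsilon>(2) by (simp add: \<eta>''_def)
      qed
    qed
  qed
qed

end

text \<open>Conjugating the concave cutoff by the power \<open>\<eta>\<close> makes the
  \<open>\<eta>\<close>-th power of \<open>\<Theta> x\<close> a concave function of that of
  \<open>x\<close>, as plurisubharmonicity requires. Below \<open>m1\<close>, and in particular for
  \<open>x \<le> 0\<close>, \<open>\<Theta>\<close> is the identity, so
  \<open>\<Theta> (- \<rho>)\<close> stays \<open>C\<^sup>k\<close> across the boundary, where the
  power is singular.\<close>

lemma smooth_exhausting_cutoff:
  fixes \<eta> m :: real
  assumes \<eta>: "0 < \<eta>" and m: "0 < m"
  obtains \<Theta> F s s' m1 where "Ck_on k UNIV \<Theta>" "0 < m1" "\<And>x. 0 < x \<Longrightarrow> \<Theta> x \<le> x" "\<And>x. 0 < x \<Longrightarrow> min x m1 \<le> \<Theta> x"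
    "\<And>x. m \<le> x \<Longrightarrow> \<Theta> x = \<Theta> m" "\<And>x. 0 < x \<Longrightarrow> \<Theta> x powr \<eta> = F (x powr \<eta>)" "m1 \<le> m" "Ck_on k {0<..} F"
    "\<And>y. 0 < y \<Longrightarrow> (F has_real_derivative s y) (at y)" "\<And>y. (s has_real_derivative s' y) (at y)"
    "\<And>y. 0 \<le> s y" "\<And>y. s' y \<le> (0 :: real)"
proof -
  define y2 where "y2 = m powr \<eta>"
  define y1 where "y1 = y2 / 2"
  have y: "0 < y1" "y1 < y2" using m by (auto simp: y1_def y2_def)
  obtain F s s' where F: "\<And>y. 0 < y \<Longrightarrow> (F has_real_derivative s y) (at y)" "\<And>y. (s has_real_derivative s' y) (at y)"
    "\<And>y. 0 \<le> s y" "\<And>y. s' y \<le> 0" "Ck_on k {0<..} F"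
    "\<And>y. 0 < y \<Longrightarrow> y \<le> y1 \<Longrightarrow> F y = y" "\<And>y. y2 \<le> y \<Longrightarrow> F y = F y2"
    "\<And>y. 0 < y \<Longrightarrow> F y \<le> y" "\<And>y. y1 \<le> y \<Longrightarrow> y1 \<le> F y"
    using concave_cutoff[OF y, of k] by blast
  define m1 where "m1 = y1 powr (1 / \<eta>)"
  have m1: "m1 > 0" "m1 powr \<eta> = y1" using y(1) \<eta> by (simp_all add: m1_def powr_powr)
  define G where "G x = F (x powr \<eta>) powr (1 / \<eta>)" for x
  define \<Theta> where "\<Theta> x = (if x < m1 then x else G x)" for x
  have root: "(x powr \<eta>) powr (1 / \<eta>) = x" if "x > 0" for x :: real using that \<eta> by (simp add: powr_powr)
  have low: "x powr \<eta> \<le> y1" if "0 < x" "x < m1" for x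
    using powr_mono2[of \<eta> x m1] that \<eta> m1 by simp
  have high: "y1 \<le> x powr \<eta>" if "m1 \<le> x" for x
    using powr_mono2[of \<eta> m1 x] that \<eta> m1 by simp
  have Fpos: "F y > 0" if "y > 0" for y using F(6)[of y] F(9)[of y] that y(1) by linarith
  have G_low: "G x = x" if "0 < x" "x < m1" for x
    unfolding G_def using F(6)[of "x powr \<eta>"] low[OF that] root[OF that(1)] that(1) by simp
  have \<Theta>G: "\<Theta> x = G x" if "0 < x" for x using G_low[OF that] by (simp add: \<Theta>_def)
  have "Ck_on k {0<..} G" unfolding G_def[abs_def]
    by (rule Ck_on_compose_real[OF open_greaterThan Ck_on_compose_real[OF open_greaterThan Ck_on_powr F(5)] Ck_on_powr])
      (use Fpos in auto)
  then have "Ck_on k {0<..} \<Theta>" by (rule Ck_on_cong[OF open_greaterThan]) (simp add: \<Theta>G)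
  moreover have "Ck_on k {..<m1} \<Theta>"
    by (rule Ck_on_cong[OF open_lessThan Ck_on_linear[OF bounded_linear_ident]]) (simp add: \<Theta>_def)
  ultimately have "Ck_on k ({0<..} \<union> {..<m1}) \<Theta>" by (intro Ck_on_Un) simp_all
  moreover have "{0<..} \<union> {..<m1} = UNIV" using m1(1) by auto
  ultimately have \<Theta>Ck: "Ck_on k UNIV \<Theta>" by simp
  have \<Theta>F: "\<Theta> x powr \<eta> = F (x powr \<eta>)" if "0 < x" for x
    unfolding \<Theta>G[OF that] G_def using Fpos[of "x powr \<eta>"] that \<eta> by (simp add: powr_powr)
  have le: "\<Theta> x \<le> x" if "0 < x" for x
  proof -
    have "F (x powr \<eta>) powr (1 / \<eta>) \<le> (x powr \<eta>) powr (1 / \<eta>)"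
      by (rule powr_mono2) (use F(8)[of "x powr \<eta>"] Fpos[of "x powr \<eta>"] that \<eta> in auto)
    then show ?thesis using \<Theta>G[OF that] root[OF that] by (simp add: G_def)
  qed
  have ge: "min x m1 \<le> \<Theta> x" if "0 < x" for x
  proof (cases "x < m1")
    case False
    have "y1 powr (1 / \<eta>) \<le> F (x powr \<eta>) powr (1 / \<eta>)"
      by (rule powr_mono2) (use F(9)[OF high[of x]] False y \<eta> in auto)
    then have "m1 \<le> \<Theta> x" using \<Theta>G[OF that] by (simp add: G_def m1_def)
    then show ?thesis by simp
  qed (simp add: \<Theta>_def)
  have "m1 \<le> y2 powr (1 / \<eta>)" unfolding m1_def by (rule powr_mono2) (use y \<eta> in auto)
  then have m1m: "m1 \<le> m" using root[OF m] by (simp add: y2_def)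
  have const: "\<Theta> x = \<Theta> m" if "m \<le> x" for x
  proof -
    have "y2 \<le> x powr \<eta>" unfolding y2_def by (rule powr_mono2) (use m \<eta> that in auto)
    then have "F (x powr \<eta>) = F y2" by (rule F(7))
    then show ?thesis using \<Theta>G[of x] \<Theta>G[of m] m that by (simp add: G_def y2_def)
  qed
  show ?thesis by (rule that[OF \<Theta>Ck m1(1) le ge const \<Theta>F m1m F(5) F(1-4)])
qed

lemma submean_const:
  fixes z w :: "complex ^ 'n"
  shows "\<exists>d>0. \<forall>s. 0 < s \<and> s < d \<longrightarrow> a \<le> cmean (\<lambda>\<tau>. a) 0 s"
  by (rule submean_of_levi_nonneg[of UNIV "\<lambda>_ :: complex ^ 'n. a" z w])
    (simp_all add: Ck_on_const levi_def frechet_derivative_const)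

lemma levi_compose:
  fixes f :: "complex ^ 'n \<Rightarrow> real"
  assumes "open U" "Ck_on 2 U f" "x \<in> U"
    and "\<And>x. x \<in> U \<Longrightarrow> (\<phi> has_real_derivative \<phi>' (f x)) (at (f x))"
    and "\<And>x. x \<in> U \<Longrightarrow> (\<phi>' has_real_derivative \<phi>'' (f x)) (at (f x))"
  shows "levi (\<lambda>x. \<phi> (f x)) x w = \<phi>'' (f x) * (norm (dd f x w))\<^sup>2 + \<phi>' (f x) * levi f x w"
proof -
  have "D2 (\<lambda>x. \<phi> (f x)) x v v = \<phi>'' (f x) * (D1 f x v)\<^sup>2 + \<phi>' (f x) * D2 f x v v" for v
    using chain_rule_real(2)[OF assms(1,2,4,5,3), of v v] by (simp add: power2_eq_square)
  then show ?thesis unfolding levi_def norm_dd_sq by (simp add: algebra_simps)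
qed

text \<open>\<open>t \<mapsto> - F (- t)\<close> is non-decreasing and convex because
  \<open>F\<close> is non-decreasing and concave. It is composed with
  \<open>\<mu> = - exp (- \<eta> * u)\<close>, whose Levi form is non-negative by
  \<open>levi_neg_exp\<close>.\<close>

lemma levi_cutoff_nonneg:
  fixes u :: "complex ^ 'n \<Rightarrow> real"
  assumes u: "Ck_on 2 X u" "open X" "x \<in> X" and \<eta>: "0 < \<eta>"
    and lev: "\<eta> * (norm (dd u x w))\<^sup>2 \<le> levi u x w"
    and F: "\<And>y. 0 < y \<Longrightarrow> (F has_real_derivative s y) (at y)" "\<And>y. (s has_real_derivative s' y) (at y)"
      "\<And>y. 0 \<le> s y" "\<And>y. s' y \<le> (0 :: real)"
  shows "0 \<le> levi (\<lambda>x. - F (exp (- \<eta> * u x))) x w"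
proof -
  define \<mu> where "\<mu> x = - exp (- \<eta> * u x)" for x
  have \<mu>: "Ck_on 2 X \<mu>" unfolding \<mu>_def[abs_def]
    by (rule Ck_on_uminus[OF u(2) Ck_on_compose_real[OF u(2) Ck_on_cmult[OF u(2,1)] Ck_on_exp]]) simp
  have "0 \<le> levi \<mu> x w"
    unfolding \<mu>_def[abs_def] levi_neg_exp[OF u] using lev \<eta> by simp
  moreover have "levi (\<lambda>x. - F (- \<mu> x)) x w = - s' (- \<mu> x) * (norm (dd \<mu> x w))\<^sup>2 + s (- \<mu> x) * levi \<mu> x w"
  proof (rule levi_compose[OF u(2) \<mu> u(3), where \<phi>="\<lambda>t. - F (- t)" and \<phi>'="\<lambda>t. s (- t)" and \<phi>''="\<lambda>t. - s' (- t)"])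
    fix y
    have "((\<lambda>t. F (- t)) has_real_derivative s (- \<mu> y) * (- 1)) (at (\<mu> y))"
      by (rule DERIV_chain2[OF F(1)]) (auto simp: \<mu>_def intro!: derivative_eq_intros)
    from DERIV_minus[OF this] show "((\<lambda>t. - F (- t)) has_real_derivative s (- \<mu> y)) (at (\<mu> y))" by simp
    have "((\<lambda>t. s (- t)) has_real_derivative s' (- \<mu> y) * (- 1)) (at (\<mu> y))"
      by (rule DERIV_chain2[OF F(2)]) (auto intro!: derivative_eq_intros)
    then show "((\<lambda>t. s (- t)) has_real_derivative - s' (- \<mu> y)) (at (\<mu> y))" by simp
  qed
  moreover have "0 \<le> - s' (- \<mu> x) * (norm (dd \<mu> x w))\<^sup>2" by (rule mult_nonneg_nonneg) (use F(4) in auto)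
  moreover have "0 \<le> s (- \<mu> x) * levi \<mu> x w" by (rule mult_nonneg_nonneg) (use F(3) calculation(1) in auto)
  ultimately show ?thesis by (simp add: \<mu>_def)
qed

lemma DF_exponent_of_collar_function:
  fixes \<Omega> :: "(complex ^ 'n) set"
  assumes \<Omega>: "open \<Omega>" "bounded \<Omega>" "\<Omega> \<noteq> {}" and \<eta>: "0 < \<eta>" "\<eta> < 1" and W: "open W" and \<epsilon>: "\<epsilon> > 0"
    and KW: "\<And>z. z \<in> closure \<Omega> \<Longrightarrow> bdist \<Omega> z \<le> \<epsilon> \<Longrightarrow> z \<in> W"
    and \<rho>: "Ck_on k W \<rho>" and k: "2 \<le> k" and B: "B1 > 0" "B2 > 0"
    and \<rho>B: "\<And>z. z \<in> \<Omega> \<Longrightarrow> bdist \<Omega> z \<le> \<epsilon> \<Longrightarrow> B1 * bdist \<Omega> z \<le> - \<rho> z \<and> - \<rho> z \<le> B2 * bdist \<Omega> z"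
    and u: "Ck_on 2 (\<Omega> \<inter> W) u" "\<And>z. z \<in> \<Omega> \<inter> W \<Longrightarrow> - \<rho> z = exp (- u z)"
    and lev: "\<And>z w. z \<in> \<Omega> \<Longrightarrow> bdist \<Omega> z \<le> \<epsilon> \<Longrightarrow> \<eta> * (norm (dd u z w))\<^sup>2 \<le> levi u z w"
  shows "\<eta> \<in> DF_exponents (Ck_closure k \<Omega>) \<Omega>"
proof -
  \<comment> \<open>In the collar \<open>- \<rho> z \<ge> m\<close> as soon as
    \<open>bdist \<Omega> z \<ge> \<epsilon> / 2\<close>, so the cut-off function is already
    constant where the open sets \<open>N\<close> and \<open>I\<close> overlap.\<close>
  define m where "m = B1 * \<epsilon> / 2"
  have m: "m > 0" using B \<epsilon> by (simp add: m_def)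
  obtain \<Theta> F s s' m1 where \<Theta>: "Ck_on k UNIV \<Theta>" "0 < m1" "\<And>x. 0 < x \<Longrightarrow> \<Theta> x \<le> x" "\<And>x. 0 < x \<Longrightarrow> min x m1 \<le> \<Theta> x"
    "\<And>x. m \<le> x \<Longrightarrow> \<Theta> x = \<Theta> m" "\<And>x. 0 < x \<Longrightarrow> \<Theta> x powr \<eta> = F (x powr \<eta>)" "m1 \<le> m" "Ck_on k {0<..} F"
    and F: "\<And>y. 0 < y \<Longrightarrow> (F has_real_derivative s y) (at y)" "\<And>y. (s has_real_derivative s' y) (at y)"
    "\<And>y. 0 \<le> s y" "\<And>y. s' y \<le> (0 :: real)"
    by (rule smooth_exhausting_cutoff[OF \<eta>(1) m, of k], rule that; assumption)
  define N where "N = W \<inter> bdist \<Omega> -` {..<\<epsilon>}"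
  define I where "I = \<Omega> \<inter> bdist \<Omega> -` {\<epsilon>/2<..}"
  have N: "open N" "N \<subseteq> W" unfolding N_def
    by (auto intro: continuous_open_preimage[OF continuous_on_bdist W open_lessThan])
  have I: "open I" "I \<subseteq> \<Omega>" unfolding I_def
    by (auto intro: continuous_open_preimage[OF continuous_on_bdist \<Omega>(1) open_greaterThan])
  define \<sigma> where "\<sigma> z = (if z \<in> N then - \<Theta> (- \<rho> z) else - \<Theta> m)" for z
  have cl: "\<Omega> \<subseteq> closure \<Omega>" by (rule closure_subset)
  have inN: "z \<in> N" if "z \<in> closure \<Omega>" "bdist \<Omega> z < \<epsilon>" for z using KW[OF that(1)] that by (simp add: N_def)
  have \<sigma>I: "\<sigma> z = - \<Theta> m" if "z \<in> I" for z
  proof (cases "z \<in> N")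
    case True
    then have z: "z \<in> \<Omega>" "\<epsilon> / 2 < bdist \<Omega> z" "bdist \<Omega> z < \<epsilon>" using that by (auto simp: N_def I_def)
    have "B1 * (\<epsilon> / 2) \<le> B1 * bdist \<Omega> z" using z B by simp
    then have "m \<le> - \<rho> z" using \<rho>B[OF z(1)] z(3) by (simp add: m_def)
    then have "\<Theta> (- \<rho> z) = \<Theta> m" by (rule \<Theta>(5))
    then show ?thesis by (simp add: \<sigma>_def)
  qed (simp add: \<sigma>_def)
  have "Ck_on k N (\<lambda>z. - \<Theta> (- \<rho> z))"
    by (rule Ck_on_uminus[OF N(1) Ck_on_compose_real[OF N(1) Ck_on_uminus[OF N(1) Ck_on_subset[OF \<rho> N(2)]] \<Theta>(1)]]) simp
  then have "Ck_on k N \<sigma>" by (rule Ck_on_cong[OF N(1)]) (simp add: \<sigma>_def)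
  moreover have "Ck_on k I \<sigma>" by (rule Ck_on_cong[OF I(1) Ck_on_const[of _ _ "- \<Theta> m"]]) (simp add: \<sigma>I)
  ultimately have \<sigma>Ck: "Ck_on k (N \<union> I) \<sigma>" by (rule Ck_on_Un[OF N(1) I(1)])
  have cNI: "closure \<Omega> \<subseteq> N \<union> I"
  proof
    fix z assume z: "z \<in> closure \<Omega>"
    show "z \<in> N \<union> I"
    proof (cases "bdist \<Omega> z < \<epsilon>")
      case False
      then have "bdist \<Omega> z \<noteq> 0" using \<epsilon> by simp
      then have "z \<notin> frontier \<Omega>" by (auto simp: bdist_def)
      then have "z \<in> \<Omega>" using z \<Omega>(1) by (simp add: frontier_def interior_open)
      then show ?thesis using False \<epsilon> by (simp add: I_def)
    qed (use inN z in simp)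
  qed
  have \<sigma>c: "continuous_on (closure \<Omega>) \<sigma>" by (rule continuous_on_subset[OF Ck_on_continuous[OF \<sigma>Ck] cNI])
  have "bounded (bdist \<Omega> ` closure \<Omega>)"
    by (intro compact_imp_bounded compact_continuous_image continuous_on_bdist) (use \<Omega>(2) in simp)
  then obtain D where D: "D > 0" "\<And>z. z \<in> closure \<Omega> \<Longrightarrow> bdist \<Omega> z \<le> D"
    unfolding bounded_pos by (auto simp: abs_le_iff)
  \<comment> \<open>Near the boundary the lower bound comes from \<open>B1\<close>; after the cutoff
    only the level \<open>m1\<close> remains, to be compared with the largest distance
    \<open>D\<close>. The summand \<open>2 * B3\<close> in \<open>B4\<close> makes the final
    constant \<open>B4 / B3\<close> exceed \<open>1\<close>.\<close>
  define B3 where "B3 = min B1 (m1 / D)"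
  define B4 where "B4 = B1 + B2 + 2 * B3"
  have B3: "B3 > 0" "B3 \<le> B1" "B3 * D \<le> m1"
  proof -
    show "B3 > 0" "B3 \<le> B1" using B \<Theta>(2) D by (auto simp: B3_def)
    have "B3 \<le> m1 / D" by (simp add: B3_def)
    then show "B3 * D \<le> m1" using D(1) by (simp add: pos_le_divide_eq)
  qed
  have \<rho>pos: "0 < - \<rho> z" if "z \<in> \<Omega> \<inter> W" for z using u(2)[OF that] by simp
  have \<Omega>b: "B3 * bdist \<Omega> z \<le> - \<sigma> z \<and> - \<sigma> z \<le> B4 * bdist \<Omega> z" if z: "z \<in> \<Omega>" for z
  proof -
    have d: "bdist \<Omega> z > 0" "bdist \<Omega> z \<le> D" using bdist_pos[OF \<Omega>(1,2) z] D(2)[of z] z cl by auto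
    have h: "B3 * bdist \<Omega> z \<le> m1" by (rule order_trans[OF mult_left_mono[OF d(2)] B3(3)]) (use B3(1) in simp)
    have b1: "B3 * bdist \<Omega> z \<le> B1 * bdist \<Omega> z" by (rule mult_right_mono[OF B3(2)]) (use d in simp)
    show ?thesis
    proof (cases "bdist \<Omega> z < \<epsilon>")
      case True
      then have zN: "z \<in> N" using inN z cl by blast
      then have p: "0 < - \<rho> z" using \<rho>pos[of z] N(2) z by blast
      have b: "B1 * bdist \<Omega> z \<le> - \<rho> z" "- \<rho> z \<le> B2 * bdist \<Omega> z" using \<rho>B[OF z] True by auto
      have "B2 * bdist \<Omega> z \<le> B4 * bdist \<Omega> z" by (rule mult_right_mono) (use d B B3 in \<open>simp_all add: B4_def\<close>)
      then show ?thesis using \<Theta>(3)[OF p] \<Theta>(4)[OF p] b b1 h zN by (simp add: \<sigma>_def min_def split: if_splits)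
    next
      case False
      then have \<sigma>: "\<sigma> z = - \<Theta> m" using \<sigma>I[of z] z \<epsilon> by (simp add: I_def)
      have "m \<le> B1 * bdist \<Omega> z" using False B \<epsilon> mult_left_mono[of \<epsilon> "bdist \<Omega> z" B1] mult_pos_pos[OF B(1) \<epsilon>] by (simp add: m_def)
      moreover have "B1 * bdist \<Omega> z \<le> B4 * bdist \<Omega> z" by (rule mult_right_mono) (use d B B3 in \<open>simp_all add: B4_def\<close>)
      moreover have "B3 * bdist \<Omega> z \<le> \<Theta> m"
        using \<Theta>(4)[OF m] \<Theta>(7) h by (simp add: min_def split: if_splits)
      ultimately show ?thesis using \<Theta>(3)[OF m] by (simp add: \<sigma>)
    qed
  qed
  have clb: "B3 * bdist \<Omega> z \<le> - \<sigma> z \<and> - \<sigma> z \<le> B4 * bdist \<Omega> z" if z: "z \<in> closure \<Omega>" for z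
  proof
    show "B3 * bdist \<Omega> z \<le> - \<sigma> z"
      by (rule bdist_closure_bounds[of \<Omega>]) (use \<Omega>b z in \<open>auto intro!: continuous_intros continuous_on_bdist \<sigma>c\<close>)
    show "- \<sigma> z \<le> B4 * bdist \<Omega> z"
      by (rule bdist_closure_bounds[of \<Omega>]) (use \<Omega>b z in \<open>auto intro!: continuous_intros continuous_on_bdist \<sigma>c\<close>)
  qed
  have \<sigma>neg: "0 < - \<sigma> z" if "z \<in> \<Omega>" for z
    using \<Omega>b[OF that] mult_pos_pos[OF B3(1) bdist_pos[OF \<Omega>(1,2) that]] by linarith
  define v where "v z = - ((- \<sigma> z) powr \<eta>)" for z
  have vpsh: "psh_on \<Omega> v"
  proof (rule psh_onI_local[OF \<Omega>(1)])
    show "continuous_on \<Omega> v" unfolding v_def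
      by (intro continuous_intros continuous_on_subset[OF \<sigma>c cl]) (use \<sigma>neg in force)
    fix z w :: "complex ^ 'n" assume z: "z \<in> \<Omega>"
    show "\<exists>d>0. \<forall>s. 0 < s \<and> s < d \<longrightarrow> v z \<le> cmean (\<lambda>\<tau>. v (z + \<tau> *s w)) 0 s"
    proof (cases "z \<in> I")
      case True
      show ?thesis
        by (rule submean_cong[OF I(1) True _ submean_const]) (simp add: v_def \<sigma>I)
    next
      case False
      define X where "X = \<Omega> \<inter> N"
      have X: "open X" "X \<subseteq> \<Omega> \<inter> W" using \<Omega>(1) N by (auto simp: X_def)
      have zX: "z \<in> X" using False z \<epsilon> inN[of z] cl by (auto simp: X_def I_def)
      have uX: "Ck_on 2 X u" by (rule Ck_on_subset[OF u(1) X(2)])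
      have "Ck_on 2 X (\<lambda>x. exp (- \<eta> * u x))"
        by (rule Ck_on_compose_real[OF X(1) Ck_on_cmult[OF X(1) uX] Ck_on_exp]) simp
      then have FX: "Ck_on 2 X (\<lambda>x. - F (exp (- \<eta> * u x)))"
        by (intro Ck_on_uminus[OF X(1)] Ck_on_compose_real[OF X(1) _ Ck_on_mono[OF \<Theta>(8) k]]) simp_all
      have vX: "v x = - F (exp (- \<eta> * u x))" if x: "x \<in> X" for x
      proof -
        have p: "0 < - \<rho> x" "- \<rho> x = exp (- u x)" using \<rho>pos u(2) X(2) x by blast+
        have "(- \<sigma> x) powr \<eta> = F ((- \<rho> x) powr \<eta>)" using \<Theta>(6)[OF p(1)] x by (simp add: \<sigma>_def X_def)
        then show ?thesis unfolding p(2) by (simp add: v_def powr_def)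
      qed
      show ?thesis
      proof (rule submean_cong[OF X(1) zX vX submean_of_levi_nonneg[OF FX X(1) zX]])
        fix x assume x: "x \<in> X"
        show "0 \<le> levi (\<lambda>x. - F (exp (- \<eta> * u x))) x w"
          by (rule levi_cutoff_nonneg[OF uX X(1) x \<eta>(1) lev F]) (use x in \<open>auto simp: X_def N_def\<close>)
      qed
    qed
  qed
  \<comment> \<open>Rescales the lower bound for \<open>- \<sigma>\<close> to constant
    \<open>1\<close>; on the powers this is multiplication by a positive constant.\<close>
  define \<sigma>' where "\<sigma>' z = (1 / B3) * \<sigma> z" for z
  have "\<sigma>' \<in> Ck_closure k \<Omega>" unfolding Ck_closure_def
  proof (rule CollectI, intro exI conjI ballI)
    show "open (N \<union> I)" using N(1) I(1) by (rule open_Un)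
    show "Ck_on k (N \<union> I) \<sigma>'" unfolding \<sigma>'_def[abs_def] by (rule Ck_on_cmult[OF open_Un[OF N(1) I(1)] \<sigma>Ck])
  qed (use cNI in simp_all)
  moreover have "B4 / B3 > 1" using B B3 by (simp add: B4_def)
  moreover have "- (B4 / B3) * bdist \<Omega> z \<le> \<sigma>' z \<and> \<sigma>' z \<le> - bdist \<Omega> z" if z: "z \<in> closure \<Omega>" for z
    using clb[OF z] B3(1) by (simp add: \<sigma>'_def field_simps)
  moreover have "psh_on \<Omega> (\<lambda>z. - ((- \<sigma>' z) powr \<eta>))"
  proof (rule psh_on_cong[OF psh_on_scale[OF vpsh, of "(1 / B3) powr \<eta>"]])
    show "(1 / B3) powr \<eta> > 0" using B3(1) by simp
    show "(1 / B3) powr \<eta> * v z = - ((- \<sigma>' z) powr \<eta>)" if "z \<in> \<Omega>" for z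
      using \<sigma>neg[OF that] B3(1) powr_mult[of "1 / B3" "- \<sigma> z" \<eta>] by (simp add: v_def \<sigma>'_def)
  qed
  ultimately show ?thesis unfolding DF_exponents_def using \<eta> by blast
qed

section \<open>The indices agree\<close>

lemma Ck_improvement:
  fixes \<Omega> :: "(complex ^ 'n) set"
  assumes \<Omega>: "open \<Omega>" "bounded \<Omega>" "\<Omega> \<noteq> {}" and bd: "Ck_boundary k \<Omega>" and k: "3 \<le> k"
    and \<eta>: "\<eta> \<in> DF_exponents (Ck_closure 2 \<Omega>) \<Omega>" and \<eta>': "0 < \<eta>'" "\<eta>' < \<eta>"
  shows "\<eta>' \<in> DF_exponents (Ck_closure k \<Omega>) \<Omega>"
proof -
  obtain \<rho>0 c where \<eta>1: "\<eta> < 1" and "\<rho>0 \<in> Ck_closure 2 \<Omega>"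
    and \<rho>0: "\<And>z. z \<in> closure \<Omega> \<Longrightarrow> - c * bdist \<Omega> z \<le> \<rho>0 z \<and> \<rho>0 z \<le> - bdist \<Omega> z"
    and psh0: "psh_on \<Omega> (\<lambda>z. - ((- \<rho>0 z) powr \<eta>))"
    using \<eta> unfolding DF_exponents_def by blast
  then obtain U \<rho> where U: "open U" "closure \<Omega> \<subseteq> U" "Ck_on 2 U \<rho>" and \<rho>_eq: "\<And>z. z \<in> closure \<Omega> \<Longrightarrow> \<rho> z = \<rho>0 z"
    unfolding Ck_closure_def by blast
  have "1 \<le> k" "2 \<le> k" using k by auto
  obtain V0 r where V0: "open V0" "frontier \<Omega> \<subseteq> V0" "Ck_on k V0 r" "\<And>z. z \<in> V0 \<Longrightarrow> z \<in> \<Omega> \<longleftrightarrow> r z < 0"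
    "\<And>z. z \<in> V0 \<Longrightarrow> \<exists>v. D1 r z v \<noteq> 0"
    by (rule global_defining_function[OF \<Omega> bd \<open>1 \<le> k\<close>], rule that; assumption)
  have cl: "\<Omega> \<subseteq> closure \<Omega>" by (rule closure_subset)
  have \<rho>neg: "\<rho> z < 0" if "z \<in> \<Omega>" for z
    using \<rho>0[of z] \<rho>_eq[of z] bdist_pos[OF \<Omega>(1,2) that] cl that by force
  define u where "u z = - ln (- \<rho> z)" for z
  have "Ck_on 2 \<Omega> \<rho>" by (rule Ck_on_subset[OF U(3)]) (use U(2) cl in blast)
  then have u: "Ck_on 2 \<Omega> u" unfolding u_def[abs_def] by (rule Ck_neg_log[OF _ \<Omega>(1) \<rho>neg])
  have psh: "psh_on \<Omega> (\<lambda>z. - exp (- \<eta> * u z))"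
  proof (rule psh_on_cong[OF psh0])
    show "- ((- \<rho>0 z) powr \<eta>) = - exp (- \<eta> * u z)" if "z \<in> \<Omega>" for z
      using \<rho>neg[OF that] \<rho>_eq[of z] cl that by (auto simp: u_def powr_def)
  qed
  have E: "Ck_on 2 \<Omega> (\<lambda>z. - exp (- \<eta> * u z))"
    by (rule Ck_on_uminus[OF \<Omega>(1) Ck_on_compose_real[OF \<Omega>(1) Ck_on_cmult[OF \<Omega>(1) u] Ck_on_exp]]) simp
  have \<eta>0: "0 < \<eta>" using \<eta>' by simp
  have lev: "\<eta> * (norm (dd u z w))\<^sup>2 \<le> levi u z w" if "z \<in> \<Omega>" for z w
  proof -
    have "0 \<le> \<eta> * exp (- \<eta> * u z) * (levi u z w - \<eta> * (norm (dd u z w))\<^sup>2)"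
      using levi_nonneg_of_psh[OF psh E \<Omega>(1) that, of w] levi_neg_exp[OF u \<Omega>(1) that, of \<eta> w] by simp
    then have "0 \<le> levi u z w - \<eta> * (norm (dd u z w))\<^sup>2"
      by (rule mult_left_le_imp_le[of "\<eta> * exp (- \<eta> * u z)" 0, unfolded mult_zero_right]) (use \<eta>0 in simp)
    then show ?thesis by simp
  qed
  have dp: "defining_pair \<Omega> (V0 \<inter> U) r \<rho> c \<eta>"
  proof
    show "frontier \<Omega> \<subseteq> V0 \<inter> U" using V0(2) U(2) by (auto simp: frontier_def)
    show "Ck_on 3 (V0 \<inter> U) r" by (rule Ck_on_mono[OF Ck_on_subset[OF V0(3)] k]) simp
    show "Ck_on 2 (V0 \<inter> U) \<rho>" by (rule Ck_on_subset[OF U(3)]) simp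
    show "- c * bdist \<Omega> z \<le> \<rho> z \<and> \<rho> z \<le> - bdist \<Omega> z" if "z \<in> V0 \<inter> U \<inter> closure \<Omega>" for z
      using \<rho>0[of z] \<rho>_eq[of z] that by simp
    show "\<eta> * (norm (dd (\<lambda>x. - ln (- \<rho> x)) z w))\<^sup>2 \<le> levi (\<lambda>x. - ln (- \<rho> x)) z w" if "z \<in> \<Omega> \<inter> (V0 \<inter> U)" for z w
      using lev[of z w] that unfolding u_def[abs_def] by simp
  qed (use \<Omega> V0 U(1) \<eta>0 in auto)
  obtain K C c1 T where "collar \<Omega> (V0 \<inter> U) r \<rho> c \<eta> K C c1 T"
    using defining_pair.collar_exists[OF dp] by blast
  then interpret collar \<Omega> "V0 \<inter> U" r \<rho> c \<eta> K C c1 T .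
  have rk: "Ck_on k (V0 \<inter> U) r" by (rule Ck_on_subset[OF V0(3)]) simp
  show ?thesis
  proof (rule smooth_collar_function[OF rk \<open>2 \<le> k\<close> \<eta>'])
    fix W \<rho>' u' \<epsilon> B1 B2
    assume *: "open W" "\<epsilon> > 0" "\<And>z. z \<in> closure \<Omega> \<Longrightarrow> bdist \<Omega> z \<le> \<epsilon> \<Longrightarrow> z \<in> W"
      "Ck_on k W \<rho>'" "B1 > 0" "B2 > 0"
      "\<And>z. z \<in> \<Omega> \<Longrightarrow> bdist \<Omega> z \<le> \<epsilon> \<Longrightarrow> B1 * bdist \<Omega> z \<le> - \<rho>' z \<and> - \<rho>' z \<le> B2 * bdist \<Omega> z"
      "Ck_on 2 (\<Omega> \<inter> W) u'" "\<And>z. z \<in> \<Omega> \<inter> W \<Longrightarrow> - \<rho>' z = exp (- u' z)"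
      "\<And>z w. z \<in> \<Omega> \<Longrightarrow> bdist \<Omega> z \<le> \<epsilon> \<Longrightarrow> \<eta>' * (norm (dd u' z w))\<^sup>2 \<le> levi u' z w"
    have "\<eta>' < 1" using \<eta>1 \<eta>' by simp
    show ?thesis
      by (rule DF_exponent_of_collar_function[OF \<Omega> \<eta>'(1) \<open>\<eta>' < 1\<close> *(1-4) \<open>2 \<le> k\<close> *(5-10)])
  qed
qed

lemma DF_Ck_eq_DF_C2:
  fixes \<Omega> :: "(complex ^ 'n) set"
  assumes \<Omega>: "open \<Omega>" "bounded \<Omega>" "\<Omega> \<noteq> {}" and bd: "Ck_boundary k \<Omega>" and k: "2 \<le> k"
  shows "DF (Ck_closure k \<Omega>) \<Omega> = DF (Ck_closure 2 \<Omega>) \<Omega>"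
\<comment> \<open>For \<open>k = 2\<close> the two families coincide. Larger \<open>k\<close>
  provides the third derivative of the defining function on which the collar construction
  rests.\<close>
proof (cases "k = 2")
  case False
  then have k3: "3 \<le> k" using k by simp
  have "Ck_closure k \<Omega> \<subseteq> Ck_closure 2 \<Omega>" unfolding Ck_closure_def using Ck_on_mono[OF _ k] by blast
  then have "DF_exponents (Ck_closure k \<Omega>) \<Omega> \<subseteq> DF_exponents (Ck_closure 2 \<Omega>) \<Omega>" unfolding DF_exponents_def by blast
  then show ?thesis unfolding DF_def
    by (rule Sup_exponents_eq) (use Ck_improvement[OF \<Omega> bd k3] in \<open>simp_all add: DF_exponents_def\<close>)
qed simp

theorem theorem1p3:
  fixes \<Omega> :: "(complex ^ 'n) set"
  assumes "open \<Omega>" and "connected \<Omega>" and "\<Omega> \<noteq> {}"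
    and "bounded \<Omega>" and "pseudoconvex \<Omega>"
  shows "DF (Lip_closure \<Omega>) \<Omega> = DF_w \<Omega> \<and>
    (\<forall>k\<ge>2. Ck_boundary k \<Omega> \<longrightarrow> DF (Ck_closure k \<Omega>) \<Omega> = DF (Ck_closure 2 \<Omega>) \<Omega>)"
  using DF_Lip_eq_DF_w[OF assms(1,4,3)] DF_Ck_eq_DF_C2[OF assms(1,4,3)] by blast

end
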